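(* Suppose that $c_i(0)\ge0$, $c_i(0)\in H^1(\mathbb{R}^3)\cap L^1(\mathbb{R}^3)$ and $\int_{\mathbb{R}^3}c_i(0)\log c_i(0)\,dx\in\mathbb{R}$ for any $i\in\{1,\dots,N\}$, and that $\int_{\mathbb{R}^3}\rho_0\,dx=0$. Let $(c_1,\dots,c_N)$ be the corresponding solution of the Nernst--Planck--Darcy system on $\mathbb{R}^3$, and let $\mathcal{E}_i(t)=\int_{\mathbb{R}^3}c_i(x,t)\log c_i(x,t)\,dx$ and $\mathcal{E}(t)=\sum_{i=1}^N\mathcal{E}_i(t)$. Then there exist positive constants $\Gamma_1$ and $\Gamma_2$ depending on the parameters of the problem, $\mathcal{E}_i(0)$, $\|c_i(0)\|_{L^1}$ and $\|c_i(0)\|_{L^2}$, and a positive constant $\Gamma_3$ depending only on the diffusivity $D$ and $\|c_i(0)\|_{L^1}$, such that $$-\mathcal{E}_i(t)\ge\Gamma_1+\frac32\|c_i(0)\|_{L^1}\log(\Gamma_2+\Gamma_3t)$$ for any $t\ge0$ and all $i\in\{1,\dots,N\}$. As a consequence, $\lim_{t\to\infty}\mathcal{E}(t)=-\infty$.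
   Context: Fix an integer $N\ge1$, a common diffusivity $D>0$, and real valences $z_1,\dots,z_N$ with equal absolute values $|z_1|=\dots=|z_N|=z$ (the parameters of the problem). The Nernst--Planck--Darcy (NPD) system on $\mathbb{R}^3$, with decay at infinity, is the system for the ionic concentrations $c_i(x,t)$, the velocity $u$, the pressure $p$ and the potential $\phi$: $$\partial_t c_i+u\cdot\nabla c_i-D\Delta c_i-z_iD\,\nabla\cdot(c_i\nabla\phi)=0\quad(i=1,\dots,N),$$ $$u+\nabla p=-\rho\nabla\phi,\qquad \nabla\cdot u=0,\qquad -\Delta\phi=\rho,\qquad \rho:=\sum_{i=1}^N z_ic_i,$$ with initial data $c_i(\cdot,0)=c_i(0)$ and $\rho_0:=\sum_i z_ic_i(0)$. Decay at infinity means in particular $\phi=(-\Delta)^{-1}\rho$ and $u=-\mathbb{P}(\rho\nabla\phi)$, where $\mathbb{P}$ is the Leray projector onto divergence-free fields. For nonnegative initial data in $H^1\cap L^1$ with $\int\rho_0=0$, the system has a unique smooth solution, nonnegativity of the $c_i$ is preserved, and the solution is global in time; "the solution" refers to this one. The convention $0\log0=0$ is used.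
   Formalization: The bound is stated only for i with ‖c_i(0)‖_{L^1} > 0, and the limit only if some c_i(0) is nonzero: for c_i(0) = 0 the bound would read 0 ≥ Γ_1 > 0, and if all c_i(0) vanish then 𝓔(t) = 0 for all t. *)

theory Defs
  imports "HOL-Analysis.Analysis"
begin

section \<open>Smooth functions and differential operators\<close>

text \<open>Meant for open \<open>S\<close>. The directional derivatives along all vectors carry the same
  information as the partial derivatives.\<close>

primrec Ck_on :: "nat \<Rightarrow> 'a::euclidean_space set \<Rightarrow> ('a \<Rightarrow> 'b::real_normed_vector) \<Rightarrow> bool" where
  "Ck_on 0 S f \<longleftrightarrow> continuous_on S f"
| "Ck_on (Suc k) S f \<longleftrightarrow>
     (\<forall>x\<in>S. f differentiable (at x)) \<and> (\<forall>v. Ck_on k S (\<lambda>x. frechet_derivative f (at x) v))"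

definition smooth_on :: "'a::euclidean_space set \<Rightarrow> ('a \<Rightarrow> 'b::real_normed_vector) \<Rightarrow> bool" where
  "smooth_on S f \<longleftrightarrow> (\<forall>k. Ck_on k S f)"

definition test_function :: "(real^3 \<Rightarrow> real) \<Rightarrow> bool" where
  "test_function \<psi> \<longleftrightarrow> smooth_on UNIV \<psi> \<and> compact (closure {x. \<psi> x \<noteq> 0})"

definition grad :: "(real^3 \<Rightarrow> real) \<Rightarrow> real^3 \<Rightarrow> real^3" where
  "grad f x = (\<chi> j. frechet_derivative f (at x) (axis j 1))"

definition divergence :: "(real^3 \<Rightarrow> real^3) \<Rightarrow> real^3 \<Rightarrow> real" where
  "divergence F x = (\<Sum>j\<in>UNIV. frechet_derivative F (at x) (axis j 1) $ j)"

definition laplacian :: "(real^3 \<Rightarrow> real) \<Rightarrow> real^3 \<Rightarrow> real" where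
  "laplacian f x = divergence (grad f) x"


section \<open>Function spaces\<close>

text \<open>Elements of the spaces are functions rather than classes modulo null sets, and they are
  represented by Borel measurable functions.\<close>

definition in_L1 :: "(real^3 \<Rightarrow> real) \<Rightarrow> bool" where
  "in_L1 f \<longleftrightarrow> integrable lborel f"

definition L1_norm :: "(real^3 \<Rightarrow> real) \<Rightarrow> real" where
  "L1_norm f = (\<integral>x. \<bar>f x\<bar> \<partial>lborel)"

definition in_L2 :: "(real^3 \<Rightarrow> 'b::euclidean_space) \<Rightarrow> bool" where
  "in_L2 f \<longleftrightarrow> f \<in> borel_measurable lborel \<and> integrable lborel (\<lambda>x. (norm (f x))\<^sup>2)"

definition L2_norm :: "(real^3 \<Rightarrow> 'b::euclidean_space) \<Rightarrow> real" where
  "L2_norm f = sqrt (\<integral>x. (norm (f x))\<^sup>2 \<partial>lborel)"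

text \<open>\<open>g\<close> is the distributional gradient of \<open>f\<close>, both in \<open>L\<^sup>2\<close>.\<close>

definition weak_grad :: "(real^3 \<Rightarrow> real) \<Rightarrow> (real^3 \<Rightarrow> real^3) \<Rightarrow> bool" where
  "weak_grad f g \<longleftrightarrow> in_L2 f \<and> in_L2 g \<and>
     (\<forall>\<psi>. test_function \<psi> \<longrightarrow>
        (\<integral>x. f x *\<^sub>R grad \<psi> x \<partial>lborel) = - (\<integral>x. \<psi> x *\<^sub>R g x \<partial>lborel))"

definition in_H1 :: "(real^3 \<Rightarrow> real) \<Rightarrow> bool" where
  "in_H1 f \<longleftrightarrow> (\<exists>g. weak_grad f g)"

text \<open>The weak gradient is unique up to null sets, so the norm does not depend on the choice.\<close>

definition H1_norm :: "(real^3 \<Rightarrow> real) \<Rightarrow> real" where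
  "H1_norm f = sqrt ((L2_norm f)\<^sup>2 + (L2_norm (SOME g. weak_grad f g))\<^sup>2)"

text \<open>Curves in \<open>C([0,\<infinity>); H\<^sup>1 \<inter> L\<^sup>1)\<close>.\<close>

definition continuous_into_H1_L1 :: "(real \<Rightarrow> real^3 \<Rightarrow> real) \<Rightarrow> bool" where
  "continuous_into_H1_L1 f \<longleftrightarrow>
     (\<forall>t\<ge>0. in_H1 (f t) \<and> in_L1 (f t)) \<and>
     (\<forall>t\<ge>0. ((\<lambda>s. H1_norm (\<lambda>x. f s x - f t x)) \<longlongrightarrow> 0) (at t within {0..}) \<and>
             ((\<lambda>s. L1_norm (\<lambda>x. f s x - f t x)) \<longlongrightarrow> 0) (at t within {0..}))"


section \<open>The inverse Laplacian and the Leray projector\<close>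

definition newton_potential :: "(real^3 \<Rightarrow> real) \<Rightarrow> real^3 \<Rightarrow> real" where
  "newton_potential \<rho> x = (\<integral>y. \<rho> y / (4 * pi * norm (x - y)) \<partial>lborel)"

definition solenoidal_L2 :: "(real^3 \<Rightarrow> real^3) \<Rightarrow> bool" where
  "solenoidal_L2 w \<longleftrightarrow> in_L2 w \<and>
     (\<forall>\<psi>. test_function \<psi> \<longrightarrow> (\<integral>x. w x \<bullet> grad \<psi> x \<partial>lborel) = 0)"

text \<open>\<open>v = \<P> F\<close> (almost everywhere), where \<open>\<P>\<close> is the orthogonal projector of \<open>L\<^sup>2\<close> onto the
  divergence-free fields.\<close>

definition leray_projection :: "(real^3 \<Rightarrow> real^3) \<Rightarrow> (real^3 \<Rightarrow> real^3) \<Rightarrow> bool" where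
  "leray_projection F v \<longleftrightarrow> in_L2 F \<and> solenoidal_L2 v \<and>
     (\<forall>w. solenoidal_L2 w \<longrightarrow> (\<integral>x. (F x - v x) \<bullet> w x \<partial>lborel) = 0)"


section \<open>The Nernst--Planck--Darcy system\<close>

definition charge :: "('n::finite \<Rightarrow> real) \<Rightarrow> ('n \<Rightarrow> real \<Rightarrow> real^3 \<Rightarrow> real) \<Rightarrow> real \<Rightarrow> real^3 \<Rightarrow> real" where
  "charge z c t x = (\<Sum>i\<in>UNIV. z i * c i t x)"

text \<open>Global smooth solutions with initial data \<open>\<lambda>i. c i 0\<close>. The species are indexed by the
  finite type \<open>'n\<close>. The solution is smooth on \<open>(0,\<infinity>) \<times> \<real>\<^sup>3\<close> and attains its data through
  continuity of the concentrations in \<open>H\<^sup>1 \<inter> L\<^sup>1\<close>. The last two conditions on \<open>\<phi>\<close> and \<open>u\<close> are the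
  decay at infinity, i.e. \<open>\<phi> = (-\<Delta>)\<^sup>-\<^sup>1 \<rho>\<close> and \<open>u = -\<P>(\<rho> \<nabla>\<phi>)\<close>.\<close>

definition npd_solution ::
  "real \<Rightarrow> ('n::finite \<Rightarrow> real) \<Rightarrow> ('n \<Rightarrow> real \<Rightarrow> real^3 \<Rightarrow> real) \<Rightarrow> (real \<Rightarrow> real^3 \<Rightarrow> real^3) \<Rightarrow>
   (real \<Rightarrow> real^3 \<Rightarrow> real) \<Rightarrow> (real \<Rightarrow> real^3 \<Rightarrow> real) \<Rightarrow> bool" where
  "npd_solution D z c u p \<phi> \<longleftrightarrow>
     (\<forall>i. continuous_into_H1_L1 (c i)) \<and>
     (\<forall>i. smooth_on ({0<..} \<times> UNIV) (\<lambda>(t, x). c i t x)) \<and>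
     smooth_on ({0<..} \<times> UNIV) (\<lambda>(t, x). u t x) \<and>
     smooth_on ({0<..} \<times> UNIV) (\<lambda>(t, x). p t x) \<and>
     smooth_on ({0<..} \<times> UNIV) (\<lambda>(t, x). \<phi> t x) \<and>
     (\<forall>t>0. \<forall>x.
        (\<forall>i. deriv (\<lambda>s. c i s x) t + u t x \<bullet> grad (c i t) x - D * laplacian (c i t) x
             - z i * D * divergence (\<lambda>y. c i t y *\<^sub>R grad (\<phi> t) y) x = 0) \<and>
        u t x + grad (p t) x = - (charge z c t x *\<^sub>R grad (\<phi> t) x) \<and>
        divergence (u t) x = 0 \<and>
        - laplacian (\<phi> t) x = charge z c t x) \<and>
     (\<forall>t>0. \<phi> t = newton_potential (charge z c t)) \<and>
     (\<forall>t>0. leray_projection (\<lambda>x. charge z c t x *\<^sub>R grad (\<phi> t) x) (\<lambda>x. - u t x))"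

text \<open>Since \<open>ln 0\<close> is multiplied by \<open>0\<close>, the convention \<open>0 log 0 = 0\<close> holds.\<close>

definition entropy :: "(real^3 \<Rightarrow> real) \<Rightarrow> real" where
  "entropy f = (\<integral>x. f x * ln (f x) \<partial>lborel)"

definition entropy_finite :: "(real^3 \<Rightarrow> real) \<Rightarrow> bool" where
  "entropy_finite f \<longleftrightarrow> integrable lborel (\<lambda>x. f x * ln (f x))"

end

theory Submission
  imports Defs
begin

text \<open>Let \<open>P\<close> and \<open>N\<close> be the sums of the concentrations with nonnegative and with negative valence.
  As all \<open>|z\<^sub>i|\<close> agree, \<open>\<rho> = |z| (P - N)\<close>, and \<open>P\<close> and \<open>N\<close> solve drift-diffusion equations with
  opposite drifts. In the sum of their \<open>L\<^sup>2\<close> balances the drifts contribute the dissipative term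
  \<open>|z|\<^sup>2 (P - N)\<^sup>2 (P + N)\<close>, so Nash's inequality and conservation of mass give the heat-type decay
  \<open>\<parallel>P\<parallel>\<^sup>2 + \<parallel>N\<parallel>\<^sup>2 \<le> (A + B t)\<^bsup>-3/2\<^esup>\<close>. The bound
  \<open>c ln c \<le> c\<^sup>2 / k + c (ln k - 1)\<close>, with \<open>k\<close> a multiple of this quantity, turns the decay into the
  entropy estimate. Nonnegativity follows from conservation of mass and contraction in \<open>L\<^sup>1\<close>.

  That \<open>c\<^sub>i ln c\<^sub>i\<close> stays integrable is shown without moments: if \<open>g\<close> is the convolution of
  \<open>c\<^sub>i(0)\<close> with a slowly varying integrable kernel, then \<open>ln g\<close> has bounded derivatives, hence the
  integral of \<open>c\<^sub>i(t) ln (1/g)\<close> grows at most linearly in time, and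
  \<open>c ln (1/c) \<le> c ln (1/g) + g\<close>. Its initial value is finite because \<open>c\<^sub>i(0)\<close> lies in \<open>H\<^sup>1\<close>.\<close>

section \<open>Integration on Euclidean space\<close>

text \<open>No decay of the concentrations is known beyond H^1 and L^1, and the equations hold
  pointwise only for t > 0. Every integration by parts is therefore done against a cut-off of radius
  R, on an interval [s, t] with s > 0, and s tends to 0 only at the end. The flux errors contain c,
  c u and c grad \<phi> times derivatives of the cut-off: c u is in L^1 because c and u are in L^2,
  and grad \<phi> is bounded because Hardy's inequality controls the kernel 1/|x - y|^2. Testing
  with c itself would produce c^2 u instead; hence the renormalisation by functions of linear growth
  that approach the square. The constants: Nash's inequality gives, formally, E' <= -a E^(5/3),
  which makes E^(-2/3) grow at least linearly; this is the origin of the exponent 3/2. The term m ln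
  m left by the comparison of entropy and energy may have either sign. It is moved into the
  logarithm through a factor depending only on the masses, so that the first constant can be 1 and
  the third keeps its restricted dependence.\<close>

lemma lborel_translation:
  fixes f :: "'a::euclidean_space \<Rightarrow> 'b::{banach, second_countable_topology}"
  assumes [measurable]: "f \<in> borel_measurable borel"
  shows integral_translation: "(\<integral>x. f (x + a) \<partial>lborel) = (\<integral>x. f x \<partial>lborel)"
    and integrable_translation_iff: "integrable lborel (\<lambda>x. f (x + a)) \<longleftrightarrow> integrable lborel f"
proof -
  have "(\<integral>x. f x \<partial>lborel) = (\<integral>x. f x \<partial>(distr lborel borel ((+) a)))"
    by (simp add: lborel_distr_plus)
  also have "\<dots> = (\<integral>x. f (a + x) \<partial>lborel)" by (rule integral_distr) simp_all
  finally show "(\<integral>x. f (x + a) \<partial>lborel) = (\<integral>x. f x \<partial>lborel)" by (simp add: add.commute)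
  have "integrable lborel f \<longleftrightarrow> integrable (distr lborel borel ((+) a)) f"
    by (simp add: lborel_distr_plus)
  also have "\<dots> \<longleftrightarrow> integrable lborel (\<lambda>x. f (a + x))" by (rule integrable_distr_eq) simp_all
  finally show "integrable lborel (\<lambda>x. f (x + a)) \<longleftrightarrow> integrable lborel f" by (simp add: add.commute)
qed

lemma nn_integral_translation:
  fixes f :: "'a::euclidean_space \<Rightarrow> ennreal"
  assumes [measurable]: "f \<in> borel_measurable borel"
  shows "(\<integral>\<^sup>+x. f (x + a) \<partial>lborel) = (\<integral>\<^sup>+x. f x \<partial>lborel)"
proof -
  have "(\<integral>\<^sup>+x. f x \<partial>lborel) = (\<integral>\<^sup>+x. f x \<partial>(distr lborel borel ((+) a)))"
    by (simp add: lborel_distr_plus)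
  also have "\<dots> = (\<integral>\<^sup>+x. f (a + x) \<partial>lborel)" by (rule nn_integral_distr) simp_all
  finally show ?thesis by (simp add: add.commute)
qed

lemma integrable_continuous_compact_support:
  fixes f :: "'a::euclidean_space \<Rightarrow> 'b::{banach, second_countable_topology}"
  assumes "continuous_on UNIV f" "\<And>x. norm x > r \<Longrightarrow> f x = 0"
  shows "integrable lborel f"
proof -
  have "integrable lborel (\<lambda>x. indicator (cball 0 r) x *\<^sub>R f x)"
    by (rule borel_integrable_compact) (auto intro: continuous_on_subset[OF assms(1)])
  also have "(\<lambda>x. indicator (cball 0 r) x *\<^sub>R f x) = f"
    using assms(2) by (force simp: indicator_def not_le)
  finally show ?thesis .
qed

lemma bounded_continuous_compact_support:
  fixes f :: "'a::euclidean_space \<Rightarrow> 'b::real_normed_vector"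
  assumes "continuous_on UNIV f" "\<And>x. norm x > r \<Longrightarrow> f x = 0"
  obtains B where "B > 0" "\<And>x. norm (f x) \<le> B"
proof -
  have "bounded (f ` cball 0 r)"
    by (intro compact_imp_bounded compact_continuous_image continuous_on_subset[OF assms(1)]) auto
  then obtain B where B: "\<And>x. x \<in> cball 0 r \<Longrightarrow> norm (f x) \<le> B"
    unfolding bounded_iff by blast
  have "norm (f x) \<le> max B 1" for x
    using B[of x] assms(2)[of x] by (cases "norm x > r") auto
  then show ?thesis using that[of "max B 1"] by auto
qed

lemma frechet_derivative_outside_support:
  fixes f :: "'a::euclidean_space \<Rightarrow> 'b::real_normed_vector"
  assumes "\<And>x. norm x > r \<Longrightarrow> f x = 0" "norm x > r"
  shows "frechet_derivative f (at x) = (\<lambda>v. 0)"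
proof -
  have "((\<lambda>_. 0) has_derivative (\<lambda>v. 0)) (at x)" by simp
  then have "(f has_derivative (\<lambda>v. 0)) (at x)"
  proof (rule has_derivative_transform_within_open)
    show "open {x. norm x > r}" by (intro open_Collect_less continuous_intros)
  qed (use assms in auto)
  then show ?thesis by (metis frechet_derivative_at)
qed

lemma has_real_derivative_along_line:
  fixes f :: "'a::euclidean_space \<Rightarrow> real"
  assumes "f differentiable (at (x + t *\<^sub>R v))"
  shows "((\<lambda>s. f (x + s *\<^sub>R v)) has_real_derivative frechet_derivative f (at (x + t *\<^sub>R v)) v) (at t)"
proof -
  have "(f has_derivative frechet_derivative f (at (x + t *\<^sub>R v))) (at (x + t *\<^sub>R v))"
    using assms by (simp add: frechet_derivative_works)
  then have "((\<lambda>s. f (x + s *\<^sub>R v)) has_derivative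
      (\<lambda>h. frechet_derivative f (at (x + t *\<^sub>R v)) (h *\<^sub>R v))) (at t)"
    by (rule has_derivative_compose[rotated]) (auto intro!: derivative_eq_intros)
  moreover have "frechet_derivative f (at (x + t *\<^sub>R v)) (h *\<^sub>R v) = h * frechet_derivative f (at (x + t *\<^sub>R v)) v" for h
    using linear_frechet_derivative[OF assms] by (simp add: linear_scale)
  ultimately show ?thesis by (simp add: has_field_derivative_def mult.commute[of _ "frechet_derivative _ _ _"])
qed

text \<open>The integral of a directional derivative is the limit of the integrals of difference
  quotients, and each of these vanishes because Lebesgue measure is translation invariant.\<close>

lemma integral_frechet_derivative_eq_0:
  fixes F :: "'a::euclidean_space \<Rightarrow> real"
  assumes diff: "\<And>x. F differentiable (at x)"
    and cont: "continuous_on UNIV (\<lambda>x. frechet_derivative F (at x) v)"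
    and supp: "\<And>x. norm x > r \<Longrightarrow> F x = 0"
  shows "(\<integral>x. frechet_derivative F (at x) v \<partial>lborel) = 0"
proof -
  define d where "d x = frechet_derivative F (at x) v" for x
  have d0: "d x = 0" if "norm x > r" for x
    unfolding d_def using frechet_derivative_outside_support[OF supp that] by simp
  obtain B where B: "\<And>x. norm (d x) \<le> B" "B > 0"
    using bounded_continuous_compact_support[of d r] cont d0 unfolding d_def[abs_def] by metis
  have contF: "continuous_on UNIV F"
    by (simp add: continuous_at_imp_continuous_on differentiable_imp_continuous_within diff)
  have [measurable]: "F \<in> borel_measurable borel" "d \<in> borel_measurable borel"
    using contF cont by (auto intro: borel_measurable_continuous_onI simp: d_def[abs_def])
  have intF: "integrable lborel F" using contF supp by (rule integrable_continuous_compact_support)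
  define q where "q n x = real (Suc n) * (F (x + (1 / real (Suc n)) *\<^sub>R v) - F x)" for n x
  have der: "((\<lambda>s. F (x + s *\<^sub>R v)) has_real_derivative d (x + t *\<^sub>R v)) (at t)" for x t
    unfolding d_def by (rule has_real_derivative_along_line[OF diff])
  have "(\<integral>x. q n x \<partial>lborel) = 0" for n
    using intF by (simp add: q_def[abs_def] integral_translation integrable_translation_iff)
  moreover have "(\<lambda>n. \<integral>x. q n x \<partial>lborel) \<longlonglongrightarrow> (\<integral>x. d x \<partial>lborel)"
  proof (rule integral_dominated_convergence)
    \<comment> \<open>Step sizes are at most 1, so all quotients vanish outside the ball of radius
      \<open>r + norm v\<close>; inside it the mean value theorem bounds them by the bound
      \<open>B\<close> of the derivative.\<close>
    show "integrable lborel (\<lambda>x::'a. B * indicator (cball 0 (r + norm v)) x)"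
      using emeasure_lborel_cball_finite[of "0::'a" "r + norm v"]
      by (intro integrable_mult_right integrable_real_indicator) (auto simp: less_top)
    show "AE x in lborel. (\<lambda>n. q n x) \<longlonglongrightarrow> d x"
    proof (rule AE_I2)
      fix x
      have "((\<lambda>s. (F (x + s *\<^sub>R v) - F x) / s) \<longlongrightarrow> d x) (at 0)"
        using der[of x 0] by (simp add: has_field_derivative_iff)
      moreover have "filterlim (\<lambda>n. 1 / real (Suc n)) (at 0) sequentially"
        using LIMSEQ_inverse_real_of_nat by (auto simp: filterlim_at inverse_eq_divide)
      ultimately have "(\<lambda>n. (F (x + (1 / real (Suc n)) *\<^sub>R v) - F x) / (1 / real (Suc n))) \<longlonglongrightarrow> d x"
        by (rule filterlim_compose)
      then show "(\<lambda>n. q n x) \<longlonglongrightarrow> d x" by (simp add: q_def mult.commute)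
    qed
    show "AE x in lborel. norm (q n x) \<le> B * indicator (cball 0 (r + norm v)) x" for n
    proof (rule AE_I2)
      fix x
      define h where "h = 1 / real (Suc n)"
      have h: "0 < h" "h \<le> 1" "real (Suc n) * h = 1" by (auto simp: h_def)
      show "norm (q n x) \<le> B * indicator (cball 0 (r + norm v)) x"
      proof (cases "norm x \<le> r + norm v")
        case True
        obtain t where "F (x + h *\<^sub>R v) - F (x + 0 *\<^sub>R v) = (h - 0) * d (x + t *\<^sub>R v)"
          using MVT2[OF h(1), of "\<lambda>s. F (x + s *\<^sub>R v)" "\<lambda>t. d (x + t *\<^sub>R v)"] der by blast
        then have "q n x = real (Suc n) * h * d (x + t *\<^sub>R v)"
          unfolding q_def h_def by simp
        with h True B show ?thesis by simp
      next
        case False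
        have "norm x - norm (h *\<^sub>R v) \<le> norm (x + h *\<^sub>R v)"
          by (rule norm_diff_ineq)
        moreover have "norm (h *\<^sub>R v) \<le> norm v" using h by (simp add: mult_left_le_one_le)
        ultimately have "norm (x + h *\<^sub>R v) > r" "norm x > r" using False norm_ge_zero[of v] by linarith+
        then have "F (x + h *\<^sub>R v) = 0" "F x = 0" using supp by auto
        then have "q n x = 0" unfolding q_def h_def[symmetric] by simp
        then show ?thesis using B(2) by simp
      qed
    qed
  qed (auto simp: q_def[abs_def])
  ultimately show ?thesis by (simp add: LIMSEQ_const_iff d_def[abs_def])
qed

lemma frechet_derivative_nth:
  fixes F :: "'a::real_normed_vector \<Rightarrow> real^'n"
  assumes "F differentiable (at x)"
  shows "(\<lambda>x. F x $ j) differentiable (at x)"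
    "frechet_derivative (\<lambda>x. F x $ j) (at x) v = frechet_derivative F (at x) v $ j"
proof -
  have "((\<lambda>x. F x $ j) has_derivative (\<lambda>v. frechet_derivative F (at x) v $ j)) (at x)"
    using assms bounded_linear.has_derivative[OF bounded_linear_vec_nth]
    unfolding frechet_derivative_works by blast
  from frechet_derivative_at[OF this] this
  show "(\<lambda>x. F x $ j) differentiable (at x)"
    "frechet_derivative (\<lambda>x. F x $ j) (at x) v = frechet_derivative F (at x) v $ j"
    by (auto simp: differentiable_def dest: fun_cong[of _ _ v])
qed

lemma integral_divergence_eq_0:
  fixes F :: "real^3 \<Rightarrow> real^3"
  assumes F: "Ck_on 1 UNIV F" and supp: "\<And>x. norm x > r \<Longrightarrow> F x = 0"
  shows "(\<integral>x. divergence F x \<partial>lborel) = 0"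
proof -
  have diff: "F differentiable (at x)" for x using F by simp
  have cont: "continuous_on UNIV (\<lambda>x. frechet_derivative F (at x) v)" for v using F by simp
  have contj: "continuous_on UNIV (\<lambda>x. frechet_derivative F (at x) v $ j)" for v j
    by (intro continuous_intros cont)
  have "(\<integral>x. frechet_derivative F (at x) v $ j \<partial>lborel) = 0" for j v
    using integral_frechet_derivative_eq_0[of "\<lambda>x. F x $ j" v r] supp contj
    by (simp add: frechet_derivative_nth[OF diff])
  moreover have "integrable lborel (\<lambda>x. frechet_derivative F (at x) v $ j)" for j v
    using contj frechet_derivative_outside_support[of r F] supp
    by (intro integrable_continuous_compact_support[of _ r]) auto
  ultimately show ?thesis unfolding divergence_def by simp
qed

text \<open>The fundamental theorem is applied in time at each x, and Fubini exchanges the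
  integrals, since \<open>f'\<close> is continuous and lives on a compact set of space-time. The
  increment of the integral is thus expressed without differentiating under the integral
  sign.\<close>

lemma integral_time_derivative:
  fixes f :: "real \<Rightarrow> 'a::euclidean_space \<Rightarrow> real"
  assumes st: "s \<le> t"
    and der: "\<And>\<tau> x. \<tau> \<in> {s..t} \<Longrightarrow> ((\<lambda>\<tau>. f \<tau> x) has_real_derivative f' \<tau> x) (at \<tau>)"
    and cont': "continuous_on ({s..t} \<times> UNIV) (\<lambda>(\<tau>, x). f' \<tau> x)"
    and int: "\<And>\<tau>. \<tau> \<in> {s..t} \<Longrightarrow> integrable lborel (f \<tau>)"
    and supp: "\<And>\<tau> x. \<tau> \<in> {s..t} \<Longrightarrow> norm x > r \<Longrightarrow> f' \<tau> x = 0"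
  shows "set_integrable lborel {s..t} (\<lambda>\<tau>. \<integral>x. f' \<tau> x \<partial>lborel)"
    and "(\<integral>x. f t x \<partial>lborel) - (\<integral>x. f s x \<partial>lborel) = (LINT \<tau>:{s..t}|lborel. (\<integral>x. f' \<tau> x \<partial>lborel))"
proof -

  define g where "g p = indicator ({s..t} \<times> cball 0 r) p *\<^sub>R (case p of (\<tau>, x) \<Rightarrow> f' \<tau> x)" for p :: "real \<times> 'a"
  have geq: "g (\<tau>, x) = indicator {s..t} \<tau> * f' \<tau> x" for \<tau> x
    using supp[of \<tau> x] by (auto simp: g_def indicator_def not_le)
  have "integrable lborel g" unfolding g_def
    by (intro borel_integrable_compact compact_Times continuous_on_subset[OF cont']) auto
  then have g: "integrable (lborel \<Otimes>\<^sub>M lborel) g" by (simp add: lborel_prod)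
  have "integrable lborel (\<lambda>\<tau>. \<integral>x. g (\<tau>, x) \<partial>lborel)" by (rule lborel_pair.integrable_fst'[OF g])
  then show "set_integrable lborel {s..t} (\<lambda>\<tau>. \<integral>x. f' \<tau> x \<partial>lborel)"
    by (simp add: geq set_integrable_def)
  have inner: "(\<integral>\<tau>. g (\<tau>, x) \<partial>lborel) = f t x - f s x" for x
  proof -
    have "continuous_on {s..t} (\<lambda>\<tau>. (\<lambda>(\<tau>, x). f' \<tau> x) (\<tau>, x))"
      by (rule continuous_on_compose2[OF cont']) (auto intro!: continuous_intros)
    then have "continuous_on {s..t} (\<lambda>\<tau>. f' \<tau> x)" by simp
    then have "(\<integral>\<tau>. indicator {s..t} \<tau> *\<^sub>R f' \<tau> x \<partial>lborel) = f t x - f s x"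
      using der by (intro integral_FTC_Icc st)
        (auto intro: has_vector_derivative_at_within simp: has_real_derivative_iff_has_vector_derivative)
    then show ?thesis by (simp add: geq)
  qed
  have "(\<integral>x. f t x \<partial>lborel) - (\<integral>x. f s x \<partial>lborel) = (\<integral>x. (\<integral>\<tau>. g (\<tau>, x) \<partial>lborel) \<partial>lborel)"
    using int st by (simp add: inner)
  also have "\<dots> = (\<integral>\<tau>. (\<integral>x. g (\<tau>, x) \<partial>lborel) \<partial>lborel)"
    using lborel_pair.Fubini_integral[of "\<lambda>\<tau> x. g (\<tau>, x)"] g by simp
  finally show "(\<integral>x. f t x \<partial>lborel) - (\<integral>x. f s x \<partial>lborel) = (LINT \<tau>:{s..t}|lborel. (\<integral>x. f' \<tau> x \<partial>lborel))"
    by (simp add: geq set_lebesgue_integral_def)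
qed

section \<open>Calculus of smooth functions\<close>

lemma frechet_derivative_eqI:
  "(f has_derivative f') (at x) \<Longrightarrow> frechet_derivative f (at x) v = f' v"
  using frechet_derivative_at by metis

lemma Ck_on_Suc_imp: "Ck_on (Suc k) S f \<Longrightarrow> Ck_on k S f"
proof (induction k arbitrary: f)
  case 0
  then show ?case
    by (auto intro: continuous_at_imp_continuous_on differentiable_imp_continuous_within)
next
  case (Suc k)
  then show ?case using Ck_on.simps(2) by blast
qed

lemma Ck_on_le: "Ck_on n S f \<Longrightarrow> m \<le> n \<Longrightarrow> Ck_on m S f"
  by (induction n) (use Ck_on_Suc_imp le_Suc_eq in blast)+

lemma Ck_on_imp_continuous_on: "Ck_on k S f \<Longrightarrow> continuous_on S f"
  using Ck_on_le[of k S f 0] by simp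

lemma frechet_derivative_cong_open:
  assumes "open S" "x \<in> S" "\<And>y. y \<in> S \<Longrightarrow> f y = g y" "f differentiable (at x)"
  shows "g differentiable (at x)" "frechet_derivative g (at x) = frechet_derivative f (at x)"
proof -
  have "(f has_derivative frechet_derivative f (at x)) (at x)"
    using assms(4) by (simp add: frechet_derivative_works)
  then have g: "(g has_derivative frechet_derivative f (at x)) (at x)"
    by (rule has_derivative_transform_within_open) (use assms in auto)
  then show "g differentiable (at x)" by (auto simp: differentiable_def)
  show "frechet_derivative g (at x) = frechet_derivative f (at x)"
    using frechet_derivative_at[OF g] by simp
qed

lemma Ck_on_cong:
  "Ck_on k S f \<Longrightarrow> open S \<Longrightarrow> (\<And>y. y \<in> S \<Longrightarrow> f y = g y) \<Longrightarrow> Ck_on k S g"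
proof (induction k arbitrary: f g)
  case 0
  then show ?case using continuous_on_cong[of S S f g] by simp
next
  case (Suc k)
  show ?case
    unfolding Ck_on.simps
  proof (intro conjI ballI allI)
    show "g differentiable (at x)" if "x \<in> S" for x
      using frechet_derivative_cong_open[of S x f g] Suc.prems that by auto
    show "Ck_on k S (\<lambda>x. frechet_derivative g (at x) v)" for v
      by (rule Suc.IH[of "\<lambda>x. frechet_derivative f (at x) v"])
        (use Suc.prems frechet_derivative_cong_open[of S _ f g] in auto)
  qed
qed

text \<open>Any explicitly known derivative may replace the chosen \<open>frechet_derivative\<close>
  in the recursion; openness of \<open>S\<close> makes the two agree near each point, as the next
  differentiation requires.\<close>

lemma Ck_on_SucI:
  assumes "open S" "\<And>x. x \<in> S \<Longrightarrow> (f has_derivative f' x) (at x)"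
    "\<And>v. Ck_on k S (\<lambda>x. f' x v)"
  shows "Ck_on (Suc k) S f"
  unfolding Ck_on.simps
proof (intro conjI ballI allI)
  show "f differentiable (at x)" if "x \<in> S" for x
    using assms(2)[OF that] by (auto simp: differentiable_def)
  show "Ck_on k S (\<lambda>x. frechet_derivative f (at x) v)" for v
    by (rule Ck_on_cong[OF assms(3)[of v] assms(1)])
      (use assms(2) frechet_derivative_eqI in metis)
qed

lemma Ck_on_SucD:
  assumes "Ck_on (Suc k) S f" "x \<in> S"
  shows "(f has_derivative frechet_derivative f (at x)) (at x)"
  using assms by (simp add: frechet_derivative_works)

lemma Ck_on_const: "open S \<Longrightarrow> Ck_on k S (\<lambda>x. c)"
  by (induction k arbitrary: c) (auto intro!: Ck_on_SucI[where f' = "\<lambda>_ _. 0"] simp del: Ck_on.simps(2))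

lemma Ck_on_add:
  "open S \<Longrightarrow> Ck_on k S f \<Longrightarrow> Ck_on k S g \<Longrightarrow> Ck_on k S (\<lambda>x. f x + g x)"
proof (induction k arbitrary: f g)
  case 0
  then show ?case by (simp add: continuous_on_add)
next
  case (Suc k)
  show ?case
  proof (rule Ck_on_SucI[OF Suc.prems(1)])
    show "((\<lambda>x. f x + g x) has_derivative (\<lambda>v. frechet_derivative f (at x) v + frechet_derivative g (at x) v)) (at x)"
      if "x \<in> S" for x
      using Suc.prems that by (intro has_derivative_add Ck_on_SucD)
  qed (use Suc in auto)
qed

lemma Ck_on_bounded_linear:
  assumes L: "bounded_linear L" and "open S" "Ck_on k S f"
  shows "Ck_on k S (\<lambda>x. L (f x))"
  using assms(3)
proof (induction k arbitrary: f)
  case 0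
  then show ?case using bounded_linear.continuous_on[OF L] by simp
next
  case (Suc k)
  show ?case
  proof (rule Ck_on_SucI[OF \<open>open S\<close>])
    show "((\<lambda>x. L (f x)) has_derivative (\<lambda>v. L (frechet_derivative f (at x) v))) (at x)" if "x \<in> S" for x
      using Ck_on_SucD[OF Suc.prems that] by (rule bounded_linear.has_derivative[OF L])
  qed (use Suc in auto)
qed

lemma Ck_on_bounded_bilinear:
  assumes P: "bounded_bilinear P" and S: "open S" and "Ck_on k S f" "Ck_on k S g"
  shows "Ck_on k S (\<lambda>x. P (f x) (g x))"
  using assms(3,4)
proof (induction k arbitrary: f g)
  case 0
  then show ?case using bounded_bilinear.continuous_on[OF P] by simp
next
  case (Suc k)
  show ?case
  proof (rule Ck_on_SucI[OF S])
    show "((\<lambda>x. P (f x) (g x)) has_derivative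
        (\<lambda>v. P (f x) (frechet_derivative g (at x) v) + P (frechet_derivative f (at x) v) (g x))) (at x)" if "x \<in> S" for x
      using Suc.prems that by (intro bounded_bilinear.FDERIV[OF P] Ck_on_SucD)
    have fg: "Ck_on k S f" "Ck_on k S g" using Suc.prems Ck_on_Suc_imp by blast+
    show "Ck_on k S (\<lambda>x. P (f x) (frechet_derivative g (at x) v) + P (frechet_derivative f (at x) v) (g x))" for v
      using Suc.prems by (intro Ck_on_add[OF S] Suc.IH fg) auto
  qed
qed

lemmas Ck_on_scaleR = Ck_on_bounded_bilinear[OF bounded_bilinear_scaleR]
lemmas Ck_on_mult = Ck_on_bounded_bilinear[OF bounded_bilinear_mult]
lemmas Ck_on_inner = Ck_on_bounded_bilinear[OF bounded_bilinear_inner]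
lemmas Ck_on_vec_nth = Ck_on_bounded_linear[OF bounded_linear_vec_nth]

lemma Ck_on_minus: "open S \<Longrightarrow> Ck_on k S f \<Longrightarrow> Ck_on k S (\<lambda>x. - f x)"
  by (rule Ck_on_bounded_linear[OF bounded_linear_minus[OF bounded_linear_ident]])

lemma Ck_on_diff: "open S \<Longrightarrow> Ck_on k S f \<Longrightarrow> Ck_on k S g \<Longrightarrow> Ck_on k S (\<lambda>x. f x - g x)"
  using Ck_on_add[of S k f "\<lambda>x. - g x"] Ck_on_minus[of S k g] by simp

lemma Ck_on_sum:
  assumes "open S" "\<And>i. i \<in> A \<Longrightarrow> Ck_on k S (f i)"
  shows "Ck_on k S (\<lambda>x. \<Sum>i\<in>A. f i x)"
  using assms(2)
proof (induction A rule: infinite_finite_induct)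
  case (insert i A)
  then show ?case using Ck_on_add[of S k "f i" "\<lambda>x. \<Sum>i\<in>A. f i x"] assms(1) by simp
qed (auto intro: Ck_on_const assms(1))

lemma Ck_on_compose_affine:
  assumes L: "bounded_linear L" and S: "open S" and sub: "\<And>x. x \<in> S \<Longrightarrow> a + L x \<in> T" and "Ck_on k T f"
  shows "Ck_on k S (\<lambda>x. f (a + L x))"
  using assms(4)
proof (induction k arbitrary: f)
  case 0
  then show ?case
    using sub by (auto intro!: continuous_on_compose2[of T f] continuous_intros bounded_linear.continuous_on[OF L])
next
  case (Suc k)
  show ?case
  proof (rule Ck_on_SucI[OF S])
    show "((\<lambda>x. f (a + L x)) has_derivative (\<lambda>v. frechet_derivative f (at (a + L x)) (L v))) (at x)"
      if "x \<in> S" for x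
    proof (rule has_derivative_compose[of "\<lambda>x. a + L x" L x UNIV f, OF _ Ck_on_SucD[OF Suc.prems sub[OF that]]])
      show "((\<lambda>x. a + L x) has_derivative L) (at x)"
        by (auto intro!: derivative_eq_intros bounded_linear_imp_has_derivative[OF L])
    qed
  qed (use Suc in auto)
qed

text \<open>The outer function comes with its successive derivatives \<open>B 0\<close>,
  \<open>B 1\<close>, and so on, so the induction hypothesis applies to the shifted sequence. The
  set \<open>I\<close> admits functions such as \<open>ln\<close> that are differentiable only on
  part of the line.\<close>

lemma Ck_on_compose_real:
  fixes c :: "'a::euclidean_space \<Rightarrow> real"
  assumes "open S" and "c ` S \<subseteq> I" and "Ck_on k S c"
    and "\<And>j s. j < k \<Longrightarrow> s \<in> I \<Longrightarrow> (B j has_real_derivative B (Suc j) s) (at s)"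
    and "continuous_on I (B k)"
  shows "Ck_on k S (\<lambda>x. B 0 (c x))"
  using assms(3-)
proof (induction k arbitrary: B)
  case 0
  then show ?case using assms(2) by (auto intro: continuous_on_compose2)
next
  case (Suc k)
  show ?case
  proof (rule Ck_on_SucI[OF assms(1)])
    show "((\<lambda>x. B 0 (c x)) has_derivative (\<lambda>v. B 1 (c x) * frechet_derivative c (at x) v)) (at x)" if "x \<in> S" for x
      using Suc.prems(2)[of 0 "c x"] assms(2) that
      by (auto simp: has_field_derivative_def
          intro!: has_derivative_compose[OF Ck_on_SucD[OF Suc.prems(1) that], of "B 0"])
    have c: "Ck_on k S c" using Suc.prems Ck_on_Suc_imp by blast
    have "Ck_on k S (\<lambda>x. B (Suc 0) (c x))"
      using Suc.prems by (intro Suc.IH[of "\<lambda>j. B (Suc j)"] c) auto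
    then show "Ck_on k S (\<lambda>x. B 1 (c x) * frechet_derivative c (at x) v)" for v
      using Suc.prems(1) by (intro Ck_on_mult assms(1)) auto
  qed
qed

lemma grad_works:
  assumes "f differentiable (at x)"
  shows "(f has_derivative (\<lambda>v. grad f x \<bullet> v)) (at x)"
proof -
  have l: "linear (frechet_derivative f (at x))" by (rule linear_frechet_derivative[OF assms])
  have "frechet_derivative f (at x) v = grad f x \<bullet> v" for v
  proof -
    have "v = (\<Sum>j\<in>UNIV. v $ j *\<^sub>R axis j 1)"
      by (simp add: vec_eq_iff axis_def if_distrib cong: if_cong)
    then have "frechet_derivative f (at x) v = (\<Sum>j\<in>UNIV. v $ j * frechet_derivative f (at x) (axis j 1))"
      using linear_sum[OF l, of "\<lambda>j. v $ j *\<^sub>R axis j 1" UNIV] by (simp add: linear_scale[OF l])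
    then show ?thesis by (simp add: grad_def inner_vec_def mult.commute)
  qed
  then have "frechet_derivative f (at x) = (\<lambda>v. grad f x \<bullet> v)" by auto
  then show ?thesis using assms by (simp add: frechet_derivative_works)
qed

lemma grad_eqI: "(f has_derivative (\<lambda>v. w \<bullet> v)) (at x) \<Longrightarrow> grad f x = w"
  by (simp add: grad_def vec_eq_iff frechet_derivative_eqI inner_axis)

lemma Ck_on_cart:
  assumes "open S" "\<And>j. Ck_on k S (\<lambda>x. F x $ j)"
  shows "Ck_on k S (F :: 'a::euclidean_space \<Rightarrow> real^'n)"
proof -
  have "Ck_on k S (\<lambda>x. \<Sum>j\<in>UNIV. F x $ j *\<^sub>R (axis j 1 :: real^'n))"
    using assms by (intro Ck_on_sum Ck_on_scaleR Ck_on_const)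
  moreover have "(\<Sum>j\<in>UNIV. F x $ j *\<^sub>R axis j 1) = F x" for x
    by (simp add: vec_eq_iff axis_def if_distrib cong: if_cong)
  ultimately show ?thesis by simp
qed

lemma Ck_on_grad: "open S \<Longrightarrow> Ck_on (Suc k) S f \<Longrightarrow> Ck_on k S (grad f)"
  by (rule Ck_on_cart) (auto simp: grad_def)

section \<open>Cut-off functions\<close>

text \<open>Polynomials in 1/s times exp (-1/s), extended by zero. The class is closed under
  differentiation, \<open>p\<close> becoming X^2 (p - p'), so smoothness at the origin comes from a
  single decay estimate.\<close>

definition flat_exp :: "real poly \<Rightarrow> real \<Rightarrow> real" where
  "flat_exp p s = (if s \<le> 0 then 0 else poly p (1 / s) * exp (- (1 / s)))"

lemma poly_times_exp_minus_tendsto_0: "((\<lambda>x::real. poly p x * exp (- x)) \<longlongrightarrow> 0) at_top"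
proof -
  have "((\<lambda>x::real. \<Sum>i\<le>degree p. coeff p i * (x ^ i / exp x)) \<longlongrightarrow> (\<Sum>i\<le>degree p. coeff p i * 0)) at_top"
    by (intro tendsto_intros tendsto_power_div_exp_0)
  then show ?thesis
    by (simp add: poly_altdef exp_minus divide_inverse sum_distrib_left mult_ac)
qed

lemma flat_exp_has_derivative:
  "(flat_exp p has_real_derivative flat_exp ([:0, 0, 1:] * (p - pderiv p)) s) (at s)"
proof -
  consider "s < 0" | "s > 0" | "s = 0" by linarith
  then show ?thesis
  proof cases
    case 1
    have "((\<lambda>_. 0) has_real_derivative 0) (at s)" by simp
    then have "(flat_exp p has_real_derivative 0) (at s)"
      by (rule DERIV_cong_ev[THEN iffD1, rotated 3])
        (auto simp: flat_exp_def 1 intro!: eventually_nhds_in_open[of "{..<0}" s, THEN eventually_mono])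
    then show ?thesis using 1 by (simp add: flat_exp_def)
  next
    case 2
    have "((\<lambda>s. poly p (1 / s) * exp (- (1 / s))) has_real_derivative
        flat_exp ([:0, 0, 1:] * (p - pderiv p)) s) (at s)"
      using 2 by (auto intro!: derivative_eq_intros simp: flat_exp_def field_simps power2_eq_square)
    then show ?thesis
      by (rule DERIV_cong_ev[THEN iffD1, rotated 3])
        (auto simp: flat_exp_def 2 intro!: eventually_nhds_in_open[of "{0<..}" s, THEN eventually_mono])
  next
    case 3
    \<comment> \<open>At the origin the difference quotient is again of this kind:
      \<open>flat_exp p s / s\<close> belongs to the polynomial X p for s > 0 and is zero for s <
      0.\<close>
    have "((\<lambda>x. poly ([:0, 1:] * p) x * exp (- x)) \<longlongrightarrow> 0) at_top" by (rule poly_times_exp_minus_tendsto_0)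
    from filterlim_compose[OF this filterlim_inverse_at_top_right]
    have "((\<lambda>s. flat_exp p s / s) \<longlongrightarrow> 0) (at_right 0)"
      by (rule Lim_transform_eventually) (auto simp: eventually_at_filter flat_exp_def field_simps)
    moreover have "((\<lambda>s. flat_exp p s / s) \<longlongrightarrow> 0) (at_left 0)"
      by (rule Lim_transform_eventually[OF tendsto_const]) (auto simp: eventually_at_filter flat_exp_def)
    ultimately have "((\<lambda>s. flat_exp p s / s) \<longlongrightarrow> 0) (at 0)" by (simp add: filterlim_split_at)
    then show ?thesis using 3 by (simp add: has_field_derivative_iff flat_exp_def)
  qed
qed

lemma cutoff_exists:
  obtains \<eta> :: "real^3 \<Rightarrow> real" where
    "smooth_on UNIV \<eta>" "\<And>x. 0 \<le> \<eta> x" "\<And>x. \<eta> x \<le> 1" "\<eta> 0 = 1" "\<And>x. norm x > 1 \<Longrightarrow> \<eta> x = 0"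
proof -
  \<comment> \<open>The classical bump function exp (-1 / (1 - |x|^2)), normalised by
    \<open>exp 1\<close> to the value 1 at the origin; \<open>p\<close> lists the polynomials of the
    successive derivatives of its outer function.\<close>
  define p where "p j = ((\<lambda>q::real poly. [:0, 0, 1:] * (q - pderiv q)) ^^ j) [:1:]" for j :: nat
  define \<eta> where "\<eta> x = exp 1 * flat_exp (p 0) (1 - x \<bullet> x)" for x :: "real^3"
  have p: "(flat_exp (p j) has_real_derivative flat_exp (p (Suc j)) s) (at s)" for j s
    unfolding p_def funpow.simps comp_def by (rule flat_exp_has_derivative)
  have "Ck_on k UNIV \<eta>" for k
  proof -
    have "Ck_on k UNIV (\<lambda>x::real^3. x)"
    proof -
      have "Ck_on k UNIV (\<lambda>x::real^3. x)" if "k = Suc n" for n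
        unfolding that by (rule Ck_on_SucI[where f' = "\<lambda>x v. v"]) (auto intro: Ck_on_const)
      then show ?thesis by (cases k) auto
    qed
    then have "Ck_on k UNIV (\<lambda>x::real^3. 1 - x \<bullet> x)"
      by (intro Ck_on_diff Ck_on_const Ck_on_inner) auto
    moreover have "continuous_on UNIV (flat_exp (p k))"
      using p by (meson DERIV_continuous_on has_field_derivative_at_within)
    ultimately have "Ck_on k UNIV (\<lambda>x::real^3. flat_exp (p 0) (1 - x \<bullet> x))"
      using p by (intro Ck_on_compose_real[of UNIV _ UNIV k "\<lambda>j. flat_exp (p j)"]) auto
    then show ?thesis unfolding \<eta>_def by (intro Ck_on_mult Ck_on_const) auto
  qed
  moreover have "\<eta> x = 0" if "norm x > 1" for x
  proof -
    have "norm x ^ 2 > 1" using that by (simp add: one_less_power)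
    then show ?thesis by (simp add: \<eta>_def flat_exp_def power2_norm_eq_inner)
  qed
  moreover have "\<eta> x \<le> 1" for x
    using inner_ge_zero[of x]
    by (auto simp: \<eta>_def flat_exp_def p_def field_simps not_le simp flip: exp_add)
  moreover have "0 \<le> \<eta> x" "\<eta> 0 = 1" for x
    by (auto simp: \<eta>_def flat_exp_def p_def simp flip: exp_add)
  ultimately show ?thesis using that[of \<eta>] unfolding smooth_on_def by blast
qed

definition standard_cutoff :: "real^3 \<Rightarrow> real" where
  "standard_cutoff = (SOME \<eta>. smooth_on UNIV \<eta> \<and> (\<forall>x. 0 \<le> \<eta> x \<and> \<eta> x \<le> 1) \<and> \<eta> 0 = 1 \<and> (\<forall>x. norm x > 1 \<longrightarrow> \<eta> x = 0))"

text \<open>All cut-offs are dilations of one profile, so their derivatives obey bounds with a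
  single constant. The summand \<open>0 +\<close> gives the argument the shape
  \<open>a + L x\<close> of \<open>Ck_on_compose_affine\<close>.\<close>

definition cutoff :: "real \<Rightarrow> real^3 \<Rightarrow> real" where
  "cutoff R x = standard_cutoff (0 + x /\<^sub>R R)"

lemma standard_cutoff:
  "smooth_on UNIV standard_cutoff" "0 \<le> standard_cutoff x" "standard_cutoff x \<le> 1"
  "standard_cutoff 0 = 1" "norm x > 1 \<Longrightarrow> standard_cutoff x = 0"
proof -
  have ex: "\<exists>\<eta>::real^3 \<Rightarrow> real. smooth_on UNIV \<eta> \<and> (\<forall>x. 0 \<le> \<eta> x \<and> \<eta> x \<le> 1) \<and> \<eta> 0 = 1 \<and> (\<forall>x. norm x > 1 \<longrightarrow> \<eta> x = 0)"
    by (rule cutoff_exists) blast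
  have "smooth_on UNIV standard_cutoff \<and> (\<forall>x. 0 \<le> standard_cutoff x \<and> standard_cutoff x \<le> 1) \<and>
      standard_cutoff 0 = 1 \<and> (\<forall>x. norm x > 1 \<longrightarrow> standard_cutoff x = 0)"
    by (rule someI_ex[OF ex, folded standard_cutoff_def])
  then show "smooth_on UNIV standard_cutoff" "0 \<le> standard_cutoff x" "standard_cutoff x \<le> 1"
    "standard_cutoff 0 = 1" "norm x > 1 \<Longrightarrow> standard_cutoff x = 0" by auto
qed

lemma cutoff_range: "0 \<le> cutoff R x" "cutoff R x \<le> 1"
  by (auto simp: cutoff_def standard_cutoff)

lemma cutoff_support: "R > 0 \<Longrightarrow> norm x > R \<Longrightarrow> cutoff R x = 0"
  by (auto simp: cutoff_def field_simps intro!: standard_cutoff(5))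

lemma Ck_on_cutoff: "Ck_on k UNIV (cutoff R)"
  unfolding cutoff_def
  using standard_cutoff(1) by (intro Ck_on_compose_affine[where T = UNIV] bounded_linear_scaleR_right)
    (auto simp: smooth_on_def)

lemma cutoff_tendsto_1: "((\<lambda>R. cutoff R x) \<longlongrightarrow> 1) at_top"
proof -
  have "isCont standard_cutoff 0"
    using standard_cutoff(1) Ck_on_imp_continuous_on[of 0 UNIV standard_cutoff]
    by (auto simp: smooth_on_def continuous_on_eq_continuous_at)
  moreover have "((\<lambda>R. 0 + x /\<^sub>R R) \<longlongrightarrow> 0 + 0 *\<^sub>R x) at_top"
    by (intro tendsto_intros tendsto_inverse_0_at_top filterlim_ident)
  ultimately show ?thesis
    unfolding cutoff_def using isCont_tendsto_compose[of 0 standard_cutoff] standard_cutoff(4) by fastforce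
qed

lemma laplacian_eqI: "(grad f has_derivative H) (at x) \<Longrightarrow> laplacian f x = (\<Sum>j\<in>UNIV. H (axis j 1) $ j)"
  by (simp add: laplacian_def divergence_def frechet_derivative_eqI)

lemma divergence_eqI: "(F has_derivative H) (at x) \<Longrightarrow> divergence F x = (\<Sum>j\<in>UNIV. H (axis j 1) $ j)"
  by (simp add: divergence_def frechet_derivative_eqI)

text \<open>Dilation gives 1/R for the gradient and 1/R^2 for the Laplacian; since R >= 1 the second
  is weakened to 1/R, so that one constant governs both error terms.\<close>

lemma cutoff_bounds:
  obtains C where "C > 0"
    "\<And>R x. R \<ge> 1 \<Longrightarrow> norm (grad (cutoff R) x) \<le> C / R"
    "\<And>R x. R \<ge> 1 \<Longrightarrow> \<bar>laplacian (cutoff R) x\<bar> \<le> C / R"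
proof -
  have C: "Ck_on k UNIV standard_cutoff" for k using standard_cutoff(1) by (simp add: smooth_on_def)
  define H where "H x = frechet_derivative (grad standard_cutoff) (at x)" for x
  have g1: "Ck_on 1 UNIV (grad standard_cutoff)" by (rule Ck_on_grad) (auto intro: C simp del: Ck_on.simps)
  have supp0: "grad standard_cutoff x = 0" if "norm x > 1" for x
    using frechet_derivative_outside_support[of 1 standard_cutoff, OF _ that] standard_cutoff(5)
    by (simp add: grad_def vec_eq_iff)
  obtain B1 where B1: "B1 > 0" "\<And>x. norm (grad standard_cutoff x) \<le> B1"
    using bounded_continuous_compact_support[of "grad standard_cutoff" 1]
      Ck_on_imp_continuous_on[OF g1] supp0 by metis
  have lap: "laplacian standard_cutoff x = (\<Sum>j\<in>UNIV. H x (axis j 1) $ j)" for x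
    by (simp add: laplacian_def divergence_def H_def)
  have "continuous_on UNIV (laplacian standard_cutoff)"
    unfolding lap H_def using g1 by (intro continuous_intros) auto
  moreover have "laplacian standard_cutoff x = 0" if "norm x > 1" for x
    using frechet_derivative_outside_support[of 1 "grad standard_cutoff", OF supp0 that]
    by (simp add: lap H_def)
  ultimately obtain B2 where B2: "B2 > 0" "\<And>x. norm (laplacian standard_cutoff x) \<le> B2"
    using bounded_continuous_compact_support[of "laplacian standard_cutoff" 1] by metis
  have aff: "((\<lambda>x. 0 + x /\<^sub>R R) has_derivative (\<lambda>v. v /\<^sub>R R)) (at x)" for x :: "real^3" and R
    by (auto intro!: derivative_eq_intros)
  have gr: "grad (cutoff R) x = grad standard_cutoff (0 + x /\<^sub>R R) /\<^sub>R R" for R x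
  proof (rule grad_eqI)
    have "(cutoff R has_derivative (\<lambda>v. grad standard_cutoff (0 + x /\<^sub>R R) \<bullet> (v /\<^sub>R R))) (at x)"
      unfolding cutoff_def[abs_def]
      by (rule has_derivative_compose[OF aff grad_works]) (use C[of 1] in auto)
    then show "(cutoff R has_derivative (\<bullet>) (grad standard_cutoff (0 + x /\<^sub>R R) /\<^sub>R R)) (at x)"
      by (rule has_derivative_eq_rhs) auto
  qed
  have Hd: "(grad standard_cutoff has_derivative H y) (at y)" for y
    using Ck_on_SucD[of 0 UNIV "grad standard_cutoff" y] g1 by (simp add: H_def)
  have la: "laplacian (cutoff R) x = laplacian standard_cutoff (0 + x /\<^sub>R R) / R / R" for R x
  proof -
    have "((\<lambda>x. grad standard_cutoff (0 + x /\<^sub>R R)) has_derivative (\<lambda>v. H (0 + x /\<^sub>R R) (v /\<^sub>R R))) (at x)"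
      by (rule has_derivative_compose[OF aff Hd])
    then have "(grad (cutoff R) has_derivative (\<lambda>v. H (0 + x /\<^sub>R R) (v /\<^sub>R R) /\<^sub>R R)) (at x)"
      unfolding gr[abs_def] by (auto intro!: derivative_eq_intros)
    moreover have "linear (H y)" for y
      unfolding H_def using g1 by (intro linear_frechet_derivative) auto
    ultimately show ?thesis
      by (simp add: laplacian_eqI lap linear_scale[of "H _"] divide_inverse sum_distrib_left mult_ac)
  qed
  show ?thesis
  proof (rule that[of "B1 + B2"])
    show "norm (grad (cutoff R) x) \<le> (B1 + B2) / R" if "R \<ge> 1" for R x
      using that B1(2)[of "0 + x /\<^sub>R R"] B2(1) by (simp add: gr field_simps)
    show "\<bar>laplacian (cutoff R) x\<bar> \<le> (B1 + B2) / R" if "R \<ge> 1" for R x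
    proof -
      have "\<bar>laplacian (cutoff R) x\<bar> \<le> B2 / R / R"
        using that B2(2)[of "0 + x /\<^sub>R R"] by (simp add: la abs_mult divide_right_mono)
      also have "\<dots> \<le> B2 / R" using that B2(1) by (simp add: field_simps)
      also have "\<dots> \<le> (B1 + B2) / R" using that B1(1) by (simp add: field_simps)
      finally show ?thesis .
    qed
  qed (use B1 B2 in auto)
qed

lemma test_functionI:
  assumes "\<And>k. Ck_on k UNIV \<psi>" "\<And>x. norm x > r \<Longrightarrow> \<psi> x = 0"
  shows "test_function \<psi>"
  unfolding test_function_def smooth_on_def
proof
  have "{x. \<psi> x \<noteq> 0} \<subseteq> cball 0 r" using assms(2) by (force simp: not_le)
  then show "compact (closure {x. \<psi> x \<noteq> 0})"
    by (meson bounded_cball bounded_subset compact_closure)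
qed (use assms in auto)

text \<open>Fatou's lemma for truncated integrands: bounds that merely converge are allowed, and
  integrability of the limit is part of the conclusion. This is how integrability is gained when a
  cut-off or a regularisation is removed.\<close>

lemma Fatou_integrable:
  fixes f :: "'a \<Rightarrow> real"
  assumes [measurable]: "f \<in> borel_measurable M" and int: "\<And>n. integrable M (s n)"
    and nn: "\<And>n x. 0 \<le> s n x" and lim: "AE x in M. (\<lambda>n. s n x) \<longlonglongrightarrow> f x"
    and le: "\<And>n. (\<integral>x. s n x \<partial>M) \<le> b n" and b: "b \<longlonglongrightarrow> C"
  shows "integrable M f" "(\<integral>x. f x \<partial>M) \<le> C"
proof -
  have f0: "AE x in M. 0 \<le> f x" using lim
    by eventually_elim (use nn LIMSEQ_le_const in blast)
  have "(\<integral>x. s n x \<partial>M) \<ge> 0" for n using nn by (intro Bochner_Integration.integral_nonneg)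
  then have b0: "0 \<le> b n" for n using le order_trans by blast
  then have C0: "0 \<le> C" using b LIMSEQ_le_const by blast
  have "(\<integral>\<^sup>+x. ennreal (f x) \<partial>M) = (\<integral>\<^sup>+x. liminf (\<lambda>n. ennreal (s n x)) \<partial>M)"
    by (rule nn_integral_cong_AE, use lim in eventually_elim) (auto intro!: lim_imp_Liminf[symmetric] tendsto_ennrealI)
  also have "\<dots> \<le> liminf (\<lambda>n. \<integral>\<^sup>+x. ennreal (s n x) \<partial>M)"
    by (rule nn_integral_liminf) (use int in measurable)
  also have "\<dots> \<le> liminf (\<lambda>n. ennreal (b n))"
    by (rule Liminf_mono) (auto simp: nn_integral_eq_integral[OF int] nn intro!: always_eventually ennreal_leI le)
  also have "\<dots> = ennreal C" using b by (intro lim_imp_Liminf tendsto_ennrealI) auto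
  finally have *: "(\<integral>\<^sup>+x. ennreal (f x) \<partial>M) \<le> ennreal C" .
  then show int_f: "integrable M f"
    using f0 by (intro integrableI_nonneg) (auto simp: top_unique less_top[symmetric])
  show "(\<integral>x. f x \<partial>M) \<le> C"
    using * f0 C0 by (simp add: nn_integral_eq_integral[OF int_f])
qed

lemma cutoff_Fatou:
  fixes f :: "real^3 \<Rightarrow> real"
  assumes "f \<in> borel_measurable borel" "\<And>x. 0 \<le> f x"
    "\<And>R. R \<ge> 1 \<Longrightarrow> integrable lborel (\<lambda>x. cutoff R x * f x)"
    "\<And>R. R \<ge> 1 \<Longrightarrow> (\<integral>x. cutoff R x * f x \<partial>lborel) \<le> A + C / R"
  shows "integrable lborel f" "(\<integral>x. f x \<partial>lborel) \<le> A"
proof -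
  have lim: "AE x in lborel. (\<lambda>n. cutoff (real (Suc n)) x * f x) \<longlonglongrightarrow> f x"
  proof (rule AE_I2)
    fix x
    have "(\<lambda>n. cutoff (real (Suc n)) x) \<longlonglongrightarrow> 1"
      by (rule filterlim_compose[OF cutoff_tendsto_1 filterlim_compose[OF filterlim_real_sequentially filterlim_Suc]])
    from tendsto_mult_right[OF this, of "f x"]
    show "(\<lambda>n. cutoff (real (Suc n)) x * f x) \<longlonglongrightarrow> f x" by simp
  qed
  have "(\<lambda>n. A + C * inverse (real (Suc n))) \<longlonglongrightarrow> A + C * 0"
    by (intro tendsto_intros LIMSEQ_inverse_real_of_nat)
  then have b: "(\<lambda>n. A + C / real (Suc n)) \<longlonglongrightarrow> A" by (simp add: divide_inverse)
  show "integrable lborel f"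
    by (rule Fatou_integrable(1)[OF _ _ _ lim _ b]) (use assms cutoff_range in auto)
  show "(\<integral>x. f x \<partial>lborel) \<le> A"
    by (rule Fatou_integrable(2)[OF _ _ _ lim _ b]) (use assms cutoff_range in auto)
qed

section \<open>Weak gradients\<close>

lemma integral_mult_grad_by_parts:
  fixes f :: "real^3 \<Rightarrow> real"
  assumes f: "Ck_on 1 UNIV f" and \<psi>: "Ck_on 1 UNIV \<psi>" and supp: "\<And>x. norm x > r \<Longrightarrow> \<psi> x = 0"
  shows "(\<integral>x. f x * grad \<psi> x $ j \<partial>lborel) = - (\<integral>x. \<psi> x * grad f x $ j \<partial>lborel)"
proof -
  have d: "((\<lambda>x. f x * \<psi> x) has_derivative
      (\<lambda>v. f x * frechet_derivative \<psi> (at x) v + frechet_derivative f (at x) v * \<psi> x)) (at x)" for x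
    using f \<psi> by (intro has_derivative_mult Ck_on_SucD[of 0 UNIV]) (auto simp: One_nat_def)
  have fd: "frechet_derivative (\<lambda>x. f x * \<psi> x) (at x) (axis j 1) = f x * grad \<psi> x $ j + \<psi> x * grad f x $ j" for x
    unfolding frechet_derivative_eqI[OF d] grad_def by simp
  have c0: "continuous_on UNIV f" "continuous_on UNIV \<psi>"
    using f \<psi> by (auto intro!: Ck_on_imp_continuous_on simp del: Ck_on.simps)
  have c1: "continuous_on UNIV (\<lambda>x. grad f x $ j)" "continuous_on UNIV (\<lambda>x. grad \<psi> x $ j)"
    using f \<psi> by (auto simp: grad_def)
  have "grad \<psi> x $ j = 0" if "norm x > r" for x
    using frechet_derivative_outside_support[OF supp that] by (simp add: grad_def)
  then have "integrable lborel (\<lambda>x. f x * grad \<psi> x $ j)" "integrable lborel (\<lambda>x. \<psi> x * grad f x $ j)"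
    using supp c0 c1 by (auto intro!: integrable_continuous_compact_support[of _ r] continuous_intros)
  moreover have "(\<integral>x. frechet_derivative (\<lambda>x. f x * \<psi> x) (at x) (axis j 1) \<partial>lborel) = 0"
    using supp d c0 c1 unfolding fd
    by (intro integral_frechet_derivative_eq_0[of "\<lambda>x. f x * \<psi> x" "axis j 1" r, unfolded fd])
      (auto simp: differentiable_def intro!: continuous_intros)
  ultimately show ?thesis unfolding fd by simp
qed

lemma integrable_mult_of_squares:
  fixes f g :: "'a \<Rightarrow> real"
  assumes [measurable]: "f \<in> borel_measurable M" "g \<in> borel_measurable M"
    and "integrable M (\<lambda>x. (f x)\<^sup>2)" "integrable M (\<lambda>x. (g x)\<^sup>2)"
  shows "integrable M (\<lambda>x. f x * g x)"
proof (rule Bochner_Integration.integrable_bound)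
  show "integrable M (\<lambda>x. (f x)\<^sup>2 + (g x)\<^sup>2)" using assms by simp
  show "AE x in M. norm (f x * g x) \<le> norm ((f x)\<^sup>2 + (g x)\<^sup>2)"
  proof (rule AE_I2)
    fix x
    have "2 * (\<bar>f x\<bar> * \<bar>g x\<bar>) \<le> \<bar>f x\<bar>\<^sup>2 + \<bar>g x\<bar>\<^sup>2" using sum_squares_bound[of "\<bar>f x\<bar>" "\<bar>g x\<bar>"] by simp
    moreover have "0 \<le> \<bar>f x\<bar> * \<bar>g x\<bar>" by simp
    ultimately show "norm (f x * g x) \<le> norm ((f x)\<^sup>2 + (g x)\<^sup>2)"
      using abs_ge_self[of "(f x)\<^sup>2 + (g x)\<^sup>2"] unfolding real_norm_def abs_mult power2_abs by linarith
  qed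
qed simp

text \<open>Testing the weak gradient with a cut-off times a partial derivative of f turns the
  truncated integral of |grad f|^2 into that of the inner product of grad f and \<open>g\<close>;
  Young's inequality absorbs half of it. The classical gradient is bounded in this way without
  showing that it equals \<open>g\<close> almost everywhere.\<close>

lemma grad_bounded_by_weak_grad:
  assumes f: "\<And>k. Ck_on k UNIV f" and g: "weak_grad f g"
  shows "integrable lborel (\<lambda>x. (norm (grad f x))\<^sup>2)"
    "(\<integral>x. (norm (grad f x))\<^sup>2 \<partial>lborel) \<le> (\<integral>x. (norm (g x))\<^sup>2 \<partial>lborel)"
proof -
  have [measurable]: "g \<in> borel_measurable borel" "f \<in> borel_measurable borel"
    and g2: "integrable lborel (\<lambda>x. (norm (g x))\<^sup>2)"
    using g by (auto simp: weak_grad_def in_L2_def)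
  have gradC: "Ck_on k UNIV (grad f)" for k by (rule Ck_on_grad) (use f in auto)
  have contg: "continuous_on UNIV (grad f)" using gradC by (rule Ck_on_imp_continuous_on)
  have [measurable]: "grad f \<in> borel_measurable borel" using contg by (rule borel_measurable_continuous_onI)
  have contc: "continuous_on UNIV (cutoff R)" for R by (rule Ck_on_imp_continuous_on[OF Ck_on_cutoff])
  have [measurable]: "cutoff R \<in> borel_measurable borel" for R using contc by (rule borel_measurable_continuous_onI)
  have [measurable]: "(\<lambda>x. g x $ j) \<in> borel_measurable borel" for j by (simp add: cart_eq_inner_axis)
  have gj: "integrable lborel (\<lambda>x. (g x $ j)\<^sup>2)" for j
  proof (rule Bochner_Integration.integrable_bound[OF g2])
    show "AE x in lborel. norm ((g x $ j)\<^sup>2) \<le> norm ((norm (g x))\<^sup>2)"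
    proof (rule AE_I2)
      fix x
      have "\<bar>g x $ j\<bar>\<^sup>2 \<le> (norm (g x))\<^sup>2" by (rule power_mono[OF component_le_norm_cart]) simp
      then show "norm ((g x $ j)\<^sup>2) \<le> norm ((norm (g x))\<^sup>2)" by simp
    qed
  qed simp
  have int1: "integrable lborel (\<lambda>x. cutoff R x * (norm (grad f x))\<^sup>2)" if "R \<ge> 1" for R
    using that cutoff_support contg contc
    by (intro integrable_continuous_compact_support[of _ R]) (auto intro!: continuous_intros)
  \<comment> \<open>The error \<open>0 / R\<close> only gives the bound the shape expected by
    \<open>cutoff_Fatou\<close>.\<close>
  have key: "(\<integral>x. cutoff R x * (norm (grad f x))\<^sup>2 \<partial>lborel) \<le> (\<integral>x. (norm (g x))\<^sup>2 \<partial>lborel) + 0 / R"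
    if R: "R \<ge> 1" for R
  proof -
    define \<psi> where "\<psi> j x = cutoff R x * grad f x $ j" for j x
    have \<psi>C: "Ck_on k UNIV (\<psi> j)" for k j unfolding \<psi>_def
      by (intro Ck_on_mult Ck_on_cutoff Ck_on_vec_nth gradC) auto
    have \<psi>0: "\<psi> j x = 0" if "norm x > R" for j x using that R cutoff_support[of R x] by (simp add: \<psi>_def)
    have \<psi>cont: "continuous_on UNIV (\<psi> j)" for j using \<psi>C by (rule Ck_on_imp_continuous_on)
    have [measurable]: "\<psi> j \<in> borel_measurable borel" for j using \<psi>cont by (rule borel_measurable_continuous_onI)
    have \<psi>2: "integrable lborel (\<lambda>x. (\<psi> j x)\<^sup>2)" for j
      using \<psi>0 \<psi>cont by (intro integrable_continuous_compact_support[of _ R]) (auto intro!: continuous_intros)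
    have i2: "integrable lborel (\<lambda>x. \<psi> j x * g x $ j)" for j
      by (rule integrable_mult_of_squares[OF _ _ \<psi>2 gj]) auto
    have i3: "integrable lborel (\<lambda>x. \<psi> j x * grad f x $ j)" for j
      using \<psi>0 \<psi>cont contg by (intro integrable_continuous_compact_support[of _ R]) (auto intro!: continuous_intros)
    have "(\<integral>x. \<psi> j x * grad f x $ j \<partial>lborel) = (\<integral>x. \<psi> j x * g x $ j \<partial>lborel)" for j
    proof -
      have gC: "Ck_on 1 UNIV (grad (\<psi> j))" by (rule Ck_on_grad[OF open_UNIV \<psi>C])
      have gcont: "continuous_on UNIV (grad (\<psi> j))" using gC by (rule Ck_on_imp_continuous_on)
      have gsupp: "grad (\<psi> j) x = 0" if "norm x > R" for x
        using frechet_derivative_outside_support[OF \<psi>0 that] by (simp add: grad_def vec_eq_iff)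
      have fc: "continuous_on UNIV f" using f by (rule Ck_on_imp_continuous_on)
      have int: "integrable lborel (\<lambda>x. f x *\<^sub>R grad (\<psi> j) x)"
        using gcont fc gsupp by (intro integrable_continuous_compact_support[of _ R]) (auto intro!: continuous_intros)
      have intg: "integrable lborel (\<lambda>x. \<psi> j x *\<^sub>R g x)"
      proof (rule Bochner_Integration.integrable_bound)
        show "integrable lborel (\<lambda>x. (\<psi> j x)\<^sup>2 + (norm (g x))\<^sup>2)" using \<psi>2 g2 by simp
        show "AE x in lborel. norm (\<psi> j x *\<^sub>R g x) \<le> norm ((\<psi> j x)\<^sup>2 + (norm (g x))\<^sup>2)"
        proof (rule AE_I2)
          fix x
          have "2 * (\<bar>\<psi> j x\<bar> * norm (g x)) \<le> \<bar>\<psi> j x\<bar>\<^sup>2 + (norm (g x))\<^sup>2"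
            using sum_squares_bound[of "\<bar>\<psi> j x\<bar>" "norm (g x)"] by simp
          moreover have "0 \<le> \<bar>\<psi> j x\<bar> * norm (g x)" by simp
          ultimately show "norm (\<psi> j x *\<^sub>R g x) \<le> norm ((\<psi> j x)\<^sup>2 + (norm (g x))\<^sup>2)"
            using abs_ge_self[of "(\<psi> j x)\<^sup>2 + (norm (g x))\<^sup>2"]
            unfolding norm_scaleR power2_abs real_norm_def[of "_ + _"] by linarith
        qed
      qed simp
      have "test_function (\<psi> j)" using \<psi>C \<psi>0 by (rule test_functionI)
      then have "(\<integral>x. f x *\<^sub>R grad (\<psi> j) x \<partial>lborel) $ j = - (\<integral>x. \<psi> j x *\<^sub>R g x \<partial>lborel) $ j"
        using g by (simp add: weak_grad_def)
      then have "(\<integral>x. f x * grad (\<psi> j) x $ j \<partial>lborel) = - (\<integral>x. \<psi> j x * g x $ j \<partial>lborel)"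
        using integral_bounded_linear[OF bounded_linear_vec_nth[of j] int]
          integral_bounded_linear[OF bounded_linear_vec_nth[of j] intg] by simp
      then show ?thesis using integral_mult_grad_by_parts[OF f \<psi>C \<psi>0, where j = j] by simp
    qed
    then have eq: "(\<integral>x. (\<Sum>j\<in>UNIV. \<psi> j x * grad f x $ j) \<partial>lborel) = (\<integral>x. (\<Sum>j\<in>UNIV. \<psi> j x * g x $ j) \<partial>lborel)"
      using i2 i3 by simp
    have "(\<integral>x. cutoff R x * (norm (grad f x))\<^sup>2 \<partial>lborel) = (\<integral>x. (\<Sum>j\<in>UNIV. \<psi> j x * grad f x $ j) \<partial>lborel)"
      by (simp add: \<psi>_def power2_norm_eq_inner inner_vec_def sum_distrib_left mult_ac)
    also note eq
    also have "(\<integral>x. (\<Sum>j\<in>UNIV. \<psi> j x * g x $ j) \<partial>lborel)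
        \<le> (\<integral>x. (cutoff R x * (norm (grad f x))\<^sup>2 + (norm (g x))\<^sup>2) / 2 \<partial>lborel)"
    proof (rule integral_mono)
      fix x
      have "(\<Sum>j\<in>UNIV. \<psi> j x * g x $ j) = cutoff R x * (grad f x \<bullet> g x)"
        by (simp add: \<psi>_def inner_vec_def sum_distrib_left mult_ac)
      also have "\<dots> \<le> cutoff R x * (((norm (grad f x))\<^sup>2 + (norm (g x))\<^sup>2) / 2)"
      proof (rule mult_left_mono[OF _ cutoff_range(1)])
        have "grad f x \<bullet> g x \<le> norm (grad f x) * norm (g x)" by (rule norm_cauchy_schwarz)
        then show "grad f x \<bullet> g x \<le> ((norm (grad f x))\<^sup>2 + (norm (g x))\<^sup>2) / 2"
          using sum_squares_bound[of "norm (grad f x)" "norm (g x)"] by simp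
      qed
      also have "\<dots> \<le> (cutoff R x * (norm (grad f x))\<^sup>2 + (norm (g x))\<^sup>2) / 2"
        using mult_right_mono[OF cutoff_range(2)[of R x], of "(norm (g x))\<^sup>2"] by (simp add: algebra_simps)
      finally show "(\<Sum>j\<in>UNIV. \<psi> j x * g x $ j) \<le> (cutoff R x * (norm (grad f x))\<^sup>2 + (norm (g x))\<^sup>2) / 2" .
    qed (use i2 int1[OF R] g2 in auto)
    also have "\<dots> = ((\<integral>x. cutoff R x * (norm (grad f x))\<^sup>2 \<partial>lborel) + (\<integral>x. (norm (g x))\<^sup>2 \<partial>lborel)) / 2"
      using int1[OF R] g2 by simp
    finally show ?thesis by simp
  qed
  show "integrable lborel (\<lambda>x. (norm (grad f x))\<^sup>2)"
    by (rule cutoff_Fatou(1)[OF _ _ int1 key]) auto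
  show "(\<integral>x. (norm (grad f x))\<^sup>2 \<partial>lborel) \<le> (\<integral>x. (norm (g x))\<^sup>2 \<partial>lborel)"
    by (rule cutoff_Fatou(2)[OF _ _ int1 key]) auto
qed

lemma in_L2_add_scaled:
  fixes f g :: "real^3 \<Rightarrow> 'b::euclidean_space"
  assumes f: "in_L2 f" and g: "in_L2 g"
  shows "in_L2 (\<lambda>x. f x + a *\<^sub>R g x)"
    and "(\<integral>x. (norm (f x + a *\<^sub>R g x))\<^sup>2 \<partial>lborel)
      \<le> 2 * (\<integral>x. (norm (f x))\<^sup>2 \<partial>lborel) + 2 * a\<^sup>2 * (\<integral>x. (norm (g x))\<^sup>2 \<partial>lborel)"
proof -
  have [measurable]: "f \<in> borel_measurable borel" "g \<in> borel_measurable borel"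
    and int: "integrable lborel (\<lambda>x. (norm (f x))\<^sup>2)" "integrable lborel (\<lambda>x. (norm (g x))\<^sup>2)"
    using f g by (auto simp: in_L2_def)
  have le: "(norm (f x + a *\<^sub>R g x))\<^sup>2 \<le> 2 * (norm (f x))\<^sup>2 + 2 * a\<^sup>2 * (norm (g x))\<^sup>2" for x
  proof -
    have "(norm (f x + a *\<^sub>R g x))\<^sup>2 \<le> (norm (f x) + norm (a *\<^sub>R g x))\<^sup>2"
      by (intro power_mono norm_triangle_ineq) auto
    also have "\<dots> \<le> 2 * (norm (f x))\<^sup>2 + 2 * (norm (a *\<^sub>R g x))\<^sup>2"
      using sum_squares_bound[of "norm (f x)" "norm (a *\<^sub>R g x)"] by (simp add: power2_sum)
    finally show ?thesis by (simp add: power_mult_distrib)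
  qed
  have int': "integrable lborel (\<lambda>x. 2 * (norm (f x))\<^sup>2 + 2 * a\<^sup>2 * (norm (g x))\<^sup>2)" using int by simp
  have i: "integrable lborel (\<lambda>x. (norm (f x + a *\<^sub>R g x))\<^sup>2)"
  proof (rule Bochner_Integration.integrable_bound[OF int'])
    have r0: "0 \<le> 2 * (norm (f x))\<^sup>2 + 2 * a\<^sup>2 * (norm (g x))\<^sup>2" for x by simp
    show "AE x in lborel. norm ((norm (f x + a *\<^sub>R g x))\<^sup>2) \<le> norm (2 * (norm (f x))\<^sup>2 + 2 * a\<^sup>2 * (norm (g x))\<^sup>2)"
      by (rule AE_I2) (simp only: real_norm_def abs_of_nonneg[OF r0] abs_of_nonneg[OF zero_le_power2] le)
  qed simp
  then show "in_L2 (\<lambda>x. f x + a *\<^sub>R g x)" by (simp add: in_L2_def)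
  have "(\<integral>x. (norm (f x + a *\<^sub>R g x))\<^sup>2 \<partial>lborel) \<le> (\<integral>x. 2 * (norm (f x))\<^sup>2 + 2 * a\<^sup>2 * (norm (g x))\<^sup>2 \<partial>lborel)"
    by (rule integral_mono[OF i int']) (rule le)
  then show "(\<integral>x. (norm (f x + a *\<^sub>R g x))\<^sup>2 \<partial>lborel)
      \<le> 2 * (\<integral>x. (norm (f x))\<^sup>2 \<partial>lborel) + 2 * a\<^sup>2 * (\<integral>x. (norm (g x))\<^sup>2 \<partial>lborel)"
    using int by simp
qed

lemma integrable_scaleR_L2:
  fixes f :: "real^3 \<Rightarrow> real" and g :: "real^3 \<Rightarrow> 'b::euclidean_space"
  assumes "in_L2 f" "in_L2 g"
  shows "integrable lborel (\<lambda>x. f x *\<^sub>R g x)"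
proof (rule Bochner_Integration.integrable_bound)
  have [measurable]: "f \<in> borel_measurable borel" "g \<in> borel_measurable borel"
    using assms by (auto simp: in_L2_def)
  show "integrable lborel (\<lambda>x. norm (f x) * norm (g x))"
    using assms by (intro integrable_mult_of_squares) (auto simp: in_L2_def)
qed (use assms in \<open>auto simp: in_L2_def\<close>)

lemma test_functionD:
  assumes "test_function \<psi>"
  shows "in_L2 \<psi>" "in_L2 (grad \<psi>)"
proof -
  have C: "Ck_on k UNIV \<psi>" for k using assms by (simp add: test_function_def smooth_on_def)
  have "bounded (closure {x. \<psi> x \<noteq> 0})"
    using assms by (auto simp: test_function_def intro: compact_imp_bounded)
  then obtain r where r: "\<And>x. x \<in> closure {x. \<psi> x \<noteq> 0} \<Longrightarrow> norm x \<le> r"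
    unfolding bounded_iff by auto
  have s: "\<psi> x = 0" if "norm x > r" for x
  proof (rule ccontr)
    assume "\<psi> x \<noteq> 0"
    then have "x \<in> closure {x. \<psi> x \<noteq> 0}" using closure_subset[of "{x. \<psi> x \<noteq> 0}"] by auto
    then show False using r that by fastforce
  qed
  have s': "grad \<psi> x = 0" if "norm x > r" for x
    using frechet_derivative_outside_support[OF s that] by (simp add: grad_def vec_eq_iff)
  have c: "continuous_on UNIV \<psi>" using C by (rule Ck_on_imp_continuous_on)
  have c': "continuous_on UNIV (grad \<psi>)" by (rule Ck_on_imp_continuous_on[OF Ck_on_grad[OF open_UNIV C]])
  show "in_L2 \<psi>" unfolding in_L2_def using c s
    by (auto intro!: integrable_continuous_compact_support[of _ r] continuous_intros borel_measurable_continuous_onI)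
  show "in_L2 (grad \<psi>)" unfolding in_L2_def using c' s'
    by (auto intro!: integrable_continuous_compact_support[of _ r] continuous_intros borel_measurable_continuous_onI)
qed

lemma weak_grad_add_scaled:
  assumes f: "weak_grad f f'" and g: "weak_grad g g'"
  shows "weak_grad (\<lambda>x. f x + a * g x) (\<lambda>x. f' x + a *\<^sub>R g' x)"
  unfolding weak_grad_def
proof (intro conjI allI impI)
  have L2: "in_L2 f" "in_L2 g" "in_L2 f'" "in_L2 g'" using f g by (auto simp: weak_grad_def)
  show "in_L2 (\<lambda>x. f x + a * g x)" using in_L2_add_scaled(1)[OF L2(1,2)] by simp
  show "in_L2 (\<lambda>x. f' x + a *\<^sub>R g' x)" using in_L2_add_scaled(1)[OF L2(3,4)] by simp
  fix \<psi> assume \<psi>: "test_function \<psi>"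
  note t = test_functionD[OF \<psi>]
  have i: "integrable lborel (\<lambda>x. f x *\<^sub>R grad \<psi> x)" "integrable lborel (\<lambda>x. g x *\<^sub>R grad \<psi> x)"
    "integrable lborel (\<lambda>x. \<psi> x *\<^sub>R f' x)" "integrable lborel (\<lambda>x. \<psi> x *\<^sub>R g' x)"
    using integrable_scaleR_L2 t L2 by blast+
  have ia: "integrable lborel (\<lambda>x. a *\<^sub>R (g x *\<^sub>R grad \<psi> x))" "integrable lborel (\<lambda>x. a *\<^sub>R (\<psi> x *\<^sub>R g' x))"
    by (intro integrable_scaleR_right i)+
  have "(\<integral>x. (f x + a * g x) *\<^sub>R grad \<psi> x \<partial>lborel) = (\<integral>x. f x *\<^sub>R grad \<psi> x + a *\<^sub>R (g x *\<^sub>R grad \<psi> x) \<partial>lborel)"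
    by (simp add: algebra_simps)
  also have "\<dots> = (\<integral>x. f x *\<^sub>R grad \<psi> x \<partial>lborel) + a *\<^sub>R (\<integral>x. g x *\<^sub>R grad \<psi> x \<partial>lborel)"
    by (simp only: Bochner_Integration.integral_add[OF i(1) ia(1)] integral_scaleR_right)
  also have "\<dots> = - ((\<integral>x. \<psi> x *\<^sub>R f' x \<partial>lborel) + a *\<^sub>R (\<integral>x. \<psi> x *\<^sub>R g' x \<partial>lborel))"
    using f g \<psi> by (simp add: weak_grad_def)
  also have "(\<integral>x. \<psi> x *\<^sub>R f' x \<partial>lborel) + a *\<^sub>R (\<integral>x. \<psi> x *\<^sub>R g' x \<partial>lborel)
      = (\<integral>x. \<psi> x *\<^sub>R f' x + a *\<^sub>R (\<psi> x *\<^sub>R g' x) \<partial>lborel)"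
    by (simp only: Bochner_Integration.integral_add[OF i(3) ia(2)] integral_scaleR_right)
  also have "\<dots> = (\<integral>x. \<psi> x *\<^sub>R (f' x + a *\<^sub>R g' x) \<partial>lborel)"
    by (simp add: algebra_simps)
  finally show "(\<integral>x. (f x + a * g x) *\<^sub>R grad \<psi> x \<partial>lborel) = - (\<integral>x. \<psi> x *\<^sub>R (f' x + a *\<^sub>R g' x) \<partial>lborel)" .
qed

section \<open>Bounds in H^1 and L^1 along continuous curves\<close>

lemma H1_norm_squared:
  assumes "in_H1 f"
  obtains g where "weak_grad f g"
    "(H1_norm f)\<^sup>2 = (\<integral>x. (f x)\<^sup>2 \<partial>lborel) + (\<integral>x. (norm (g x))\<^sup>2 \<partial>lborel)"
proof
  show "weak_grad f (SOME g. weak_grad f g)" using assms unfolding in_H1_def by (rule someI_ex)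
  show "(H1_norm f)\<^sup>2 = (\<integral>x. (f x)\<^sup>2 \<partial>lborel) + (\<integral>x. (norm ((SOME g. weak_grad f g) x))\<^sup>2 \<partial>lborel)"
    by (simp add: H1_norm_def L2_norm_def)
qed

text \<open>The constant bounds the integrals themselves, hence the squares of the L^2 norms. The
  gradient is the classical one because the predicate is applied to smooth functions.\<close>

definition H1_L1_bound :: "real \<Rightarrow> (real^3 \<Rightarrow> real) \<Rightarrow> bool" where
  "H1_L1_bound B f \<longleftrightarrow>
     integrable lborel f \<and> (\<integral>x. \<bar>f x\<bar> \<partial>lborel) \<le> B \<and>
     integrable lborel (\<lambda>x. (f x)\<^sup>2) \<and> (\<integral>x. (f x)\<^sup>2 \<partial>lborel) \<le> B \<and>
     integrable lborel (\<lambda>x. (norm (grad f x))\<^sup>2) \<and> (\<integral>x. (norm (grad f x))\<^sup>2 \<partial>lborel) \<le> B"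

lemma H1_L1_bound_mono: "H1_L1_bound B f \<Longrightarrow> B \<le> B' \<Longrightarrow> H1_L1_bound B' f"
  by (auto simp: H1_L1_bound_def)

text \<open>The weak gradient \<open>h\<close> hidden in the norm of \<open>g - f\<close> is some
  choice, not literally a difference of given gradients. Adding it to \<open>f'\<close> still yields
  a weak gradient of \<open>g\<close>, and any weak gradient bounds the classical one. Smoothness is
  asked of \<open>g\<close> alone, so \<open>f\<close> can be the initial datum.\<close>

lemma H1_L1_bound_near:
  assumes f: "in_H1 f" "in_L1 f" and g: "in_H1 g" "in_L1 g" and C: "\<And>k. Ck_on k UNIV g"
    and wf: "weak_grad f f'"
  shows "H1_L1_bound ((\<integral>x. \<bar>f x\<bar> \<partial>lborel) + L1_norm (\<lambda>x. g x - f x)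
      + 2 * (\<integral>x. (f x)\<^sup>2 \<partial>lborel) + 2 * (\<integral>x. (norm (f' x))\<^sup>2 \<partial>lborel)
      + 2 * (H1_norm (\<lambda>x. g x - f x))\<^sup>2) g"
proof -
  obtain g' where wg: "weak_grad g g'" using g by (auto simp: in_H1_def)
  have wd: "weak_grad (\<lambda>x. g x - f x) (\<lambda>x. g' x + (-1) *\<^sub>R f' x)"
    using weak_grad_add_scaled[OF wg wf, of "-1"] by simp
  then have "in_H1 (\<lambda>x. g x - f x)" by (auto simp: in_H1_def)
  then obtain h where h: "weak_grad (\<lambda>x. g x - f x) h"
    "(H1_norm (\<lambda>x. g x - f x))\<^sup>2 = (\<integral>x. (g x - f x)\<^sup>2 \<partial>lborel) + (\<integral>x. (norm (h x))\<^sup>2 \<partial>lborel)"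
    by (rule H1_norm_squared)
  have wg2: "weak_grad g (\<lambda>x. f' x + 1 *\<^sub>R h x)"
    using weak_grad_add_scaled[OF wf h(1), of 1] by simp
  have L2: "in_L2 f" "in_L2 f'" "in_L2 h" "in_L2 (\<lambda>x. g x - f x)" "in_L2 g"
    using wf h wg by (auto simp: weak_grad_def)
  note gr = grad_bounded_by_weak_grad[OF C wg2]
  have 1: "(\<integral>x. (norm (grad g x))\<^sup>2 \<partial>lborel)
      \<le> 2 * (\<integral>x. (norm (f' x))\<^sup>2 \<partial>lborel) + 2 * (\<integral>x. (norm (h x))\<^sup>2 \<partial>lborel)"
    using gr(2) in_L2_add_scaled(2)[OF L2(2,3), of 1] by simp
  have 2: "(\<integral>x. (g x)\<^sup>2 \<partial>lborel)
      \<le> 2 * (\<integral>x. (f x)\<^sup>2 \<partial>lborel) + 2 * (\<integral>x. (g x - f x)\<^sup>2 \<partial>lborel)"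
    using in_L2_add_scaled(2)[OF L2(1,4), of 1] by simp
  have i: "integrable lborel f" "integrable lborel g" using f g by (auto simp: in_L1_def)
  have "(\<integral>x. \<bar>g x\<bar> \<partial>lborel) \<le> (\<integral>x. \<bar>f x\<bar> + \<bar>g x - f x\<bar> \<partial>lborel)"
    using i by (intro integral_mono) auto
  then have 3: "(\<integral>x. \<bar>g x\<bar> \<partial>lborel) \<le> (\<integral>x. \<bar>f x\<bar> \<partial>lborel) + L1_norm (\<lambda>x. g x - f x)"
    using i by (simp add: L1_norm_def)
  have nn: "0 \<le> (\<integral>x. (f x)\<^sup>2 \<partial>lborel)" "0 \<le> (\<integral>x. (norm (f' x))\<^sup>2 \<partial>lborel)" "0 \<le> (\<integral>x. \<bar>f x\<bar> \<partial>lborel)"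
    "0 \<le> L1_norm (\<lambda>x. g x - f x)" "0 \<le> (\<integral>x. (g x - f x)\<^sup>2 \<partial>lborel)" "0 \<le> (\<integral>x. (norm (h x))\<^sup>2 \<partial>lborel)"
    by (auto simp: L1_norm_def intro!: Bochner_Integration.integral_nonneg)
  have i2: "integrable lborel (\<lambda>x. (g x)\<^sup>2)" using L2(5) by (simp add: in_L2_def)
  have 4: "2 * ((\<integral>x. (g x - f x)\<^sup>2 \<partial>lborel) + (\<integral>x. (norm (h x))\<^sup>2 \<partial>lborel))
      = 2 * (\<integral>x. (g x - f x)\<^sup>2 \<partial>lborel) + 2 * (\<integral>x. (norm (h x))\<^sup>2 \<partial>lborel)" by simp
  show ?thesis
    unfolding H1_L1_bound_def h(2) 4
  proof (intro conjI i(2) gr(1) i2)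
    show "(\<integral>x. \<bar>g x\<bar> \<partial>lborel) \<le> (\<integral>x. \<bar>f x\<bar> \<partial>lborel) + L1_norm (\<lambda>x. g x - f x)
      + 2 * (\<integral>x. (f x)\<^sup>2 \<partial>lborel) + 2 * (\<integral>x. (norm (f' x))\<^sup>2 \<partial>lborel)
      + (2 * (\<integral>x. (g x - f x)\<^sup>2 \<partial>lborel) + 2 * (\<integral>x. (norm (h x))\<^sup>2 \<partial>lborel))"
      using 3 nn by linarith
    show "(\<integral>x. (g x)\<^sup>2 \<partial>lborel) \<le> (\<integral>x. \<bar>f x\<bar> \<partial>lborel) + L1_norm (\<lambda>x. g x - f x)
      + 2 * (\<integral>x. (f x)\<^sup>2 \<partial>lborel) + 2 * (\<integral>x. (norm (f' x))\<^sup>2 \<partial>lborel)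
      + (2 * (\<integral>x. (g x - f x)\<^sup>2 \<partial>lborel) + 2 * (\<integral>x. (norm (h x))\<^sup>2 \<partial>lborel))"
      using 2 nn by linarith
    show "(\<integral>x. (norm (grad g x))\<^sup>2 \<partial>lborel) \<le> (\<integral>x. \<bar>f x\<bar> \<partial>lborel) + L1_norm (\<lambda>x. g x - f x)
      + 2 * (\<integral>x. (f x)\<^sup>2 \<partial>lborel) + 2 * (\<integral>x. (norm (f' x))\<^sup>2 \<partial>lborel)
      + (2 * (\<integral>x. (g x - f x)\<^sup>2 \<partial>lborel) + 2 * (\<integral>x. (norm (h x))\<^sup>2 \<partial>lborel))"
      using 1 nn by linarith
  qed
qed

text \<open>If no bound existed, the failures would occur along times converging to a point of
  [0, T], possibly 0, against continuity there. The bound is thus uniform down to the initial time,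
  on which the limits s -> 0 rely.\<close>

lemma continuous_into_H1_L1_locally_bounded:
  assumes f: "continuous_into_H1_L1 f" and C: "\<And>t k. t > 0 \<Longrightarrow> Ck_on k UNIV (f t)"
  obtains B where "\<And>t. 0 < t \<Longrightarrow> t \<le> T \<Longrightarrow> H1_L1_bound B (f t)"
proof (rule ccontr)
  assume "\<not> thesis"
  then have "\<forall>n::nat. \<exists>t. 0 < t \<and> t \<le> T \<and> \<not> H1_L1_bound (real n) (f t)" using that by blast
  then obtain \<tau> where \<tau>: "\<And>n::nat. 0 < \<tau> n \<and> \<tau> n \<le> T \<and> \<not> H1_L1_bound (real n) (f (\<tau> n))" by metis
  then have "\<forall>n. \<tau> n \<in> {0..T}" by (simp add: less_imp_le)
  then obtain t0 r where t0: "t0 \<in> {0..T}" and r: "strict_mono r" "(\<tau> \<circ> r) \<longlonglongrightarrow> t0"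
    using compact_Icc[of 0 T] unfolding compact_def by metis
  have fH: "in_H1 (f s)" "in_L1 (f s)" if "s \<ge> 0" for s using f that by (auto simp: continuous_into_H1_L1_def)
  have "0 \<le> t0" using t0 by simp
  then obtain f' where wf: "weak_grad (f t0) f'" using fH by (auto simp: in_H1_def)
  define N where "N s = (\<integral>x. \<bar>f t0 x\<bar> \<partial>lborel) + L1_norm (\<lambda>x. f s x - f t0 x)
      + 2 * (\<integral>x. (f t0 x)\<^sup>2 \<partial>lborel) + 2 * (\<integral>x. (norm (f' x))\<^sup>2 \<partial>lborel)
      + 2 * (H1_norm (\<lambda>x. f s x - f t0 x))\<^sup>2" for s
  have bd: "H1_L1_bound (N s) (f s)" if "s > 0" for s
    unfolding N_def using fH \<open>0 \<le> t0\<close> that C wf by (intro H1_L1_bound_near) auto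
  define N0 where "N0 = (\<integral>x. \<bar>f t0 x\<bar> \<partial>lborel) + 2 * (\<integral>x. (f t0 x)\<^sup>2 \<partial>lborel) + 2 * (\<integral>x. (norm (f' x))\<^sup>2 \<partial>lborel)"
  have "(N \<longlongrightarrow> (\<integral>x. \<bar>f t0 x\<bar> \<partial>lborel) + 0 + 2 * (\<integral>x. (f t0 x)\<^sup>2 \<partial>lborel) + 2 * (\<integral>x. (norm (f' x))\<^sup>2 \<partial>lborel) + 2 * 0\<^sup>2) (at t0 within {0..})"
    unfolding N_def using f \<open>0 \<le> t0\<close> by (intro tendsto_intros) (auto simp: continuous_into_H1_L1_def)
  then have "(N \<longlongrightarrow> N0) (at t0 within {0..})" by (simp add: N0_def)
  then have "\<forall>\<^sub>F s in at t0 within {0..}. N s < N0 + 1" by (rule order_tendstoD) simp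
  then obtain d where d: "d > 0" "\<And>s. s \<ge> 0 \<Longrightarrow> s \<noteq> t0 \<Longrightarrow> dist s t0 < d \<Longrightarrow> N s < N0 + 1"
    unfolding eventually_at by auto
  obtain n1 where n1: "\<And>n. n \<ge> n1 \<Longrightarrow> dist (\<tau> (r n)) t0 < d"
    using r(2) d(1) unfolding lim_sequentially comp_def by blast
  \<comment> \<open>The punctured limit says nothing at \<open>t0\<close> itself, which the sequence
    may hit, so \<open>N t0\<close> enters the bound as well.\<close>
  obtain n2 :: nat where n2: "real n2 \<ge> max (N0 + 1) (N t0)" using real_arch_simple by blast
  define n where "n = max n1 n2"
  have "real n2 \<le> real (r n)" using seq_suble[OF r(1), of n] by (simp add: n_def)
  moreover have "N (\<tau> (r n)) \<le> max (N0 + 1) (N t0)"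
    using d(2)[of "\<tau> (r n)"] n1[of n] \<tau>[of "r n"] by (cases "\<tau> (r n) = t0") (auto simp: n_def)
  ultimately have "N (\<tau> (r n)) \<le> real (r n)" using n2 by linarith
  then show False using H1_L1_bound_mono bd \<tau>[of "r n"] by blast
qed

text \<open>The link between smooth positive times and the initial data; the L^2 convergence is read
  off from the H^1 norm.\<close>

lemma continuous_into_H1_L1_at_0:
  assumes f: "continuous_into_H1_L1 f"
  shows "((\<lambda>s. \<integral>x. \<bar>f s x - f 0 x\<bar> \<partial>lborel) \<longlongrightarrow> 0) (at_right 0)"
    "((\<lambda>s. \<integral>x. (f s x - f 0 x)\<^sup>2 \<partial>lborel) \<longlongrightarrow> 0) (at_right 0)"
proof -
  have le: "at_right (0::real) \<le> at 0 within {0..}" by (intro at_le) auto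
  have "((\<lambda>s. L1_norm (\<lambda>x. f s x - f 0 x)) \<longlongrightarrow> 0) (at 0 within {0..})"
    and H: "((\<lambda>s. H1_norm (\<lambda>x. f s x - f 0 x)) \<longlongrightarrow> 0) (at 0 within {0..})"
    using f by (auto simp: continuous_into_H1_L1_def)
  then show "((\<lambda>s. \<integral>x. \<bar>f s x - f 0 x\<bar> \<partial>lborel) \<longlongrightarrow> 0) (at_right 0)"
    using tendsto_mono[OF le] by (simp add: L1_norm_def)
  show "((\<lambda>s. \<integral>x. (f s x - f 0 x)\<^sup>2 \<partial>lborel) \<longlongrightarrow> 0) (at_right 0)"
  proof (rule tendsto_sandwich[where f = "\<lambda>_. 0" and h = "\<lambda>s. (H1_norm (\<lambda>x. f s x - f 0 x))\<^sup>2"])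
    have "((\<lambda>s. (H1_norm (\<lambda>x. f s x - f 0 x))\<^sup>2) \<longlongrightarrow> 0\<^sup>2) (at_right 0)"
      by (intro tendsto_intros tendsto_mono[OF le H])
    then show "((\<lambda>s. (H1_norm (\<lambda>x. f s x - f 0 x))\<^sup>2) \<longlongrightarrow> 0) (at_right 0)" by simp
    show "\<forall>\<^sub>F s in at_right 0. (\<integral>x. (f s x - f 0 x)\<^sup>2 \<partial>lborel) \<le> (H1_norm (\<lambda>x. f s x - f 0 x))\<^sup>2"
      unfolding eventually_at_right_field
    proof (intro exI[of _ 1] conjI allI impI)
      fix s :: real assume s: "0 < s"
      obtain g g' where "weak_grad (f 0) g" "weak_grad (f s) g'"
        using f s unfolding continuous_into_H1_L1_def in_H1_def by (meson less_imp_le order_refl)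
      then have "in_H1 (\<lambda>x. f s x - f 0 x)"
        using weak_grad_add_scaled[of "f s" g' "f 0" g "-1"] by (auto simp: in_H1_def)
      then obtain h where "weak_grad (\<lambda>x. f s x - f 0 x) h"
        "(H1_norm (\<lambda>x. f s x - f 0 x))\<^sup>2 = (\<integral>x. (f s x - f 0 x)\<^sup>2 \<partial>lborel) + (\<integral>x. (norm (h x))\<^sup>2 \<partial>lborel)"
        by (rule H1_norm_squared)
      moreover have "0 \<le> (\<integral>x. (norm (h x))\<^sup>2 \<partial>lborel)" by (auto intro!: Bochner_Integration.integral_nonneg)
      ultimately show "(\<integral>x. (f s x - f 0 x)\<^sup>2 \<partial>lborel) \<le> (H1_norm (\<lambda>x. f s x - f 0 x))\<^sup>2" by linarith
    qed auto
  qed (auto intro!: always_eventually)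
qed

section \<open>Translations and Nash's inequality\<close>

text \<open>The increment by h is the mean over [0, 1] of a directional derivative along the
  segment; Jensen's inequality, Fubini and translation invariance give the bound.\<close>

lemma translation_estimate:
  fixes f :: "real^3 \<Rightarrow> real"
  assumes f: "Ck_on 1 UNIV f" and g: "integrable lborel (\<lambda>x. (norm (grad f x))\<^sup>2)"
  shows "(\<integral>\<^sup>+x. ennreal ((f (x + h) - f x)\<^sup>2) \<partial>lborel) \<le> ennreal ((norm h)\<^sup>2 * (\<integral>x. (norm (grad f x))\<^sup>2 \<partial>lborel))"
proof -
  have gc: "continuous_on UNIV (grad f)" using Ck_on_imp_continuous_on[OF Ck_on_grad[of UNIV 0 f]] f by simp
  then have [measurable]: "grad f \<in> borel_measurable borel" by (rule borel_measurable_continuous_onI)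
  have d: "f differentiable at x" for x using f by simp
  have pt: "ennreal ((f (x + h) - f x)\<^sup>2)
      \<le> (\<integral>\<^sup>+\<tau>. indicator {0..1} \<tau> * ennreal ((norm h)\<^sup>2 * (norm (grad f (x + \<tau> *\<^sub>R h)))\<^sup>2) \<partial>lborel)" for x
  proof -
    define a where "a \<tau> = grad f (x + \<tau> *\<^sub>R h) \<bullet> h" for \<tau>
    define A where "A = f (x + h) - f x"
    have ac: "continuous_on S a" for S unfolding a_def
      by (intro continuous_intros continuous_on_compose2[OF gc]) auto
    have der: "((\<lambda>s. f (x + s *\<^sub>R h)) has_real_derivative a \<tau>) (at \<tau>)" for \<tau>
      using has_real_derivative_along_line[OF d, where x = x and t = \<tau> and v = h] frechet_derivative_eqI[OF grad_works[OF d]]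
      by (simp add: a_def)
    have "(a has_integral (f (x + 1 *\<^sub>R h) - f (x + 0 *\<^sub>R h))) {0..1}"
      by (rule fundamental_theorem_of_calculus)
        (auto simp: has_real_derivative_iff_has_vector_derivative[symmetric] intro: DERIV_subset der)
    then have iA: "(a has_integral A) {0..1}" by (simp add: A_def)
    have i2: "((\<lambda>\<tau>. (a \<tau>)\<^sup>2) has_integral integral {0..1} (\<lambda>\<tau>. (a \<tau>)\<^sup>2)) {0..1}"
      by (intro integrable_integral integrable_continuous_real continuous_intros ac)
    \<comment> \<open>Jensen's inequality in the form that the variance of \<open>a\<close> about
      its mean \<open>A\<close> is nonnegative.\<close>
    have "((\<lambda>\<tau>. (a \<tau>)\<^sup>2 - 2 * A * a \<tau> + A\<^sup>2) has_integral (integral {0..1} (\<lambda>\<tau>. (a \<tau>)\<^sup>2) - 2 * A * A + A\<^sup>2)) {0..1}"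
      using has_integral_const_real[of "A\<^sup>2" 0 1]
      by (intro has_integral_add has_integral_diff i2 has_integral_mult_right iA) auto
    then have "0 \<le> integral {0..1} (\<lambda>\<tau>. (a \<tau>)\<^sup>2) - 2 * A * A + A\<^sup>2"
    proof (rule has_integral_nonneg)
      fix \<tau>
      have "(a \<tau>)\<^sup>2 - 2 * A * a \<tau> + A\<^sup>2 = (a \<tau> - A)\<^sup>2" by (simp add: power2_eq_square algebra_simps)
      then show "0 \<le> (a \<tau>)\<^sup>2 - 2 * A * a \<tau> + A\<^sup>2" by simp
    qed
    then have "A\<^sup>2 \<le> integral {0..1} (\<lambda>\<tau>. (a \<tau>)\<^sup>2)" by (simp add: power2_eq_square)
    then have "ennreal (A\<^sup>2) \<le> ennreal (integral {0..1} (\<lambda>\<tau>. (a \<tau>)\<^sup>2))" by (rule ennreal_leI)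
    also have "\<dots> = (\<integral>\<^sup>+\<tau>\<in>{0..1}. ennreal ((a \<tau>)\<^sup>2) \<partial>lborel)"
      by (rule nn_integral_has_integral_lebesgue'[OF _ i2, symmetric]) auto
    also have "\<dots> \<le> (\<integral>\<^sup>+\<tau>. indicator {0..1} \<tau> * ennreal ((norm h)\<^sup>2 * (norm (grad f (x + \<tau> *\<^sub>R h)))\<^sup>2) \<partial>lborel)"
    proof (rule nn_integral_mono)
      fix \<tau>
      have "\<bar>a \<tau>\<bar> \<le> norm (grad f (x + \<tau> *\<^sub>R h)) * norm h" unfolding a_def by (rule Cauchy_Schwarz_ineq2)
      then have "\<bar>a \<tau>\<bar>\<^sup>2 \<le> (norm (grad f (x + \<tau> *\<^sub>R h)) * norm h)\<^sup>2" by (rule power_mono) simp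
      then show "ennreal ((a \<tau>)\<^sup>2) * indicator {0..1} \<tau> \<le> indicator {0..1} \<tau> * ennreal ((norm h)\<^sup>2 * (norm (grad f (x + \<tau> *\<^sub>R h)))\<^sup>2)"
        by (auto simp: indicator_def power_mult_distrib mult.commute intro!: ennreal_leI)
    qed
    finally show ?thesis by (simp add: A_def)
  qed
  have "(\<integral>\<^sup>+x. ennreal ((f (x + h) - f x)\<^sup>2) \<partial>lborel)
      \<le> (\<integral>\<^sup>+x. (\<integral>\<^sup>+\<tau>. indicator {0..1} \<tau> * ennreal ((norm h)\<^sup>2 * (norm (grad f (x + \<tau> *\<^sub>R h)))\<^sup>2) \<partial>lborel) \<partial>lborel)"
    by (rule nn_integral_mono) (rule pt)
  also have "\<dots> = (\<integral>\<^sup>+\<tau>. (\<integral>\<^sup>+x. indicator {0..1} \<tau> * ennreal ((norm h)\<^sup>2 * (norm (grad f (x + \<tau> *\<^sub>R h)))\<^sup>2) \<partial>lborel) \<partial>lborel)"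
    by (rule lborel_pair.Fubini') measurable
  also have "\<dots> = (\<integral>\<^sup>+\<tau>. indicator {0..1::real} \<tau> * (\<integral>\<^sup>+x. ennreal ((norm h)\<^sup>2 * (norm (grad f x))\<^sup>2) \<partial>lborel) \<partial>lborel)"
  proof (rule nn_integral_cong)
    fix \<tau> :: real
    have "(\<integral>\<^sup>+x. indicator {0..1} \<tau> * ennreal ((norm h)\<^sup>2 * (norm (grad f (x + \<tau> *\<^sub>R h)))\<^sup>2) \<partial>lborel)
        = indicator {0..1} \<tau> * (\<integral>\<^sup>+x. ennreal ((norm h)\<^sup>2 * (norm (grad f (x + \<tau> *\<^sub>R h)))\<^sup>2) \<partial>lborel)"
      by (rule nn_integral_cmult) measurable
    also have "(\<integral>\<^sup>+x. ennreal ((norm h)\<^sup>2 * (norm (grad f (x + \<tau> *\<^sub>R h)))\<^sup>2) \<partial>lborel) = (\<integral>\<^sup>+x. ennreal ((norm h)\<^sup>2 * (norm (grad f x))\<^sup>2) \<partial>lborel)"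
      by (rule nn_integral_translation) measurable
    finally show "(\<integral>\<^sup>+x. indicator {0..1} \<tau> * ennreal ((norm h)\<^sup>2 * (norm (grad f (x + \<tau> *\<^sub>R h)))\<^sup>2) \<partial>lborel)
        = indicator {0..1} \<tau> * (\<integral>\<^sup>+x. ennreal ((norm h)\<^sup>2 * (norm (grad f x))\<^sup>2) \<partial>lborel)" .
  qed
  also have "\<dots> = (\<integral>\<^sup>+x. ennreal ((norm h)\<^sup>2 * (norm (grad f x))\<^sup>2) \<partial>lborel)"
    by (subst nn_integral_multc) auto
  also have "\<dots> = ennreal ((norm h)\<^sup>2 * (\<integral>x. (norm (grad f x))\<^sup>2 \<partial>lborel))"
    using g by (subst nn_integral_eq_integral) auto
  finally show ?thesis .
qed

text \<open>From f(x+h)^2 >= 0 follows f(x)^2 <= (f(x+h) - f(x))^2 + 2 f(x) f(x+h), which is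
  averaged over |h| <= r: the square of f is traded for its roughness plus a local mass. The whole
  space as \<open>S\<close> leads to Nash's inequality, a set where local averages are small leads
  to \<open>f_sq_sublevel\<close>.\<close>

lemma averaging_estimate:
  fixes f :: "real^3 \<Rightarrow> real"
  assumes [measurable]: "f \<in> borel_measurable borel" "S \<in> sets borel" and f0: "\<And>x. 0 \<le> f x" and B: "B \<ge> 0"
    and tr: "\<And>h. (\<integral>\<^sup>+x. ennreal ((f (x + h) - f x)\<^sup>2) \<partial>lborel) \<le> ennreal ((norm h)\<^sup>2 * B)"
  shows "emeasure lborel (cball (0::real^3) r) * (\<integral>\<^sup>+x\<in>S. ennreal ((f x)\<^sup>2) \<partial>lborel)
    \<le> emeasure lborel (cball (0::real^3) r) * ennreal (r\<^sup>2 * B)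
      + 2 * (\<integral>\<^sup>+x\<in>S. (ennreal (f x) * (\<integral>\<^sup>+h. ennreal (f (x + h)) * indicator (cball 0 r) h \<partial>lborel)) \<partial>lborel)"
proof -
  define I where "I h = (\<integral>\<^sup>+x\<in>S. (ennreal (f x) * ennreal (f (x + h))) \<partial>lborel)" for h
  have [measurable]: "I \<in> borel_measurable borel" unfolding I_def by measurable
  have [measurable]: "cball (0::real^3) r \<in> sets borel" by simp
  have 1: "(\<integral>\<^sup>+x\<in>S. ennreal ((f x)\<^sup>2) \<partial>lborel) \<le> ennreal (r\<^sup>2 * B) + 2 * I h" if "h \<in> cball 0 r" for h
  proof -
    have "(\<integral>\<^sup>+x\<in>S. ennreal ((f x)\<^sup>2) \<partial>lborel)
      \<le> (\<integral>\<^sup>+x. ennreal ((f (x + h) - f x)\<^sup>2) + 2 * ((ennreal (f x) * ennreal (f (x + h))) * indicator S x) \<partial>lborel)"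
    proof (rule nn_integral_mono)
      fix x
      have "(f x)\<^sup>2 \<le> (f (x + h) - f x)\<^sup>2 + 2 * (f x * f (x + h))"
        by (simp add: power2_eq_square algebra_simps)
      then have "ennreal ((f x)\<^sup>2) \<le> ennreal ((f (x + h) - f x)\<^sup>2 + 2 * (f x * f (x + h)))" by (rule ennreal_leI)
      also have "\<dots> = ennreal ((f (x + h) - f x)\<^sup>2) + 2 * (ennreal (f x) * ennreal (f (x + h)))"
        using f0 by (simp add: ennreal_plus ennreal_mult')
      finally show "ennreal ((f x)\<^sup>2) * indicator S x
          \<le> ennreal ((f (x + h) - f x)\<^sup>2) + 2 * ((ennreal (f x) * ennreal (f (x + h))) * indicator S x)"
        by (auto simp: indicator_def)
    qed
    also have "\<dots> = (\<integral>\<^sup>+x. ennreal ((f (x + h) - f x)\<^sup>2) \<partial>lborel) + 2 * I h"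
      unfolding I_def by (subst nn_integral_add, measurable, subst nn_integral_cmult, measurable)
    also have "\<dots> \<le> ennreal (r\<^sup>2 * B) + 2 * I h"
    proof (intro add_right_mono order_trans[OF tr] ennreal_leI mult_right_mono B)
      show "(norm h)\<^sup>2 \<le> r\<^sup>2" using that by (intro power_mono) auto
    qed
    finally show ?thesis .
  qed
  have "emeasure lborel (cball (0::real^3) r) * (\<integral>\<^sup>+x\<in>S. ennreal ((f x)\<^sup>2) \<partial>lborel)
      = (\<integral>\<^sup>+h. indicator (cball (0::real^3) r) h * (\<integral>\<^sup>+x\<in>S. ennreal ((f x)\<^sup>2) \<partial>lborel) \<partial>lborel)"
    by (subst nn_integral_multc) (auto intro: borel_measurable_indicator)
  also have "\<dots> \<le> (\<integral>\<^sup>+h. indicator (cball 0 r) h * ennreal (r\<^sup>2 * B) + 2 * (I h * indicator (cball 0 r) h) \<partial>lborel)"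
    by (rule nn_integral_mono) (use 1 in \<open>auto simp: indicator_def\<close>)
  also have "\<dots> = emeasure lborel (cball (0::real^3) r) * ennreal (r\<^sup>2 * B) + 2 * (\<integral>\<^sup>+h. I h * indicator (cball 0 r) h \<partial>lborel)"
  proof -
    have "(\<integral>\<^sup>+h. indicator (cball 0 r) h * ennreal (r\<^sup>2 * B) + 2 * (I h * indicator (cball 0 r) h) \<partial>lborel)
        = (\<integral>\<^sup>+h. indicator (cball (0::real^3) r) h * ennreal (r\<^sup>2 * B) \<partial>lborel) + (\<integral>\<^sup>+h. 2 * (I h * indicator (cball 0 r) h) \<partial>lborel)"
      by (rule nn_integral_add) measurable
    also have "(\<integral>\<^sup>+h. indicator (cball (0::real^3) r) h * ennreal (r\<^sup>2 * B) \<partial>lborel)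
        = emeasure lborel (cball (0::real^3) r) * ennreal (r\<^sup>2 * B)"
      by (subst nn_integral_multc) (auto intro: borel_measurable_indicator)
    also have "(\<integral>\<^sup>+h. 2 * (I h * indicator (cball 0 r) h) \<partial>lborel) = 2 * (\<integral>\<^sup>+h. I h * indicator (cball 0 r) h \<partial>lborel)"
      by (rule nn_integral_cmult) measurable
    finally show ?thesis .
  qed
  also have "(\<integral>\<^sup>+h. I h * indicator (cball 0 r) h \<partial>lborel)
      = (\<integral>\<^sup>+h. (\<integral>\<^sup>+x. (ennreal (f x) * ennreal (f (x + h))) * indicator S x * indicator (cball 0 r) h \<partial>lborel) \<partial>lborel)"
    unfolding I_def by (intro nn_integral_cong nn_integral_multc[symmetric]) measurable
  also have "\<dots> = (\<integral>\<^sup>+x. (\<integral>\<^sup>+h. (ennreal (f x) * ennreal (f (x + h))) * indicator S x * indicator (cball 0 r) h \<partial>lborel) \<partial>lborel)"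
    by (rule lborel_pair.Fubini') measurable
  also have "\<dots> = (\<integral>\<^sup>+x\<in>S. (ennreal (f x) * (\<integral>\<^sup>+h. ennreal (f (x + h)) * indicator (cball 0 r) h \<partial>lborel)) \<partial>lborel)"
  proof (rule nn_integral_cong)
    fix x
    have "(\<integral>\<^sup>+h. (ennreal (f x) * ennreal (f (x + h))) * indicator S x * indicator (cball 0 r) h \<partial>lborel)
        = (\<integral>\<^sup>+h. (ennreal (f x) * indicator S x) * (ennreal (f (x + h)) * indicator (cball 0 r) h) \<partial>lborel)"
      by (simp add: mult_ac)
    also have "\<dots> = (ennreal (f x) * indicator S x) * (\<integral>\<^sup>+h. ennreal (f (x + h)) * indicator (cball 0 r) h \<partial>lborel)"
      by (rule nn_integral_cmult) measurable
    finally show "(\<integral>\<^sup>+h. (ennreal (f x) * ennreal (f (x + h))) * indicator S x * indicator (cball 0 r) h \<partial>lborel)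
        = ennreal (f x) * (\<integral>\<^sup>+h. ennreal (f (x + h)) * indicator (cball 0 r) h \<partial>lborel) * indicator S x"
      by (simp add: mult_ac)
  qed
  finally show ?thesis .
qed

text \<open>Nash's inequality before optimisation over the radius; the local mass of
  \<open>averaging_estimate\<close> is bounded by the total mass. A free r permits one common radius
  for two functions in \<open>Nash_lower_bound\<close>.\<close>

lemma Nash_inequality:
  fixes f :: "real^3 \<Rightarrow> real"
  assumes f: "Ck_on 1 UNIV f" "\<And>x. 0 \<le> f x" "integrable lborel f"
    and f2: "integrable lborel (\<lambda>x. (f x)\<^sup>2)"
    and g: "integrable lborel (\<lambda>x. (norm (grad f x))\<^sup>2)" and r: "r > 0"
  shows "(\<integral>x. (f x)\<^sup>2 \<partial>lborel)
    \<le> r\<^sup>2 * (\<integral>x. (norm (grad f x))\<^sup>2 \<partial>lborel) + 2 * (\<integral>x. f x \<partial>lborel)\<^sup>2 / (unit_ball_vol 3 * r ^ 3)"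
proof -
  define F where "F = (\<integral>x. (norm (grad f x))\<^sup>2 \<partial>lborel)"
  define M where "M = (\<integral>x. f x \<partial>lborel)"
  define E where "E = (\<integral>x. (f x)\<^sup>2 \<partial>lborel)"
  define V where "V = unit_ball_vol 3 * r ^ 3"
  have F0: "F \<ge> 0" "M \<ge> 0" "E \<ge> 0" unfolding F_def M_def E_def using f by (auto intro!: Bochner_Integration.integral_nonneg)
  have V0: "V > 0" unfolding V_def using r by (intro mult_pos_pos) auto
  have [measurable]: "f \<in> borel_measurable borel"
    using Ck_on_imp_continuous_on[OF f(1)] by (rule borel_measurable_continuous_onI)
  have em: "emeasure lborel (cball (0::real^3) r) = ennreal V"
    using r by (simp add: emeasure_cball V_def)
  have nM: "(\<integral>\<^sup>+x. ennreal (f x) \<partial>lborel) = ennreal M"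
    unfolding M_def using f by (intro nn_integral_eq_integral) auto
  have J: "(\<integral>\<^sup>+x\<in>UNIV. (ennreal (f x) * (\<integral>\<^sup>+h. ennreal (f (x + h)) * indicator (cball 0 r) h \<partial>lborel)) \<partial>lborel)
      \<le> (\<integral>\<^sup>+x. ennreal (f x) * ennreal M \<partial>lborel)"
  proof (rule nn_integral_mono)
    fix x
    have "(\<integral>\<^sup>+h. ennreal (f (x + h)) * indicator (cball 0 r) h \<partial>lborel) \<le> (\<integral>\<^sup>+h. ennreal (f (h + x)) \<partial>lborel)"
      by (intro nn_integral_mono) (auto simp: indicator_def add.commute)
    also have "\<dots> = (\<integral>\<^sup>+h. ennreal (f h) \<partial>lborel)"
      by (rule nn_integral_translation) measurable
    finally have "(\<integral>\<^sup>+h. ennreal (f (x + h)) * indicator (cball 0 r) h \<partial>lborel) \<le> ennreal M" by (simp add: nM)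
    then show "ennreal (f x) * (\<integral>\<^sup>+h. ennreal (f (x + h)) * indicator (cball 0 r) h \<partial>lborel) * indicator UNIV x \<le> ennreal (f x) * ennreal M"
      by (auto intro: mult_left_mono)
  qed
  have MM: "(\<integral>\<^sup>+x. ennreal (f x) * ennreal M \<partial>lborel) = ennreal (M * M)"
    using F0 by (subst nn_integral_multc) (auto simp: nM ennreal_mult)
  have "ennreal (V * E) = ennreal V * (\<integral>\<^sup>+x\<in>UNIV. ennreal ((f x)\<^sup>2) \<partial>lborel)"
    using V0 F0 f2 by (simp add: E_def nn_integral_eq_integral ennreal_mult)
  also have "\<dots> \<le> ennreal V * ennreal (r\<^sup>2 * F)
      + 2 * (\<integral>\<^sup>+x\<in>UNIV. (ennreal (f x) * (\<integral>\<^sup>+h. ennreal (f (x + h)) * indicator (cball 0 r) h \<partial>lborel)) \<partial>lborel)"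
    unfolding em[symmetric] F_def using f F0 translation_estimate[OF f(1) g]
    by (intro averaging_estimate) (auto simp: F_def)
  also have "\<dots> \<le> ennreal V * ennreal (r\<^sup>2 * F) + 2 * ennreal (M * M)"
    using J unfolding MM by (intro add_left_mono mult_left_mono) auto
  also have "ennreal V * ennreal (r\<^sup>2 * F) + 2 * ennreal (M * M) = ennreal (V * (r\<^sup>2 * F) + 2 * (M * M))"
    using F0 V0 by (simp add: ennreal_plus ennreal_mult)
  finally have "V * E \<le> V * (r\<^sup>2 * F) + 2 * (M * M)"
    using F0 V0 by (subst (asm) ennreal_le_iff) auto
  then have "E \<le> (V * (r\<^sup>2 * F) + 2 * (M * M)) / V" using V0 by (simp add: field_simps)
  also have "\<dots> = r\<^sup>2 * F + 2 * M\<^sup>2 / V" using V0 by (simp add: field_simps power2_eq_square)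
  finally show ?thesis by (simp add: E_def F_def M_def V_def)
qed

section \<open>Hardy's inequality and the Newton potential\<close>

lemma divergence_scaleR:
  assumes "s differentiable (at x)" "V differentiable (at x)"
  shows "divergence (\<lambda>x. s x *\<^sub>R V x) x = s x * divergence V x + grad s x \<bullet> V x"
proof -
  have "((\<lambda>x. s x *\<^sub>R V x) has_derivative
      (\<lambda>h. s x *\<^sub>R frechet_derivative V (at x) h + (grad s x \<bullet> h) *\<^sub>R V x)) (at x)"
    using assms by (intro has_derivative_scaleR grad_works) (auto simp: frechet_derivative_works[symmetric])
  from divergence_eqI[OF this]
  have "divergence (\<lambda>x. s x *\<^sub>R V x) x = s x * divergence V x + (\<Sum>j\<in>UNIV. grad s x $ j * V x $ j)"
    by (simp add: divergence_def sum.distrib sum_distrib_left inner_axis)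
  then show ?thesis by (simp add: inner_vec_def)
qed

lemma grad_mult:
  assumes "f differentiable (at x)" "g differentiable (at x)"
  shows "grad (\<lambda>x. f x * g x) x = f x *\<^sub>R grad g x + g x *\<^sub>R grad f x"
proof (rule grad_eqI)
  show "((\<lambda>x. f x * g x) has_derivative (\<bullet>) (f x *\<^sub>R grad g x + g x *\<^sub>R grad f x)) (at x)"
    by (rule has_derivative_eq_rhs[OF has_derivative_mult[OF grad_works grad_works]])
      (auto simp: assms inner_add_left mult.commute)
qed

lemma grad_compose_real:
  assumes "f differentiable (at x)" "(B has_real_derivative B') (at (f x))"
  shows "(\<lambda>x. B (f x)) differentiable (at x)" "grad (\<lambda>x. B (f x)) x = B' *\<^sub>R grad f x"
proof -
  have d: "((\<lambda>x. B (f x)) has_derivative (\<lambda>v. B' * (grad f x \<bullet> v))) (at x)"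
    by (rule has_derivative_compose[OF grad_works[OF assms(1)]])
      (use assms(2) in \<open>simp add: has_field_derivative_def\<close>)
  then show "(\<lambda>x. B (f x)) differentiable (at x)" by (auto simp: differentiable_def)
  show "grad (\<lambda>x. B (f x)) x = B' *\<^sub>R grad f x"
  proof (rule grad_eqI)
    have "(\<lambda>v. B' * (grad f x \<bullet> v)) = (\<bullet>) (B' *\<^sub>R grad f x)" by auto
    then show "((\<lambda>x. B (f x)) has_derivative (\<bullet>) (B' *\<^sub>R grad f x)) (at x)" using d by simp
  qed
qed

lemma Ck_on_ident: "open S \<Longrightarrow> Ck_on k S (\<lambda>x. x)"
proof (cases k)
  case (Suc n)
  assume "open S"
  then show ?thesis unfolding Suc by (rule Ck_on_SucI[where f' = "\<lambda>x v. v"]) (auto intro: Ck_on_const[OF \<open>open S\<close>])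
qed auto

lemma Ck_on_1_differentiable: "Ck_on 1 UNIV f \<Longrightarrow> f differentiable (at x)"
  by simp

lemma Ck_on_1_of_real_deriv:
  fixes c :: "'a::euclidean_space \<Rightarrow> real"
  assumes "open S" "Ck_on 1 S c" "\<And>x. x \<in> S \<Longrightarrow> c x \<in> I"
    and "\<And>s. s \<in> I \<Longrightarrow> (B has_real_derivative B' s) (at s)" "continuous_on I B'"
  shows "Ck_on 1 S (\<lambda>x. B (c x))"
proof -
  have "c ` S \<subseteq> I" using assms(3) by auto
  from Ck_on_compose_real[OF assms(1) this assms(2), of "\<lambda>j. if j = 0 then B else B'"] assms(4,5)
  show ?thesis by (simp del: Ck_on.simps)
qed

text \<open>With w = 1 / (|x|^2 + \<delta>) the field w x has divergence 3 w - 2 |x|^2 w^2 >= w.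
  Integrating f^2 against it by parts and absorbing half of the cross term gives the constant 4. The
  shift \<delta> keeps the weight smooth at the origin.\<close>

lemma Hardy_inequality_regularised:
  fixes f :: "real^3 \<Rightarrow> real"
  assumes f: "Ck_on 1 UNIV f" and f2: "integrable lborel (\<lambda>x. (f x)\<^sup>2)"
    and g: "integrable lborel (\<lambda>x. (norm (grad f x))\<^sup>2)" and \<delta>: "\<delta> > 0"
  shows "integrable lborel (\<lambda>x. (f x)\<^sup>2 / (x \<bullet> x + \<delta>))"
    "(\<integral>x. (f x)\<^sup>2 / (x \<bullet> x + \<delta>) \<partial>lborel) \<le> 4 * (\<integral>x. (norm (grad f x))\<^sup>2 \<partial>lborel)"
proof -
  define w where "w x = inverse (x \<bullet> x + \<delta>)" for x :: "real^3"
  have pos: "x \<bullet> x + \<delta> > 0" for x :: "real^3" using \<delta> by (simp add: add_nonneg_pos)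
  have w0: "w x > 0" for x unfolding w_def using pos by simp
  have w2: "(x \<bullet> x) * (w x)\<^sup>2 \<le> w x" for x
  proof -
    have "(x \<bullet> x) * w x \<le> 1" using pos[of x] \<delta> by (simp add: w_def field_simps)
    then have "((x \<bullet> x) * w x) * w x \<le> 1 * w x" using w0[of x] by (intro mult_right_mono) auto
    then show ?thesis by (simp add: power2_eq_square mult_ac)
  qed
  have q: "Ck_on 1 UNIV (\<lambda>x::real^3. x \<bullet> x + \<delta>)"
    by (intro Ck_on_add Ck_on_inner Ck_on_ident Ck_on_const) auto
  have gq: "grad (\<lambda>x::real^3. x \<bullet> x + \<delta>) x = 2 *\<^sub>R x" for x
    by (rule grad_eqI) (auto intro!: derivative_eq_intros simp: inner_commute)
  have wC: "Ck_on 1 UNIV w" unfolding w_def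
  proof (rule Ck_on_1_of_real_deriv[OF open_UNIV q, of "{0<..}" inverse "\<lambda>s. - (inverse s ^ Suc (Suc 0))"])
    show "(inverse has_real_derivative - (inverse s ^ Suc (Suc 0))) (at s)" if "s \<in> {0<..}" for s :: real
      using that by (intro DERIV_inverse) auto
  qed (auto intro!: pos continuous_intros)
  have gw: "grad w x = - (w x)\<^sup>2 *\<^sub>R (2 *\<^sub>R x)" for x
    unfolding w_def gq[symmetric]
    by (rule grad_compose_real(2)[OF Ck_on_1_differentiable[OF q]])
      (use pos[of x] in \<open>auto intro!: DERIV_inverse[THEN DERIV_cong] simp: numeral_2_eq_2\<close>)
  have cont: "continuous_on UNIV f" "continuous_on UNIV w" "continuous_on UNIV (grad f)" "continuous_on UNIV (grad (cutoff R))"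
    "continuous_on UNIV (cutoff R)" for R
    using Ck_on_imp_continuous_on[OF f] Ck_on_imp_continuous_on[OF wC] Ck_on_imp_continuous_on[OF Ck_on_grad[of UNIV 0 f]]
      Ck_on_imp_continuous_on[OF Ck_on_grad[of UNIV 0 "cutoff R"]] Ck_on_cutoff[of 1 R] f
      Ck_on_imp_continuous_on[OF Ck_on_cutoff] by auto
  have [measurable]: "f \<in> borel_measurable borel" "w \<in> borel_measurable borel"
    using cont by (auto intro: borel_measurable_continuous_onI)
  obtain C where C: "C > 0" "\<And>R x. R \<ge> 1 \<Longrightarrow> norm (grad (cutoff R) x) \<le> C / R"
    by (rule cutoff_bounds) blast
  \<comment> \<open>This bound for |w x| degenerates like \<delta>^(-1/2), but it enters only with
    the factor 1/R and disappears before \<delta> does.\<close>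
  define K where "K = sqrt (inverse \<delta>)"
  have K: "norm (w x *\<^sub>R x) \<le> K" for x
  proof -
    have "(norm (w x *\<^sub>R x))\<^sup>2 = (x \<bullet> x) * (w x)\<^sup>2"
      by (simp add: power_mult_distrib power2_norm_eq_inner)
    also have "\<dots> \<le> inverse \<delta>" using w2[of x] \<delta> pos[of x] by (simp add: w_def order_trans[OF _ le_imp_inverse_le])
    finally show ?thesis unfolding K_def by (rule real_le_rsqrt)
  qed
  define E where "E = (\<integral>x. (f x)\<^sup>2 \<partial>lborel)"
  define G where "G = (\<integral>x. (norm (grad f x))\<^sup>2 \<partial>lborel)"
  have supp: "grad (cutoff R) x = 0" if "R \<ge> 1" "norm x > R" for R x
    using frechet_derivative_outside_support[of R "cutoff R", OF cutoff_support that(2)] that(1)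
    by (simp add: grad_def vec_eq_iff)
  have int: "integrable lborel (\<lambda>x. cutoff R x * ((f x)\<^sup>2 * w x))" if "R \<ge> 1" for R
    using that cutoff_support cont
    by (intro integrable_continuous_compact_support[of _ R]) (auto intro!: continuous_intros)
  have main: "(\<integral>x. cutoff R x * ((f x)\<^sup>2 * w x) \<partial>lborel) \<le> 4 * G + (2 * C * K * E) / R" if R: "R \<ge> 1" for R
  proof -
    define s where "s x = cutoff R x * (f x * f x * w x)" for x
    have c1: "Ck_on 1 UNIV (cutoff R)" by (rule Ck_on_cutoff)
    have sC: "Ck_on 1 UNIV s" unfolding s_def
      by (intro Ck_on_mult c1 f wC) auto
    note d = Ck_on_1_differentiable
    have gs: "grad s x = (f x * f x * w x) *\<^sub>R grad (cutoff R) x + (2 * cutoff R x * f x * w x) *\<^sub>R grad f x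
        - (2 * s x * w x) *\<^sub>R x" for x
      unfolding s_def
      by (simp add: grad_mult d[OF f] d[OF wC] d[OF c1] differentiable_mult gw scaleR_add_right del: Ck_on.simps)
        (simp add: vec_eq_iff algebra_simps power2_eq_square)
    have dv: "divergence (\<lambda>x. s x *\<^sub>R x) x = 3 * s x + grad s x \<bullet> x" for x
    proof -
      have "divergence (\<lambda>x. x) x = 3"
        using divergence_eqI[OF has_derivative_ident, of x] by simp
      then show ?thesis using divergence_scaleR[OF d[OF sC], of "\<lambda>x. x" x] by simp
    qed
    have s0: "s x = 0" if "norm x > R" for x using that R by (simp add: s_def cutoff_support)
    have z: "(\<integral>x. divergence (\<lambda>x. s x *\<^sub>R x) x \<partial>lborel) = 0"
      using s0 by (intro integral_divergence_eq_0[of _ R] Ck_on_scaleR sC Ck_on_ident) auto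
    have le: "s x \<le> divergence (\<lambda>x. s x *\<^sub>R x) x + (s x / 2 + 2 * (norm (grad f x))\<^sup>2 + (C / R * K) * (f x)\<^sup>2)" for x
    proof -
      have 1: "2 * s x * w x * (x \<bullet> x) \<le> 2 * s x"
      proof -
        have "(x \<bullet> x) * w x \<le> 1" using pos[of x] \<delta> by (simp add: w_def field_simps)
        moreover have "0 \<le> 2 * s x" using w0[of x] cutoff_range(1) by (simp add: s_def)
        ultimately show ?thesis using mult_left_mono[of "(x \<bullet> x) * w x" 1 "2 * s x"] by (simp add: mult_ac)
      qed
      \<comment> \<open>Young's inequality with weights 1/2 and 2; moving the half of
        \<open>s\<close> to the left doubles 2 to the final constant 4.\<close>
      have 2: "- (2 * cutoff R x * f x * w x * (grad f x \<bullet> x)) \<le> s x / 2 + 2 * (norm (grad f x))\<^sup>2"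
      proof -
        have "- (2 * f x * w x * (grad f x \<bullet> x)) \<le> 2 * (\<bar>f x\<bar> * w x * norm x) * norm (grad f x)"
        proof -
          have "\<bar>grad f x \<bullet> x\<bar> \<le> norm (grad f x) * norm x" by (rule Cauchy_Schwarz_ineq2)
          then have "(2 * \<bar>f x\<bar> * w x) * \<bar>grad f x \<bullet> x\<bar> \<le> (2 * \<bar>f x\<bar> * w x) * (norm (grad f x) * norm x)"
            using w0[of x] by (intro mult_left_mono) auto
          moreover have "- (2 * f x * w x * (grad f x \<bullet> x)) \<le> \<bar>2 * f x * w x * (grad f x \<bullet> x)\<bar>" by simp
          moreover have "\<bar>2 * f x * w x * (grad f x \<bullet> x)\<bar> = (2 * \<bar>f x\<bar> * w x) * \<bar>grad f x \<bullet> x\<bar>"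
            using w0[of x] by (simp add: abs_mult)
          ultimately have "- (2 * f x * w x * (grad f x \<bullet> x)) \<le> (2 * \<bar>f x\<bar> * w x) * (norm (grad f x) * norm x)"
            by linarith
          also have "\<dots> = 2 * (\<bar>f x\<bar> * w x * norm x) * norm (grad f x)" by (simp only: mult_ac)
          finally show ?thesis .
        qed
        also have "\<dots> \<le> (\<bar>f x\<bar> * w x * norm x)\<^sup>2 / 2 + 2 * (norm (grad f x))\<^sup>2"
          using sum_squares_bound[of "\<bar>f x\<bar> * w x * norm x" "2 * norm (grad f x)"] by (simp add: power_mult_distrib)
        also have "(\<bar>f x\<bar> * w x * norm x)\<^sup>2 = f x * f x * ((x \<bullet> x) * (w x)\<^sup>2)"
        proof -
          have "(\<bar>f x\<bar> * w x * norm x)\<^sup>2 = \<bar>f x\<bar>\<^sup>2 * (w x)\<^sup>2 * (norm x)\<^sup>2" by (simp only: power_mult_distrib)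
          then show ?thesis by (simp only: power2_abs power2_norm_eq_inner) (simp only: power2_eq_square mult_ac)
        qed
        also have "\<dots> \<le> f x * f x * w x" by (intro mult_left_mono w2) auto
        finally have "- (2 * f x * w x * (grad f x \<bullet> x)) \<le> f x * f x * w x / 2 + 2 * (norm (grad f x))\<^sup>2" by simp
        then have "cutoff R x * - (2 * f x * w x * (grad f x \<bullet> x)) \<le> cutoff R x * (f x * f x * w x / 2 + 2 * (norm (grad f x))\<^sup>2)"
          by (rule mult_left_mono) (rule cutoff_range)
        also have "\<dots> \<le> s x / 2 + 2 * (norm (grad f x))\<^sup>2"
          using mult_right_mono[OF cutoff_range(2)[of R x], of "2 * (norm (grad f x))\<^sup>2"]
          by (simp add: s_def algebra_simps)
        finally show ?thesis by (simp add: mult_ac)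
      qed
      have 3: "- ((f x * f x * w x) * (grad (cutoff R) x \<bullet> x)) \<le> (C / R * K) * (f x)\<^sup>2"
      proof -
        have "\<bar>grad (cutoff R) x \<bullet> (w x *\<^sub>R x)\<bar> \<le> norm (grad (cutoff R) x) * norm (w x *\<^sub>R x)"
          by (rule Cauchy_Schwarz_ineq2)
        also have "\<dots> \<le> C / R * K" using C R by (intro mult_mono K) auto
        finally have "(f x)\<^sup>2 * - (grad (cutoff R) x \<bullet> (w x *\<^sub>R x)) \<le> (f x)\<^sup>2 * (C / R * K)"
          by (intro mult_left_mono) auto
        then show ?thesis by (simp add: power2_eq_square mult_ac)
      qed
      show ?thesis unfolding dv gs using 1 2 3
        by (simp add: inner_add_left inner_diff_left)
    qed
    have dint: "integrable lborel (\<lambda>x. divergence (\<lambda>x. s x *\<^sub>R x) x)"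
      unfolding dv gs using cont supp[OF R] s0
      by (intro integrable_continuous_compact_support[of _ R])
        (auto intro!: continuous_intros simp: s_def[abs_def] cutoff_support R order_less_le_trans[OF zero_less_one R])
    have sint: "integrable lborel s" using int[OF R] by (simp add: s_def[abs_def] power2_eq_square mult_ac)
    have "(\<integral>x. s x \<partial>lborel) \<le> (\<integral>x. divergence (\<lambda>x. s x *\<^sub>R x) x + (s x / 2 + 2 * (norm (grad f x))\<^sup>2 + (C / R * K) * (f x)\<^sup>2) \<partial>lborel)"
      using dint sint f2 g by (intro integral_mono le) auto
    also have "\<dots> = (\<integral>x. s x \<partial>lborel) / 2 + 2 * G + (C / R * K) * E"
      using dint sint f2 g z by (simp add: G_def E_def)
    finally have "(\<integral>x. s x \<partial>lborel) \<le> 4 * G + 2 * ((C / R * K) * E)" by simp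
    moreover have "(\<integral>x. cutoff R x * ((f x)\<^sup>2 * w x) \<partial>lborel) = (\<integral>x. s x \<partial>lborel)"
      by (simp add: s_def power2_eq_square)
    ultimately show ?thesis by simp
  qed
  have nn: "0 \<le> (f x)\<^sup>2 * w x" for x using w0[of x] by simp
  have "integrable lborel (\<lambda>x. (f x)\<^sup>2 * w x)"
    by (rule cutoff_Fatou(1)[OF _ nn int main]) auto
  moreover have "(\<integral>x. (f x)\<^sup>2 * w x \<partial>lborel) \<le> 4 * G"
    by (rule cutoff_Fatou(2)[OF _ nn int main]) auto
  ultimately show "integrable lborel (\<lambda>x. (f x)\<^sup>2 / (x \<bullet> x + \<delta>))"
    "(\<integral>x. (f x)\<^sup>2 / (x \<bullet> x + \<delta>) \<partial>lborel) \<le> 4 * (\<integral>x. (norm (grad f x))\<^sup>2 \<partial>lborel)"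
    by (simp_all add: w_def divide_inverse G_def)
qed

text \<open>Fatou's lemma removes the regularisation, as the constant 4 does not depend on
  it.\<close>

lemma Hardy_inequality:
  fixes f :: "real^3 \<Rightarrow> real"
  assumes f: "Ck_on 1 UNIV f" and f2: "integrable lborel (\<lambda>x. (f x)\<^sup>2)"
    and g: "integrable lborel (\<lambda>x. (norm (grad f x))\<^sup>2)"
  shows "integrable lborel (\<lambda>x. (f x)\<^sup>2 / (norm x)\<^sup>2)"
    "(\<integral>x. (f x)\<^sup>2 / (norm x)\<^sup>2 \<partial>lborel) \<le> 4 * (\<integral>x. (norm (grad f x))\<^sup>2 \<partial>lborel)"
proof -
  have [measurable]: "f \<in> borel_measurable borel"
    using Ck_on_imp_continuous_on[OF f] by (rule borel_measurable_continuous_onI)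
  note H = Hardy_inequality_regularised[OF f f2 g]
  define e where "e n = inverse (real (Suc n))" for n
  have e: "e n > 0" for n by (simp add: e_def)
  have lim: "AE x in lborel. (\<lambda>n. (f x)\<^sup>2 / (x \<bullet> x + e n)) \<longlonglongrightarrow> (f x)\<^sup>2 / (norm x)\<^sup>2"
  proof -
    have "AE x in lborel. x \<noteq> (0::real^3)" by (rule AE_lborel_singleton)
    then show ?thesis
    proof eventually_elim
      fix x :: "real^3" assume "x \<noteq> 0"
      then have "(\<lambda>n. (f x)\<^sup>2 / (x \<bullet> x + e n)) \<longlonglongrightarrow> (f x)\<^sup>2 / (x \<bullet> x + 0)"
        unfolding e_def by (intro tendsto_intros LIMSEQ_inverse_real_of_nat) auto
      then show "(\<lambda>n. (f x)\<^sup>2 / (x \<bullet> x + e n)) \<longlonglongrightarrow> (f x)\<^sup>2 / (norm x)\<^sup>2"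
        by (simp add: power2_norm_eq_inner)
    qed
  qed
  have nn: "0 \<le> (f x)\<^sup>2 / (x \<bullet> x + e n)" for n x
    using e[of n] by (intro divide_nonneg_nonneg) (auto intro: add_nonneg_nonneg)
  show "integrable lborel (\<lambda>x. (f x)\<^sup>2 / (norm x)\<^sup>2)"
    by (rule Fatou_integrable(1)[OF _ H(1)[OF e] nn lim H(2)[OF e] tendsto_const]) simp
  show "(\<integral>x. (f x)\<^sup>2 / (norm x)\<^sup>2 \<partial>lborel) \<le> 4 * (\<integral>x. (norm (grad f x))\<^sup>2 \<partial>lborel)"
    by (rule Fatou_integrable(2)[OF _ H(1)[OF e] nn lim H(2)[OF e] tendsto_const]) simp
qed

text \<open>Along the gradient the derivative is |grad f|^2, while the Lipschitz bound limits it by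
  K |grad f|. The lemma turns the Lipschitz estimate for the Newton potential into a gradient bound
  without differentiating a singular integral.\<close>

lemma norm_grad_le_Lipschitz:
  assumes f: "f differentiable (at x)" and L: "\<And>y. \<bar>f x - f y\<bar> \<le> K * norm (x - y)"
  shows "norm (grad f x) \<le> K"
proof (cases "grad f x = 0")
  case True
  \<comment> \<open>Two points at distance 1 force \<open>K\<close> to be nonnegative.\<close>
  have "0 \<le> \<bar>f x - f (x + axis 1 1)\<bar>" by simp
  also have "\<dots> \<le> K" using L[of "x + axis 1 1"] by (simp add: norm_axis_1)
  finally show ?thesis using True by simp
next
  case False
  define v where "v = grad f x"
  have "((\<lambda>s. f (x + s *\<^sub>R v)) has_real_derivative v \<bullet> v) (at 0)"
    using has_real_derivative_along_line[of f x 0 v] f frechet_derivative_eqI[OF grad_works[OF f]]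
    by (simp add: v_def)
  then have lim: "((\<lambda>s. (f (x + s *\<^sub>R v) - f x) / s) \<longlongrightarrow> v \<bullet> v) (at 0)"
    by (simp add: has_field_derivative_iff)
  have "v \<bullet> v \<le> K * norm v"
  proof (rule tendsto_upperbound[OF lim])
    show "\<forall>\<^sub>F s in at 0. (f (x + s *\<^sub>R v) - f x) / s \<le> K * norm v"
    proof (rule eventually_mono[OF eventually_neq_at_within[of 0]])
      fix s :: real assume s: "s \<noteq> 0"
      have "(f (x + s *\<^sub>R v) - f x) / s \<le> \<bar>f x - f (x + s *\<^sub>R v)\<bar> / \<bar>s\<bar>"
        by (metis abs_divide abs_ge_self abs_minus_commute)
      also have "\<dots> \<le> (K * norm (s *\<^sub>R v)) / \<bar>s\<bar>"
        using L[of "x + s *\<^sub>R v"] by (intro divide_right_mono) auto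
      also have "\<dots> = K * norm v" using s by simp
      finally show "(f (x + s *\<^sub>R v) - f x) / s \<le> K * norm v" .
    qed
  qed auto
  then have "norm v * norm v \<le> K * norm v" by (simp add: norm_eq_sqrt_inner)
  then show ?thesis using False by (simp add: v_def)
qed

text \<open>For \<open>k = 3\<close> this is an integrable kernel whose derivatives are bounded by multiples of the
  kernel itself, so that the logarithm of a convolution with it has bounded derivatives.\<close>

definition ker :: "nat \<Rightarrow> real^3 \<Rightarrow> real" where
  "ker k x = inverse (1 + x \<bullet> x) ^ k"

lemma ker_base: "1 + x \<bullet> x \<ge> (1::real)" "1 + x \<bullet> x > (0::real)" for x :: "'a::real_inner"
  by (auto intro: add_pos_nonneg)

lemma ker_pos: "ker k x > 0"
  using ker_base(2)[of x] by (simp add: ker_def)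

lemma ker_mono: "k \<le> n \<Longrightarrow> ker n x \<le> ker k x"
  using ker_base[of x] by (auto simp: ker_def inverse_le_1_iff intro!: power_decreasing)

lemma ker_le_1: "ker k x \<le> 1"
  using ker_mono[of 0 k x] by (simp add: ker_def)

lemma ker_Suc: "ker (Suc k) x * (x \<bullet> x) \<le> ker k x"
proof -
  have "ker (Suc k) x * (x \<bullet> x) \<le> ker (Suc k) x * (1 + x \<bullet> x)"
    using ker_pos[of "Suc k" x] by (intro mult_left_mono) auto
  also have "\<dots> = ker k x" using ker_base(2)[of x] by (simp add: ker_def)
  finally show ?thesis .
qed

lemma grad_ker: "(ker k has_derivative (\<lambda>v. (- 2 * real k * ker (Suc k) x) *\<^sub>R x \<bullet> v)) (at x)"
proof -
  have q: "((\<lambda>x. 1 + x \<bullet> x) has_derivative (\<lambda>v. 2 * (x \<bullet> v))) (at x)" for x :: "real^3"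
    by (auto intro!: derivative_eq_intros simp: inner_commute)
  have "((\<lambda>s. inverse s ^ k) has_real_derivative - real k * inverse s ^ Suc k) (at s)" if "s > 0" for s :: real
  proof (cases k)
    case (Suc m)
    have "(inverse has_real_derivative - (inverse s ^ Suc (Suc 0))) (at s)" using that by (intro DERIV_inverse) auto
    from DERIV_power_Suc[OF this, of m] show ?thesis unfolding Suc by (rule DERIV_cong) (simp add: algebra_simps)
  qed simp
  from this[OF ker_base(2), unfolded has_field_derivative_def, of x]
  have "((\<lambda>x. inverse (1 + x \<bullet> x) ^ k) has_derivative (\<lambda>v. - real k * inverse (1 + x \<bullet> x) ^ Suc k * (2 * (x \<bullet> v)))) (at x)"
    by (rule has_derivative_compose[OF q])
  then show ?thesis unfolding ker_def[abs_def] by (rule has_derivative_eq_rhs) (auto simp: fun_eq_iff)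
qed

lemma Ck_on_ker: "Ck_on n UNIV (ker k)"
proof (induction n arbitrary: k)
  case 0
  show ?case using has_derivative_continuous[OF grad_ker] by (simp add: continuous_at_imp_continuous_on)
next
  case (Suc n)
  show ?case
    by (rule Ck_on_SucI[OF open_UNIV grad_ker])
      (intro Ck_on_inner Ck_on_scaleR Ck_on_mult Ck_on_const Ck_on_ident Suc open_UNIV)
qed

lemma borel_measurable_ker [measurable]: "ker k \<in> borel_measurable borel"
  by (rule borel_measurable_continuous_onI[OF Ck_on_imp_continuous_on[OF Ck_on_ker]])

text \<open>For n <= |x| <= n + 1 the kernel is at most (1 + n^2)^(-3), so it is dominated by a sum
  of such constants on balls of radius n + 1. Volumes grow like (n + 1)^3 and 1 + n^2 >= (n + 1)^2 /
  2, whence the factor 8 and a convergent series.\<close>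

lemma integrable_ker: "integrable lborel (ker 3)"
proof -
  define s where "s n x = inverse (1 + real n ^ 2) ^ 3 * indicator (cball 0 (real (Suc n))) x" for n and x :: "real^3"
  have s0: "0 \<le> s n x" for n x by (simp add: s_def indicator_def)
  have fin: "emeasure lborel (cball 0 (real (Suc n)) :: (real^3) set) < \<infinity>" for n by (rule emeasure_lborel_cball_finite)
  have si: "integrable lborel (s n)" for n unfolding s_def
    using fin by (intro integrable_mult_right integrable_real_indicator) (auto simp: less_top)
  have b: "inverse (1 + real n ^ 2) ^ 3 * real (Suc n) ^ 3 \<le> 8 * inverse (real (Suc n) ^ 2)" for n
  proof -
    define m where "m = real (Suc n)"
    have m: "m \<ge> 1" by (simp add: m_def)
    have "m\<^sup>2 \<le> 2 * (1 + real n ^ 2)"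
      using sum_squares_bound[of 1 "real n"] by (simp add: m_def power2_eq_square algebra_simps)
    moreover have "0 < 1 + real n ^ 2" by (simp add: add_pos_nonneg)
    ultimately have "inverse (1 + real n ^ 2) \<le> 2 / m\<^sup>2" using m by (simp add: divide_simps)
    then have "inverse (1 + real n ^ 2) ^ 3 \<le> (2 / m\<^sup>2) ^ 3" by (intro power_mono) auto
    then have "inverse (1 + real n ^ 2) ^ 3 * m ^ 3 \<le> (2 / m\<^sup>2) ^ 3 * m ^ 3" using m by (intro mult_right_mono) auto
    also have "\<dots> = 8 * inverse (m ^ 3)" using m by (simp add: field_simps power_divide flip: power_mult)
    also have "\<dots> \<le> 8 * inverse (m ^ 2)" using m by (simp add: power_increasing)
    finally show ?thesis by (simp add: m_def)
  qed
  have sint: "(\<integral>x. norm (s n x) \<partial>lborel) = inverse (1 + real n ^ 2) ^ 3 * (unit_ball_vol 3 * real (Suc n) ^ 3)" for n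
    using s0 by (simp add: s_def content_cball)
  have "summable (\<lambda>n. inverse (real (Suc n) ^ 2))"
    using inverse_power_summable[of 2, where ?'a = real] by (subst summable_Suc_iff) simp
  then have summ: "summable (\<lambda>n. 8 * unit_ball_vol 3 * inverse (real (Suc n) ^ 2))" by (rule summable_mult)
  have "summable (\<lambda>n. \<integral>x. norm (s n x) \<partial>lborel)"
  proof (rule summable_comparison_test'[OF summ])
    fix n :: nat
    show "norm (\<integral>x. norm (s n x) \<partial>lborel) \<le> 8 * unit_ball_vol 3 * inverse (real (Suc n) ^ 2)"
      using mult_left_mono[OF b[of n], of "unit_ball_vol 3"] unfolding sint
      by (simp add: mult_ac)
  qed
  moreover have sx: "summable (\<lambda>n. norm (s n x))" for x
  proof (rule summable_comparison_test'[OF \<open>summable (\<lambda>n. inverse (real (Suc n) ^ 2))\<close>[THEN summable_mult, of 8]])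
    fix n :: nat
    have "inverse (1 + real n ^ 2) ^ 3 * 1 \<le> inverse (1 + real n ^ 2) ^ 3 * real (Suc n) ^ 3"
      by (intro mult_left_mono one_le_power) auto
    with b[of n] show "norm (norm (s n x)) \<le> 8 * inverse (real (Suc n) ^ 2)"
      by (auto simp: s_def indicator_def)
  qed
  ultimately have I: "integrable lborel (\<lambda>x. \<Sum>n. s n x)"
    by (intro integrable_suminf si) auto
  show ?thesis
  proof (rule Bochner_Integration.integrable_bound[OF I])
    show "AE x in lborel. norm (ker 3 x) \<le> norm (\<Sum>n. s n x)"
    proof (rule AE_I2)
      fix x :: "real^3"
      define n where "n = nat \<lfloor>norm x\<rfloor>"
      have "real n = of_int \<lfloor>norm x\<rfloor>" by (simp add: n_def)
      then have n: "real n \<le> norm x" "norm x \<le> real (Suc n)"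
        using of_int_floor_le[of "norm x"] real_of_int_floor_add_one_ge[of "norm x"] unfolding of_nat_Suc by linarith+
      have "real n ^ 2 \<le> x \<bullet> x" using power_mono[OF n(1), of 2] by (simp add: power2_norm_eq_inner)
      then have "ker 3 x \<le> inverse (1 + real n ^ 2) ^ 3"
        unfolding ker_def by (intro power_mono le_imp_inverse_le) (auto intro: add_pos_nonneg)
      also have "\<dots> = s n x" using n(2) by (simp add: s_def)
      also have "\<dots> \<le> (\<Sum>n. s n x)"
        using sum_le_suminf[of "\<lambda>n. s n x" "{n}"] sx[of x] s0 by (auto dest: summable_norm_cancel)
      finally show "norm (ker 3 x) \<le> norm (\<Sum>n. s n x)" using ker_pos[of 3 x] by simp
    qed
  qed simp
qed

text \<open>Makes Hardy's inequality applicable to \<open>ker 3\<close>, which supplies the local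
  integrability of |x|^(-2).\<close>

lemma integrable_ker_squared:
  "integrable lborel (\<lambda>x. (ker 3 x)\<^sup>2)" "integrable lborel (\<lambda>x. (norm (grad (ker 3) x))\<^sup>2)"
proof -
  have g: "grad (ker 3) x = (- 6 * ker 4 x) *\<^sub>R x" for x
    using grad_eqI[OF grad_ker, of 3 x] by simp
  have [measurable]: "grad (ker 3) \<in> borel_measurable borel"
    unfolding g[abs_def] by measurable
  show "integrable lborel (\<lambda>x. (ker 3 x)\<^sup>2)"
  proof (rule Bochner_Integration.integrable_bound[OF integrable_ker])
    show "AE x in lborel. norm ((ker 3 x)\<^sup>2) \<le> norm (ker 3 x)"
      using ker_pos[of 3] ker_le_1[of 3] by (auto simp: power2_eq_square mult_left_le less_imp_le)
  qed simp
  show "integrable lborel (\<lambda>x. (norm (grad (ker 3) x))\<^sup>2)"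
  proof (rule Bochner_Integration.integrable_bound[OF integrable_mult_right[OF integrable_ker, of 36]])
    show "AE x in lborel. norm ((norm (grad (ker 3) x))\<^sup>2) \<le> norm (36 * ker 3 x)"
    proof (rule AE_I2)
      fix x :: "real^3"
      have "(norm (grad (ker 3) x))\<^sup>2 = (- 6 * ker 4 x)\<^sup>2 * (x \<bullet> x)"
        by (simp only: g norm_scaleR power_mult_distrib power2_abs power2_norm_eq_inner)
      then have "(norm (grad (ker 3) x))\<^sup>2 = 36 * (ker 4 x * (ker 4 x * (x \<bullet> x)))"
        by (simp add: power2_eq_square)
      also have "\<dots> \<le> 36 * (1 * ker 3 x)"
        using ker_Suc[of 3 x] ker_le_1[of 4 x] ker_pos[of 4 x] ker_pos[of 3 x]
        by (intro mult_left_mono mult_mono) (auto simp: numeral_eq_Suc)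
      finally show "norm ((norm (grad (ker 3) x))\<^sup>2) \<le> norm (36 * ker 3 x)" by simp
    qed
  qed simp
qed

text \<open>Since |1/a - 1/b| <= |a - b| (a^(-2) + b^(-2)) / 2, it remains to bound the integral of
  |\<rho>(y)| / |x - y|^2. Away from the pole the L^1 norm suffices; near it |\<rho>| <= \<rho>^2 /
  2 + 1/2, and both terms fall under Hardy's inequality, for \<rho> and for
  \<open>ker 3\<close>.\<close>

lemma newton_potential_Lipschitz:
  obtains K where "\<And>B \<rho> x y. Ck_on 1 UNIV \<rho> \<Longrightarrow> H1_L1_bound B \<rho> \<Longrightarrow>
    \<bar>newton_potential \<rho> x - newton_potential \<rho> y\<bar> \<le> (3 * B + K) * norm (x - y)"
proof -
  \<comment> \<open>On the unit ball \<open>ker 3\<close> is at least 1/8, so its square times 32 is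
    at least 1/2; Hardy's constant 4 turns 32 into 128. Likewise 3 B is the L^1 bound B plus half of
    Hardy's 4 B.\<close>
  define K where "K = 128 * (\<integral>x. (norm (grad (ker 3) x))\<^sup>2 \<partial>lborel)"
  have main: "\<bar>newton_potential \<rho> x - newton_potential \<rho> y\<bar> \<le> (3 * B + K) * norm (x - y)"
    if \<rho>: "Ck_on 1 UNIV \<rho>" and B: "H1_L1_bound B \<rho>" for B \<rho> x y
  proof -
    note Bd = B[unfolded H1_L1_bound_def]
    have cont: "continuous_on UNIV \<rho>" using \<rho> by (rule Ck_on_imp_continuous_on)
    then have [measurable]: "\<rho> \<in> borel_measurable borel" by (rule borel_measurable_continuous_onI)
    note Hk = Hardy_inequality[OF Ck_on_ker integrable_ker_squared]
    have ptw: "\<bar>\<rho> y\<bar> / (norm (y - a))\<^sup>2 \<le> \<bar>\<rho> y\<bar> + ((\<rho> y)\<^sup>2 / (norm (y - a))\<^sup>2) / 2 + 32 * ((ker 3 (y - a))\<^sup>2 / (norm (y - a))\<^sup>2)" for a y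
    proof (cases "norm (y - a) \<ge> 1")
      case True
      then have "(norm (y - a))\<^sup>2 \<ge> 1" by simp
      then have "\<bar>\<rho> y\<bar> / (norm (y - a))\<^sup>2 \<le> \<bar>\<rho> y\<bar> / 1" by (intro divide_left_mono) auto
      moreover have "0 \<le> ((\<rho> y)\<^sup>2 / (norm (y - a))\<^sup>2) / 2" "0 \<le> 32 * ((ker 3 (y - a))\<^sup>2 / (norm (y - a))\<^sup>2)" by auto
      ultimately show ?thesis by linarith
    next
      case False
      then have "(y - a) \<bullet> (y - a) \<le> 1" by (simp add: power_le_one flip: power2_norm_eq_inner)
      then have "inverse 2 \<le> inverse (1 + (y - a) \<bullet> (y - a))"
        by (intro le_imp_inverse_le) (auto intro: add_pos_nonneg)
      then have "inverse 2 ^ 3 \<le> ker 3 (y - a)" unfolding ker_def by (intro power_mono) auto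
      then have "(inverse 2 ^ 3)\<^sup>2 \<le> (ker 3 (y - a))\<^sup>2" by (intro power_mono) auto
      then have k: "1 / 2 \<le> 32 * (ker 3 (y - a))\<^sup>2" by (simp add: power2_eq_square eval_nat_numeral)
      have "\<bar>\<rho> y\<bar> \<le> (\<rho> y)\<^sup>2 / 2 + 1 / 2" using sum_squares_bound[of "\<bar>\<rho> y\<bar>" 1] by simp
      with k have "\<bar>\<rho> y\<bar> \<le> (\<rho> y)\<^sup>2 / 2 + 32 * (ker 3 (y - a))\<^sup>2" by linarith
      then have "\<bar>\<rho> y\<bar> / (norm (y - a))\<^sup>2 \<le> ((\<rho> y)\<^sup>2 / 2 + 32 * (ker 3 (y - a))\<^sup>2) / (norm (y - a))\<^sup>2"
        by (rule divide_right_mono) simp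
      then show ?thesis by (simp add: add_divide_distrib)
    qed
    have I1: "integrable lborel (\<lambda>y. (\<rho> y)\<^sup>2 / (norm (y - a))\<^sup>2) \<and> (\<integral>y. (\<rho> y)\<^sup>2 / (norm (y - a))\<^sup>2 \<partial>lborel) \<le> 4 * B" for a
    proof -
      define f where "f y = \<rho> (a + y)" for y
      have fC: "Ck_on 1 UNIV f" unfolding f_def
        by (rule Ck_on_compose_affine[OF bounded_linear_ident _ _ \<rho>]) auto
      have gf: "grad f y = grad \<rho> (y + a)" for y
      proof (rule grad_eqI)
        have "((\<lambda>y. a + y) has_derivative (\<lambda>v. v)) (at y)" by (auto intro!: derivative_eq_intros)
        from has_derivative_compose[OF this grad_works[OF Ck_on_1_differentiable[OF \<rho>]]]
        show "(f has_derivative (\<bullet>) (grad \<rho> (y + a))) (at y)" by (simp add: f_def[abs_def] add.commute)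
      qed
      have gc: "continuous_on UNIV (grad \<rho>)" using Ck_on_imp_continuous_on[OF Ck_on_grad[of UNIV 0 \<rho>]] \<rho> by simp
      then have [measurable]: "grad \<rho> \<in> borel_measurable borel" by (rule borel_measurable_continuous_onI)
      have f2: "integrable lborel (\<lambda>y. (f y)\<^sup>2)"
        unfolding f_def using integrable_translation_iff[of "\<lambda>y. (\<rho> y)\<^sup>2" a] Bd by (simp add: add.commute)
      have g2: "integrable lborel (\<lambda>y. (norm (grad f y))\<^sup>2)" "(\<integral>y. (norm (grad f y))\<^sup>2 \<partial>lborel) \<le> B"
        unfolding gf using lborel_translation[of "\<lambda>y. (norm (grad \<rho> y))\<^sup>2" a] Bd by simp_all
      note H = Hardy_inequality[OF fC f2 g2(1)]
      have *: "(f (y + (- a)))\<^sup>2 / (norm (y + (- a)))\<^sup>2 = (\<rho> y)\<^sup>2 / (norm (y - a))\<^sup>2" for y by (simp add: f_def)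
      have [measurable]: "f \<in> borel_measurable borel" unfolding f_def by measurable
      show ?thesis
        using lborel_translation[of "\<lambda>y. (f y)\<^sup>2 / (norm y)\<^sup>2" "- a"] H g2(2) unfolding * by simp
    qed
    have I2: "integrable lborel (\<lambda>y. (ker 3 (y - a))\<^sup>2 / (norm (y - a))\<^sup>2)"
      "32 * (\<integral>y. (ker 3 (y - a))\<^sup>2 / (norm (y - a))\<^sup>2 \<partial>lborel) \<le> K" for a
      using lborel_translation[of "\<lambda>y. (ker 3 y)\<^sup>2 / (norm y)\<^sup>2" "- a"] Hk by (simp_all add: K_def)
    define W where "W a y = \<bar>\<rho> y\<bar> + ((\<rho> y)\<^sup>2 / (norm (y - a))\<^sup>2) / 2 + 32 * ((ker 3 (y - a))\<^sup>2 / (norm (y - a))\<^sup>2)" for a y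
    have i3: "integrable lborel (\<lambda>y. \<bar>\<rho> y\<bar>)" "integrable lborel (\<lambda>y. (\<rho> y)\<^sup>2 / (norm (y - a))\<^sup>2 / 2)"
      "integrable lborel (\<lambda>y. 32 * ((ker 3 (y - a))\<^sup>2 / (norm (y - a))\<^sup>2))" for a
      using I1[of a] I2[of a] Bd by (intro integrable_abs integrable_divide integrable_mult_right; blast)+
    have Wi: "integrable lborel (W a)" for a
      unfolding W_def by (intro Bochner_Integration.integrable_add i3)
    have Wb: "(\<integral>y. W a y \<partial>lborel) \<le> 3 * B + K" for a
    proof -
      have "(\<integral>y. W a y \<partial>lborel) = (\<integral>y. \<bar>\<rho> y\<bar> \<partial>lborel) + (\<integral>y. (\<rho> y)\<^sup>2 / (norm (y - a))\<^sup>2 / 2 \<partial>lborel)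
          + (\<integral>y. 32 * ((ker 3 (y - a))\<^sup>2 / (norm (y - a))\<^sup>2) \<partial>lborel)"
        unfolding W_def by (simp only: Bochner_Integration.integral_add Bochner_Integration.integrable_add i3)
      also have "\<dots> \<le> 3 * B + K"
        using I1[of a] I2(2)[of a] Bd unfolding integral_divide_zero integral_mult_right_zero by linarith
      finally show ?thesis .
    qed
    define S where "S a y = \<bar>\<rho> y\<bar> / (norm (y - a))\<^sup>2" for a y
    have [measurable]: "S a \<in> borel_measurable borel" for a unfolding S_def by measurable
    have S: "integrable lborel (S a)" for a
      by (rule Bochner_Integration.integrable_bound[OF Wi[of a]])
        (use ptw[of _ a] in \<open>auto simp: S_def W_def intro!: AE_I2\<close>)
    have Sb: "(\<integral>y. S a y \<partial>lborel) \<le> 3 * B + K" for a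
      by (rule order_trans[OF integral_mono[OF S Wi] Wb]) (use ptw in \<open>simp add: S_def W_def\<close>)
    have N: "integrable lborel (\<lambda>y. \<rho> y / (4 * pi * norm (a - y)))" for a
    proof (rule Bochner_Integration.integrable_bound)
      show "integrable lborel (\<lambda>y. \<bar>\<rho> y\<bar> + S a y)" using S Bd by simp
      show "AE y in lborel. norm (\<rho> y / (4 * pi * norm (a - y))) \<le> norm (\<bar>\<rho> y\<bar> + S a y)"
      proof (rule AE_I2)
        fix y
        define r where "r = norm (y - a)"
        have r0: "r \<ge> 0" by (simp add: r_def)
        have "inverse (4 * pi * r) \<le> 1 + inverse (r\<^sup>2)"
        proof (cases "r = 0")
          case False
          then have r: "r > 0" using r0 by simp
          have "inverse (4 * pi * r) \<le> inverse (1 * r)"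
            using r pi_gt3 by (intro le_imp_inverse_le mult_right_mono) auto
          also have "\<dots> \<le> 1 + inverse (r\<^sup>2)"
          proof (cases "r \<ge> 1")
            case True
            then have "inverse r \<le> 1" by (simp add: inverse_le_1_iff)
            then show ?thesis by (simp add: add_increasing2)
          next
            case False
            then have "inverse r \<le> inverse (r\<^sup>2)" using r by (intro le_imp_inverse_le) (auto simp: power2_eq_square mult_left_le)
            then show ?thesis by simp
          qed
          finally show ?thesis .
        qed simp
        then have "\<bar>\<rho> y\<bar> * inverse (4 * pi * r) \<le> \<bar>\<rho> y\<bar> * (1 + inverse (r\<^sup>2))" by (intro mult_left_mono) auto
        also have "\<dots> = \<bar>\<rho> y\<bar> + S a y" by (simp add: S_def r_def algebra_simps divide_inverse)
        finally have "\<bar>\<rho> y\<bar> * inverse (4 * pi * r) \<le> \<bar>\<rho> y\<bar> + S a y" .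
        moreover have "norm (\<rho> y / (4 * pi * norm (a - y))) = \<bar>\<rho> y\<bar> * inverse (4 * pi * r)"
          unfolding r_def norm_minus_commute[of y a] by (simp add: abs_mult field_simps)
        ultimately show "norm (\<rho> y / (4 * pi * norm (a - y))) \<le> norm (\<bar>\<rho> y\<bar> + S a y)"
          using abs_ge_self[of "\<bar>\<rho> y\<bar> + S a y"] by simp
      qed
    qed simp
    have "newton_potential \<rho> x - newton_potential \<rho> y
        = (\<integral>z. \<rho> z / (4 * pi * norm (x - z)) - \<rho> z / (4 * pi * norm (y - z)) \<partial>lborel)"
      unfolding newton_potential_def using N by simp
    also have "\<bar>\<dots>\<bar> \<le> (\<integral>z. \<bar>\<rho> z / (4 * pi * norm (x - z)) - \<rho> z / (4 * pi * norm (y - z))\<bar> \<partial>lborel)"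
      by (rule integral_abs_bound)
    also have "\<dots> \<le> (\<integral>z. (norm (x - y) / 2) * (S x z + S y z) \<partial>lborel)"
    proof (rule integral_mono_AE)
      have "AE z in lborel. z \<noteq> x" "AE z in lborel. z \<noteq> y" by (rule AE_lborel_singleton)+
      then show "AE z in lborel. \<bar>\<rho> z / (4 * pi * norm (x - z)) - \<rho> z / (4 * pi * norm (y - z))\<bar>
          \<le> (norm (x - y) / 2) * (S x z + S y z)"
      proof eventually_elim
        fix z assume z: "z \<noteq> x" "z \<noteq> y"
        define a where "a = norm (x - z)"
        define b where "b = norm (y - z)"
        have ab: "a > 0" "b > 0" using z by (auto simp: a_def b_def)
        have d: "\<bar>b - a\<bar> \<le> norm (x - y)" unfolding a_def b_def
          using norm_triangle_ineq3[of "y - z" "x - z"] by (simp add: norm_minus_commute)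
        have "\<bar>inverse a - inverse b\<bar> = \<bar>b - a\<bar> * (inverse a * inverse b)"
        proof -
          have "inverse a - inverse b = (b - a) * (inverse a * inverse b)" using ab by (simp add: field_simps)
          then show ?thesis using ab by (simp add: abs_mult)
        qed
        also have "\<dots> \<le> norm (x - y) * (((inverse a)\<^sup>2 + (inverse b)\<^sup>2) / 2)"
          using d sum_squares_bound[of "inverse a" "inverse b"] ab by (intro mult_mono) auto
        finally have e: "\<bar>inverse a - inverse b\<bar> \<le> norm (x - y) * (((inverse a)\<^sup>2 + (inverse b)\<^sup>2) / 2)" .
        have "\<bar>\<rho> z / (4 * pi * a) - \<rho> z / (4 * pi * b)\<bar> = (\<bar>\<rho> z\<bar> * inverse (4 * pi)) * \<bar>inverse a - inverse b\<bar>"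
        proof -
          have "\<rho> z / (4 * pi * a) - \<rho> z / (4 * pi * b) = (\<rho> z * inverse (4 * pi)) * (inverse a - inverse b)"
            unfolding divide_inverse inverse_mult_distrib by (simp only: algebra_simps)
          moreover have "\<bar>inverse (4 * pi)\<bar> = inverse (4 * pi)" by (rule abs_of_nonneg) simp
          ultimately show ?thesis by (simp only: abs_mult)
        qed
        also have "\<dots> \<le> (\<bar>\<rho> z\<bar> * 1) * (norm (x - y) * (((inverse a)\<^sup>2 + (inverse b)\<^sup>2) / 2))"
          using pi_gt3 by (intro mult_mono e mult_left_mono) (simp_all add: inverse_le_1_iff del: inverse_mult_distrib)
        also have "\<dots> = (norm (x - y) / 2) * (S x z + S y z)"
          unfolding S_def a_def b_def norm_minus_commute[of z x] norm_minus_commute[of z y]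
          by (simp add: field_simps)
        finally show "\<bar>\<rho> z / (4 * pi * norm (x - z)) - \<rho> z / (4 * pi * norm (y - z))\<bar>
            \<le> (norm (x - y) / 2) * (S x z + S y z)" by (simp add: a_def b_def)
      qed
    qed (use N S in auto)
    also have "\<dots> = (norm (x - y) / 2) * ((\<integral>z. S x z \<partial>lborel) + (\<integral>z. S y z \<partial>lborel))" using S by simp
    also have "\<dots> \<le> (norm (x - y) / 2) * ((3 * B + K) + (3 * B + K))"
      by (intro mult_left_mono add_mono Sb) auto
    finally show ?thesis by (simp add: algebra_simps)
  qed
  then show ?thesis using that by blast
qed

section \<open>Renormalised balance laws for drift-diffusion equations\<close>

lemma divergence_add:
  assumes "F differentiable (at x)" "G differentiable (at x)"
  shows "divergence (\<lambda>x. F x + G x) x = divergence F x + divergence G x"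
proof -
  have "((\<lambda>x. F x + G x) has_derivative (\<lambda>v. frechet_derivative F (at x) v + frechet_derivative G (at x) v)) (at x)"
    using assms by (intro has_derivative_add) (auto simp: frechet_derivative_works[symmetric])
  from divergence_eqI[OF this] show ?thesis by (simp add: divergence_def sum.distrib)
qed

lemma continuous_grad_laplacian:
  assumes f: "Ck_on 2 UNIV f"
  shows "continuous_on UNIV (grad f)" "continuous_on UNIV (laplacian f)" "Ck_on 1 UNIV (grad f)" "Ck_on 1 UNIV f"
proof -
  show g: "Ck_on 1 UNIV (grad f)" using f by (intro Ck_on_grad) (auto simp: numeral_2_eq_2)
  then show "continuous_on UNIV (grad f)" by (rule Ck_on_imp_continuous_on)
  show "continuous_on UNIV (laplacian f)"
    unfolding laplacian_def[abs_def] divergence_def[abs_def] using g by (intro continuous_intros) auto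
  show "Ck_on 1 UNIV f" by (rule Ck_on_le[OF f]) simp
qed

lemma grad_laplacian_outside_support:
  assumes "\<And>x. norm x > r \<Longrightarrow> f x = 0" "norm x > r"
  shows "grad f x = 0" "laplacian f x = 0"
proof -
  have g: "grad f x = 0" if "norm x > r" for x
    using frechet_derivative_outside_support[OF assms(1) that] by (simp add: grad_def vec_eq_iff)
  then show "grad f x = 0" using assms(2) .
  show "laplacian f x = 0"
    using frechet_derivative_outside_support[OF g assms(2)] by (simp add: laplacian_def divergence_def)
qed

text \<open>The equation is multiplied by \<eta> B'(c), and four compactly supported fields
  integrate to zero: \<eta> B'(c) grad c, B(c) grad \<eta>, \<eta> B(c) u and \<eta> B(c) grad
  \<phi>. All terms with derivatives of \<eta> end up with the factor B(c) and no derivative of c,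
  which is why growth of B controls them. The drift leaves s B'(s) - B(s), the defect of B from
  being linear.\<close>

lemma balance_identity:
  fixes c \<eta> \<phi> \<rho> c' :: "real^3 \<Rightarrow> real" and u :: "real^3 \<Rightarrow> real^3" and B B' B'' :: "real \<Rightarrow> real"
  assumes c: "Ck_on 2 UNIV c" and \<eta>: "Ck_on 2 UNIV \<eta>" and \<phi>: "Ck_on 2 UNIV \<phi>" and u: "Ck_on 1 UNIV u"
    and supp: "\<And>x. norm x > r \<Longrightarrow> \<eta> x = 0"
    and B: "\<And>s. (B has_real_derivative B' s) (at s)" "\<And>s. (B' has_real_derivative B'' s) (at s)" "continuous_on UNIV B''"
    and div: "\<And>x. divergence u x = 0" and lap: "\<And>x. laplacian \<phi> x = - \<rho> x"
    and eq: "\<And>x. c' x = D * laplacian c x - u x \<bullet> grad c x + \<zeta> * D * (grad c x \<bullet> grad \<phi> x - c x * \<rho> x)"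
  shows "(\<integral>x. \<eta> x * (B' (c x) * c' x) \<partial>lborel) =
      - D * (\<integral>x. \<eta> x * (B'' (c x) * (norm (grad c x))\<^sup>2) \<partial>lborel)
      - \<zeta> * D * (\<integral>x. \<eta> x * ((c x * B' (c x) - B (c x)) * \<rho> x) \<partial>lborel)
      + (\<integral>x. B (c x) * (D * laplacian \<eta> x + u x \<bullet> grad \<eta> x - \<zeta> * D * (grad \<phi> x \<bullet> grad \<eta> x)) \<partial>lborel)"
proof -
  note cc = continuous_grad_laplacian[OF c] and c\<eta> = continuous_grad_laplacian[OF \<eta>] and c\<phi> = continuous_grad_laplacian[OF \<phi>]
  note d = Ck_on_1_differentiable
  have contB: "continuous_on UNIV B" "continuous_on UNIV B'"
    using B(1,2) by (meson DERIV_continuous_on has_field_derivative_at_within)+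
  have BC: "Ck_on 1 UNIV (\<lambda>x. B (c x))"
    by (rule Ck_on_1_of_real_deriv[OF open_UNIV cc(4), of UNIV B B']) (auto simp: B contB)
  have B'C: "Ck_on 1 UNIV (\<lambda>x. B' (c x))"
    by (rule Ck_on_1_of_real_deriv[OF open_UNIV cc(4), of UNIV B' B'']) (auto simp: B)
  have gB: "grad (\<lambda>x. B (c x)) x = B' (c x) *\<^sub>R grad c x" for x
    by (rule grad_compose_real(2)[OF d[OF cc(4)] B(1)])
  have gB': "grad (\<lambda>x. B' (c x)) x = B'' (c x) *\<^sub>R grad c x" for x
    by (rule grad_compose_real(2)[OF d[OF cc(4)] B(2)])
  define a1 where "a1 x = \<eta> x * B' (c x)" for x
  define a2 where "a2 x = \<eta> x * B (c x)" for x
  have aC: "Ck_on 1 UNIV a1" "Ck_on 1 UNIV a2" unfolding a1_def a2_def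
    by (intro Ck_on_mult c\<eta> BC B'C open_UNIV)+
  have ga1: "grad a1 x = \<eta> x *\<^sub>R (B'' (c x) *\<^sub>R grad c x) + B' (c x) *\<^sub>R grad \<eta> x" for x
    unfolding a1_def by (simp add: grad_mult[OF d[OF c\<eta>(4)] d[OF B'C]] gB')
  have ga2: "grad a2 x = \<eta> x *\<^sub>R (B' (c x) *\<^sub>R grad c x) + B (c x) *\<^sub>R grad \<eta> x" for x
    unfolding a2_def by (simp add: grad_mult[OF d[OF c\<eta>(4)] d[OF BC]] gB)
  define F1 where "F1 x = a1 x *\<^sub>R grad c x" for x
  define F2 where "F2 x = B (c x) *\<^sub>R grad \<eta> x" for x
  define F3 where "F3 x = a2 x *\<^sub>R u x" for x
  define F4 where "F4 x = a2 x *\<^sub>R grad \<phi> x" for x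
  have FC: "Ck_on 1 UNIV F1" "Ck_on 1 UNIV F2" "Ck_on 1 UNIV F3" "Ck_on 1 UNIV F4"
    unfolding F1_def F2_def F3_def F4_def by (intro Ck_on_scaleR aC BC u cc c\<eta> c\<phi> open_UNIV)+
  note out = grad_laplacian_outside_support[OF supp]
  have F0: "F1 x = 0" "F2 x = 0" "F3 x = 0" "F4 x = 0" if "norm x > r" for x
    using supp[OF that] out[OF _ that] that by (simp_all add: F1_def F2_def F3_def F4_def a1_def a2_def)
  have I0: "(\<integral>x. divergence F1 x \<partial>lborel) = 0" "(\<integral>x. divergence F2 x \<partial>lborel) = 0"
    "(\<integral>x. divergence F3 x \<partial>lborel) = 0" "(\<integral>x. divergence F4 x \<partial>lborel) = 0"
    by (rule integral_divergence_eq_0[of _ r]; use FC F0 in auto)+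
  have dI: "integrable lborel (\<lambda>x. divergence F x)" if "Ck_on 1 UNIV F" "\<And>x. norm x > r \<Longrightarrow> F x = 0" for F
  proof (rule integrable_continuous_compact_support[of _ r])
    show "continuous_on UNIV (divergence F)" unfolding divergence_def[abs_def]
      using that(1) by (intro continuous_intros) auto
    show "divergence F x = 0" if "norm x > r" for x
      using frechet_derivative_outside_support[OF \<open>\<And>x. norm x > r \<Longrightarrow> F x = 0\<close> that] by (simp add: divergence_def)
  qed
  have I: "integrable lborel (divergence F1)" "integrable lborel (divergence F2)"
    "integrable lborel (divergence F3)" "integrable lborel (divergence F4)"
    by (rule dI; use FC F0 in auto)+
  have dF1: "divergence F1 x = a1 x * laplacian c x + grad a1 x \<bullet> grad c x" for x
    unfolding F1_def laplacian_def by (rule divergence_scaleR[OF d[OF aC(1)] d[OF cc(3)]])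
  have dF2: "divergence F2 x = B (c x) * laplacian \<eta> x + (B' (c x) *\<^sub>R grad c x) \<bullet> grad \<eta> x" for x
    unfolding F2_def laplacian_def gB[symmetric] by (rule divergence_scaleR[OF d[OF BC] d[OF c\<eta>(3)]])
  have dF3: "divergence F3 x = grad a2 x \<bullet> u x" for x
    unfolding F3_def by (subst divergence_scaleR[OF d[OF aC(2)] d[OF u]]) (simp add: div)
  have dF4: "divergence F4 x = a2 x * laplacian \<phi> x + grad a2 x \<bullet> grad \<phi> x" for x
    unfolding F4_def laplacian_def by (rule divergence_scaleR[OF d[OF aC(2)] d[OF c\<phi>(3)]])
  define T2 where "T2 x = \<eta> x * (B'' (c x) * (norm (grad c x))\<^sup>2)" for x
  define T3 where "T3 x = \<eta> x * ((c x * B' (c x) - B (c x)) * \<rho> x)" for x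
  define T4 where "T4 x = B (c x) * (D * laplacian \<eta> x + u x \<bullet> grad \<eta> x - \<zeta> * D * (grad \<phi> x \<bullet> grad \<eta> x))" for x
  have \<rho>: "\<rho> = (\<lambda>x. - laplacian \<phi> x)" by (simp add: lap)
  have cont0: "continuous_on UNIV c" "continuous_on UNIV \<eta>" "continuous_on UNIV u"
    using Ck_on_imp_continuous_on c \<eta> u by blast+
  have contBc: "continuous_on UNIV (\<lambda>x. B (c x))" "continuous_on UNIV (\<lambda>x. B' (c x))" "continuous_on UNIV (\<lambda>x. B'' (c x))"
    using continuous_on_compose2[OF contB(1) cont0(1)] continuous_on_compose2[OF contB(2) cont0(1)]
      continuous_on_compose2[OF B(3) cont0(1)] by auto
  have iT: "integrable lborel T2" "integrable lborel T3" "integrable lborel T4"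
    unfolding T2_def T3_def T4_def \<rho> using cont0 contBc cc c\<eta> c\<phi> supp out
    by (auto intro!: integrable_continuous_compact_support[of _ r] continuous_intros simp del: Ck_on.simps)
  \<comment> \<open>\<open>F1\<close> and \<open>F2\<close> cancel in the mixed term of grad c and
    grad \<eta>; \<open>F3\<close> accounts for the transport by u and \<open>F4\<close> for the
    drift by \<phi>.\<close>
  have pt: "\<eta> x * (B' (c x) * c' x) = D * divergence F1 x - D * divergence F2 x - divergence F3 x
      + \<zeta> * D * divergence F4 x - D * T2 x - \<zeta> * D * T3 x + T4 x" for x
  proof -
    have 1: "grad a1 x \<bullet> grad c x = \<eta> x * (B'' (c x) * (norm (grad c x))\<^sup>2) + B' (c x) * (grad c x \<bullet> grad \<eta> x)"
      unfolding ga1 by (simp add: inner_add_left power2_norm_eq_inner inner_commute[of "grad \<eta> x" "grad c x"])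
    have 2: "grad a2 x \<bullet> u x = \<eta> x * (B' (c x) * (u x \<bullet> grad c x)) + B (c x) * (u x \<bullet> grad \<eta> x)"
      unfolding ga2 by (simp add: inner_add_left inner_commute[of "grad \<eta> x" "u x"] inner_commute[of "grad c x" "u x"])
    have 3: "grad a2 x \<bullet> grad \<phi> x = \<eta> x * (B' (c x) * (grad c x \<bullet> grad \<phi> x)) + B (c x) * (grad \<phi> x \<bullet> grad \<eta> x)"
      unfolding ga2 by (simp add: inner_add_left inner_commute[of "grad \<eta> x" "grad \<phi> x"])
    have 4: "(B' (c x) *\<^sub>R grad c x) \<bullet> grad \<eta> x = B' (c x) * (grad c x \<bullet> grad \<eta> x)" by simp
    show ?thesis
      unfolding dF1 dF2 dF3 dF4 1 2 3 4 eq T2_def T3_def T4_def a1_def a2_def lap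
      by algebra
  qed
  have "(\<integral>x. \<eta> x * (B' (c x) * c' x) \<partial>lborel) = D * 0 - D * 0 - 0 + \<zeta> * D * 0
      - D * (\<integral>x. T2 x \<partial>lborel) - \<zeta> * D * (\<integral>x. T3 x \<partial>lborel) + (\<integral>x. T4 x \<partial>lborel)"
    unfolding pt using I iT I0 by simp
  then show ?thesis by (simp add: T2_def T3_def T4_def)
qed

lemma Ck_slice:
  fixes f :: "real \<Rightarrow> real^3 \<Rightarrow> 'b::real_normed_vector"
  assumes "smooth_on ({0<..} \<times> UNIV) (\<lambda>(t, x). f t x)" "t > 0"
  shows "Ck_on k UNIV (f t)"
proof -
  have "Ck_on k UNIV (\<lambda>x. (\<lambda>(t, x). f t x) ((t, 0) + (0, x)))"
    by (rule Ck_on_compose_affine[where T = "{0<..} \<times> UNIV"])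
      (use assms in \<open>auto simp: smooth_on_def intro: bounded_linear_Pair bounded_linear_zero bounded_linear_ident\<close>)
  then show ?thesis by simp
qed

text \<open>The partial derivative in time is the joint derivative in the direction (1, 0), which
  carries joint continuity over to \<open>deriv\<close>.\<close>

lemma slice_time_derivative:
  fixes c :: "real \<Rightarrow> real^3 \<Rightarrow> real"
  assumes c_smooth: "smooth_on ({0<..} \<times> UNIV) (\<lambda>(t, x). c t x)"
  shows "t > 0 \<Longrightarrow> ((\<lambda>s. c s x) has_real_derivative deriv (\<lambda>s. c s x) t) (at t)"
    and "continuous_on ({0<..} \<times> UNIV) (\<lambda>(t, x). deriv (\<lambda>s. c s x) t)"
    and "continuous_on ({0<..} \<times> UNIV) (\<lambda>(t, x). c t x)"
proof -
  define c2 where "c2 = (\<lambda>(t, x). c t x)"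
  have c2: "Ck_on 1 ({0<..} \<times> UNIV) c2" using c_smooth by (auto simp: smooth_on_def c2_def)
  have d: "((\<lambda>s. c s x) has_real_derivative frechet_derivative c2 (at (t, x)) (1, 0)) (at t)" if t: "t > 0" for t x
  proof -
    have "((\<lambda>s. c2 (s, x)) has_derivative (\<lambda>h. frechet_derivative c2 (at (t, x)) (h, 0))) (at t)"
    proof -
      have e: "((\<lambda>s. (s, x)) has_derivative (\<lambda>h. (h, 0))) (at t)" by (auto intro!: derivative_eq_intros)
      have "(c2 has_derivative frechet_derivative c2 (at (t, x))) (at (t, x))"
        using Ck_on_SucD[of 0 "{0<..} \<times> UNIV" c2 "(t, x)"] c2 t by simp
      from has_derivative_compose[OF e this] show ?thesis .
    qed
    moreover have l: "linear (frechet_derivative c2 (at (t, x)))"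
      using c2 t by (intro linear_frechet_derivative) auto
    have "frechet_derivative c2 (at (t, x)) (h, 0) = frechet_derivative c2 (at (t, x)) (1, 0) * h" for h
    proof -
      have "h *\<^sub>R (1, 0) = (h, 0 :: real^3)" by simp
      then show ?thesis
        using linear_scale[OF l, of h "(1, 0)"] by (metis mult.commute real_scaleR_def)
    qed
    then have "(\<lambda>h. frechet_derivative c2 (at (t, x)) (h, 0)) = (*) (frechet_derivative c2 (at (t, x)) (1, 0))"
      by (rule ext)
    moreover have "(\<lambda>s. c2 (s, x)) = (\<lambda>s. c s x)" by (simp add: c2_def)
    ultimately show ?thesis unfolding has_field_derivative_def by (simp only:)
  qed
  then have e: "deriv (\<lambda>s. c s x) t = frechet_derivative c2 (at (t, x)) (1, 0)" if "t > 0" for t x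
    using that DERIV_imp_deriv by blast
  show "((\<lambda>s. c s x) has_real_derivative deriv (\<lambda>s. c s x) t) (at t)" if "t > 0"
    using d[OF that] e[OF that] by simp
  have "continuous_on ({0<..} \<times> UNIV) (\<lambda>p. frechet_derivative c2 (at p) (1, 0))" using c2 by simp
  then show "continuous_on ({0<..} \<times> UNIV) (\<lambda>(t, x). deriv (\<lambda>s. c s x) t)"
    by (rule continuous_on_eq) (auto simp: e)
  show "continuous_on ({0<..} \<times> UNIV) (\<lambda>(t, x). c t x)"
    using Ck_on_imp_continuous_on[OF c2] by (simp add: c2_def)
qed

text \<open>One scalar equation with \<phi>, \<rho> and u regarded as given, so that a single
  species and a sum of species of equal valence are treated alike. The bounds are uniform down to
  time 0, so that estimates over [s, t] survive the limit s -> 0.\<close>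

locale drift_diffusion =
  fixes D \<zeta> T M Q K :: real and c \<phi> \<rho> :: "real \<Rightarrow> real^3 \<Rightarrow> real" and u :: "real \<Rightarrow> real^3 \<Rightarrow> real^3"
  assumes D: "D > 0"
    and c_smooth: "smooth_on ({0<..} \<times> UNIV) (\<lambda>(t, x). c t x)"
    and \<phi>_smooth: "\<And>t. t > 0 \<Longrightarrow> Ck_on 2 UNIV (\<phi> t)"
    and u_smooth: "\<And>t. t > 0 \<Longrightarrow> Ck_on 1 UNIV (u t)"
    and eqn: "\<And>t x. t > 0 \<Longrightarrow> deriv (\<lambda>s. c s x) t
        = D * laplacian (c t) x - u t x \<bullet> grad (c t) x + \<zeta> * D * (grad (c t) x \<bullet> grad (\<phi> t) x - c t x * \<rho> t x)"
    and div_u: "\<And>t x. t > 0 \<Longrightarrow> divergence (u t) x = 0"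
    and lap_\<phi>: "\<And>t x. t > 0 \<Longrightarrow> laplacian (\<phi> t) x = - \<rho> t x"
    and c_L1: "\<And>t. 0 < t \<Longrightarrow> t \<le> T \<Longrightarrow> integrable lborel (c t)"
    and c_L1_le: "\<And>t. 0 < t \<Longrightarrow> t \<le> T \<Longrightarrow> (\<integral>x. \<bar>c t x\<bar> \<partial>lborel) \<le> M"
    and \<rho>_L1: "\<And>t. 0 < t \<Longrightarrow> t \<le> T \<Longrightarrow> integrable lborel (\<rho> t)"
    and \<rho>_L1_le: "\<And>t. 0 < t \<Longrightarrow> t \<le> T \<Longrightarrow> (\<integral>x. \<bar>\<rho> t x\<bar> \<partial>lborel) \<le> M"
    and cu: "\<And>t. 0 < t \<Longrightarrow> t \<le> T \<Longrightarrow> integrable lborel (\<lambda>x. \<bar>c t x\<bar> * norm (u t x))"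
    and cu_le: "\<And>t. 0 < t \<Longrightarrow> t \<le> T \<Longrightarrow> (\<integral>x. \<bar>c t x\<bar> * norm (u t x) \<partial>lborel) \<le> Q"
    and grad_\<phi>: "\<And>t x. 0 < t \<Longrightarrow> t \<le> T \<Longrightarrow> norm (grad (\<phi> t) x) \<le> K"
begin

lemma c_Ck: "t > 0 \<Longrightarrow> Ck_on k UNIV (c t)"
  by (rule Ck_slice[OF c_smooth])

lemmas c_time_derivative = slice_time_derivative[OF c_smooth]

lemma flux_error_bound:
  assumes t: "0 < t" "t \<le> T" and \<eta>: "Ck_on 2 UNIV \<eta>" and supp: "\<And>x. norm x > r \<Longrightarrow> \<eta> x = 0"
    and B: "continuous_on UNIV B" "\<And>s. \<bar>B s\<bar> \<le> \<bar>s\<bar>"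
    and a: "\<And>x. norm (grad \<eta> x) \<le> a" and b: "\<And>x. \<bar>laplacian \<eta> x\<bar> \<le> b"
  shows "\<bar>\<integral>x. B (c t x) * (D * laplacian \<eta> x + u t x \<bullet> grad \<eta> x - \<zeta> * D * (grad (\<phi> t) x \<bullet> grad \<eta> x)) \<partial>lborel\<bar>
    \<le> (D * b + \<bar>\<zeta>\<bar> * D * K * a) * M + a * Q"
proof -
  define f where "f x = B (c t x) * (D * laplacian \<eta> x + u t x \<bullet> grad \<eta> x - \<zeta> * D * (grad (\<phi> t) x \<bullet> grad \<eta> x))" for x
  have a0: "0 \<le> a" using a[of 0] norm_ge_zero order_trans by blast
  have b0: "0 \<le> b" using b[of 0] abs_ge_zero order_trans by blast
  have K0: "0 \<le> K" using grad_\<phi>[OF t, of 0] norm_ge_zero order_trans by blast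
  note i = c_L1[OF t] cu[OF t]
  have le: "\<bar>f x\<bar> \<le> (D * b + \<bar>\<zeta>\<bar> * D * K * a) * \<bar>c t x\<bar> + a * (\<bar>c t x\<bar> * norm (u t x))" for x
  proof -
    have 1: "\<bar>D * laplacian \<eta> x\<bar> \<le> D * b" using D b[of x] by (simp add: abs_mult)
    have 2: "\<bar>u t x \<bullet> grad \<eta> x\<bar> \<le> norm (u t x) * a"
      by (rule order_trans[OF Cauchy_Schwarz_ineq2]) (simp add: a mult_left_mono)
    have "\<bar>grad (\<phi> t) x \<bullet> grad \<eta> x\<bar> \<le> K * a"
      by (rule order_trans[OF Cauchy_Schwarz_ineq2]) (simp add: a K0 grad_\<phi>[OF t] mult_mono)
    then have "\<bar>\<zeta>\<bar> * D * \<bar>grad (\<phi> t) x \<bullet> grad \<eta> x\<bar> \<le> \<bar>\<zeta>\<bar> * D * (K * a)" using D by (intro mult_left_mono) auto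
    then have 3: "\<bar>\<zeta> * D * (grad (\<phi> t) x \<bullet> grad \<eta> x)\<bar> \<le> \<bar>\<zeta>\<bar> * D * (K * a)" using D by (simp add: abs_mult)
    have "\<bar>f x\<bar> = \<bar>B (c t x)\<bar> * \<bar>D * laplacian \<eta> x + u t x \<bullet> grad \<eta> x - \<zeta> * D * (grad (\<phi> t) x \<bullet> grad \<eta> x)\<bar>"
      by (simp add: f_def abs_mult)
    also have "\<dots> \<le> \<bar>c t x\<bar> * (D * b + norm (u t x) * a + \<bar>\<zeta>\<bar> * D * (K * a))"
    proof (intro mult_mono B)
      show "\<bar>D * laplacian \<eta> x + u t x \<bullet> grad \<eta> x - \<zeta> * D * (grad (\<phi> t) x \<bullet> grad \<eta> x)\<bar>
          \<le> D * b + norm (u t x) * a + \<bar>\<zeta>\<bar> * D * (K * a)" using 1 2 3 by linarith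
    qed auto
    finally show ?thesis by (simp add: algebra_simps)
  qed
  have "\<bar>\<integral>x. f x \<partial>lborel\<bar> \<le> (\<integral>x. \<bar>f x\<bar> \<partial>lborel)" by (rule integral_abs_bound)
  also have "\<dots> \<le> (\<integral>x. (D * b + \<bar>\<zeta>\<bar> * D * K * a) * \<bar>c t x\<bar> + a * (\<bar>c t x\<bar> * norm (u t x)) \<partial>lborel)"
    by (rule integral_mono'[OF _ le order_trans[OF abs_ge_zero le]]) (use i in auto)
  also have "\<dots> = (D * b + \<bar>\<zeta>\<bar> * D * K * a) * (\<integral>x. \<bar>c t x\<bar> \<partial>lborel) + a * (\<integral>x. \<bar>c t x\<bar> * norm (u t x) \<partial>lborel)"
    using i by simp
  also have "\<dots> \<le> (D * b + \<bar>\<zeta>\<bar> * D * K * a) * M + a * Q"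
    using D a0 b0 K0 by (intro add_mono mult_left_mono c_L1_le cu_le t) auto
  finally show ?thesis by (simp add: f_def)
qed

text \<open>The time derivative \<open>I\<close> consists of the dissipation and the drift term up
  to a flux error uniform in time. The flux is replaced by a bound that sees the weight only through
  the suprema \<open>a\<close> and \<open>b\<close> of its derivatives.\<close>

lemma balance:
  fixes B B' B'' :: "real \<Rightarrow> real"
  assumes st: "0 < s" "s \<le> t" "t \<le> T" and \<eta>: "Ck_on 2 UNIV \<eta>" and supp: "\<And>x. norm x > r \<Longrightarrow> \<eta> x = 0"
    and B: "\<And>s. (B has_real_derivative B' s) (at s)" "\<And>s. (B' has_real_derivative B'' s) (at s)" "continuous_on UNIV B''"
      "\<And>s. \<bar>B s\<bar> \<le> \<bar>s\<bar>"
    and a: "\<And>x. norm (grad \<eta> x) \<le> a" and b: "\<And>x. \<bar>laplacian \<eta> x\<bar> \<le> b"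
  obtains I where "set_integrable lborel {s..t} I"
    "(\<integral>x. \<eta> x * B (c t x) \<partial>lborel) - (\<integral>x. \<eta> x * B (c s x) \<partial>lborel) = (LINT \<tau>:{s..t}|lborel. I \<tau>)"
    "\<And>\<tau>. \<tau> \<in> {s..t} \<Longrightarrow> \<bar>I \<tau> + D * (\<integral>x. \<eta> x * (B'' (c \<tau> x) * (norm (grad (c \<tau>) x))\<^sup>2) \<partial>lborel)
        + \<zeta> * D * (\<integral>x. \<eta> x * ((c \<tau> x * B' (c \<tau> x) - B (c \<tau> x)) * \<rho> \<tau> x) \<partial>lborel)\<bar>
      \<le> (D * b + \<bar>\<zeta>\<bar> * D * K * a) * M + a * Q"
proof -
  define f' where "f' \<tau> x = \<eta> x * (B' (c \<tau> x) * deriv (\<lambda>s. c s x) \<tau>)" for \<tau> x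
  have contB: "continuous_on UNIV B" "continuous_on UNIV B'"
    using B(1,2) by (meson DERIV_continuous_on has_field_derivative_at_within)+
  have c\<eta>: "continuous_on UNIV \<eta>" using \<eta> by (rule Ck_on_imp_continuous_on)
  have sub: "{s..t} \<times> UNIV \<subseteq> {0<..} \<times> (UNIV :: (real^3) set)" using st by auto
  have der: "((\<lambda>\<tau>. \<eta> x * B (c \<tau> x)) has_real_derivative f' \<tau> x) (at \<tau>)" if "\<tau> \<in> {s..t}" for \<tau> x
    unfolding f'_def using that st
    by (intro DERIV_cmult DERIV_chain2[OF B(1)] c_time_derivative(1)) auto
  have cont: "continuous_on ({s..t} \<times> UNIV) (\<lambda>(\<tau>, x). f' \<tau> x)"
  proof -
    have "continuous_on ({s..t} \<times> UNIV) (\<lambda>p. \<eta> (snd p) * (B' ((\<lambda>(t, x). c t x) p) * (\<lambda>(t, x). deriv (\<lambda>s. c s x) t) p))"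
      by (intro continuous_intros continuous_on_compose2[OF c\<eta>] continuous_on_compose2[OF contB(2)]
          continuous_on_subset[OF c_time_derivative(3) sub] continuous_on_subset[OF c_time_derivative(2) sub]) auto
    then show ?thesis by (simp add: f'_def case_prod_beta)
  qed
  have int: "integrable lborel (\<lambda>x. \<eta> x * B (c \<tau> x))" if "\<tau> \<in> {s..t}" for \<tau>
  proof (rule integrable_continuous_compact_support[of _ r])
    have "continuous_on UNIV (c \<tau>)" using that st by (intro Ck_on_imp_continuous_on[OF c_Ck]) auto
    then show "continuous_on UNIV (\<lambda>x. \<eta> x * B (c \<tau> x))"
      using continuous_on_compose2[OF contB(1)] by (intro continuous_intros c\<eta>) auto
  qed (simp add: supp)
  note td = integral_time_derivative[OF st(2) der cont int, of r]
  have f'0: "f' \<tau> x = 0" if "norm x > r" for \<tau> x using supp[OF that] by (simp add: f'_def)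
  show ?thesis
  proof (rule that[of "\<lambda>\<tau>. \<integral>x. f' \<tau> x \<partial>lborel"])
    show "set_integrable lborel {s..t} (\<lambda>\<tau>. \<integral>x. f' \<tau> x \<partial>lborel)" by (rule td(1)) (use f'0 in auto)
    show "(\<integral>x. \<eta> x * B (c t x) \<partial>lborel) - (\<integral>x. \<eta> x * B (c s x) \<partial>lborel)
        = (LINT \<tau>:{s..t}|lborel. (\<integral>x. f' \<tau> x \<partial>lborel))" by (rule td(2)) (use f'0 in auto)
    fix \<tau> assume \<tau>: "\<tau> \<in> {s..t}"
    then have t: "0 < \<tau>" "\<tau> \<le> T" using st by auto
    have "(\<integral>x. f' \<tau> x \<partial>lborel) + D * (\<integral>x. \<eta> x * (B'' (c \<tau> x) * (norm (grad (c \<tau>) x))\<^sup>2) \<partial>lborel)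
        + \<zeta> * D * (\<integral>x. \<eta> x * ((c \<tau> x * B' (c \<tau> x) - B (c \<tau> x)) * \<rho> \<tau> x) \<partial>lborel)
      = (\<integral>x. B (c \<tau> x) * (D * laplacian \<eta> x + u \<tau> x \<bullet> grad \<eta> x - \<zeta> * D * (grad (\<phi> \<tau>) x \<bullet> grad \<eta> x)) \<partial>lborel)"
      unfolding f'_def
      by (subst balance_identity[OF c_Ck[OF t(1)] \<eta> \<phi>_smooth[OF t(1)] u_smooth[OF t(1)] supp B(1-3)
            div_u[OF t(1)] lap_\<phi>[OF t(1)] eqn[OF t(1)]]) auto
    then show "\<bar>(\<integral>x. f' \<tau> x \<partial>lborel) + D * (\<integral>x. \<eta> x * (B'' (c \<tau> x) * (norm (grad (c \<tau>) x))\<^sup>2) \<partial>lborel)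
        + \<zeta> * D * (\<integral>x. \<eta> x * ((c \<tau> x * B' (c \<tau> x) - B (c \<tau> x)) * \<rho> \<tau> x) \<partial>lborel)\<bar>
      \<le> (D * b + \<bar>\<zeta>\<bar> * D * K * a) * M + a * Q"
      using flux_error_bound[OF t \<eta> supp contB(1) B(4) a b] by simp
  qed
qed

end

lemma set_lebesgue_integral_Icc_le:
  fixes I :: "real \<Rightarrow> real"
  assumes "s \<le> t" "set_integrable lborel {s..t} I" "\<And>\<tau>. \<tau> \<in> {s..t} \<Longrightarrow> I \<tau> \<le> k"
  shows "(LINT \<tau>:{s..t}|lborel. I \<tau>) \<le> (t - s) * k"
proof -
  have "set_integrable lborel {s..t} (\<lambda>\<tau>. k)"
    unfolding set_integrable_def by (intro integrable_scaleR_left integrable_real_indicator) (auto simp: assms)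
  then have "(LINT \<tau>:{s..t}|lborel. I \<tau>) \<le> (LINT \<tau>:{s..t}|lborel. k)"
    using assms by (intro set_integral_mono) auto
  also have "\<dots> = (t - s) * k" using assms(1) by (simp add: set_lebesgue_integral_def)
  finally show ?thesis .
qed

text \<open>The convex functions \<open>sqrt (L\<^sup>2 + s\<^sup>2) - L\<close> interpolate between \<open>|s|\<close> (as \<open>L\<close> tends to \<open>0\<close>) and,
  after multiplication by \<open>2 * L\<close>, \<open>s\<^sup>2\<close> (as \<open>L\<close> tends to infinity). Their linear growth is what
  makes the flux terms vanish at infinity without any further integrability.\<close>

definition pabs :: "real \<Rightarrow> real \<Rightarrow> real" where
  "pabs L s = sqrt (L\<^sup>2 + s\<^sup>2)"

lemma pabs:
  assumes "L > 0"
  shows pabs_pos: "pabs L s > 0" and pabs_ge: "L \<le> pabs L s" "\<bar>s\<bar> \<le> pabs L s"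
    and pabs_le: "pabs L s \<le> L + \<bar>s\<bar>" and pabs_sq: "(pabs L s)\<^sup>2 = L\<^sup>2 + s\<^sup>2"
proof -
  show "pabs L s > 0" using assms by (auto simp: pabs_def intro: add_pos_nonneg)
  show "L \<le> pabs L s" unfolding pabs_def by (rule real_le_rsqrt) simp
  show "\<bar>s\<bar> \<le> pabs L s" unfolding pabs_def by (rule real_le_rsqrt) simp
  show "pabs L s \<le> L + \<bar>s\<bar>" unfolding pabs_def using assms by (intro real_le_lsqrt) (auto simp: power2_sum)
  show "(pabs L s)\<^sup>2 = L\<^sup>2 + s\<^sup>2" by (simp add: pabs_def)
qed

lemma pabs_derivatives:
  assumes "L > 0"
  shows "((\<lambda>s. pabs L s - L) has_real_derivative s / pabs L s) (at s)"
    and "((\<lambda>s. s / pabs L s) has_real_derivative L\<^sup>2 / (pabs L s) ^ 3) (at s)"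
    and "continuous_on UNIV (\<lambda>s. L\<^sup>2 / (pabs L s) ^ 3)"
proof -
  have pos: "L\<^sup>2 + s\<^sup>2 > 0" for s using assms by (auto intro: add_pos_nonneg)
  have d: "(pabs L has_real_derivative s / pabs L s) (at s)" for s
    unfolding pabs_def[abs_def] using pos[of s] by (auto intro!: derivative_eq_intros simp: field_simps)
  show "((\<lambda>s. pabs L s - L) has_real_derivative s / pabs L s) (at s)"
    by (rule DERIV_cong[OF DERIV_diff[OF d DERIV_const]]) simp
  have p: "pabs L s \<noteq> 0" for s using pabs_pos[OF assms, of s] by simp
  have "((\<lambda>s. s / pabs L s) has_real_derivative (1 * pabs L s - s * (s / pabs L s)) / (pabs L s * pabs L s)) (at s)"
    by (rule DERIV_divide[OF DERIV_ident d p])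
  moreover have "(1 * pabs L s - s * (s / pabs L s)) / (pabs L s * pabs L s) = L\<^sup>2 / (pabs L s) ^ 3"
  proof -
    have "1 * pabs L s - s * (s / pabs L s) = ((pabs L s)\<^sup>2 - s\<^sup>2) / pabs L s"
      using p[of s] by (simp add: diff_divide_distrib power2_eq_square)
    then have "1 * pabs L s - s * (s / pabs L s) = L\<^sup>2 / pabs L s" unfolding pabs_sq[OF assms] by simp
    then show ?thesis by (simp add: power3_eq_cube mult.assoc)
  qed
  ultimately show "((\<lambda>s. s / pabs L s) has_real_derivative L\<^sup>2 / (pabs L s) ^ 3) (at s)"
    by (rule DERIV_cong)
  have "continuous_on UNIV (pabs L)" by (rule DERIV_continuous_on, rule has_field_derivative_at_within, rule d)
  then show "continuous_on UNIV (\<lambda>s. L\<^sup>2 / (pabs L s) ^ 3)" using p by (intro continuous_intros) auto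
qed

text \<open>For B = \<open>pabs L\<close> - L the defect s B'(s) - B(s) lies between 0 and L. It
  vanishes with L in the contraction estimate; in the energy estimate its monotonicity on s >= 0 is
  used instead.\<close>

lemma pabs_gamma:
  assumes "L > 0"
  shows "s * (s / pabs L s) - (pabs L s - L) = L - L\<^sup>2 / pabs L s"
    and "0 \<le> L - L\<^sup>2 / pabs L s" "L - L\<^sup>2 / pabs L s \<le> L"
proof -
  note p = pabs_pos[OF assms, of s] pabs_sq[OF assms, of s] pabs_ge(1)[OF assms, of s]
  show "s * (s / pabs L s) - (pabs L s - L) = L - L\<^sup>2 / pabs L s"
    using p by (simp add: field_simps power2_eq_square)
  have "L\<^sup>2 / pabs L s \<le> L\<^sup>2 / L" using p assms by (intro divide_left_mono) auto
  then show "0 \<le> L - L\<^sup>2 / pabs L s" using assms by (simp add: power2_eq_square)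
  show "L - L\<^sup>2 / pabs L s \<le> L" using p by simp
qed

lemma pabs_minus_bound: "L > 0 \<Longrightarrow> 0 \<le> pabs L s - L" "L > 0 \<Longrightarrow> \<bar>pabs L s - L\<bar> \<le> \<bar>s\<bar>"
  using pabs_ge[of L s] pabs_le[of L s] by auto

lemma pabs_scaled_le_square:
  assumes "L > 0"
  shows "2 * L * (pabs L s - L) \<le> s\<^sup>2"
proof -
  note p = pabs_sq[OF assms, of s]
  have "0 \<le> (pabs L s - L)\<^sup>2" by simp
  then show ?thesis using p by (simp add: power2_diff algebra_simps power2_eq_square)
qed

lemma pabs_limits:
  shows "(\<lambda>n. 2 * real (Suc n) * (pabs (real (Suc n)) s - real (Suc n))) \<longlonglongrightarrow> s\<^sup>2"
    and "(\<lambda>n. 2 * real (Suc n) * ((real (Suc n))\<^sup>2 / (pabs (real (Suc n)) s) ^ 3)) \<longlonglongrightarrow> 2"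
proof -
  \<comment> \<open>\<open>q\<close> is \<open>pabs\<close> divided by its parameter n + 1; the
    identity (q - 1)(q + 1) = (s / (n + 1))^2 removes the difference of two large numbers.\<close>
  define q where "q n = sqrt (1 + (s * inverse (real (Suc n)))\<^sup>2)" for n
  have "q \<longlonglongrightarrow> sqrt (1 + (s * 0)\<^sup>2)" unfolding q_def
    by (intro tendsto_intros LIMSEQ_inverse_real_of_nat)
  then have q: "q \<longlonglongrightarrow> 1" by simp
  have pq: "pabs (real (Suc n)) s = real (Suc n) * q n" for n
  proof -
    have "(real (Suc n))\<^sup>2 + s\<^sup>2 = (real (Suc n))\<^sup>2 * (1 + (s * inverse (real (Suc n)))\<^sup>2)"
      by (simp add: field_simps del: of_nat_Suc)
    then show ?thesis by (simp add: pabs_def q_def real_sqrt_mult del: of_nat_Suc)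
  qed
  have q1: "q n \<ge> 1" for n by (simp add: q_def)
  have q2: "(q n)\<^sup>2 = 1 + (s * inverse (real (Suc n)))\<^sup>2" for n by (simp add: q_def add_nonneg_nonneg)
  have e1: "2 * real (Suc n) * (pabs (real (Suc n)) s - real (Suc n)) = 2 * s\<^sup>2 / (q n + 1)" for n
  proof -
    have "(q n - 1) * (q n + 1) = s\<^sup>2 * inverse (real (Suc n)) ^ 2"
      using q2[of n] by (simp add: algebra_simps power2_eq_square)
    then have "(real (Suc n))\<^sup>2 * ((q n - 1) * (q n + 1)) = s\<^sup>2" by (simp add: field_simps del: of_nat_Suc)
    then have "2 * (real (Suc n))\<^sup>2 * (q n - 1) = 2 * s\<^sup>2 / (q n + 1)" using q1[of n] by (simp add: field_simps)
    moreover have "2 * real (Suc n) * (pabs (real (Suc n)) s - real (Suc n)) = 2 * (real (Suc n))\<^sup>2 * (q n - 1)"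
      unfolding pq by (simp add: algebra_simps power2_eq_square)
    ultimately show ?thesis by simp
  qed
  have "(\<lambda>n. 2 * s\<^sup>2 / (q n + 1)) \<longlonglongrightarrow> 2 * s\<^sup>2 / (1 + 1)" by (intro tendsto_intros q) auto
  then show "(\<lambda>n. 2 * real (Suc n) * (pabs (real (Suc n)) s - real (Suc n))) \<longlonglongrightarrow> s\<^sup>2"
    unfolding e1 by simp
  have e2: "2 * real (Suc n) * ((real (Suc n))\<^sup>2 / (pabs (real (Suc n)) s) ^ 3) = 2 / (q n) ^ 3" for n
    unfolding pq using q1[of n] by (simp add: field_simps power2_eq_square power3_eq_cube del: of_nat_Suc)
  have "(\<lambda>n. 2 / (q n) ^ 3) \<longlonglongrightarrow> 2 / 1 ^ 3" by (intro tendsto_intros q) auto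
  then show "(\<lambda>n. 2 * real (Suc n) * ((real (Suc n))\<^sup>2 / (pabs (real (Suc n)) s) ^ 3)) \<longlonglongrightarrow> 2"
    unfolding e2 by simp
qed

section \<open>Contraction, conservation of mass and the energy inequality\<close>

lemma cutoff_integral_tendsto:
  fixes f :: "real^3 \<Rightarrow> real"
  assumes "integrable lborel f"
  shows "((\<lambda>R. \<integral>x. cutoff R x * f x \<partial>lborel) \<longlongrightarrow> (\<integral>x. f x \<partial>lborel)) at_top"
proof -
  have [measurable]: "f \<in> borel_measurable borel" using assms by auto
  have [measurable]: "cutoff R \<in> borel_measurable borel" for R
    by (rule borel_measurable_continuous_onI[OF Ck_on_imp_continuous_on[OF Ck_on_cutoff]])
  show ?thesis
  proof (rule integral_dominated_convergence_at_top[where w = "\<lambda>x. \<bar>f x\<bar>"])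
    have "((\<lambda>R. cutoff R x * f x) \<longlongrightarrow> 1 * f x) at_top" for x
      by (intro tendsto_intros cutoff_tendsto_1)
    then show "AE x in lborel. ((\<lambda>R. cutoff R x * f x) \<longlongrightarrow> f x) at_top" by simp
    show "\<forall>\<^sub>F R in at_top. AE x in lborel. norm (cutoff R x * f x) \<le> \<bar>f x\<bar>"
      using cutoff_range by (intro always_eventually allI AE_I2) (auto simp: abs_mult mult_left_le_one_le)
  qed (use assms in auto)
qed

context drift_diffusion
begin

text \<open>With B = \<open>pabs L\<close> - L, convexity lets the dissipation be dropped, and the
  drift term is at most a multiple of L times the L^1 norm of \<rho>. L tends to 0 first at fixed
  radius, because replacing |c| by B(c) costs L times the integral of the cut-off, which grows with
  R; then R tends to infinity.\<close>

lemma L1_contraction: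
  assumes st: "0 < s" "s \<le> t" "t \<le> T"
  shows "(\<integral>x. \<bar>c t x\<bar> \<partial>lborel) \<le> (\<integral>x. \<bar>c s x\<bar> \<partial>lborel)"
proof -
  obtain C where C: "C > 0" "\<And>R x. R \<ge> 1 \<Longrightarrow> norm (grad (cutoff R) x) \<le> C / R"
    "\<And>R x. R \<ge> 1 \<Longrightarrow> \<bar>laplacian (cutoff R) x\<bar> \<le> C / R" by (rule cutoff_bounds) blast
  define err where "err R = (D * (C / R) + \<bar>\<zeta>\<bar> * D * K * (C / R)) * M + (C / R) * Q" for R
  have ic: "integrable lborel (\<lambda>x. cutoff R x * c' x)" if "integrable lborel c'" for R c'
  proof (rule Bochner_Integration.integrable_bound[OF that])
    have [measurable]: "cutoff R \<in> borel_measurable borel"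
      by (rule borel_measurable_continuous_onI[OF Ck_on_imp_continuous_on[OF Ck_on_cutoff]])
    show "(\<lambda>x. cutoff R x * c' x) \<in> borel_measurable lborel" using that by measurable
    show "AE x in lborel. norm (cutoff R x * c' x) \<le> norm (c' x)"
      using cutoff_range by (intro AE_I2) (auto simp: abs_mult mult_left_le_one_le)
  qed
  have iL1: "integrable lborel (\<lambda>x. \<bar>c \<tau> x\<bar>)" if "0 < \<tau>" "\<tau> \<le> T" for \<tau> using c_L1[OF that] by simp
  have icut: "integrable lborel (cutoff R)" if "R \<ge> 1" for R
    using that cutoff_support[of R]
    by (intro integrable_continuous_compact_support[of _ R] Ck_on_imp_continuous_on[OF Ck_on_cutoff[of 0]]) auto
  have stepL: "(\<integral>x. cutoff R x * \<bar>c t x\<bar> \<partial>lborel) \<le> (\<integral>x. \<bar>c s x\<bar> \<partial>lborel) + (t - s) * err R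
      + L * ((\<integral>x. cutoff R x \<partial>lborel) + (t - s) * (\<bar>\<zeta>\<bar> * D * M))" if R: "R \<ge> 1" and L: "L > 0" for R L
  proof -
    define B where "B s = pabs L s - L" for s
    note Bd = pabs_derivatives[OF L]
    have R0: "R > 0" using R by simp
    have supp: "\<And>x. norm x > R \<Longrightarrow> cutoff R x = 0" using cutoff_support R0 by auto
    obtain I where I: "set_integrable lborel {s..t} I"
      "(\<integral>x. cutoff R x * B (c t x) \<partial>lborel) - (\<integral>x. cutoff R x * B (c s x) \<partial>lborel) = (LINT \<tau>:{s..t}|lborel. I \<tau>)"
      "\<And>\<tau>. \<tau> \<in> {s..t} \<Longrightarrow> \<bar>I \<tau> + D * (\<integral>x. cutoff R x * (L\<^sup>2 / (pabs L (c \<tau> x)) ^ 3 * (norm (grad (c \<tau>) x))\<^sup>2) \<partial>lborel)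
        + \<zeta> * D * (\<integral>x. cutoff R x * ((c \<tau> x * (c \<tau> x / pabs L (c \<tau> x)) - B (c \<tau> x)) * \<rho> \<tau> x) \<partial>lborel)\<bar> \<le> err R"
      unfolding err_def B_def
      using balance[OF st Ck_on_cutoff supp Bd pabs_minus_bound(2)[OF L] C(2)[OF R] C(3)[OF R]] by blast
    have "I \<tau> \<le> err R + \<bar>\<zeta>\<bar> * D * (L * M)" if \<tau>: "\<tau> \<in> {s..t}" for \<tau>
    proof -
      have t: "0 < \<tau>" "\<tau> \<le> T" using \<tau> st by auto
      define T3 where "T3 = (\<integral>x. cutoff R x * ((c \<tau> x * (c \<tau> x / pabs L (c \<tau> x)) - B (c \<tau> x)) * \<rho> \<tau> x) \<partial>lborel)"
      have 1: "0 \<le> (\<integral>x. cutoff R x * (L\<^sup>2 / (pabs L (c \<tau> x)) ^ 3 * (norm (grad (c \<tau>) x))\<^sup>2) \<partial>lborel)"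
        by (intro Bochner_Integration.integral_nonneg mult_nonneg_nonneg divide_nonneg_nonneg zero_le_power
            cutoff_range less_imp_le[OF pabs_pos[OF L]] zero_le_power2)
      have "\<bar>T3\<bar> \<le> (\<integral>x. \<bar>cutoff R x * ((c \<tau> x * (c \<tau> x / pabs L (c \<tau> x)) - B (c \<tau> x)) * \<rho> \<tau> x)\<bar> \<partial>lborel)"
        unfolding T3_def by (rule integral_abs_bound)
      also have "\<dots> \<le> (\<integral>x. L * \<bar>\<rho> \<tau> x\<bar> \<partial>lborel)"
      proof (rule integral_mono')
        show "integrable lborel (\<lambda>x. L * \<bar>\<rho> \<tau> x\<bar>)" using \<rho>_L1[OF t] by simp
        fix x
        have g: "\<bar>c \<tau> x * (c \<tau> x / pabs L (c \<tau> x)) - B (c \<tau> x)\<bar> \<le> L"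
          using pabs_gamma[OF L, of "c \<tau> x"] unfolding B_def by auto
        have "\<bar>cutoff R x * ((c \<tau> x * (c \<tau> x / pabs L (c \<tau> x)) - B (c \<tau> x)) * \<rho> \<tau> x)\<bar>
            = cutoff R x * (\<bar>c \<tau> x * (c \<tau> x / pabs L (c \<tau> x)) - B (c \<tau> x)\<bar> * \<bar>\<rho> \<tau> x\<bar>)"
          using cutoff_range(1)[of R x] by (simp only: abs_mult abs_of_nonneg)
        also have "\<dots> \<le> 1 * (L * \<bar>\<rho> \<tau> x\<bar>)"
          using L by (intro mult_mono cutoff_range mult_right_mono g mult_nonneg_nonneg) auto
        finally show "\<bar>cutoff R x * ((c \<tau> x * (c \<tau> x / pabs L (c \<tau> x)) - B (c \<tau> x)) * \<rho> \<tau> x)\<bar> \<le> L * \<bar>\<rho> \<tau> x\<bar>" by simp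
        show "0 \<le> L * \<bar>\<rho> \<tau> x\<bar>" using L by simp
      qed
      also have "\<dots> \<le> L * M" using L \<rho>_L1_le[OF t] by simp
      finally have "\<bar>\<zeta>\<bar> * D * \<bar>T3\<bar> \<le> \<bar>\<zeta>\<bar> * D * (L * M)" using D by (intro mult_left_mono) auto
      moreover have "- (\<zeta> * D * T3) \<le> \<bar>\<zeta>\<bar> * D * \<bar>T3\<bar>"
        using abs_ge_minus_self[of "\<zeta> * D * T3"] D by (simp add: abs_mult)
      moreover have "0 \<le> D * (\<integral>x. cutoff R x * (L\<^sup>2 / (pabs L (c \<tau> x)) ^ 3 * (norm (grad (c \<tau>) x))\<^sup>2) \<partial>lborel)"
        using 1 D by (intro mult_nonneg_nonneg) auto
      ultimately show ?thesis using I(3)[OF \<tau>] unfolding T3_def[symmetric] by linarith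
    qed
    then have "(LINT \<tau>:{s..t}|lborel. I \<tau>) \<le> (t - s) * (err R + \<bar>\<zeta>\<bar> * D * (L * M))"
      by (intro set_lebesgue_integral_Icc_le st I(1))
    with I(2) have 1: "(\<integral>x. cutoff R x * B (c t x) \<partial>lborel) \<le> (\<integral>x. cutoff R x * B (c s x) \<partial>lborel) + (t - s) * (err R + \<bar>\<zeta>\<bar> * D * (L * M))"
      by simp
    have ptB: "integrable lborel (\<lambda>x. B (c \<tau> x))" if "0 < \<tau>" "\<tau> \<le> T" for \<tau>
    proof (rule Bochner_Integration.integrable_bound[OF c_L1[OF that]])
      show "AE x in lborel. norm (B (c \<tau> x)) \<le> norm (c \<tau> x)"
        using pabs_minus_bound(2)[OF L] by (auto simp: B_def)
      have [measurable]: "c \<tau> \<in> borel_measurable lborel" using c_L1[OF that] by auto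
      show "(\<lambda>x. B (c \<tau> x)) \<in> borel_measurable lborel" unfolding B_def pabs_def by measurable
    qed
    have "(\<integral>x. cutoff R x * B (c s x) \<partial>lborel) \<le> (\<integral>x. \<bar>c s x\<bar> \<partial>lborel)"
    proof (rule integral_mono'[OF iL1])
      show "cutoff R x * B (c s x) \<le> \<bar>c s x\<bar>" for x
        using mult_mono[OF cutoff_range(2)[of R x] pabs_minus_bound(2)[OF L, of "c s x"]] pabs_minus_bound(1)[OF L, of "c s x"]
        by (simp add: B_def)
    qed (use st in auto)
    moreover have "(\<integral>x. cutoff R x * \<bar>c t x\<bar> \<partial>lborel) \<le> (\<integral>x. cutoff R x * B (c t x) + L * cutoff R x \<partial>lborel)"
    proof (rule integral_mono)
      show "integrable lborel (\<lambda>x. cutoff R x * \<bar>c t x\<bar>)" using st by (intro ic iL1) auto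
      show "integrable lborel (\<lambda>x. cutoff R x * B (c t x) + L * cutoff R x)"
        using st icut[OF R] by (intro Bochner_Integration.integrable_add ic ptB integrable_mult_right) auto
      fix x
      have "\<bar>c t x\<bar> \<le> B (c t x) + L" using pabs_ge(2)[OF L] by (simp add: B_def)
      from mult_left_mono[OF this cutoff_range(1)[of R x]]
      show "cutoff R x * \<bar>c t x\<bar> \<le> cutoff R x * B (c t x) + L * cutoff R x" by (simp add: algebra_simps)
    qed
    moreover have "(\<integral>x. cutoff R x * B (c t x) + L * cutoff R x \<partial>lborel)
        = (\<integral>x. cutoff R x * B (c t x) \<partial>lborel) + L * (\<integral>x. cutoff R x \<partial>lborel)"
      using st icut[OF R] ic[OF ptB] by simp
    ultimately show ?thesis using 1 by (simp add: algebra_simps)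
  qed
  have stepR: "(\<integral>x. cutoff R x * \<bar>c t x\<bar> \<partial>lborel) \<le> (\<integral>x. \<bar>c s x\<bar> \<partial>lborel) + ((t - s) * err 1) / R" if R: "R \<ge> 1" for R
  proof -
    have "(\<integral>x. cutoff R x * \<bar>c t x\<bar> \<partial>lborel) \<le> (\<integral>x. \<bar>c s x\<bar> \<partial>lborel) + (t - s) * err R"
    proof (rule tendsto_lowerbound[of _ _ "at_right 0"])
      show "((\<lambda>L. (\<integral>x. \<bar>c s x\<bar> \<partial>lborel) + (t - s) * err R
        + L * ((\<integral>x. cutoff R x \<partial>lborel) + (t - s) * (\<bar>\<zeta>\<bar> * D * M))) \<longlongrightarrow> (\<integral>x. \<bar>c s x\<bar> \<partial>lborel) + (t - s) * err R) (at_right 0)"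
        by (auto intro!: tendsto_eq_intros)
      show "\<forall>\<^sub>F L in at_right 0. (\<integral>x. cutoff R x * \<bar>c t x\<bar> \<partial>lborel) \<le> (\<integral>x. \<bar>c s x\<bar> \<partial>lborel) + (t - s) * err R
        + L * ((\<integral>x. cutoff R x \<partial>lborel) + (t - s) * (\<bar>\<zeta>\<bar> * D * M))"
        using stepL[OF R] by (auto simp: eventually_at_filter)
    qed simp
    also have "(t - s) * err R = ((t - s) * err 1) / R" using R by (simp add: err_def field_simps)
    finally show ?thesis .
  qed
  show ?thesis
    by (rule cutoff_Fatou(2)[OF _ _ _ stepR]) (use ic[OF iL1] c_L1 st in auto)
qed

end

lemma cutoff_seq_integral_tendsto:
  fixes f :: "real^3 \<Rightarrow> real" and w :: "nat \<Rightarrow> real^3 \<Rightarrow> real"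
  assumes f: "integrable lborel f" and w: "\<And>n. w n \<in> borel_measurable borel" "\<And>n x. \<bar>w n x\<bar> \<le> \<bar>f x\<bar>"
    "\<And>x. (\<lambda>n. w n x) \<longlonglongrightarrow> f x" and r: "filterlim r at_top sequentially"
  shows "(\<lambda>n. \<integral>x. cutoff (r n) x * w n x \<partial>lborel) \<longlonglongrightarrow> (\<integral>x. f x \<partial>lborel)"
proof (rule integral_dominated_convergence[where w = "\<lambda>x. \<bar>f x\<bar>"])
  have [measurable]: "f \<in> borel_measurable borel" using f by auto
  have [measurable]: "w n \<in> borel_measurable borel" for n using w(1) .
  have [measurable]: "cutoff R \<in> borel_measurable borel" for R
    by (rule borel_measurable_continuous_onI[OF Ck_on_imp_continuous_on[OF Ck_on_cutoff]])
  show "f \<in> borel_measurable lborel" "(\<lambda>x. cutoff (r n) x * w n x) \<in> borel_measurable lborel" for n by measurable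
  have "(\<lambda>n. cutoff (r n) x * w n x) \<longlonglongrightarrow> 1 * f x" for x
    by (intro tendsto_intros w filterlim_compose[OF cutoff_tendsto_1 r])
  then show "AE x in lborel. (\<lambda>n. cutoff (r n) x * w n x) \<longlonglongrightarrow> f x" by simp
  show "AE x in lborel. norm (cutoff (r n) x * w n x) \<le> \<bar>f x\<bar>" for n
  proof (rule AE_I2)
    fix x
    have "\<bar>cutoff (r n) x\<bar> * \<bar>w n x\<bar> \<le> 1 * \<bar>f x\<bar>"
      using cutoff_range[of "r n" x] w(2)[of n x] by (intro mult_mono) auto
    then show "norm (cutoff (r n) x * w n x) \<le> \<bar>f x\<bar>" by (simp add: abs_mult)
  qed
qed (use f in simp)

context drift_diffusion
begin

text \<open>For B(s) = s both the dissipation and the defect s B' - B vanish, so only the flux error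
  remains.\<close>

lemma weighted_mass_Lipschitz:
  assumes st: "0 < s" "s \<le> t" "t \<le> T" and \<eta>: "Ck_on 2 UNIV \<eta>" and supp: "\<And>x. norm x > r \<Longrightarrow> \<eta> x = 0"
    and a: "\<And>x. norm (grad \<eta> x) \<le> a" and b: "\<And>x. \<bar>laplacian \<eta> x\<bar> \<le> b"
  shows "\<bar>(\<integral>x. \<eta> x * c t x \<partial>lborel) - (\<integral>x. \<eta> x * c s x \<partial>lborel)\<bar>
    \<le> (t - s) * ((D * b + \<bar>\<zeta>\<bar> * D * K * a) * M + a * Q)"
proof -
  define e where "e = (D * b + \<bar>\<zeta>\<bar> * D * K * a) * M + a * Q"
  obtain I where I: "set_integrable lborel {s..t} I"
    "(\<integral>x. \<eta> x * c t x \<partial>lborel) - (\<integral>x. \<eta> x * c s x \<partial>lborel) = (LINT \<tau>:{s..t}|lborel. I \<tau>)"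
    "\<And>\<tau>. \<tau> \<in> {s..t} \<Longrightarrow> \<bar>I \<tau>\<bar> \<le> e"
    using balance[OF st \<eta> supp DERIV_ident DERIV_const continuous_on_const order_refl a b]
    unfolding e_def by (auto simp: algebra_simps)
  have "(LINT \<tau>:{s..t}|lborel. I \<tau>) \<le> (t - s) * e"
    using I(3) by (intro set_lebesgue_integral_Icc_le st I(1)) force
  moreover have "(LINT \<tau>:{s..t}|lborel. - I \<tau>) \<le> (t - s) * e"
    using I(1,3) by (intro set_lebesgue_integral_Icc_le st) (force simp: set_integrable_def)+
  moreover have "(LINT \<tau>:{s..t}|lborel. - I \<tau>) = - (LINT \<tau>:{s..t}|lborel. I \<tau>)"
    by (simp add: set_lebesgue_integral_def)
  ultimately show ?thesis unfolding I(2) e_def by linarith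
qed

lemma mass_conservation:
  assumes st: "0 < s" "s \<le> t" "t \<le> T"
  shows "(\<integral>x. c t x \<partial>lborel) = (\<integral>x. c s x \<partial>lborel)"
proof -
  obtain C where C: "C > 0" "\<And>R x. R \<ge> 1 \<Longrightarrow> norm (grad (cutoff R) x) \<le> C / R"
    "\<And>R x. R \<ge> 1 \<Longrightarrow> \<bar>laplacian (cutoff R) x\<bar> \<le> C / R" by (rule cutoff_bounds) blast
  define d where "d R = (\<integral>x. cutoff R x * c t x \<partial>lborel) - (\<integral>x. cutoff R x * c s x \<partial>lborel)" for R
  have lim: "(d \<longlongrightarrow> (\<integral>x. c t x \<partial>lborel) - (\<integral>x. c s x \<partial>lborel)) at_top"
    unfolding d_def using st by (intro tendsto_diff cutoff_integral_tendsto c_L1) auto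
  have le: "\<bar>d R\<bar> \<le> (t - s) * ((D + \<bar>\<zeta>\<bar> * D * K) * M + Q) * C * inverse R" if R: "R \<ge> 1" for R
  proof -
    have "\<bar>d R\<bar> \<le> (t - s) * ((D * (C / R) + \<bar>\<zeta>\<bar> * D * K * (C / R)) * M + (C / R) * Q)"
      unfolding d_def using R
      by (intro weighted_mass_Lipschitz[OF st Ck_on_cutoff cutoff_support C(2)[OF R] C(3)[OF R]]) auto
    then show ?thesis by (simp add: divide_inverse algebra_simps)
  qed
  have "(d \<longlongrightarrow> 0) at_top"
  proof (rule Lim_null_comparison)
    show "\<forall>\<^sub>F R in at_top. norm (d R) \<le> (t - s) * ((D + \<bar>\<zeta>\<bar> * D * K) * M + Q) * C * inverse R"
      using eventually_ge_at_top[of 1] by eventually_elim (use le in auto)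
    show "((\<lambda>R. (t - s) * ((D + \<bar>\<zeta>\<bar> * D * K) * M + Q) * C * inverse R) \<longlongrightarrow> 0) at_top"
      by (intro tendsto_mult_right_zero tendsto_inverse_0_at_top filterlim_ident)
  qed
  from tendsto_unique[OF trivial_limit_at_top_linorder lim this] show ?thesis by simp
qed

text \<open>2 L (\<open>pabs L\<close> - L) with L = n + 1 approximates the square. The factor 2 L
  amplifies the flux error, so the radius is taken as R = L^2 and an error of order 1/L is left. The
  drift term stays as it is, since it acquires a sign only after both charge classes are added. The
  error \<open>e\<close> is constant in its second argument.\<close>

lemma truncated_energy_balance:
  assumes st: "0 < s" "s \<le> t" "t \<le> T"
    and L2: "\<And>t. 0 < t \<Longrightarrow> t \<le> T \<Longrightarrow> integrable lborel (\<lambda>x. (c t x)\<^sup>2)"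
    and H1: "\<And>t. 0 < t \<Longrightarrow> t \<le> T \<Longrightarrow> integrable lborel (\<lambda>x. (norm (grad (c t) x))\<^sup>2)"
  obtains E F e :: "nat \<Rightarrow> real \<Rightarrow> real" and I where
    "\<And>n. set_integrable lborel {s..t} (I n)"
    "\<And>n. (LINT \<tau>:{s..t}|lborel. I n \<tau>) = E n t - E n s"
    "\<And>n \<tau>. \<tau> \<in> {s..t} \<Longrightarrow> I n \<tau> \<le> - 2 * D * F n \<tau>
      - 2 * real (Suc n) * \<zeta> * D * (\<integral>x. cutoff (real (Suc n)^2) x *
          ((real (Suc n) - (real (Suc n))\<^sup>2 / pabs (real (Suc n)) (c \<tau> x)) * \<rho> \<tau> x) \<partial>lborel) + e n 0"
    "(\<lambda>n. e n 0) \<longlonglongrightarrow> 0"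
    "\<And>\<tau>. \<tau> \<in> {s..t} \<Longrightarrow> (\<lambda>n. F n \<tau>) \<longlonglongrightarrow> (\<integral>x. (norm (grad (c \<tau>) x))\<^sup>2 \<partial>lborel)"
    "\<And>\<tau>. \<tau> \<in> {s..t} \<Longrightarrow> (\<lambda>n. E n \<tau>) \<longlonglongrightarrow> (\<integral>x. (c \<tau> x)\<^sup>2 \<partial>lborel)"
    "\<And>n \<tau>. 0 \<le> F n \<tau>"
proof -
  obtain C where C: "C > 0" "\<And>R x. R \<ge> 1 \<Longrightarrow> norm (grad (cutoff R) x) \<le> C / R"
    "\<And>R x. R \<ge> 1 \<Longrightarrow> \<bar>laplacian (cutoff R) x\<bar> \<le> C / R" by (rule cutoff_bounds) blast
  define k where "k = (D * C + \<bar>\<zeta>\<bar> * D * K * C) * M + C * Q"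
  define L where "L n = real (Suc n)" for n
  have L: "L n > 0" "L n \<ge> 1" for n by (auto simp: L_def)
  have R: "(L n)\<^sup>2 \<ge> 1" "(L n)\<^sup>2 > 0" for n
    using L(2)[of n] L(1)[of n] by (auto simp: one_le_power)
  define \<eta> where "\<eta> n = cutoff ((L n)\<^sup>2)" for n
  have \<eta>s: "\<And>x. norm x > (L n)\<^sup>2 \<Longrightarrow> \<eta> n x = 0" for n using cutoff_support R(2) by (auto simp: \<eta>_def)
  have \<eta>C: "Ck_on 2 UNIV (\<eta> n)" for n unfolding \<eta>_def by (rule Ck_on_cutoff)
  \<comment> \<open>\<open>Q'\<close> collects the conclusions of \<open>balance\<close> for a given
    n, so that the time derivatives can be chosen for all n at once.\<close>
  define Q' where "Q' n I \<longleftrightarrow> (set_integrable lborel {s..t} I \<and>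
     (\<integral>x. \<eta> n x * (pabs (L n) (c t x) - L n) \<partial>lborel) - (\<integral>x. \<eta> n x * (pabs (L n) (c s x) - L n) \<partial>lborel) = (LINT \<tau>:{s..t}|lborel. I \<tau>) \<and>
     (\<forall>\<tau>\<in>{s..t}. \<bar>I \<tau> + D * (\<integral>x. \<eta> n x * ((L n)\<^sup>2 / (pabs (L n) (c \<tau> x)) ^ 3 * (norm (grad (c \<tau>) x))\<^sup>2) \<partial>lborel)
        + \<zeta> * D * (\<integral>x. \<eta> n x * ((c \<tau> x * (c \<tau> x / pabs (L n) (c \<tau> x)) - (pabs (L n) (c \<tau> x) - L n)) * \<rho> \<tau> x) \<partial>lborel)\<bar>
      \<le> (D * (C / (L n)\<^sup>2) + \<bar>\<zeta>\<bar> * D * K * (C / (L n)\<^sup>2)) * M + (C / (L n)\<^sup>2) * Q))" for n I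
  have "\<exists>I. Q' n I" for n
  proof -
    have a: "\<And>x. norm (grad (\<eta> n) x) \<le> C / (L n)\<^sup>2" "\<And>x. \<bar>laplacian (\<eta> n) x\<bar> \<le> C / (L n)\<^sup>2"
      unfolding \<eta>_def by (rule C(2)[OF R(1)], rule C(3)[OF R(1)])
    obtain I where "set_integrable lborel {s..t} I"
      "(\<integral>x. \<eta> n x * (pabs (L n) (c t x) - L n) \<partial>lborel) - (\<integral>x. \<eta> n x * (pabs (L n) (c s x) - L n) \<partial>lborel) = (LINT \<tau>:{s..t}|lborel. I \<tau>)"
      "\<And>\<tau>. \<tau> \<in> {s..t} \<Longrightarrow> \<bar>I \<tau> + D * (\<integral>x. \<eta> n x * ((L n)\<^sup>2 / (pabs (L n) (c \<tau> x)) ^ 3 * (norm (grad (c \<tau>) x))\<^sup>2) \<partial>lborel)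
        + \<zeta> * D * (\<integral>x. \<eta> n x * ((c \<tau> x * (c \<tau> x / pabs (L n) (c \<tau> x)) - (pabs (L n) (c \<tau> x) - L n)) * \<rho> \<tau> x) \<partial>lborel)\<bar>
      \<le> (D * (C / (L n)\<^sup>2) + \<bar>\<zeta>\<bar> * D * K * (C / (L n)\<^sup>2)) * M + (C / (L n)\<^sup>2) * Q"
      using balance[OF st \<eta>C[of n] \<eta>s pabs_derivatives[OF L(1)[of n]] pabs_minus_bound(2)[OF L(1)[of n]] a] by blast
    then show ?thesis unfolding Q'_def by blast
  qed
  then obtain J where J': "\<And>n. Q' n (J n)" by metis
  note J = J'[unfolded Q'_def pabs_gamma(1)[OF L(1)], THEN conjunct1]
    J'[unfolded Q'_def pabs_gamma(1)[OF L(1)], THEN conjunct2, THEN conjunct1]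
    J'[unfolded Q'_def pabs_gamma(1)[OF L(1)], THEN conjunct2, THEN conjunct2, THEN bspec]
  define E where "E n \<tau> = (\<integral>x. \<eta> n x * (2 * L n * (pabs (L n) (c \<tau> x) - L n)) \<partial>lborel)" for n \<tau>
  define F where "F n \<tau> = (\<integral>x. \<eta> n x * (L n * ((L n)\<^sup>2 / (pabs (L n) (c \<tau> x)) ^ 3) * (norm (grad (c \<tau>) x))\<^sup>2) \<partial>lborel)" for n \<tau>
  have pull: "(\<integral>x. \<eta> n x * (a * f x) \<partial>lborel) = a * (\<integral>x. \<eta> n x * f x \<partial>lborel)" for n a f
    by (subst integral_mult_right_zero[symmetric]) (simp add: mult_ac)
  have E: "E n \<tau> = 2 * L n * (\<integral>x. \<eta> n x * (pabs (L n) (c \<tau> x) - L n) \<partial>lborel)" for n \<tau>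
    unfolding E_def by (rule pull)
  have F: "F n \<tau> = L n * (\<integral>x. \<eta> n x * ((L n)\<^sup>2 / (pabs (L n) (c \<tau> x)) ^ 3 * (norm (grad (c \<tau>) x))\<^sup>2) \<partial>lborel)" for n \<tau>
    unfolding F_def mult.assoc by (rule pull)
  have flim: "filterlim (\<lambda>n. (L n)\<^sup>2) at_top sequentially"
    unfolding L_def by (intro filterlim_pow_at_top filterlim_compose[OF filterlim_real_sequentially filterlim_Suc]) simp
  have meas: "c \<tau> \<in> borel_measurable borel" "grad (c \<tau>) \<in> borel_measurable borel" if "\<tau> > 0" for \<tau>
  proof -
    show "c \<tau> \<in> borel_measurable borel"
      by (rule borel_measurable_continuous_onI[OF Ck_on_imp_continuous_on[OF c_Ck[OF that]]])
    show "grad (c \<tau>) \<in> borel_measurable borel"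
      by (rule borel_measurable_continuous_onI[OF Ck_on_imp_continuous_on[OF Ck_on_grad[OF open_UNIV c_Ck[OF that]]]])
  qed
  show ?thesis
  proof (rule that[of "\<lambda>n \<tau>. 2 * L n * J n \<tau>" E F "\<lambda>n _. 2 * k * inverse (L n)"])
    show "0 \<le> F n \<tau>" for n \<tau>
      unfolding F_def \<eta>_def
      by (intro Bochner_Integration.integral_nonneg mult_nonneg_nonneg divide_nonneg_nonneg zero_le_power
          cutoff_range less_imp_le[OF pabs_pos[OF L(1)]] less_imp_le[OF L(1)] zero_le_power2)
    show "set_integrable lborel {s..t} (\<lambda>\<tau>. 2 * L n * J n \<tau>)" for n using J(1) by simp
    show "(LINT \<tau>:{s..t}|lborel. 2 * L n * J n \<tau>) = E n t - E n s" for n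
      by (simp add: E J(2)[symmetric] right_diff_distrib)
    show "2 * L n * J n \<tau> \<le> - 2 * D * F n \<tau>
      - 2 * real (Suc n) * \<zeta> * D * (\<integral>x. cutoff (real (Suc n)^2) x *
          ((real (Suc n) - (real (Suc n))\<^sup>2 / pabs (real (Suc n)) (c \<tau> x)) * \<rho> \<tau> x) \<partial>lborel) + 2 * k * inverse (L n)"
      if "\<tau> \<in> {s..t}" for n \<tau>
    proof -
      define f where "f = (\<integral>x. \<eta> n x * ((L n)\<^sup>2 / (pabs (L n) (c \<tau> x)) ^ 3 * (norm (grad (c \<tau>) x))\<^sup>2) \<partial>lborel)"
      define g where "g = (\<integral>x. \<eta> n x * ((L n - (L n)\<^sup>2 / pabs (L n) (c \<tau> x)) * \<rho> \<tau> x) \<partial>lborel)"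
      have e: "(D * (C / (L n)\<^sup>2) + \<bar>\<zeta>\<bar> * D * K * (C / (L n)\<^sup>2)) * M + (C / (L n)\<^sup>2) * Q = k * inverse ((L n)\<^sup>2)"
        by (simp add: k_def divide_inverse algebra_simps)
      have "J n \<tau> \<le> - D * f - \<zeta> * D * g + k * inverse ((L n)\<^sup>2)"
        using J(3)[OF that, of n] unfolding e f_def[symmetric] g_def[symmetric] by (simp add: abs_le_iff)
      then have "2 * L n * J n \<tau> \<le> 2 * L n * (- D * f - \<zeta> * D * g + k * inverse ((L n)\<^sup>2))"
        using L(1)[of n] by (intro mult_left_mono) auto
      also have "\<dots> = - 2 * D * (L n * f) - 2 * L n * \<zeta> * D * g + 2 * k * inverse (L n)"
        using L(1)[of n] by (simp add: algebra_simps power2_eq_square)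
      finally show ?thesis unfolding F f_def[symmetric] using g_def by (simp add: \<eta>_def L_def)
    qed
    have "(\<lambda>n. 2 * k * inverse (L n)) \<longlonglongrightarrow> 2 * k * 0"
      unfolding L_def by (intro tendsto_intros LIMSEQ_inverse_real_of_nat)
    then show "(\<lambda>n. 2 * k * inverse (L n)) \<longlonglongrightarrow> 0" by simp
    fix \<tau> assume "\<tau> \<in> {s..t}"
    then have t: "0 < \<tau>" "\<tau> \<le> T" using st by auto
    note [measurable] = meas[OF t(1)]
    show "(\<lambda>n. E n \<tau>) \<longlonglongrightarrow> (\<integral>x. (c \<tau> x)\<^sup>2 \<partial>lborel)"
      unfolding E_def \<eta>_def
    proof (rule cutoff_seq_integral_tendsto[OF L2[OF t] _ _ _ flim])
      show "(\<lambda>x. 2 * L n * (pabs (L n) (c \<tau> x) - L n)) \<in> borel_measurable borel" for n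
        unfolding pabs_def by measurable
      show "\<bar>2 * L n * (pabs (L n) (c \<tau> x) - L n)\<bar> \<le> \<bar>(c \<tau> x)\<^sup>2\<bar>" for n x
        using pabs_scaled_le_square[OF L(1), of n "c \<tau> x"] pabs_minus_bound(1)[OF L(1), of n "c \<tau> x"] L(1)[of n]
        by (simp add: abs_mult)
      show "(\<lambda>n. 2 * L n * (pabs (L n) (c \<tau> x) - L n)) \<longlonglongrightarrow> (c \<tau> x)\<^sup>2" for x
        unfolding L_def by (rule pabs_limits(1))
    qed
    show "(\<lambda>n. F n \<tau>) \<longlonglongrightarrow> (\<integral>x. (norm (grad (c \<tau>) x))\<^sup>2 \<partial>lborel)"
      unfolding F_def \<eta>_def
    proof (rule cutoff_seq_integral_tendsto[OF H1[OF t] _ _ _ flim])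
      show "(\<lambda>x. L n * ((L n)\<^sup>2 / (pabs (L n) (c \<tau> x)) ^ 3) * (norm (grad (c \<tau>) x))\<^sup>2) \<in> borel_measurable borel" for n
        unfolding pabs_def by measurable
      show "\<bar>L n * ((L n)\<^sup>2 / (pabs (L n) (c \<tau> x)) ^ 3) * (norm (grad (c \<tau>) x))\<^sup>2\<bar> \<le> \<bar>(norm (grad (c \<tau>) x))\<^sup>2\<bar>" for n x
      proof -
        have "L n * (L n)\<^sup>2 \<le> (pabs (L n) (c \<tau> x)) ^ 3"
          using power_mono[OF pabs_ge(1)[OF L(1), of n "c \<tau> x"], of 3] L(1)[of n]
          by (simp add: power2_eq_square power3_eq_cube)
        then have "L n * ((L n)\<^sup>2 / (pabs (L n) (c \<tau> x)) ^ 3) \<le> 1"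
          using pabs_pos[OF L(1), of n "c \<tau> x"] by simp
        moreover have "0 \<le> L n * ((L n)\<^sup>2 / (pabs (L n) (c \<tau> x)) ^ 3)"
          using pabs_pos[OF L(1), of n "c \<tau> x"] L(1)[of n] by simp
        ultimately show ?thesis
          using abs_of_nonneg[OF mult_nonneg_nonneg[OF _ zero_le_power2]] mult_left_le_one_le[OF zero_le_power2]
          by (metis abs_of_nonneg zero_le_power2)
      qed
      show "(\<lambda>n. L n * ((L n)\<^sup>2 / (pabs (L n) (c \<tau> x)) ^ 3) * (norm (grad (c \<tau>) x))\<^sup>2) \<longlonglongrightarrow> (norm (grad (c \<tau>) x))\<^sup>2" for x
      proof -
        have "(\<lambda>n. 2 * L n * ((L n)\<^sup>2 / (pabs (L n) (c \<tau> x)) ^ 3) / 2 * (norm (grad (c \<tau>) x))\<^sup>2) \<longlonglongrightarrow> 2 / 2 * (norm (grad (c \<tau>) x))\<^sup>2"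
          unfolding L_def by (intro tendsto_intros pabs_limits(2)) simp
        moreover have "2 * L n * q / 2 * a = L n * q * a" for n q a by simp
        ultimately show ?thesis by simp
      qed
    qed
  qed
qed

end

text \<open>The drift terms combine to (g(cP) - g(cN)) \<rho>, where g is nondecreasing on the
  nonnegative reals and \<rho> is a nonnegative multiple of cP - cN; hence their favourable sign.
  The dissipation enters through a constant lower bound k on [s, t], so that time integrals of the
  gradient norms, and their measurability, do not come up.\<close>

lemma energy_inequality:
  assumes P: "drift_diffusion D \<zeta> T M Q K cP \<phi> \<rho> u" and N: "drift_diffusion D (- \<zeta>) T M Q K cN \<phi> \<rho> u"
    and \<zeta>: "\<zeta> \<ge> 0" and \<rho>: "\<And>t x. 0 < t \<Longrightarrow> \<rho> t x = \<zeta> * (cP t x - cN t x)"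
    and nn: "\<And>t x. 0 < t \<Longrightarrow> t \<le> T \<Longrightarrow> 0 \<le> cP t x" "\<And>t x. 0 < t \<Longrightarrow> t \<le> T \<Longrightarrow> 0 \<le> cN t x"
    and L2: "\<And>t. 0 < t \<Longrightarrow> t \<le> T \<Longrightarrow> integrable lborel (\<lambda>x. (cP t x)\<^sup>2)"
      "\<And>t. 0 < t \<Longrightarrow> t \<le> T \<Longrightarrow> integrable lborel (\<lambda>x. (cN t x)\<^sup>2)"
    and H1: "\<And>t. 0 < t \<Longrightarrow> t \<le> T \<Longrightarrow> integrable lborel (\<lambda>x. (norm (grad (cP t) x))\<^sup>2)"
      "\<And>t. 0 < t \<Longrightarrow> t \<le> T \<Longrightarrow> integrable lborel (\<lambda>x. (norm (grad (cN t) x))\<^sup>2)"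
    and st: "0 < s" "s \<le> t" "t \<le> T"
    and k: "\<And>\<tau>. \<tau> \<in> {s..t} \<Longrightarrow>
      k \<le> (\<integral>x. (norm (grad (cP \<tau>) x))\<^sup>2 \<partial>lborel) + (\<integral>x. (norm (grad (cN \<tau>) x))\<^sup>2 \<partial>lborel)"
  shows "(\<integral>x. (cP t x)\<^sup>2 \<partial>lborel) + (\<integral>x. (cN t x)\<^sup>2 \<partial>lborel) + 2 * D * k * (t - s)
    \<le> (\<integral>x. (cP s x)\<^sup>2 \<partial>lborel) + (\<integral>x. (cN s x)\<^sup>2 \<partial>lborel)"
proof -
  interpret P: drift_diffusion D \<zeta> T M Q K cP \<phi> \<rho> u by (rule P)
  interpret N: drift_diffusion D "- \<zeta>" T M Q K cN \<phi> \<rho> u by (rule N)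
  define g where "g n a = real (Suc n) - (real (Suc n))\<^sup>2 / pabs (real (Suc n)) a" for n a
  obtain EP FP eP IP where P: "\<And>n::nat. set_integrable lborel {s..t} (IP n)"
    "\<And>n. (LINT \<tau>:{s..t}|lborel. IP n \<tau>) = EP n t - EP n s"
    "\<And>n \<tau>. \<tau> \<in> {s..t} \<Longrightarrow> IP n \<tau> \<le> - 2 * D * FP n \<tau>
      - 2 * real (Suc n) * \<zeta> * D * (\<integral>x. cutoff (real (Suc n)^2) x * (g n (cP \<tau> x) * \<rho> \<tau> x) \<partial>lborel) + eP n (0::real)"
    "(\<lambda>n. eP n 0) \<longlonglongrightarrow> 0"
    "\<And>\<tau>. \<tau> \<in> {s..t} \<Longrightarrow> (\<lambda>n. FP n \<tau>) \<longlonglongrightarrow> (\<integral>x. (norm (grad (cP \<tau>) x))\<^sup>2 \<partial>lborel)"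
    "\<And>\<tau>. \<tau> \<in> {s..t} \<Longrightarrow> (\<lambda>n. EP n \<tau>) \<longlonglongrightarrow> (\<integral>x. (cP \<tau> x)\<^sup>2 \<partial>lborel)"
    "\<And>n \<tau>. 0 \<le> FP n \<tau>"
    by (rule P.truncated_energy_balance[OF st L2(1) H1(1), folded g_def]) (assumption | (rule that; assumption))+
  obtain EN FN eN IN where N: "\<And>n::nat. set_integrable lborel {s..t} (IN n)"
    "\<And>n. (LINT \<tau>:{s..t}|lborel. IN n \<tau>) = EN n t - EN n s"
    "\<And>n \<tau>. \<tau> \<in> {s..t} \<Longrightarrow> IN n \<tau> \<le> - 2 * D * FN n \<tau>
      - 2 * real (Suc n) * (- \<zeta>) * D * (\<integral>x. cutoff (real (Suc n)^2) x * (g n (cN \<tau> x) * \<rho> \<tau> x) \<partial>lborel) + eN n (0::real)"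
    "(\<lambda>n. eN n 0) \<longlonglongrightarrow> 0"
    "\<And>\<tau>. \<tau> \<in> {s..t} \<Longrightarrow> (\<lambda>n. FN n \<tau>) \<longlonglongrightarrow> (\<integral>x. (norm (grad (cN \<tau>) x))\<^sup>2 \<partial>lborel)"
    "\<And>\<tau>. \<tau> \<in> {s..t} \<Longrightarrow> (\<lambda>n. EN n \<tau>) \<longlonglongrightarrow> (\<integral>x. (cN \<tau> x)\<^sup>2 \<partial>lborel)"
    "\<And>n \<tau>. 0 \<le> FN n \<tau>"
    by (rule N.truncated_energy_balance[OF st L2(2) H1(2), folded g_def]) (assumption | (rule that; assumption))+
  define e where "e n = eP n 0 + eN n 0" for n
  have e: "e \<longlonglongrightarrow> 0" using tendsto_add[OF P(4) N(4)] by (simp add: e_def[abs_def])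
  \<comment> \<open>The rate of energy loss with the error added back; it is bounded below by the
    truncated dissipation.\<close>
  define J where "J n \<tau> = e n - IP n \<tau> - IN n \<tau>" for n \<tau>
  have J: "2 * D * (FP n \<tau> + FN n \<tau>) \<le> J n \<tau>" if \<tau>: "\<tau> \<in> {s..t}" for n \<tau>
  proof -
    have t: "0 < \<tau>" "\<tau> \<le> T" using \<tau> st by auto
    define GP where "GP = (\<integral>x. cutoff (real (Suc n)^2) x * (g n (cP \<tau> x) * \<rho> \<tau> x) \<partial>lborel)"
    define GN where "GN = (\<integral>x. cutoff (real (Suc n)^2) x * (g n (cN \<tau> x) * \<rho> \<tau> x) \<partial>lborel)"
    have mono: "0 \<le> (g n (cP \<tau> x) - g n (cN \<tau> x)) * \<rho> \<tau> x" for x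
    proof -
      have m: "g n a \<le> g n b" if "0 \<le> a" "a \<le> b" for a b
      proof -
        have "pabs (real (Suc n)) a \<le> pabs (real (Suc n)) b"
          unfolding pabs_def using that by (intro real_sqrt_le_mono add_left_mono power_mono)
        then have "(real (Suc n))\<^sup>2 / pabs (real (Suc n)) b \<le> (real (Suc n))\<^sup>2 / pabs (real (Suc n)) a"
          using pabs_pos[of "real (Suc n)"] by (intro divide_left_mono mult_pos_pos) auto
        then show ?thesis by (simp add: g_def)
      qed
      have "0 \<le> (g n (cP \<tau> x) - g n (cN \<tau> x)) * (cP \<tau> x - cN \<tau> x)"
        using m[of "cP \<tau> x" "cN \<tau> x"] m[of "cN \<tau> x" "cP \<tau> x"] nn[OF t, of x]
        by (cases "cP \<tau> x \<le> cN \<tau> x") (auto intro: mult_nonpos_nonpos mult_nonneg_nonneg)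
      then have "0 \<le> \<zeta> * ((g n (cP \<tau> x) - g n (cN \<tau> x)) * (cP \<tau> x - cN \<tau> x))"
        using \<zeta> by (rule mult_nonneg_nonneg[rotated])
      then show ?thesis by (simp add: \<rho>[OF t(1)] mult_ac)
    qed
    have gi: "integrable lborel (\<lambda>x. cutoff (real (Suc n)^2) x * (g n (c x) * \<rho> \<tau> x))" if c: "Ck_on 0 UNIV c" for c
    proof (rule Bochner_Integration.integrable_bound[OF integrable_mult_right[OF P.\<rho>_L1[OF t], of "real (Suc n)"]])
      have [measurable]: "c \<in> borel_measurable borel"
        by (rule borel_measurable_continuous_onI[OF Ck_on_imp_continuous_on[OF c]])
      have [measurable]: "\<rho> \<tau> \<in> borel_measurable borel" using P.\<rho>_L1[OF t] by auto
      have [measurable]: "cutoff R \<in> borel_measurable borel" for R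
        by (rule borel_measurable_continuous_onI[OF Ck_on_imp_continuous_on[OF Ck_on_cutoff]])
      show "(\<lambda>x. cutoff (real (Suc n)^2) x * (g n (c x) * \<rho> \<tau> x)) \<in> borel_measurable lborel"
        unfolding g_def pabs_def by measurable
      show "AE x in lborel. norm (cutoff (real (Suc n)^2) x * (g n (c x) * \<rho> \<tau> x)) \<le> norm (real (Suc n) * \<rho> \<tau> x)"
      proof (rule AE_I2)
        fix x
        have "\<bar>g n (c x)\<bar> \<le> real (Suc n)" using pabs_gamma(2,3)[of "real (Suc n)" "c x"] by (simp add: g_def)
        then have "\<bar>cutoff (real (Suc n)^2) x\<bar> * (\<bar>g n (c x)\<bar> * \<bar>\<rho> \<tau> x\<bar>) \<le> 1 * (real (Suc n) * \<bar>\<rho> \<tau> x\<bar>)"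
          using cutoff_range[of "real (Suc n)^2" x] by (intro mult_mono) auto
        then show "norm (cutoff (real (Suc n)^2) x * (g n (c x) * \<rho> \<tau> x)) \<le> norm (real (Suc n) * \<rho> \<tau> x)"
          by (simp add: abs_mult)
      qed
    qed
    have "GP - GN = (\<integral>x. cutoff (real (Suc n)^2) x * ((g n (cP \<tau> x) - g n (cN \<tau> x)) * \<rho> \<tau> x) \<partial>lborel)"
      unfolding GP_def GN_def
      by (subst Bochner_Integration.integral_diff[OF gi gi, symmetric])
        (use P.c_Ck[OF t(1), of 0] N.c_Ck[OF t(1), of 0] in \<open>auto simp: algebra_simps\<close>)
    also have "\<dots> \<ge> 0"
      by (intro Bochner_Integration.integral_nonneg) (rule mult_nonneg_nonneg[OF cutoff_range(1) mono])
    finally have G: "0 \<le> GP - GN" .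
    define A where "A = 2 * real (Suc n) * \<zeta> * D"
    have "0 \<le> A" unfolding A_def using \<zeta> P.D by simp
    then have "0 \<le> A * (GP - GN)" using G by (rule mult_nonneg_nonneg)
    then have "0 \<le> A * GP - A * GN" by (simp only: right_diff_distrib)
    moreover have "IP n \<tau> \<le> - 2 * D * FP n \<tau> - A * GP + eP n 0"
      using P(3)[OF \<tau>, of n] by (simp only: A_def GP_def)
    moreover have "IN n \<tau> \<le> - 2 * D * FN n \<tau> + A * GN + eN n 0"
    proof -
      have "- 2 * real (Suc n) * - \<zeta> * D * GN = A * GN" by (simp add: A_def algebra_simps)
      moreover have "2 * real (Suc n) * - \<zeta> * D * GN = - (A * GN)" by (simp add: A_def algebra_simps)
      ultimately show ?thesis using N(3)[OF \<tau>, of n] unfolding GN_def[symmetric] by linarith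
    qed
    moreover have "2 * D * (FP n \<tau> + FN n \<tau>) = 2 * D * FP n \<tau> + 2 * D * FN n \<tau>" by (rule distrib_left)
    ultimately show ?thesis unfolding J_def e_def by linarith
  qed
  have iconst: "set_integrable lborel {s..t} (\<lambda>\<tau>. a)" for a :: real
    unfolding set_integrable_def using st by (intro integrable_scaleR_left integrable_real_indicator) auto
  have iJ: "set_integrable lborel {s..t} (J n)" for n
    unfolding J_def by (intro set_integral_diff iconst P(1) N(1))
  have intJ: "(LINT \<tau>:{s..t}|lborel. J n \<tau>) = (t - s) * e n - (EP n t - EP n s) - (EN n t - EN n s)" for n
  proof -
    have "(LINT \<tau>:{s..t}|lborel. J n \<tau>) = (LINT \<tau>:{s..t}|lborel. e n) - (LINT \<tau>:{s..t}|lborel. IP n \<tau>) - (LINT \<tau>:{s..t}|lborel. IN n \<tau>)"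
      unfolding J_def by (simp add: set_integral_diff iconst P(1) N(1))
    also have "(LINT \<tau>:{s..t}|lborel. e n) = (t - s) * e n" using st by (simp add: set_lebesgue_integral_def)
    finally show ?thesis by (simp add: P(2) N(2))
  qed
  \<comment> \<open>The truncated dissipation converges only pointwise in time. Capping
    \<open>J\<close> at 2 D k supplies an integrable majorant, and the capped functions still
    converge to 2 D k.\<close>
  define m where "m n \<tau> = indicator {s..t} \<tau> * min (J n \<tau>) (2 * D * k)" for n and \<tau> :: real
  have Jm [measurable]: "(\<lambda>\<tau>. indicator {s..t} \<tau> * J n \<tau>) \<in> borel_measurable borel" for n
    using iJ[of n] by (auto simp: set_integrable_def)
  have meq: "m n = (\<lambda>\<tau>. indicator {s..t} \<tau> * min (indicator {s..t} \<tau> * J n \<tau>) (2 * D * k))" for n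
    by (auto simp: m_def indicator_def)
  have [measurable]: "m n \<in> borel_measurable borel" for n unfolding meq by measurable
  have "(\<lambda>n. \<integral>\<tau>. m n \<tau> \<partial>lborel) \<longlonglongrightarrow> (\<integral>\<tau>. indicator {s..t} \<tau> * (2 * D * k) \<partial>lborel)"
  proof (rule integral_dominated_convergence[where w = "\<lambda>\<tau>. indicator {s..t} \<tau> * \<bar>2 * D * k\<bar>"])
    show "integrable lborel (\<lambda>\<tau>. indicator {s..t} \<tau> * \<bar>2 * D * k\<bar>)"
      using iconst[of "\<bar>2 * D * k\<bar>"] by (simp add: set_integrable_def)
    show "AE \<tau> in lborel. norm (m n \<tau>) \<le> indicator {s..t} \<tau> * \<bar>2 * D * k\<bar>" for n
    proof (rule AE_I2)
      fix \<tau> :: real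
      have "0 \<le> J n \<tau>" if "\<tau> \<in> {s..t}"
        using J[OF that, of n] P(7)[of n \<tau>] N(7)[of n \<tau>] P.D
        by (meson add_nonneg_nonneg less_imp_le mult_nonneg_nonneg order_trans zero_le_numeral)
      then show "norm (m n \<tau>) \<le> indicator {s..t} \<tau> * \<bar>2 * D * k\<bar>"
        by (auto simp: m_def indicator_def)
    qed
    show "AE \<tau> in lborel. (\<lambda>n. m n \<tau>) \<longlonglongrightarrow> indicator {s..t} \<tau> * (2 * D * k)"
    proof (rule AE_I2)
      fix \<tau> :: real
      show "(\<lambda>n. m n \<tau>) \<longlonglongrightarrow> indicator {s..t} \<tau> * (2 * D * k)"
      proof (cases "\<tau> \<in> {s..t}")
        case True
        define a where "a = (\<integral>x. (norm (grad (cP \<tau>) x))\<^sup>2 \<partial>lborel) + (\<integral>x. (norm (grad (cN \<tau>) x))\<^sup>2 \<partial>lborel)"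
        have ka: "2 * D * k \<le> 2 * D * a" using k[OF True] P.D by (simp add: a_def)
        have "(\<lambda>n. min (2 * D * (FP n \<tau> + FN n \<tau>)) (2 * D * k)) \<longlonglongrightarrow> min (2 * D * a) (2 * D * k)"
          unfolding a_def by (intro tendsto_intros P(5) N(5) True)
        then have "(\<lambda>n. min (2 * D * (FP n \<tau> + FN n \<tau>)) (2 * D * k)) \<longlonglongrightarrow> 2 * D * k" using ka by (simp add: min_absorb2)
        then have "(\<lambda>n. min (J n \<tau>) (2 * D * k)) \<longlonglongrightarrow> 2 * D * k"
        proof (rule tendsto_sandwich[rotated 2])
          show "(\<lambda>n. 2 * D * k) \<longlonglongrightarrow> 2 * D * k" by simp
          show "\<forall>\<^sub>F n in sequentially. min (2 * D * (FP n \<tau> + FN n \<tau>)) (2 * D * k) \<le> min (J n \<tau>) (2 * D * k)"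
            by (intro always_eventually allI min.mono J True order_refl)
        qed auto
        then show ?thesis using True by (simp add: m_def)
      qed (simp add: m_def)
    qed
  qed auto
  also have "(\<integral>\<tau>. indicator {s..t} \<tau> * (2 * D * k) \<partial>lborel) = 2 * D * k * (t - s)" using st by simp
  finally have lim1: "(\<lambda>n. \<integral>\<tau>. m n \<tau> \<partial>lborel) \<longlonglongrightarrow> 2 * D * k * (t - s)" .
  have le: "(\<integral>\<tau>. m n \<tau> \<partial>lborel) \<le> (t - s) * e n - (EP n t - EP n s) - (EN n t - EN n s)" for n
  proof -
    have "integrable lborel (m n)"
    proof (rule Bochner_Integration.integrable_bound)
      show "integrable lborel (\<lambda>\<tau>. indicator {s..t} \<tau> * J n \<tau> + indicator {s..t} \<tau> * \<bar>2 * D * k\<bar>)"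
        using iconst[of "\<bar>2 * D * k\<bar>"] iJ[of n] by (simp add: set_integrable_def)
      show "AE \<tau> in lborel. norm (m n \<tau>) \<le> norm (indicator {s..t} \<tau> * J n \<tau> + indicator {s..t} \<tau> * \<bar>2 * D * k\<bar>)"
      proof (rule AE_I2)
        fix \<tau> :: real
        have "0 \<le> J n \<tau>" if "\<tau> \<in> {s..t}"
          using J[OF that, of n] P(7)[of n \<tau>] N(7)[of n \<tau>] P.D
          by (meson add_nonneg_nonneg less_imp_le mult_nonneg_nonneg order_trans zero_le_numeral)
        then show "norm (m n \<tau>) \<le> norm (indicator {s..t} \<tau> * J n \<tau> + indicator {s..t} \<tau> * \<bar>2 * D * k\<bar>)"
          by (auto simp: m_def indicator_def)
      qed
    qed simp
    moreover have "m n \<tau> \<le> indicator {s..t} \<tau> * J n \<tau>" for \<tau> by (auto simp: m_def indicator_def)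
    ultimately have "(\<integral>\<tau>. m n \<tau> \<partial>lborel) \<le> (\<integral>\<tau>. indicator {s..t} \<tau> * J n \<tau> \<partial>lborel)"
      using iJ[of n] by (intro integral_mono) (auto simp: set_integrable_def)
    then show ?thesis using intJ[of n] by (simp add: set_lebesgue_integral_def)
  qed
  have tt: "t \<in> {s..t}" "s \<in> {s..t}" using st by auto
  have "(\<lambda>n. (t - s) * e n - (EP n t - EP n s) - (EN n t - EN n s)) \<longlonglongrightarrow>
      (t - s) * 0 - ((\<integral>x. (cP t x)\<^sup>2 \<partial>lborel) - (\<integral>x. (cP s x)\<^sup>2 \<partial>lborel)) - ((\<integral>x. (cN t x)\<^sup>2 \<partial>lborel) - (\<integral>x. (cN s x)\<^sup>2 \<partial>lborel))"
    by (intro tendsto_intros e P(6) N(6) tt)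
  from LIMSEQ_le[OF lim1 this] le show ?thesis by auto
qed

section \<open>Algebraic decay from Nash's inequality\<close>

definition nash_const :: "real \<Rightarrow> real" where
  "nash_const m = (8 * m\<^sup>2 / unit_ball_vol 3) powr (- (2 / 3)) / 2"

lemma nash_const_pos: "m > 0 \<Longrightarrow> nash_const m > 0"
  using unit_ball_vol_pos[of 3, THEN less_imp_neq] by (simp add: nash_const_def)

text \<open>\<open>E\<close> may be any lower bound of the total: it is applied with the energy at
  the end of a time interval, which lies below the energy at all earlier times.\<close>

lemma Nash_lower_bound:
  fixes f g :: "real^3 \<Rightarrow> real"
  assumes f: "Ck_on 1 UNIV f" "\<And>x. 0 \<le> f x" "integrable lborel f" "integrable lborel (\<lambda>x. (f x)\<^sup>2)"
      "integrable lborel (\<lambda>x. (norm (grad f x))\<^sup>2)" "(\<integral>x. f x \<partial>lborel) \<le> m"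
    and g: "Ck_on 1 UNIV g" "\<And>x. 0 \<le> g x" "integrable lborel g" "integrable lborel (\<lambda>x. (g x)\<^sup>2)"
      "integrable lborel (\<lambda>x. (norm (grad g x))\<^sup>2)" "(\<integral>x. g x \<partial>lborel) \<le> m"
    and m: "m > 0" and E: "0 \<le> E" "E \<le> (\<integral>x. (f x)\<^sup>2 \<partial>lborel) + (\<integral>x. (g x)\<^sup>2 \<partial>lborel)"
  shows "nash_const m * E powr (5 / 3)
    \<le> (\<integral>x. (norm (grad f x))\<^sup>2 \<partial>lborel) + (\<integral>x. (norm (grad g x))\<^sup>2 \<partial>lborel)"
proof (cases "E = 0")
  case False
  then have E0: "E > 0" using E by simp
  define \<omega> where "\<omega> = unit_ball_vol (3::real)"
  have \<omega>: "\<omega> > 0" by (simp add: \<omega>_def)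
  define F where "F = (\<integral>x. (norm (grad f x))\<^sup>2 \<partial>lborel) + (\<integral>x. (norm (grad g x))\<^sup>2 \<partial>lborel)"
  define A where "A = 8 * m\<^sup>2 / \<omega>"
  have A: "A > 0" using m \<omega> by (simp add: A_def)
  \<comment> \<open>This radius makes each of the two mass terms at most E/4. The remaining E <= r^2
    F + E/2 gives F >= E / (2 r^2), and r^3 = A/E produces both the exponent 5/3 and
    \<open>nash_const\<close>.\<close>
  define r where "r = (A / E) powr (1 / 3)"
  have r: "r > 0" using A E0 by (simp add: r_def)
  have r3: "r ^ 3 = A / E"
  proof -
    have "r ^ 3 = r powr 3" using r by simp
    also have "\<dots> = (A / E) powr 1" unfolding r_def powr_powr by simp
    finally show ?thesis using A E0 by simp
  qed
  have sq: "(\<integral>x. f x \<partial>lborel)\<^sup>2 \<le> m\<^sup>2" "(\<integral>x. g x \<partial>lborel)\<^sup>2 \<le> m\<^sup>2"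
    using f(2,6) g(2,6) by (auto intro!: power_mono Bochner_Integration.integral_nonneg)
  have half: "2 * m\<^sup>2 / (\<omega> * r ^ 3) = E / 4"
    using m \<omega> E0 by (simp add: r3 A_def field_simps)
  have b: "2 * a / (\<omega> * r ^ 3) \<le> E / 4" if "a \<le> m\<^sup>2" for a
    unfolding half[symmetric] using that \<omega> r by (intro divide_right_mono mult_left_mono) auto
  have "E \<le> r\<^sup>2 * F + E / 2"
    using Nash_inequality[OF f(1-5) r, folded \<omega>_def] Nash_inequality[OF g(1-5) r, folded \<omega>_def]
      b[OF sq(1)] b[OF sq(2)] E(2) unfolding F_def distrib_left by linarith
  then have "E / (2 * r\<^sup>2) \<le> F" using r by (simp add: field_simps)
  moreover have "E / (2 * r\<^sup>2) = nash_const m * E powr (5 / 3)"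
  proof -
    have "r\<^sup>2 = r powr 2" using r by simp
    also have "\<dots> = (A / E) powr (2 / 3)" unfolding r_def powr_powr by simp
    also have "\<dots> = A powr (2 / 3) / E powr (2 / 3)" using A E0 by (simp add: powr_divide)
    finally have "E / (2 * r\<^sup>2) = (E powr 1 * E powr (2 / 3)) / A powr (2 / 3) / 2" using A E0 by simp
    also have "E powr 1 * E powr (2 / 3) = E powr (5 / 3)" by (subst powr_add[symmetric]) simp
    also have "E powr (5 / 3) / A powr (2 / 3) / 2 = nash_const m * E powr (5 / 3)"
    proof -
      have "nash_const m = A powr (- (2 / 3)) / 2" by (simp add: nash_const_def A_def \<omega>_def)
      also have "\<dots> = inverse (A powr (2 / 3)) / 2" by (simp only: powr_minus)
      finally show ?thesis by (simp add: field_simps)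
    qed
    finally show ?thesis .
  qed
  ultimately show ?thesis by (simp add: F_def)
qed (auto intro!: add_nonneg_nonneg Bochner_Integration.integral_nonneg)

text \<open>The loss term carries E at the later time, so E need not be continuous. Let Y(t) = t
  E(t)^(2/3). If a Y(t) > 8, the step from t/2 to t gives E(t/2) >= 4 E(t) and thus Y(t/2) >= Y(t).
  Iteration yields Y(t) <= Y(t / 2^n), which tends to 0 because E <= A; a contradiction. So Y <=
  8/a.\<close>

lemma decay_of_differential_inequality:
  fixes E :: "real \<Rightarrow> real"
  assumes a: "a > 0" and nn: "\<And>t. t \<ge> 0 \<Longrightarrow> 0 \<le> E t"
    and ineq: "\<And>s t. 0 \<le> s \<Longrightarrow> s \<le> t \<Longrightarrow> E t + a * E t powr (5 / 3) * (t - s) \<le> E s"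
    and A: "A > 0" "E 0 \<le> A" and t: "t \<ge> 0"
  shows "E t \<le> (A powr (- (2 / 3)) / 2 + a / 16 * t) powr (- (3 / 2))"
proof -
  define Y where "Y t = t * E t powr (2 / 3)" for t
  have EA: "E t \<le> A" if "t \<ge> 0" for t
  proof -
    have "0 \<le> a * E t powr (5 / 3) * (t - 0)" using a that by simp
    then show ?thesis using ineq[of 0 t] that A by linarith
  qed
  have double: "Y t \<le> Y (t / 2)" if t: "t > 0" and Y: "8 / a < Y t" for t
  proof -
    have Et: "E t > 0" using Y a nn[of t] t by (cases "E t = 0") (auto simp: Y_def)
    have "E t powr (5 / 3) = E t powr 1 * E t powr (2 / 3)" by (subst powr_add[symmetric]) simp
    then have e: "a * E t powr (5 / 3) * (t / 2) = (a * Y t) * E t / 2"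
      using Et by (simp add: Y_def)
    have "8 \<le> a * Y t" using Y a by (simp add: field_simps)
    then have "8 * E t \<le> (a * Y t) * E t" using Et by (intro mult_right_mono) auto
    moreover have "E t + a * E t powr (5 / 3) * (t / 2) \<le> E (t / 2)"
      using ineq[of "t / 2" t] t by (simp add: field_simps)
    ultimately have 4: "4 * E t \<le> E (t / 2)" using Et unfolding e by linarith
    have "2 * E t powr (2 / 3) \<le> 4 powr (2 / 3) * E t powr (2 / 3)"
    proof (rule mult_right_mono)
      have "(2::real) = 4 powr (1 / 2)" by (simp add: powr_half_sqrt)
      also have "\<dots> \<le> 4 powr (2 / 3)" by (rule powr_mono) auto
      finally show "(2::real) \<le> 4 powr (2 / 3)" .
    qed simp
    also have "\<dots> = (4 * E t) powr (2 / 3)" using Et by (simp add: powr_mult)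
    also have "\<dots> \<le> E (t / 2) powr (2 / 3)" using 4 Et by (intro powr_mono2) auto
    finally show ?thesis using t by (simp add: Y_def)
  qed
  have Yle: "Y t \<le> 8 / a" if t: "t > 0" for t
  proof (rule ccontr)
    assume "\<not> Y t \<le> 8 / a"
    then have Y: "8 / a < Y t" by simp
    have iter: "Y t \<le> Y (t / 2 ^ n)" for n
    proof (induction n)
      case (Suc n)
      then have "Y (t / 2 ^ n) \<le> Y (t / 2 ^ n / 2)" using t Y by (intro double) auto
      with Suc show ?case by (simp add: mult.commute)
    qed simp
    have "Y (t / 2 ^ n) \<le> t * A powr (2 / 3) * (1 / 2) ^ n" for n
    proof -
      have "Y (t / 2 ^ n) \<le> t / 2 ^ n * A powr (2 / 3)"
        unfolding Y_def using t nn[of "t / 2 ^ n"] EA[of "t / 2 ^ n"] by (intro mult_left_mono powr_mono2) auto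
      then show ?thesis by (simp add: power_divide)
    qed
    then have le: "Y t \<le> t * A powr (2 / 3) * (1 / 2) ^ n" for n using iter order_trans by blast
    have "(\<lambda>n. t * A powr (2 / 3) * (1 / 2) ^ n) \<longlonglongrightarrow> t * A powr (2 / 3) * 0"
      by (intro tendsto_intros LIMSEQ_power_zero) simp
    then have "Y t \<le> 0" using le by (simp add: LIMSEQ_le_const)
    moreover have "8 / a > 0" using a by simp
    ultimately show False using Y by linarith
  qed
  show ?thesis
  proof (cases "E t = 0")
    case False
    then have Et: "E t > 0" using nn[OF t] by simp
    define y where "y = E t powr (- (2 / 3))"
    have y: "y > 0" using Et by (simp add: y_def)
    have "A powr (- (2 / 3)) \<le> y" unfolding y_def using Et EA[OF t] by (intro powr_mono2') auto
    moreover have "a / 8 * t \<le> y"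
    proof (cases "t = 0")
      case False
      then have "t * E t powr (2 / 3) \<le> 8 / a" using Yle[of t] t by (simp add: Y_def)
      then show ?thesis using a Et by (simp add: y_def powr_minus field_simps)
    qed (use y in simp)
    \<comment> \<open>The two lower bounds for E^(-2/3), from E <= A and from Y <= 8/a, are replaced
      by their average; hence the factors 1/2 and a/16.\<close>
    ultimately have le: "A powr (- (2 / 3)) / 2 + a / 16 * t \<le> y" by simp
    have pos: "A powr (- (2 / 3)) / 2 + a / 16 * t > 0" using A a t by (intro add_pos_nonneg) auto
    have "E t = y powr (- (3 / 2))" using Et by (simp add: y_def powr_powr)
    also have "\<dots> \<le> (A powr (- (2 / 3)) / 2 + a / 16 * t) powr (- (3 / 2))"
      using le pos by (intro powr_mono2') auto
    finally show ?thesis .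
  qed simp
qed

section \<open>Convolution weights\<close>

definition conv :: "(real^3 \<Rightarrow> real) \<Rightarrow> (real^3 \<Rightarrow> real) \<Rightarrow> real^3 \<Rightarrow> real" where
  "conv K f x = (\<integral>y. K (x - y) * f y \<partial>lborel)"

lemma conv_integrable:
  fixes K f :: "real^3 \<Rightarrow> real"
  assumes f: "integrable lborel f" and K: "K \<in> borel_measurable borel" "\<And>z. \<bar>K z\<bar> \<le> C"
  shows "integrable lborel (\<lambda>y. K (x - y) * f y)"
proof (rule Bochner_Integration.integrable_bound)
  have [measurable]: "f \<in> borel_measurable borel" "K \<in> borel_measurable borel" using f K by auto
  show "integrable lborel (\<lambda>y. C * f y)" using f by simp
  show "(\<lambda>y. K (x - y) * f y) \<in> borel_measurable lborel" by measurable
  have "0 \<le> C" using K(2)[of 0] by (rule order_trans[rotated]) simp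
  then show "AE y in lborel. norm (K (x - y) * f y) \<le> norm (C * f y)"
    using K(2) by (auto simp: abs_mult intro!: mult_right_mono)
qed

text \<open>Pointwise domination of kernels passes to convolutions with a nonnegative function; this
  transfers the derivative bounds of the kernel to \<open>g\<close>.\<close>

lemma conv_bound:
  assumes f: "integrable lborel f" "\<And>x. 0 \<le> f x" and K: "K \<in> borel_measurable borel" "\<And>z. \<bar>K z\<bar> \<le> C * G z"
    and G: "G \<in> borel_measurable borel" "\<And>z. \<bar>G z\<bar> \<le> 1" and C: "C \<ge> 0"
  shows "\<bar>conv K f x\<bar> \<le> C * conv G f x"
proof -
  have KC: "\<bar>K z\<bar> \<le> C" for z using order_trans[OF K(2) mult_left_mono[of "G z" 1 C]] G(2)[of z] C by auto
  have "\<bar>conv K f x\<bar> \<le> (\<integral>y. \<bar>K (x - y) * f y\<bar> \<partial>lborel)" unfolding conv_def by (rule integral_abs_bound)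
  also have "\<dots> \<le> (\<integral>y. C * (G (x - y) * f y) \<partial>lborel)"
  proof (rule integral_mono)
    show "integrable lborel (\<lambda>y. \<bar>K (x - y) * f y\<bar>)" using conv_integrable[OF f(1) K(1) KC] by simp
    show "integrable lborel (\<lambda>y. C * (G (x - y) * f y))" using conv_integrable[OF f(1) G] by simp
    show "\<bar>K (x - y) * f y\<bar> \<le> C * (G (x - y) * f y)" for y
      using mult_right_mono[OF K(2)[of "x - y"] f(2)[of y]] f(2)[of y] by (simp add: abs_mult mult.assoc)
  qed
  finally show ?thesis by (simp add: conv_def)
qed

lemma conv_continuous:
  assumes f: "integrable lborel f" and K: "continuous_on UNIV K" "\<And>z. \<bar>K z\<bar> \<le> C"
  shows "continuous_on UNIV (conv K f)"
proof -
  have [measurable]: "f \<in> borel_measurable borel" using f by auto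
  have Km [measurable]: "K \<in> borel_measurable borel" using K(1) by (rule borel_measurable_continuous_onI)
  have "(conv K f \<longlongrightarrow> conv K f x) (at x)" for x
    unfolding tendsto_at_iff_sequentially comp_def conv_def
  proof (intro allI impI)
    fix X assume X: "X \<longlonglongrightarrow> x"
    show "(\<lambda>n. \<integral>y. K (X n - y) * f y \<partial>lborel) \<longlonglongrightarrow> (\<integral>y. K (x - y) * f y \<partial>lborel)"
    proof (rule integral_dominated_convergence[where w = "\<lambda>y. C * \<bar>f y\<bar>"])
      have "(\<lambda>n. K (X n - y)) \<longlonglongrightarrow> K (x - y)" for y
        by (rule continuous_on_tendsto_compose[OF K(1)]) (auto intro!: tendsto_intros X)
      then show "AE y in lborel. (\<lambda>n. K (X n - y) * f y) \<longlonglongrightarrow> K (x - y) * f y" by (auto intro!: tendsto_intros)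
      show "AE y in lborel. norm (K (X n - y) * f y) \<le> C * \<bar>f y\<bar>" for n
        using K(2) by (auto simp: abs_mult intro!: mult_right_mono)
    qed (use f in auto)
  qed
  then show ?thesis by (simp add: continuous_on)
qed

text \<open>Dominated convergence for the remainder quotients: K is Lipschitz with constant C, so
  they are bounded by 2 C |f|. The derivative in a fixed direction is again a convolution, so the
  lemma applies a second time for the Hessian.\<close>

lemma conv_has_derivative:
  assumes f: "integrable lborel f" and K: "\<And>z. (K has_derivative (\<lambda>h. k z \<bullet> h)) (at z)"
    and C: "\<And>z. \<bar>K z\<bar> \<le> C" "\<And>z. norm (k z) \<le> C" and k: "k \<in> borel_measurable borel"
  shows "(conv K f has_derivative (\<lambda>h. conv (\<lambda>z. k z \<bullet> h) f x)) (at x)"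
proof -
  have [measurable]: "f \<in> borel_measurable borel" "k \<in> borel_measurable borel" using f k by auto
  have "continuous_on UNIV K" using has_derivative_continuous[OF K] by (simp add: continuous_at_imp_continuous_on)
  then have Km [measurable]: "K \<in> borel_measurable borel" by (rule borel_measurable_continuous_onI)
  have kh: "\<bar>k z \<bullet> h\<bar> \<le> C * norm h" for z h
    by (rule order_trans[OF Cauchy_Schwarz_ineq2]) (simp add: C mult_right_mono)
  have Lip: "\<bar>K z - K z'\<bar> \<le> C * norm (z - z')" for z z'
  proof -
    have "norm (K z - K z') \<le> C * norm (z - z')"
    proof (rule differentiable_bound[of UNIV K "\<lambda>z h. k z \<bullet> h"])
      show "onorm (\<lambda>h. k z \<bullet> h) \<le> C" for z
        using kh by (intro onorm_bound) (auto intro: order_trans[OF norm_ge_zero C(2)])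
    qed (use K in auto)
    then show ?thesis by simp
  qed
  have iK: "integrable lborel (\<lambda>y. K (x - y) * f y)" for x
    by (rule conv_integrable[OF f Km C(1)])
  have ik: "integrable lborel (\<lambda>y. (k (x - y) \<bullet> h) * f y)" for x h
    by (rule conv_integrable[OF f _ kh, of "\<lambda>z. z" h, unfolded]) simp
  show ?thesis
    unfolding has_derivative_at
  proof
    have "linear (\<lambda>h. conv (\<lambda>z. k z \<bullet> h) f x)"
    proof (rule linearI)
      show "conv (\<lambda>z. k z \<bullet> (a + b)) f x = conv (\<lambda>z. k z \<bullet> a) f x + conv (\<lambda>z. k z \<bullet> b) f x" for a b
        unfolding conv_def inner_add_right distrib_right by (rule Bochner_Integration.integral_add) (rule ik)+
      show "conv (\<lambda>z. k z \<bullet> (r *\<^sub>R a)) f x = r *\<^sub>R conv (\<lambda>z. k z \<bullet> a) f x" for r a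
        unfolding conv_def by (simp add: mult.assoc)
    qed
    then show "bounded_linear (\<lambda>h. conv (\<lambda>z. k z \<bullet> h) f x)" by (simp add: linear_conv_bounded_linear)
    have e: "conv K f (x + h) - conv K f x - conv (\<lambda>z. k z \<bullet> h) f x
        = (\<integral>y. (K (x + h - y) - K (x - y) - k (x - y) \<bullet> h) * f y \<partial>lborel)" for h
      unfolding conv_def
      by (subst Bochner_Integration.integral_diff[symmetric], (intro iK ik Bochner_Integration.integrable_diff)+,
          subst Bochner_Integration.integral_diff[symmetric], (intro iK ik Bochner_Integration.integrable_diff)+)
        (simp add: algebra_simps)
    show "(\<lambda>h. norm (conv K f (x + h) - conv K f x - conv (\<lambda>z. k z \<bullet> h) f x) / norm h) \<midarrow>0\<rightarrow> 0"
      unfolding tendsto_at_iff_sequentially comp_def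
    proof (intro allI impI)
      fix X :: "nat \<Rightarrow> real^3" assume "\<forall>n. X n \<in> UNIV - {0}" and X: "X \<longlonglongrightarrow> 0"
      then have X0: "X n \<noteq> 0" for n by simp
      define q where "q n y = (K (x + X n - y) - K (x - y) - k (x - y) \<bullet> X n) / norm (X n)" for n y
      have "(\<lambda>n. \<integral>y. q n y * f y \<partial>lborel) \<longlonglongrightarrow> (\<integral>y. 0 \<partial>(lborel :: (real^3) measure))"
      proof (rule integral_dominated_convergence[where w = "\<lambda>y. 2 * C * \<bar>f y\<bar>"])
        show "AE y in lborel. (\<lambda>n. q n y * f y) \<longlonglongrightarrow> 0"
        proof (rule AE_I2)
          fix y
          have "(\<lambda>h. norm (K (x - y + h) - K (x - y) - k (x - y) \<bullet> h) / norm h) \<midarrow>0\<rightarrow> 0"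
            using K[of "x - y"] by (simp add: has_derivative_at)
          then have "(\<lambda>n. norm (K (x - y + X n) - K (x - y) - k (x - y) \<bullet> X n) / norm (X n)) \<longlonglongrightarrow> 0"
            using X X0 unfolding tendsto_at_iff_sequentially comp_def by blast
          then have "(\<lambda>n. norm (q n y)) \<longlonglongrightarrow> 0" by (simp add: q_def algebra_simps)
          then have "(\<lambda>n. q n y) \<longlonglongrightarrow> 0" by (rule tendsto_norm_zero_cancel)
          then show "(\<lambda>n. q n y * f y) \<longlonglongrightarrow> 0" by (rule tendsto_mult_left_zero)
        qed
        show "AE y in lborel. norm (q n y * f y) \<le> 2 * C * \<bar>f y\<bar>" for n
        proof (rule AE_I2)
          fix y
          have "\<bar>K (x + X n - y) - K (x - y) - k (x - y) \<bullet> X n\<bar> \<le> 2 * C * norm (X n)"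
            using Lip[of "x + X n - y" "x - y"] kh[of "x - y" "X n"] by (simp add: algebra_simps)
          then have "\<bar>q n y\<bar> \<le> 2 * C" using X0[of n] by (simp add: q_def pos_divide_le_eq)
          then show "norm (q n y * f y) \<le> 2 * C * \<bar>f y\<bar>" by (simp add: abs_mult mult_right_mono)
        qed
        show "(\<lambda>y. q n y * f y) \<in> borel_measurable lborel" for n unfolding q_def by measurable
      qed (use f in auto)
      then have "(\<lambda>n. \<integral>y. q n y * f y \<partial>lborel) \<longlonglongrightarrow> 0" by simp
      from tendsto_norm_zero[OF this] have "(\<lambda>n. norm (\<integral>y. q n y * f y \<partial>lborel)) \<longlonglongrightarrow> 0" .
      moreover have "norm (\<integral>y. q n y * f y \<partial>lborel)
          = norm (conv K f (x + X n) - conv K f x - conv (\<lambda>z. k z \<bullet> X n) f x) / norm (X n)" for n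
      proof -
        have "(\<integral>y. q n y * f y \<partial>lborel) = (\<integral>y. (K (x + X n - y) - K (x - y) - k (x - y) \<bullet> X n) * f y / norm (X n) \<partial>lborel)"
          by (simp add: q_def)
        then show ?thesis unfolding e by simp
      qed
      ultimately show "(\<lambda>n. norm (conv K f (x + X n) - conv K f x - conv (\<lambda>z. k z \<bullet> X n) f x) / norm (X n)) \<longlonglongrightarrow> 0"
        by simp
    qed
  qed
qed

lemma ker_norm_bounds:
  "ker 4 z * norm z \<le> ker 3 z" "ker 5 z * norm z * norm z \<le> ker 3 z" "ker 4 z \<le> ker 3 z"
  "ker 4 z * norm z \<le> 1" "ker 5 z * norm z * norm z \<le> 1"
proof -
  have n: "norm z \<le> 1 + z \<bullet> z"
  proof -
    have "2 * norm z \<le> 1 + (norm z)\<^sup>2" using sum_squares_bound[of 1 "norm z"] by simp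
    then show ?thesis using norm_ge_zero[of z] unfolding power2_norm_eq_inner by linarith
  qed
  have "ker 4 z * norm z \<le> ker 4 z * (1 + z \<bullet> z)"
    using n ker_pos[of 4 z] by (intro mult_left_mono) auto
  also have "\<dots> = ker 3 z" using ker_base(2)[of z] by (simp add: ker_def eval_nat_numeral)
  finally show 1: "ker 4 z * norm z \<le> ker 3 z" .
  have "ker 5 z * norm z * norm z = ker (Suc 4) z * (z \<bullet> z)"
    by (simp add: power2_norm_eq_inner[symmetric] power2_eq_square)
  also have "\<dots> \<le> ker 4 z" by (rule ker_Suc)
  also show 3: "ker 4 z \<le> ker 3 z" by (rule ker_mono) simp
  finally show 2: "ker 5 z * norm z * norm z \<le> ker 3 z" .
  show "ker 4 z * norm z \<le> 1" "ker 5 z * norm z * norm z \<le> 1" using 1 2 ker_le_1[of 3 z] by linarith+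
qed

lemma ker_grad_bound: "\<bar>(- 6 * ker 4 z) *\<^sub>R z \<bullet> v\<bar> \<le> 6 * norm v * ker 3 z"
proof -
  have "\<bar>(- 6 * ker 4 z) *\<^sub>R z \<bullet> v\<bar> \<le> norm ((- 6 * ker 4 z) *\<^sub>R z) * norm v" by (rule Cauchy_Schwarz_ineq2)
  also have "norm ((- 6 * ker 4 z) *\<^sub>R z) = 6 * (ker 4 z * norm z)" using ker_pos[of 4 z] by (simp add: abs_mult)
  also have "\<dots> * norm v \<le> 6 * ker 3 z * norm v" using ker_norm_bounds(1)[of z] by (intro mult_right_mono) auto
  finally show ?thesis by (simp add: mult_ac)
qed

text \<open>The vector is the gradient of the directional derivative of \<open>ker 3\<close> along
  v. Both parts are dominated by \<open>ker 3\<close>, and 54 = 48 + 6.\<close>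

lemma ker_hessian_bound: "norm ((48 * ker 5 z * (z \<bullet> v)) *\<^sub>R z - (6 * ker 4 z) *\<^sub>R v) \<le> 54 * norm v * ker 3 z"
proof -
  have "norm ((48 * ker 5 z * (z \<bullet> v)) *\<^sub>R z) = (48 * ker 5 z * norm z) * \<bar>z \<bullet> v\<bar>"
    using ker_pos[of 5 z] by (simp add: abs_mult)
  also have "\<dots> \<le> (48 * ker 5 z * norm z) * (norm z * norm v)"
    using ker_pos[of 5 z] by (intro mult_left_mono Cauchy_Schwarz_ineq2) auto
  also have "\<dots> = 48 * (ker 5 z * norm z * norm z) * norm v" by simp
  also have "\<dots> \<le> 48 * ker 3 z * norm v" by (intro mult_right_mono mult_left_mono ker_norm_bounds) auto
  finally have 1: "norm ((48 * ker 5 z * (z \<bullet> v)) *\<^sub>R z) \<le> 48 * ker 3 z * norm v" .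
  have "norm ((6 * ker 4 z) *\<^sub>R v) = 6 * ker 4 z * norm v" using ker_pos[of 4 z] by (simp add: abs_mult)
  also have "\<dots> \<le> 6 * ker 3 z * norm v" by (intro mult_right_mono mult_left_mono ker_norm_bounds) auto
  finally have 2: "norm ((6 * ker 4 z) *\<^sub>R v) \<le> 6 * ker 3 z * norm v" .
  have "54 * norm v * ker 3 z = 48 * ker 3 z * norm v + 6 * ker 3 z * norm v" by simp
  then show ?thesis
    using norm_triangle_ineq4[of "(48 * ker 5 z * (z \<bullet> v)) *\<^sub>R z" "(6 * ker 4 z) *\<^sub>R v"] 1 2 by linarith
qed

lemma ker_hessian_bounded: "norm ((48 * ker 5 z * (z \<bullet> v)) *\<^sub>R z - (6 * ker 4 z) *\<^sub>R v) \<le> 54 * norm v"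
  using ker_hessian_bound[of z v] mult_left_mono[OF ker_le_1[of 3 z], of "54 * norm v"] by simp

locale conv_weight =
  fixes f :: "real^3 \<Rightarrow> real"
  assumes f: "integrable lborel f" and f0: "\<And>x. 0 \<le> f x"
begin

definition g :: "real^3 \<Rightarrow> real" where "g = conv (ker 3) f"

lemma g_has_derivative: "(g has_derivative (\<lambda>h. conv (\<lambda>z. (- 6 * ker 4 z) *\<^sub>R z \<bullet> h) f x)) (at x)"
  unfolding g_def
proof (rule conv_has_derivative[OF f])
  show "(ker 3 has_derivative (\<lambda>h. (- 6 * ker 4 z) *\<^sub>R z \<bullet> h)) (at z)" for z
    using grad_ker[of 3 z] by simp
  show "\<bar>ker 3 z\<bar> \<le> 6" for z using ker_pos[of 3 z] ker_le_1[of 3 z] by simp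
  show "norm ((- 6 * ker 4 z) *\<^sub>R z) \<le> 6" for z
    using ker_norm_bounds(4)[of z] ker_pos[of 4 z] by (simp add: abs_mult)
qed measurable

lemma g2_has_derivative:
  "(conv (\<lambda>z. (- 6 * ker 4 z) *\<^sub>R z \<bullet> v) f has_derivative
    (\<lambda>h. conv (\<lambda>z. ((48 * ker 5 z * (z \<bullet> v)) *\<^sub>R z - (6 * ker 4 z) *\<^sub>R v) \<bullet> h) f x)) (at x)"
proof (rule conv_has_derivative[OF f])
  show "((\<lambda>z. (- 6 * ker 4 z) *\<^sub>R z \<bullet> v) has_derivative
      (\<lambda>h. ((48 * ker 5 z * (z \<bullet> v)) *\<^sub>R z - (6 * ker 4 z) *\<^sub>R v) \<bullet> h)) (at z)" for z
  proof -
    have k: "(ker 4 has_derivative (\<lambda>h. (- 8 * ker 5 z) *\<^sub>R z \<bullet> h)) (at z)" using grad_ker[of 4 z] by simp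
    have "((\<lambda>z. (- 6 * ker 4 z) * (z \<bullet> v)) has_derivative
        (\<lambda>h. (- 6 * ker 4 z) * (h \<bullet> v) + (- 6 * ((- 8 * ker 5 z) *\<^sub>R z \<bullet> h)) * (z \<bullet> v))) (at z)"
      by (intro has_derivative_mult has_derivative_mult_right k has_derivative_inner_left has_derivative_ident)
    then show ?thesis
      by (auto simp: inner_diff_left inner_commute[of v] algebra_simps elim!: has_derivative_eq_rhs)
  qed
  have v1: "\<bar>z \<bullet> v\<bar> \<le> norm z * norm v" for z by (rule Cauchy_Schwarz_ineq2)
  show "\<bar>(- 6 * ker 4 z) *\<^sub>R z \<bullet> v\<bar> \<le> 54 * norm v" for z
  proof -
    have "\<bar>(- 6 * ker 4 z) *\<^sub>R z \<bullet> v\<bar> \<le> 6 * ker 4 z * (norm z * norm v)"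
      using mult_left_mono[OF v1, of "6 * ker 4 z"] ker_pos[of 4 z] by (simp add: abs_mult)
    also have "\<dots> = 6 * (ker 4 z * norm z) * norm v" by simp
    also have "\<dots> \<le> 6 * 1 * norm v" by (intro mult_right_mono mult_left_mono ker_norm_bounds) auto
    also have "\<dots> \<le> 54 * norm v" by simp
    finally show ?thesis .
  qed
  show "norm ((48 * ker 5 z * (z \<bullet> v)) *\<^sub>R z - (6 * ker 4 z) *\<^sub>R v) \<le> 54 * norm v" for z
    by (rule ker_hessian_bounded)
qed measurable

lemma g_Ck: "Ck_on 2 UNIV g"
proof -
  have "Ck_on (Suc (Suc 0)) UNIV g"
  proof (rule Ck_on_SucI[OF open_UNIV g_has_derivative], rule Ck_on_SucI[OF open_UNIV g2_has_derivative])
    fix v w :: "real^3"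
    show "Ck_on 0 UNIV (conv (\<lambda>z. ((48 * ker 5 z * (z \<bullet> v)) *\<^sub>R z - (6 * ker 4 z) *\<^sub>R v) \<bullet> w) f)"
      unfolding Ck_on.simps
    proof (rule conv_continuous[OF f])
      show "continuous_on UNIV (\<lambda>z. ((48 * ker 5 z * (z \<bullet> v)) *\<^sub>R z - (6 * ker 4 z) *\<^sub>R v) \<bullet> w)"
        by (intro continuous_intros Ck_on_imp_continuous_on[OF Ck_on_ker])
      show "\<bar>((48 * ker 5 z * (z \<bullet> v)) *\<^sub>R z - (6 * ker 4 z) *\<^sub>R v) \<bullet> w\<bar> \<le> 54 * (norm v * norm w)" for z
        by (rule order_trans[OF Cauchy_Schwarz_ineq2])
          (use mult_right_mono[OF ker_hessian_bounded[of z v], of "norm w"] in \<open>simp add: mult.assoc\<close>)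
    qed
  qed
  then show ?thesis by (simp add: numeral_2_eq_2)
qed

text \<open>The gradient of the kernel is at most six times the kernel, so the estimate is
  proportional to \<open>g\<close> itself; this is what bounds the gradient of ln g. Pairing with v
  = grad g reduces the vector bound to a scalar one.\<close>

lemma g_grad_bound: "norm (grad g x) \<le> 6 * g x"
proof -
  define v where "v = grad g x"
  have "v \<bullet> v = conv (\<lambda>z. (- 6 * ker 4 z) *\<^sub>R z \<bullet> v) f x"
    using frechet_derivative_eqI[OF g_has_derivative, of x v] frechet_derivative_eqI[OF grad_works, of g x v]
      g_has_derivative[of x] by (simp add: v_def differentiable_def exI[of _ "\<lambda>h. conv (\<lambda>z. (- 6 * ker 4 z) *\<^sub>R z \<bullet> h) f x"])
  also have "\<dots> \<le> \<bar>conv (\<lambda>z. (- 6 * ker 4 z) *\<^sub>R z \<bullet> v) f x\<bar>" by simp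
  also have "\<dots> \<le> (6 * norm v) * conv (ker 3) f x"
  proof (rule conv_bound[OF f f0 _ ker_grad_bound])
    show "\<bar>ker 3 z\<bar> \<le> 1" for z using ker_pos[of 3 z] ker_le_1[of 3 z] by simp
  qed auto
  finally have "norm v * norm v \<le> norm v * (6 * g x)"
    by (simp add: g_def power2_norm_eq_inner[symmetric] power2_eq_square)
  moreover have "0 \<le> g x"
    unfolding g_def conv_def using ker_pos f0 by (intro Bochner_Integration.integral_nonneg mult_nonneg_nonneg) (auto simp: less_imp_le)
  ultimately show ?thesis unfolding v_def[symmetric] by (cases "norm v = 0") auto
qed

lemma g_nonneg: "0 \<le> g x"
  unfolding g_def conv_def using ker_pos f0 by (intro Bochner_Integration.integral_nonneg mult_nonneg_nonneg) (auto simp: less_imp_le)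

text \<open>Three pure second derivatives, each at most 54 g.\<close>

lemma g_laplacian_bound: "\<bar>laplacian g x\<bar> \<le> 162 * g x"
proof -
  have j: "frechet_derivative (grad g) (at x) (axis j 1) $ j
      = conv (\<lambda>z. ((48 * ker 5 z * (z \<bullet> axis j 1)) *\<^sub>R z - (6 * ker 4 z) *\<^sub>R axis j 1) \<bullet> axis j 1) f x" for j
  proof -
    have "Ck_on 1 UNIV (grad g)" by (rule continuous_grad_laplacian(3)[OF g_Ck])
    then have d: "grad g differentiable (at x)" by simp
    have "(\<lambda>x. grad g x $ j) = conv (\<lambda>z. (- 6 * ker 4 z) *\<^sub>R z \<bullet> axis j 1) f"
      by (rule ext) (simp only: grad_def vec_lambda_beta frechet_derivative_eqI[OF g_has_derivative])
    then show ?thesis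
      unfolding frechet_derivative_nth(2)[OF d, symmetric]
      by (simp only: frechet_derivative_eqI[OF g2_has_derivative])
  qed
  have b: "\<bar>conv (\<lambda>z. ((48 * ker 5 z * (z \<bullet> v)) *\<^sub>R z - (6 * ker 4 z) *\<^sub>R v) \<bullet> v) f x\<bar> \<le> 54 * conv (ker 3) f x" if v: "norm v = 1" for v
  proof (rule conv_bound[OF f f0])
    show "\<bar>((48 * ker 5 z * (z \<bullet> v)) *\<^sub>R z - (6 * ker 4 z) *\<^sub>R v) \<bullet> v\<bar> \<le> 54 * ker 3 z" for z
      by (rule order_trans[OF Cauchy_Schwarz_ineq2]) (use ker_hessian_bound[of z v] v in simp)
    show "\<bar>ker 3 z\<bar> \<le> 1" for z using ker_pos[of 3 z] ker_le_1[of 3 z] by simp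
  qed auto
  have "\<bar>laplacian g x\<bar> \<le> (\<Sum>j\<in>UNIV. \<bar>frechet_derivative (grad g) (at x) (axis j 1) $ j\<bar>)"
    unfolding laplacian_def divergence_def by (rule sum_abs)
  also have "\<dots> \<le> (\<Sum>j\<in>(UNIV :: 3 set). 54 * g x)"
    by (intro sum_mono, unfold j, unfold g_def, rule b) (simp add: norm_axis_1)
  finally show ?thesis by simp
qed

lemma g_le: "g x \<le> (\<integral>y. f y \<partial>lborel)"
  unfolding g_def conv_def
proof (rule integral_mono')
  show "ker 3 (x - y) * f y \<le> f y" for y
    using mult_right_mono[OF ker_le_1[of 3 "x - y"] f0[of y]] by simp
qed (use f f0 in auto)

text \<open>The kernel is positive everywhere, so \<open>g\<close> vanishes at a point only if f
  vanishes almost everywhere.\<close>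

lemma g_pos: "(\<integral>y. f y \<partial>lborel) > 0 \<Longrightarrow> g x > 0"
proof (rule ccontr)
  assume m: "(\<integral>y. f y \<partial>lborel) > 0" and "\<not> g x > 0"
  then have "g x = 0" using g_nonneg[of x] by simp
  moreover have i: "integrable lborel (\<lambda>y. ker 3 (x - y) * f y)"
    by (rule conv_integrable[OF f _, of _ 1]) (use ker_pos[of 3] ker_le_1[of 3] in \<open>auto simp: less_imp_le\<close>)
  moreover have "AE y in lborel. 0 \<le> ker 3 (x - y) * f y" using ker_pos f0 by (auto simp: less_imp_le)
  ultimately have "AE y in lborel. ker 3 (x - y) * f y = 0"
    unfolding g_def conv_def by (subst (asm) integral_nonneg_eq_0_iff_AE) auto
  then have "AE y in lborel. f y = 0" by eventually_elim (metis ker_pos mult_eq_0_iff less_irrefl)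
  then have "(\<integral>y. f y \<partial>lborel) = (\<integral>y. 0 \<partial>(lborel :: (real^3) measure))" using f by (intro integral_cong_AE) auto
  then show False using m by simp
qed

lemma g_integrable: "integrable lborel g"
proof -
  have [measurable]: "f \<in> borel_measurable borel" using f by auto
  have "continuous_on UNIV g" using g_Ck by (rule Ck_on_imp_continuous_on)
  then have [measurable]: "g \<in> borel_measurable borel" by (rule borel_measurable_continuous_onI)
  have i: "integrable lborel (\<lambda>y. ker 3 (x - y) * f y)" for x
    by (rule conv_integrable[OF f _, of _ 1]) (use ker_pos[of 3] ker_le_1[of 3] in \<open>auto simp: less_imp_le\<close>)
  have "(\<integral>\<^sup>+x. ennreal (g x) \<partial>lborel) = (\<integral>\<^sup>+x. (\<integral>\<^sup>+y. ennreal (ker 3 (x - y) * f y) \<partial>lborel) \<partial>lborel)"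
    unfolding g_def conv_def using ker_pos f0
    by (intro nn_integral_cong nn_integral_eq_integral[OF i, symmetric]) (auto simp: less_imp_le)
  also have "\<dots> = (\<integral>\<^sup>+y. (\<integral>\<^sup>+x. ennreal (ker 3 (x - y) * f y) \<partial>lborel) \<partial>lborel)"
    by (rule lborel_pair.Fubini') measurable
  also have "\<dots> = (\<integral>\<^sup>+y. (\<integral>\<^sup>+x. ennreal (ker 3 x) \<partial>lborel) * ennreal (f y) \<partial>lborel)"
  proof (rule nn_integral_cong)
    fix y
    have "(\<integral>\<^sup>+x. ennreal (ker 3 (x - y) * f y) \<partial>lborel) = (\<integral>\<^sup>+x. ennreal (ker 3 (x + (- y))) * ennreal (f y) \<partial>lborel)"
      using ker_pos f0 by (intro nn_integral_cong) (auto simp: ennreal_mult less_imp_le)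
    also have "\<dots> = (\<integral>\<^sup>+x. ennreal (ker 3 (x + (- y))) \<partial>lborel) * ennreal (f y)"
      by (rule nn_integral_multc) measurable
    also have "(\<integral>\<^sup>+x. ennreal (ker 3 (x + (- y))) \<partial>lborel) = (\<integral>\<^sup>+x. ennreal (ker 3 x) \<partial>lborel)"
      by (rule nn_integral_translation) measurable
    finally show "(\<integral>\<^sup>+x. ennreal (ker 3 (x - y) * f y) \<partial>lborel) = (\<integral>\<^sup>+x. ennreal (ker 3 x) \<partial>lborel) * ennreal (f y)" .
  qed
  also have "\<dots> = (\<integral>\<^sup>+x. ennreal (ker 3 x) \<partial>lborel) * (\<integral>\<^sup>+y. ennreal (f y) \<partial>lborel)"
    by (rule nn_integral_cmult) measurable
  also have "\<dots> < \<infinity>"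
    using integrable_ker f ker_pos f0
    by (simp add: nn_integral_eq_integral less_imp_le ennreal_mult_less_top)
  finally show ?thesis using g_nonneg by (intro integrableI_nonneg) auto
qed

text \<open>On the unit ball \<open>ker 3\<close> is at least 1/8, so a small value of g(x) limits
  the mass of f near x.\<close>

lemma local_mass_le: "0 \<le> r \<Longrightarrow> r \<le> 1 \<Longrightarrow>
    (\<integral>\<^sup>+h. ennreal (f (x + h)) * indicator (cball 0 r) h \<partial>lborel) \<le> ennreal (8 * g x)"
proof -
  assume r: "0 \<le> r" "r \<le> 1"
  have [measurable]: "f \<in> borel_measurable borel" using f by auto
  have i: "integrable lborel (\<lambda>y. ker 3 (x - y) * f y)"
    by (rule conv_integrable[OF f _, of _ 1]) (use ker_pos[of 3] ker_le_1[of 3] in \<open>auto simp: less_imp_le\<close>)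
  have "(\<integral>\<^sup>+h. ennreal (f (x + h)) * indicator (cball 0 r) h \<partial>lborel)
      \<le> (\<integral>\<^sup>+h. ennreal (8 * (ker 3 (x - (h + x)) * f (h + x))) \<partial>lborel)"
  proof (rule nn_integral_mono)
    fix h :: "real^3"
    show "ennreal (f (x + h)) * indicator (cball 0 r) h \<le> ennreal (8 * (ker 3 (x - (h + x)) * f (h + x)))"
    proof (cases "h \<in> cball 0 r")
      case True
      then have "norm h ^ 2 \<le> 1" using r by (intro power_le_one) auto
      then have "inverse 2 \<le> inverse (1 + h \<bullet> h)"
        by (intro le_imp_inverse_le) (auto intro: add_pos_nonneg simp: power2_norm_eq_inner)
      then have "inverse 2 ^ 3 \<le> ker 3 (- h)" unfolding ker_def by (intro power_mono) auto
      then have "1 \<le> 8 * ker 3 (- h)" by (simp add: eval_nat_numeral)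
      then have "1 * f (h + x) \<le> 8 * ker 3 (- h) * f (h + x)" using f0 by (intro mult_right_mono)
      then show ?thesis using True by (simp add: add.commute[of x h] mult.assoc ennreal_leI)
    qed simp
  qed
  also have "\<dots> = (\<integral>\<^sup>+y. ennreal (8 * (ker 3 (x - y) * f y)) \<partial>lborel)"
    by (rule nn_integral_translation) measurable
  also have "\<dots> = ennreal (8 * g x)"
    unfolding g_def conv_def using i ker_pos f0
    by (subst nn_integral_eq_integral) (auto simp: less_imp_le)
  finally show ?thesis .
qed

end

context conv_weight
begin

text \<open>Where g <= exp(-n), little mass of f lies near each point.
  \<open>averaging_estimate\<close> then bounds the square integral by a multiple of r^2 + exp(-n) /
  r^3, and r = exp(-n/5) balances the two terms.\<close>

lemma f_sq_sublevel:
  assumes B: "B \<ge> 0" and tr: "\<And>h. (\<integral>\<^sup>+x. ennreal ((f (x + h) - f x)\<^sup>2) \<partial>lborel) \<le> ennreal ((norm h)\<^sup>2 * B)"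
  shows "(\<integral>\<^sup>+x\<in>{x. g x \<le> exp (- real n)}. ennreal ((f x)\<^sup>2) \<partial>lborel)
    \<le> ennreal ((B + 16 * (\<integral>x. f x \<partial>lborel) / unit_ball_vol 3) * exp (- (2 * real n / 5)))"
proof -
  define S where "S = {x. g x \<le> exp (- real n)}"
  define m where "m = (\<integral>x. f x \<partial>lborel)"
  define \<omega> where "\<omega> = unit_ball_vol (3::real)"
  define r where "r = exp (- (real n / 5))"
  define V where "V = \<omega> * r ^ 3"
  have \<omega>: "\<omega> > 0" by (simp add: \<omega>_def)
  have r: "0 < r" "r \<le> 1" by (auto simp: r_def)
  have V: "V > 0" using \<omega> r by (simp add: V_def)
  have m0: "m \<ge> 0" unfolding m_def using f0 by (intro Bochner_Integration.integral_nonneg) auto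
  have [measurable]: "f \<in> borel_measurable borel" using f by auto
  have "continuous_on UNIV g" using g_Ck by (rule Ck_on_imp_continuous_on)
  then have [measurable]: "g \<in> borel_measurable borel" by (rule borel_measurable_continuous_onI)
  have S [measurable]: "S \<in> sets borel" unfolding S_def by measurable
  have em: "emeasure lborel (cball (0::real^3) r) = ennreal V"
    using r by (simp add: emeasure_cball V_def \<omega>_def)
  have nm: "(\<integral>\<^sup>+x. ennreal (f x) \<partial>lborel) = ennreal m"
    unfolding m_def using f f0 by (intro nn_integral_eq_integral) auto
  define I where "I = (\<integral>\<^sup>+x\<in>S. ennreal ((f x)\<^sup>2) \<partial>lborel)"
  have J: "(\<integral>\<^sup>+x\<in>S. (ennreal (f x) * (\<integral>\<^sup>+h. ennreal (f (x + h)) * indicator (cball 0 r) h \<partial>lborel)) \<partial>lborel)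
      \<le> (\<integral>\<^sup>+x. ennreal (f x) * ennreal (8 * exp (- real n)) \<partial>lborel)"
  proof (rule nn_integral_mono)
    fix x
    show "ennreal (f x) * (\<integral>\<^sup>+h. ennreal (f (x + h)) * indicator (cball 0 r) h \<partial>lborel) * indicator S x
        \<le> ennreal (f x) * ennreal (8 * exp (- real n))"
    proof (cases "x \<in> S")
      case True
      have "(\<integral>\<^sup>+h. ennreal (f (x + h)) * indicator (cball 0 r) h \<partial>lborel) \<le> ennreal (8 * g x)"
        using r by (intro local_mass_le) auto
      also have "\<dots> \<le> ennreal (8 * exp (- real n))" using True by (intro ennreal_leI) (auto simp: S_def)
      finally show ?thesis using True by (auto intro: mult_left_mono)
    qed simp
  qed
  have J': "(\<integral>\<^sup>+x. ennreal (f x) * ennreal (8 * exp (- real n)) \<partial>lborel) = ennreal (m * (8 * exp (- real n)))"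
    using m0 by (subst nn_integral_multc) (auto simp: nm ennreal_mult)
  have "ennreal V * I \<le> ennreal V * ennreal (r\<^sup>2 * B)
      + 2 * (\<integral>\<^sup>+x\<in>S. (ennreal (f x) * (\<integral>\<^sup>+h. ennreal (f (x + h)) * indicator (cball 0 r) h \<partial>lborel)) \<partial>lborel)"
    unfolding em[symmetric] I_def by (rule averaging_estimate) (use f0 B tr in auto)
  also have "\<dots> \<le> ennreal V * ennreal (r\<^sup>2 * B) + 2 * ennreal (m * (8 * exp (- real n)))"
    using J unfolding J' by (intro add_left_mono mult_left_mono) auto
  also have "\<dots> = ennreal (V * (r\<^sup>2 * B) + 2 * (m * (8 * exp (- real n))))"
  proof -
    define X where "X = m * (8 * exp (- real n))"
    have X: "X \<ge> 0" using m0 by (simp add: X_def)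
    have "2 * ennreal X = ennreal (2 * X)" using ennreal_mult'[of X 2] X by (simp add: ennreal_mult)
    moreover have "ennreal V * ennreal (r\<^sup>2 * B) = ennreal (V * (r\<^sup>2 * B))" using V B by (intro ennreal_mult[symmetric]) auto
    ultimately show ?thesis using V B X unfolding X_def[symmetric] by (simp only: ) (intro ennreal_plus[symmetric]; simp)
  qed
  finally have VI: "ennreal V * I \<le> ennreal (V * (r\<^sup>2 * B) + 2 * (m * (8 * exp (- real n))))" .
  have "I = ennreal (1 / V) * (ennreal V * I)"
    using V by (simp add: mult.assoc[symmetric] ennreal_mult'[symmetric])
  also have "\<dots> \<le> ennreal (1 / V) * ennreal (V * (r\<^sup>2 * B) + 2 * (m * (8 * exp (- real n))))"
    by (intro mult_left_mono VI) auto
  also have "\<dots> = ennreal (1 / V * (V * (r\<^sup>2 * B) + 2 * (m * (8 * exp (- real n)))))"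
    using V by (simp add: ennreal_mult'[symmetric])
  also have "1 / V * (V * (r\<^sup>2 * B) + 2 * (m * (8 * exp (- real n)))) = (B + 16 * m / \<omega>) * exp (- (2 * real n / 5))"
  proof -
    have r2: "r\<^sup>2 = exp (- (2 * real n / 5))" by (simp add: r_def power2_eq_square flip: exp_add)
    have "r ^ 3 * r\<^sup>2 = r ^ 5" by (simp flip: power_add)
    also have "\<dots> = exp (real 5 * (- (real n / 5)))" unfolding r_def by (rule exp_of_nat_mult[symmetric])
    finally have "r ^ 3 * r\<^sup>2 = exp (- real n)" by simp
    then have "exp (- real n) / V = r\<^sup>2 / \<omega>" using r \<omega> by (simp add: V_def field_simps)
    moreover have "1 / V * (V * (r\<^sup>2 * B) + 2 * (m * (8 * exp (- real n)))) = r\<^sup>2 * B + 16 * m * (exp (- real n) / V)"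
      using V by (simp add: field_simps)
    ultimately show ?thesis by (simp add: r2 algebra_simps)
  qed
  finally show ?thesis by (simp add: I_def S_def m_def \<omega>_def)
qed

text \<open>The rough part of \<open>f\<close> cannot be concentrated where the averages \<open>g\<close> are tiny, because the
  translation estimate bounds the mean square of \<open>f\<close> there.\<close>

lemma integrable_mult_ln_g:
  assumes ent: "integrable lborel (\<lambda>x. f x * ln (f x))" and m: "(\<integral>x. f x \<partial>lborel) > 0"
    and B: "B \<ge> 0" and tr: "\<And>h. (\<integral>\<^sup>+x. ennreal ((f (x + h) - f x)\<^sup>2) \<partial>lborel) \<le> ennreal ((norm h)\<^sup>2 * B)"
  shows "integrable lborel (\<lambda>x. f x * ln (g x))"
proof -
  have [measurable]: "f \<in> borel_measurable borel" using f by auto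
  have "continuous_on UNIV g" using g_Ck by (rule Ck_on_imp_continuous_on)
  then have gm [measurable]: "g \<in> borel_measurable borel" by (rule borel_measurable_continuous_onI)
  define S where "S n = {x. g x \<le> exp (- real n)}" for n
  have S [measurable]: "S n \<in> sets borel" for n unfolding S_def by measurable
  \<comment> \<open>The price of level n: where l = -ln g lies in [n, n + 1] and f exceeds
    exp(-l/10), one has f l <= l exp(l/10) f^2 <= \<open>a n\<close> f^2.\<close>
  define a where "a n = real (Suc n) * exp (real (Suc n) / 10)" for n
  have a0: "a n \<ge> 0" for n by (simp add: a_def)
  define c0 where "c0 = B + 16 * (\<integral>x. f x \<partial>lborel) / unit_ball_vol 3"
  have c0: "c0 \<ge> 0" unfolding c0_def using B m by (intro add_nonneg_nonneg divide_nonneg_nonneg) auto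
  define l where "l x = max 0 (- ln (g x))" for x
  have pt: "ennreal (f x * l x) \<le> ennreal (10 * \<bar>f x * ln (f x)\<bar>) + (\<Sum>n. ennreal (a n) * (ennreal ((f x)\<^sup>2) * indicator (S n) x))" for x
  proof (cases "ln (g x) \<ge> 0 \<or> f x = 0")
    case False
    then have lam: "l x = - ln (g x)" "l x > 0" and fx: "f x > 0" using f0[of x] by (auto simp: l_def)
    have gx: "g x = exp (- l x)" using g_pos[OF m, of x] lam by simp
    \<comment> \<open>Either f is so small that l is at most 10 |ln f|, and the entropy of f itself
      controls f l; or f is comparatively large, and f l is bounded by \<open>a n\<close> f^2 on the
      sublevel set \<open>S n\<close>.\<close>
    show ?thesis
    proof (cases "f x \<le> exp (- l x / 10)")
      case True
      then have "ln (f x) \<le> - l x / 10" using fx by (metis ln_exp ln_le_cancel_iff exp_gt_zero)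
      then have "l x \<le> 10 * \<bar>ln (f x)\<bar>" using lam(2) by simp
      then have "f x * l x \<le> f x * (10 * \<bar>ln (f x)\<bar>)" using fx by (intro mult_left_mono) auto
      also have "\<dots> = 10 * \<bar>f x * ln (f x)\<bar>" using fx by (simp add: abs_mult)
      finally show ?thesis by (intro add_increasing2 ennreal_leI) auto
    next
      case False
      define n where "n = nat \<lfloor>l x\<rfloor>"
      have "real n = of_int \<lfloor>l x\<rfloor>" using lam(2) by (simp add: n_def)
      then have n: "real n \<le> l x" "l x \<le> real (Suc n)"
        using of_int_floor_le[of "l x"] real_of_int_floor_add_one_ge[of "l x"] unfolding of_nat_Suc by linarith+
      have xS: "x \<in> S n" using n(1) gx by (simp add: S_def)
      have "exp (- (real (Suc n) / 10)) \<le> exp (- l x / 10)" using n(2) by simp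
      also have "\<dots> \<le> f x" using False by simp
      finally have "exp (real (Suc n) / 10) * exp (- (real (Suc n) / 10)) \<le> exp (real (Suc n) / 10) * f x"
        by (intro mult_left_mono) auto
      then have 1: "1 \<le> exp (real (Suc n) / 10) * f x" by (simp flip: exp_add)
      have "f x * l x = 1 * (f x * l x)" by simp
      also have "\<dots> \<le> (exp (real (Suc n) / 10) * f x) * (f x * real (Suc n))"
        using fx lam n by (intro mult_mono 1) (auto simp: mult_le_0_iff)
      also have "\<dots> = a n * (f x)\<^sup>2" by (simp add: a_def power2_eq_square)
      finally have "ennreal (f x * l x) \<le> ennreal (a n * (f x)\<^sup>2)" by (rule ennreal_leI)
      also have "\<dots> = ennreal (a n) * (ennreal ((f x)\<^sup>2) * indicator (S n) x)"
        using xS a0 by (simp add: ennreal_mult)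
      also have "\<dots> \<le> (\<Sum>n. ennreal (a n) * (ennreal ((f x)\<^sup>2) * indicator (S n) x))"
        using sum_le_suminf[of "\<lambda>n. ennreal (a n) * (ennreal ((f x)\<^sup>2) * indicator (S n) x)" "{n}"] by (simp add: summableI)
      finally show ?thesis by (intro add_increasing) auto
    qed
  qed (auto simp: l_def max_def)
  \<comment> \<open>The ratio of the majorising series: exp(1/10) from \<open>a n\<close> times
    exp(-2/5) from \<open>f_sq_sublevel\<close>. The exponent 1/10 of the case split only has to
    stay below 2/5.\<close>
  define z where "z = exp (- (3 / 10) :: real)"
  have z: "norm z < 1" by (simp add: z_def)
  have "(\<lambda>n. c0 * exp (1 / 10) * (of_nat (Suc n) * z ^ n)) sums (c0 * exp (1 / 10) * (1 / (1 - z)\<^sup>2))"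
    by (intro sums_mult geometric_deriv_sums z)
  moreover have "c0 * exp (1 / 10) * (of_nat (Suc n) * z ^ n) = a n * (c0 * exp (- (2 * real n / 5)))" for n
  proof -
    have "exp (1 / 10) * z ^ n = exp (real (Suc n) / 10) * exp (- (2 * real n / 5))"
      by (simp add: z_def add_divide_distrib flip: exp_of_nat_mult exp_add)
    then show ?thesis by (simp add: a_def algebra_simps)
  qed
  ultimately have sums: "(\<lambda>n. a n * (c0 * exp (- (2 * real n / 5)))) sums (c0 * exp (1 / 10) * (1 / (1 - z)\<^sup>2))"
    by (simp only:)
  have "(\<integral>\<^sup>+x. ennreal (f x * l x) \<partial>lborel)
      \<le> (\<integral>\<^sup>+x. ennreal (10 * \<bar>f x * ln (f x)\<bar>) + (\<Sum>n. ennreal (a n) * (ennreal ((f x)\<^sup>2) * indicator (S n) x)) \<partial>lborel)"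
    by (rule nn_integral_mono) (rule pt)
  also have "\<dots> = (\<integral>\<^sup>+x. ennreal (10 * \<bar>f x * ln (f x)\<bar>) \<partial>lborel)
      + (\<integral>\<^sup>+x. (\<Sum>n. ennreal (a n) * (ennreal ((f x)\<^sup>2) * indicator (S n) x)) \<partial>lborel)"
    by (rule nn_integral_add) measurable
  also have "(\<integral>\<^sup>+x. (\<Sum>n. ennreal (a n) * (ennreal ((f x)\<^sup>2) * indicator (S n) x)) \<partial>lborel)
      = (\<Sum>n. \<integral>\<^sup>+x. ennreal (a n) * (ennreal ((f x)\<^sup>2) * indicator (S n) x) \<partial>lborel)"
    by (rule nn_integral_suminf) measurable
  also have "\<dots> \<le> (\<Sum>n. ennreal (a n * (c0 * exp (- (2 * real n / 5)))))"
  proof (intro suminf_le summableI)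
    fix n
    have "(\<integral>\<^sup>+x. ennreal (a n) * (ennreal ((f x)\<^sup>2) * indicator (S n) x) \<partial>lborel)
        = ennreal (a n) * (\<integral>\<^sup>+x\<in>S n. ennreal ((f x)\<^sup>2) \<partial>lborel)"
      by (rule nn_integral_cmult) measurable
    also have "\<dots> \<le> ennreal (a n) * ennreal (c0 * exp (- (2 * real n / 5)))"
      using f_sq_sublevel[OF B tr, of n] by (intro mult_left_mono) (auto simp: S_def c0_def)
    also have "\<dots> = ennreal (a n * (c0 * exp (- (2 * real n / 5))))" using a0 c0 by (simp add: ennreal_mult)
    finally show "(\<integral>\<^sup>+x. ennreal (a n) * (ennreal ((f x)\<^sup>2) * indicator (S n) x) \<partial>lborel)
        \<le> ennreal (a n * (c0 * exp (- (2 * real n / 5))))" .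
  qed
  also have "\<dots> = ennreal (c0 * exp (1 / 10) * (1 / (1 - z)\<^sup>2))"
    using a0 c0 by (intro suminf_ennreal_eq sums) auto
  also have "(\<integral>\<^sup>+x. ennreal (10 * \<bar>f x * ln (f x)\<bar>) \<partial>lborel) = ennreal (\<integral>x. 10 * \<bar>f x * ln (f x)\<bar> \<partial>lborel)"
    using ent by (intro nn_integral_eq_integral) auto
  finally have fin: "(\<integral>\<^sup>+x. ennreal (f x * l x) \<partial>lborel) < \<infinity>"
    by (auto simp: less_top[symmetric] top_unique add_left_mono)
  have lm [measurable]: "l \<in> borel_measurable borel" unfolding l_def by measurable
  have il: "integrable lborel (\<lambda>x. f x * l x)"
    using fin f0 by (intro integrableI_nonneg) (auto simp: l_def)
  show ?thesis
  proof (rule Bochner_Integration.integrable_bound)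
    show "integrable lborel (\<lambda>x. f x * l x + max 0 (ln (\<integral>y. f y \<partial>lborel)) * f x)" using il f by simp
    show "AE x in lborel. norm (f x * ln (g x)) \<le> norm (f x * l x + max 0 (ln (\<integral>y. f y \<partial>lborel)) * f x)"
    proof (rule AE_I2)
      fix x
      have "ln (g x) \<le> ln (\<integral>y. f y \<partial>lborel)" using g_le[of x] g_pos[OF m, of x] by simp
      then have "\<bar>ln (g x)\<bar> \<le> l x + max 0 (ln (\<integral>y. f y \<partial>lborel))" by (auto simp: l_def)
      then have "f x * \<bar>ln (g x)\<bar> \<le> f x * (l x + max 0 (ln (\<integral>y. f y \<partial>lborel)))" using f0 by (intro mult_left_mono)
      then show "norm (f x * ln (g x)) \<le> norm (f x * l x + max 0 (ln (\<integral>y. f y \<partial>lborel)) * f x)"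
        using f0[of x] by (simp add: abs_mult algebra_simps)
    qed
  qed measurable
qed

text \<open>A bounded substitute for ln (1/g): adding \<open>e\<close> bounds it above, and ln (mass
  + 1) makes it nonnegative, because g + e <= mass + 1 for e <= 1. Nonnegativity permits Fatou's
  lemma as e tends to 0.\<close>

definition weight :: "real \<Rightarrow> real^3 \<Rightarrow> real" where
  "weight e x = ln ((\<integral>y. f y \<partial>lborel) + 1) - ln (g x + e)"

lemma mass_nonneg: "(\<integral>y. f y \<partial>lborel) \<ge> 0"
  using f0 by (intro Bochner_Integration.integral_nonneg) auto

lemma weight_range:
  assumes "0 < e" "e \<le> 1"
  shows "0 \<le> weight e x" "weight e x \<le> ln ((\<integral>y. f y \<partial>lborel) + 1) - ln e"
  using assms g_nonneg[of x] g_le[of x] mass_nonneg by (auto simp: weight_def)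

lemma weight_Ck:
  assumes e: "e > 0"
  shows "Ck_on 2 UNIV (weight e)"
proof -
  have pos: "g x + e > 0" for x using g_nonneg[of x] e by simp
  have gC: "Ck_on 2 UNIV (\<lambda>x. g x + e)" by (intro Ck_on_add g_Ck Ck_on_const) auto
  define B where "B j = (if j = 0 then ln else if j = 1 then inverse else (\<lambda>s::real. - (inverse s ^ Suc (Suc 0))))" for j :: nat
  have "Ck_on 2 UNIV (\<lambda>x. B 0 (g x + e))"
  proof (rule Ck_on_compose_real[OF open_UNIV _ gC, of "{0<..}"])
    show "(B j has_real_derivative B (Suc j) s) (at s)" if "j < 2" "s \<in> {0<..}" for j s
    proof -
      have "j = 0 \<or> j = 1" using that by auto
      then show ?thesis
        using DERIV_ln[of s] DERIV_inverse[of s] that by (auto simp: B_def)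
    qed
    show "continuous_on {0<..} (B 2)" unfolding B_def by (auto intro!: continuous_intros)
  qed (use pos in auto)
  then have "Ck_on 2 UNIV (\<lambda>x. ln (g x + e))" by (simp add: B_def)
  then show ?thesis unfolding weight_def[abs_def] by (intro Ck_on_diff Ck_on_const) auto
qed

text \<open>The bounds do not depend on e, since g / (g + e) <= 1. In the second one 162 comes from
  the Laplacian of g and 36 is the square of the gradient bound 6.\<close>

lemma weight_grad_laplacian:
  assumes e: "e > 0"
  shows "norm (grad (weight e) x) \<le> 6" "\<bar>laplacian (weight e) x\<bar> \<le> 198"
proof -
  define s where "s x = - inverse (g x + e)" for x
  have pos: "g x + e > 0" for x using g_nonneg[of x] e by simp
  have dg: "g differentiable (at x)" for x
    by (rule Ck_on_1_differentiable[OF continuous_grad_laplacian(4)[OF g_Ck]])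
  have ge: "((\<lambda>x. g x + e) has_derivative (\<lambda>v. grad g x \<bullet> v)) (at x)" for x
    using has_derivative_add[OF grad_works[OF dg[of x]] has_derivative_const[of e]] by simp
  then have dge: "(\<lambda>x. g x + e) differentiable (at x)" "grad (\<lambda>x. g x + e) x = grad g x" for x
    by (auto simp: differentiable_def intro: grad_eqI)
  have gw: "grad (weight e) x = s x *\<^sub>R grad g x" for x
  proof -
    have "((\<lambda>t. ln ((\<integral>y. f y \<partial>lborel) + 1) - ln t) has_real_derivative s x) (at (g x + e))"
      using pos[of x] by (auto intro!: derivative_eq_intros simp: s_def inverse_eq_divide)
    from grad_compose_real(2)[OF dge(1) this] show ?thesis by (simp add: weight_def[abs_def] dge(2))
  qed
  have gs: "s differentiable (at x)" "grad s x = ((inverse (g x + e))\<^sup>2) *\<^sub>R grad g x" for x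
  proof -
    have "((\<lambda>t. - inverse t) has_real_derivative - (- (inverse (g x + e) ^ Suc (Suc 0)))) (at (g x + e))"
      using pos[of x] by (intro DERIV_minus DERIV_inverse) auto
    then have "((\<lambda>t. - inverse t) has_real_derivative (inverse (g x + e))\<^sup>2) (at (g x + e))"
      by (simp add: power2_eq_square)
    from grad_compose_real[OF dge(1) this] show "s differentiable (at x)" "grad s x = ((inverse (g x + e))\<^sup>2) *\<^sub>R grad g x"
      by (simp_all add: s_def[abs_def] dge(2))
  qed
  have lap: "laplacian (weight e) x = s x * laplacian g x + (inverse (g x + e))\<^sup>2 * (norm (grad g x))\<^sup>2"
  proof -
    have "laplacian (weight e) x = divergence (\<lambda>x. s x *\<^sub>R grad g x) x" by (simp add: laplacian_def gw[abs_def])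
    also have "\<dots> = s x * divergence (grad g) x + grad s x \<bullet> grad g x"
      by (rule divergence_scaleR[OF gs(1) Ck_on_1_differentiable[OF continuous_grad_laplacian(3)[OF g_Ck]]])
    finally show ?thesis by (simp add: gs(2) laplacian_def power2_norm_eq_inner)
  qed
  have r: "0 \<le> inverse (g x + e)" "inverse (g x + e) * g x \<le> 1"
    using pos[of x] e g_nonneg[of x] by (auto simp: field_simps)
  have gb: "inverse (g x + e) * norm (grad g x) \<le> 6"
  proof -
    have "inverse (g x + e) * norm (grad g x) \<le> inverse (g x + e) * (6 * g x)"
      by (intro mult_left_mono g_grad_bound r)
    then show ?thesis using r(2) by simp
  qed
  show "norm (grad (weight e) x) \<le> 6" using gb r(1) by (simp add: gw s_def)
  have "(inverse (g x + e) * norm (grad g x))\<^sup>2 \<le> 6\<^sup>2" using r(1) by (intro power_mono gb) auto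
  then have 1: "(inverse (g x + e))\<^sup>2 * (norm (grad g x))\<^sup>2 \<le> 36" by (simp only: power_mult_distrib) simp
  have "inverse (g x + e) * \<bar>laplacian g x\<bar> \<le> inverse (g x + e) * (162 * g x)"
    by (intro mult_left_mono g_laplacian_bound r)
  then have 2: "\<bar>s x * laplacian g x\<bar> \<le> 162" using r by (simp add: s_def abs_mult)
  have 3: "0 \<le> (inverse (g x + e))\<^sup>2 * (norm (grad g x))\<^sup>2" by simp
  show "\<bar>laplacian (weight e) x\<bar> \<le> 198" unfolding lap using 1 2 3 by linarith
qed

end

lemma laplacian_mult:
  assumes f: "Ck_on 2 UNIV f" and g: "Ck_on 2 UNIV g"
  shows "laplacian (\<lambda>x. f x * g x) x = f x * laplacian g x + g x * laplacian f x + 2 * (grad f x \<bullet> grad g x)"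
proof -
  note cf = continuous_grad_laplacian[OF f] and cg = continuous_grad_laplacian[OF g]
  note d = Ck_on_1_differentiable
  have "grad (\<lambda>x. f x * g x) = (\<lambda>x. f x *\<^sub>R grad g x + g x *\<^sub>R grad f x)"
    by (rule ext) (rule grad_mult[OF d[OF cf(4)] d[OF cg(4)]])
  then have "laplacian (\<lambda>x. f x * g x) x = divergence (\<lambda>x. f x *\<^sub>R grad g x + g x *\<^sub>R grad f x) x"
    by (simp add: laplacian_def)
  also have "\<dots> = divergence (\<lambda>x. f x *\<^sub>R grad g x) x + divergence (\<lambda>x. g x *\<^sub>R grad f x) x"
    by (intro divergence_add d Ck_on_scaleR cf cg) auto
  also have "\<dots> = f x * laplacian g x + grad f x \<bullet> grad g x + (g x * laplacian f x + grad g x \<bullet> grad f x)"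
    unfolding laplacian_def by (simp only: divergence_scaleR[OF d[OF cf(4)] d[OF cg(3)]] divergence_scaleR[OF d[OF cg(4)] d[OF cf(3)]])
  finally show ?thesis by (simp add: inner_commute)
qed

text \<open>The weight lacks compact support, so it is multiplied by a cut-off. Its bound
  \<open>b\<close>, which blows up as e tends to 0, multiplies only derivatives of the cut-off and
  drops out as R tends to infinity; the resulting rate does not depend on e.\<close>

lemma (in drift_diffusion) weight_Lipschitz:
  assumes cw: "conv_weight f" and e: "0 < e" "e \<le> 1" and st: "0 < s" "s \<le> t" "t \<le> T"
  shows "(\<integral>x. conv_weight.weight f e x * c t x \<partial>lborel) - (\<integral>x. conv_weight.weight f e x * c s x \<partial>lborel)
    \<le> (t - s) * ((D * 198 + \<bar>\<zeta>\<bar> * D * K * 6) * M + 6 * Q)"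
proof -
  interpret W: conv_weight f by (rule cw)
  define w where "w = W.weight e"
  define b where "b = ln ((\<integral>y. f y \<partial>lborel) + 1) - ln e"
  have w: "0 \<le> w x" "w x \<le> b" for x using W.weight_range[OF e] by (auto simp: w_def b_def)
  have wC: "Ck_on 2 UNIV w" unfolding w_def by (rule W.weight_Ck[OF e(1)])
  note wb = W.weight_grad_laplacian[OF e(1), folded w_def]
  note d = Ck_on_1_differentiable
  obtain C where C: "C > 0" "\<And>R x. R \<ge> 1 \<Longrightarrow> norm (grad (cutoff R) x) \<le> C / R"
    "\<And>R x. R \<ge> 1 \<Longrightarrow> \<bar>laplacian (cutoff R) x\<bar> \<le> C / R" by (rule cutoff_bounds) blast
  have iw: "integrable lborel (\<lambda>x. w x * c \<tau> x)" if "0 < \<tau>" "\<tau> \<le> T" for \<tau>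
  proof (rule Bochner_Integration.integrable_bound[OF integrable_mult_right[OF c_L1[OF that], of b]])
    have [measurable]: "c \<tau> \<in> borel_measurable borel" using c_L1[OF that] by auto
    have [measurable]: "w \<in> borel_measurable borel"
      by (rule borel_measurable_continuous_onI[OF Ck_on_imp_continuous_on[OF wC]])
    show "(\<lambda>x. w x * c \<tau> x) \<in> borel_measurable lborel" by measurable
    show "AE x in lborel. norm (w x * c \<tau> x) \<le> norm (b * c \<tau> x)"
    proof (rule AE_I2)
      fix x
      have "\<bar>w x\<bar> \<le> \<bar>b\<bar>" using w[of x] by linarith
      then show "norm (w x * c \<tau> x) \<le> norm (b * c \<tau> x)" by (auto simp: abs_mult intro: mult_right_mono)
    qed
  qed
  define d1 where "d1 R = (\<integral>x. cutoff R x * (w x * c t x) \<partial>lborel) - (\<integral>x. cutoff R x * (w x * c s x) \<partial>lborel)" for R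
  \<comment> \<open>The bound as a function of y = 1/R, so that the limit is its value at y =
    0.\<close>
  define bd where "bd y = (t - s) * ((D * (198 + (12 * C + b * C) * y) + \<bar>\<zeta>\<bar> * D * K * (6 + b * C * y)) * M + (6 + b * C * y) * Q)" for y
  have le: "d1 R \<le> bd (inverse R)" if R: "R \<ge> 1" for R
  proof -
    have cC: "Ck_on 2 UNIV (cutoff R)" by (rule Ck_on_cutoff)
    have g: "norm (grad (\<lambda>x. cutoff R x * w x) x) \<le> 6 + b * C * inverse R" for x
    proof -
      have "norm (grad (\<lambda>x. cutoff R x * w x) x) \<le> norm (cutoff R x *\<^sub>R grad w x) + norm (w x *\<^sub>R grad (cutoff R) x)"
        by (subst grad_mult[OF d[OF continuous_grad_laplacian(4)[OF cC]] d[OF continuous_grad_laplacian(4)[OF wC]]])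
          (rule norm_triangle_ineq)
      also have "norm (cutoff R x *\<^sub>R grad w x) \<le> 1 * 6"
        unfolding norm_scaleR using cutoff_range[of R x] by (intro mult_mono wb) auto
      also have "norm (w x *\<^sub>R grad (cutoff R) x) \<le> b * (C / R)"
        unfolding norm_scaleR using w[of x] by (intro mult_mono C(2)[OF R]) auto
      finally show ?thesis by (simp add: divide_inverse)
    qed
    have l: "\<bar>laplacian (\<lambda>x. cutoff R x * w x) x\<bar> \<le> 198 + (12 * C + b * C) * inverse R" for x
    proof -
      have 1: "\<bar>cutoff R x * laplacian w x\<bar> \<le> 1 * 198"
        unfolding abs_mult using cutoff_range[of R x] by (intro mult_mono wb) auto
      have 2: "\<bar>w x * laplacian (cutoff R) x\<bar> \<le> b * (C / R)"
        unfolding abs_mult using w[of x] by (intro mult_mono C(3)[OF R]) auto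
      have 3: "\<bar>grad (cutoff R) x \<bullet> grad w x\<bar> \<le> (C / R) * 6"
        using R C(1) by (intro order_trans[OF Cauchy_Schwarz_ineq2] mult_mono C(2)[OF R] wb) auto
      have "(12 * C + b * C) * inverse R = b * (C / R) + 2 * ((C / R) * 6)" by (simp add: divide_inverse algebra_simps)
      then show ?thesis unfolding laplacian_mult[OF cC wC] using 1 2 3 by linarith
    qed
    have "Ck_on 2 UNIV (\<lambda>x. cutoff R x * w x)" by (intro Ck_on_mult cC wC) auto
    from weighted_mass_Lipschitz[OF st this _ g l, of R] cutoff_support[of R] R
    show ?thesis by (simp add: d1_def bd_def mult.assoc)
  qed
  have "(d1 \<longlongrightarrow> (\<integral>x. w x * c t x \<partial>lborel) - (\<integral>x. w x * c s x \<partial>lborel)) at_top"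
    unfolding d1_def using st by (intro tendsto_diff cutoff_integral_tendsto iw) auto
  moreover have "((\<lambda>R. bd (inverse R)) \<longlongrightarrow> bd 0) at_top"
    unfolding bd_def by (intro tendsto_intros tendsto_inverse_0_at_top filterlim_ident)
  ultimately have "(\<integral>x. w x * c t x \<partial>lborel) - (\<integral>x. w x * c s x \<partial>lborel) \<le> bd 0"
    using le by (intro tendsto_le[OF trivial_limit_at_top_linorder]) (auto intro: eventually_mono[OF eventually_ge_at_top[of 1]])
  then show ?thesis by (simp add: bd_def w_def)
qed

section \<open>Solutions of the Nernst--Planck--Darcy system\<close>

lemma grad_sum_scaled:
  assumes "\<And>i. i \<in> A \<Longrightarrow> f i differentiable (at x)"
  shows "(\<lambda>x. \<Sum>i\<in>A. a i * f i x) differentiable (at x)"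
    "grad (\<lambda>x. \<Sum>i\<in>A. a i * f i x) x = (\<Sum>i\<in>A. a i *\<^sub>R grad (f i) x)"
proof -
  have "((\<lambda>x. \<Sum>i\<in>A. a i * f i x) has_derivative (\<lambda>v. \<Sum>i\<in>A. a i * (grad (f i) x \<bullet> v))) (at x)"
    using assms by (intro has_derivative_sum has_derivative_mult_right grad_works)
  then have d: "((\<lambda>x. \<Sum>i\<in>A. a i * f i x) has_derivative (\<lambda>v. (\<Sum>i\<in>A. a i *\<^sub>R grad (f i) x) \<bullet> v)) (at x)"
    by (simp add: inner_sum_left)
  then show "(\<lambda>x. \<Sum>i\<in>A. a i * f i x) differentiable (at x)" by (auto simp: differentiable_def)
  from d show "grad (\<lambda>x. \<Sum>i\<in>A. a i * f i x) x = (\<Sum>i\<in>A. a i *\<^sub>R grad (f i) x)" by (rule grad_eqI)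
qed

lemma laplacian_sum_scaled:
  assumes f: "\<And>i. i \<in> A \<Longrightarrow> Ck_on 2 UNIV (f i)"
  shows "laplacian (\<lambda>x. \<Sum>i\<in>A. a i * f i x) x = (\<Sum>i\<in>A. a i * laplacian (f i) x)"
proof -
  note c = continuous_grad_laplacian[OF f]
  have "grad (\<lambda>x. \<Sum>i\<in>A. a i * f i x) = (\<lambda>x. \<Sum>i\<in>A. a i *\<^sub>R grad (f i) x)"
    by (rule ext) (rule grad_sum_scaled(2)[OF Ck_on_1_differentiable[OF c(4)]])
  moreover have "((\<lambda>x. \<Sum>i\<in>A. a i *\<^sub>R grad (f i) x) has_derivative
      (\<lambda>v. \<Sum>i\<in>A. a i *\<^sub>R frechet_derivative (grad (f i)) (at x) v)) (at x)"
  proof (intro has_derivative_sum has_derivative_scaleR_right)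
    fix i assume "i \<in> A"
    then have "grad (f i) differentiable (at x)" using Ck_on_1_differentiable[OF c(3)] by blast
    then show "(grad (f i) has_derivative frechet_derivative (grad (f i)) (at x)) (at x)"
      by (simp add: frechet_derivative_works)
  qed
  ultimately have "laplacian (\<lambda>x. \<Sum>i\<in>A. a i * f i x) x
      = (\<Sum>j\<in>UNIV. (\<Sum>i\<in>A. a i *\<^sub>R frechet_derivative (grad (f i)) (at x) (axis j 1)) $ j)"
    by (intro laplacian_eqI) simp
  also have "\<dots> = (\<Sum>j\<in>UNIV. \<Sum>i\<in>A. a i * frechet_derivative (grad (f i)) (at x) (axis j 1) $ j)" by simp
  also have "\<dots> = (\<Sum>i\<in>A. \<Sum>j\<in>UNIV. a i * frechet_derivative (grad (f i)) (at x) (axis j 1) $ j)" by (rule sum.swap)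
  finally show ?thesis by (simp add: laplacian_def divergence_def sum_distrib_left)
qed

lemma H1_L1_bound_add_scaled:
  assumes f: "H1_L1_bound B f" "Ck_on 1 UNIV f" and g: "H1_L1_bound B' g" "Ck_on 1 UNIV g"
  shows "H1_L1_bound (2 * B + (\<bar>a\<bar> + 2 * a\<^sup>2) * B') (\<lambda>x. f x + a * g x)"
proof -
  note F = f(1)[unfolded H1_L1_bound_def] and G = g(1)[unfolded H1_L1_bound_def]
  have contf: "continuous_on UNIV f" "continuous_on UNIV (grad f)"
    using Ck_on_imp_continuous_on[OF f(2)] Ck_on_imp_continuous_on[OF Ck_on_grad[of UNIV 0 f]] f(2) by auto
  have contg: "continuous_on UNIV g" "continuous_on UNIV (grad g)"
    using Ck_on_imp_continuous_on[OF g(2)] Ck_on_imp_continuous_on[OF Ck_on_grad[of UNIV 0 g]] g(2) by auto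
  have "((\<lambda>x. f x + a * g x) has_derivative (\<lambda>v. grad f x \<bullet> v + a * (grad g x \<bullet> v))) (at x)" for x
    by (intro has_derivative_add has_derivative_mult_right grad_works Ck_on_1_differentiable f g)
  then have gr: "grad (\<lambda>x. f x + a * g x) x = grad f x + a *\<^sub>R grad g x" for x
    by (intro grad_eqI) (simp add: inner_add_left)
  have L2: "in_L2 f" "in_L2 g" "in_L2 (grad f)" "in_L2 (grad g)"
    unfolding in_L2_def using contf contg F G by (auto intro!: borel_measurable_continuous_onI)
  note S = in_L2_add_scaled[OF L2(1,2), of a] and S' = in_L2_add_scaled[OF L2(3,4), of a]
  have nn: "0 \<le> B" "0 \<le> B'"
  proof -
    have "0 \<le> (\<integral>x. \<bar>f x\<bar> \<partial>lborel)" "0 \<le> (\<integral>x. \<bar>g x\<bar> \<partial>lborel)" by simp_all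
    then show "0 \<le> B" "0 \<le> B'" using F G by linarith+
  qed
  have "(\<integral>x. \<bar>f x + a * g x\<bar> \<partial>lborel) \<le> (\<integral>x. \<bar>f x\<bar> + \<bar>a\<bar> * \<bar>g x\<bar> \<partial>lborel)"
    using F G by (intro integral_mono) (auto simp: abs_mult[symmetric])
  also have "\<dots> \<le> B + \<bar>a\<bar> * B'" using F G by (auto intro!: add_mono mult_left_mono)
  finally have 1: "(\<integral>x. \<bar>f x + a * g x\<bar> \<partial>lborel) \<le> B + \<bar>a\<bar> * B'" .
  have 2: "2 * X + 2 * a\<^sup>2 * Y \<le> 2 * B + 2 * a\<^sup>2 * B'" if "X \<le> B" "Y \<le> B'" for X Y
    using that by (intro add_mono mult_left_mono) auto
  have 3: "0 \<le> \<bar>a\<bar> * B'" "0 \<le> a\<^sup>2 * B'" using nn by auto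
  have 4: "2 * B + (\<bar>a\<bar> + 2 * a\<^sup>2) * B' = 2 * B + \<bar>a\<bar> * B' + 2 * a\<^sup>2 * B'" by (simp add: algebra_simps)
  have i: "integrable lborel f" "integrable lborel g" using F G by auto
  have bf: "(\<integral>x. (f x)\<^sup>2 \<partial>lborel) \<le> B" "(\<integral>x. (norm (grad f x))\<^sup>2 \<partial>lborel) \<le> B" using F by auto
  have bg: "(\<integral>x. (g x)\<^sup>2 \<partial>lborel) \<le> B'" "(\<integral>x. (norm (grad g x))\<^sup>2 \<partial>lborel) \<le> B'" using G by auto
  show ?thesis
    unfolding H1_L1_bound_def gr 4
  proof (intro conjI)
    show "integrable lborel (\<lambda>x. f x + a * g x)" using i by simp
    show "integrable lborel (\<lambda>x. (f x + a * g x)\<^sup>2)" using S(1) by (simp add: in_L2_def)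
    show "integrable lborel (\<lambda>x. (norm (grad f x + a *\<^sub>R grad g x))\<^sup>2)" using S'(1) by (simp add: in_L2_def)
    show "(\<integral>x. \<bar>f x + a * g x\<bar> \<partial>lborel) \<le> 2 * B + \<bar>a\<bar> * B' + 2 * a\<^sup>2 * B'" using 1 3 nn by linarith
    have "(\<integral>x. (f x + a * g x)\<^sup>2 \<partial>lborel) \<le> 2 * B + 2 * a\<^sup>2 * B'"
      using order_trans[OF S(2)] 2[OF bf(1) bg(1)] by simp
    then show "(\<integral>x. (f x + a * g x)\<^sup>2 \<partial>lborel) \<le> 2 * B + \<bar>a\<bar> * B' + 2 * a\<^sup>2 * B'" using 3 by linarith
    have "(\<integral>x. (norm (grad f x + a *\<^sub>R grad g x))\<^sup>2 \<partial>lborel) \<le> 2 * B + 2 * a\<^sup>2 * B'"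
      by (rule order_trans[OF S'(2) 2[OF bf(2) bg(2)]])
    then show "(\<integral>x. (norm (grad f x + a *\<^sub>R grad g x))\<^sup>2 \<partial>lborel) \<le> 2 * B + \<bar>a\<bar> * B' + 2 * a\<^sup>2 * B'" using 3 by linarith
  qed
qed

text \<open>The set where f is negative is open and null, hence empty.\<close>

lemma AE_nonneg_continuous:
  fixes f :: "'a::euclidean_space \<Rightarrow> real"
  assumes f: "continuous_on UNIV f" and ae: "AE x in lborel. 0 \<le> f x"
  shows "0 \<le> f x"
proof (rule ccontr)
  assume x: "\<not> 0 \<le> f x"
  define S where "S = {x. f x < 0}"
  have "open S" unfolding S_def by (intro open_Collect_less f continuous_intros)
  have "S \<in> null_sets lborel"
    using ae \<open>open S\<close> by (subst AE_iff_null_sets) (auto simp: S_def not_less)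
  then have "negligible S" by (simp add: negligible_iff_null_sets null_sets_completionI)
  moreover have "x \<in> S" using x by (simp add: S_def not_le)
  ultimately show False using open_not_negligible[OF \<open>open S\<close>] by auto
qed

locale npd =
  fixes D :: real and z :: "'n::finite \<Rightarrow> real" and c :: "'n \<Rightarrow> real \<Rightarrow> real^3 \<Rightarrow> real"
    and u :: "real \<Rightarrow> real^3 \<Rightarrow> real^3" and p \<phi> :: "real \<Rightarrow> real^3 \<Rightarrow> real"
  assumes D: "D > 0" and sol: "npd_solution D z c u p \<phi>"
begin

text \<open>Such combinations cover a single species, the two charge classes and the charge density,
  so that regularity and bounds are proved once.\<close>

definition combo :: "('n \<Rightarrow> real) \<Rightarrow> real \<Rightarrow> real^3 \<Rightarrow> real" where
  "combo a t x = (\<Sum>i\<in>UNIV. a i * c i t x)"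

abbreviation \<rho> where "\<rho> \<equiv> charge z c"

lemma charge_eq: "\<rho> t = combo z t"
  by (simp add: charge_def[abs_def] combo_def[abs_def])

lemma solution_facts:
  shows c_cont: "continuous_into_H1_L1 (c i)"
    and smooth_c: "smooth_on ({0<..} \<times> UNIV) (\<lambda>(t, x). c i t x)"
    and smooth_u: "smooth_on ({0<..} \<times> UNIV) (\<lambda>(t, x). u t x)"
    and smooth_\<phi>: "smooth_on ({0<..} \<times> UNIV) (\<lambda>(t, x). \<phi> t x)"
    and newton: "t > 0 \<Longrightarrow> \<phi> t = newton_potential (\<rho> t)"
    and leray: "t > 0 \<Longrightarrow> leray_projection (\<lambda>x. \<rho> t x *\<^sub>R grad (\<phi> t) x) (\<lambda>x. - u t x)"
    and Nernst_Planck: "t > 0 \<Longrightarrow> deriv (\<lambda>s. c i s x) t + u t x \<bullet> grad (c i t) x - D * laplacian (c i t) x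
             - z i * D * divergence (\<lambda>y. c i t y *\<^sub>R grad (\<phi> t) y) x = 0"
    and div_u: "t > 0 \<Longrightarrow> divergence (u t) x = 0"
    and Poisson: "t > 0 \<Longrightarrow> - laplacian (\<phi> t) x = \<rho> t x"
  using sol[unfolded npd_solution_def] by blast+

lemma c_Ck: "t > 0 \<Longrightarrow> Ck_on k UNIV (c i t)"
  and u_Ck: "t > 0 \<Longrightarrow> Ck_on k UNIV (u t)"
  and \<phi>_Ck: "t > 0 \<Longrightarrow> Ck_on k UNIV (\<phi> t)"
  by (rule Ck_slice[OF smooth_c], assumption, rule Ck_slice[OF smooth_u], assumption,
      rule Ck_slice[OF smooth_\<phi>], assumption)

lemma combo_Ck: "t > 0 \<Longrightarrow> Ck_on k UNIV (combo a t)"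
  unfolding combo_def[abs_def] by (intro Ck_on_sum Ck_on_mult Ck_on_const c_Ck) auto

lemma combo_smooth: "smooth_on ({0<..} \<times> UNIV) (\<lambda>(t, x). combo a t x)"
proof -
  have "Ck_on k ({0<..} \<times> UNIV) (\<lambda>q. \<Sum>i\<in>UNIV. a i * (\<lambda>(t, x). c i t x) q)" for k
    using smooth_c by (intro Ck_on_sum Ck_on_mult Ck_on_const) (auto simp: smooth_on_def open_Times)
  moreover have "(\<lambda>q. \<Sum>i\<in>UNIV. a i * (\<lambda>(t, x). c i t x) q) = (\<lambda>(t, x). combo a t x)"
    by (auto simp: combo_def)
  ultimately show ?thesis by (simp add: smooth_on_def)
qed

lemma combo_bounded:
  obtains B where "\<And>t. 0 < t \<Longrightarrow> t \<le> T \<Longrightarrow> H1_L1_bound B (combo a t)"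
proof -
  have "\<exists>B. \<forall>t. 0 < t \<and> t \<le> T \<longrightarrow> H1_L1_bound B (\<lambda>x. \<Sum>i\<in>A. a i * c i t x)" for A :: "'n set"
  proof (induction A rule: infinite_finite_induct)
    case empty
    have "grad (\<lambda>x. 0) x = 0" for x by (rule grad_eqI) simp
    then show ?case by (intro exI[of _ 0]) (simp add: H1_L1_bound_def)
  next
    case (insert i A)
    from insert(3) obtain B where B: "\<And>t. 0 < t \<Longrightarrow> t \<le> T \<Longrightarrow> H1_L1_bound B (\<lambda>x. \<Sum>i\<in>A. a i * c i t x)" by blast
    obtain B' where B': "\<And>t. 0 < t \<Longrightarrow> t \<le> T \<Longrightarrow> H1_L1_bound B' (c i t)"
      using continuous_into_H1_L1_locally_bounded[OF c_cont c_Ck] by blast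
    have "H1_L1_bound (2 * B + (\<bar>a i\<bar> + 2 * (a i)\<^sup>2) * B') (\<lambda>x. (\<Sum>i\<in>A. a i * c i t x) + a i * c i t x)"
      if "0 < t" "t \<le> T" for t
      using that by (intro H1_L1_bound_add_scaled B B' c_Ck Ck_on_sum Ck_on_mult Ck_on_const) auto
    then show ?case using insert(1,2)
      by (intro exI[of _ "2 * B + (\<bar>a i\<bar> + 2 * (a i)\<^sup>2) * B'"]) (simp add: add.commute)
  qed auto
  from this[of UNIV] show ?thesis using that unfolding combo_def[abs_def] by blast
qed

text \<open>The coefficients live on species of one valence \<zeta>, so their drifts agree and the
  combination again solves a scalar drift-diffusion equation. The number k is a threshold rather
  than a value, so that both charge classes can be given the same constants.\<close>

lemma drift_diffusion_combo:
  assumes a: "\<And>i. a i * z i = \<zeta> * a i"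
  obtains k where "\<And>M Q K. k \<le> M \<Longrightarrow> k \<le> Q \<Longrightarrow> k \<le> K \<Longrightarrow> drift_diffusion D \<zeta> T M Q K (combo a) \<phi> \<rho> u"
proof -
  obtain Ba where Ba: "\<And>t. 0 < t \<Longrightarrow> t \<le> T \<Longrightarrow> H1_L1_bound Ba (combo a t)" by (rule combo_bounded) blast
  obtain Bz where Bz: "\<And>t. 0 < t \<Longrightarrow> t \<le> T \<Longrightarrow> H1_L1_bound Bz (combo z t)" by (rule combo_bounded) blast
  obtain K0 where K0: "\<And>B \<rho> x y. Ck_on 1 UNIV \<rho> \<Longrightarrow> H1_L1_bound B \<rho> \<Longrightarrow>
    \<bar>newton_potential \<rho> x - newton_potential \<rho> y\<bar> \<le> (3 * B + K0) * norm (x - y)" by (rule newton_potential_Lipschitz) blast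
  define K1 where "K1 = 3 * Bz + K0"
  define Q1 where "Q1 = (Ba + K1\<^sup>2 * Bz) / 2"
  have gphi: "norm (grad (\<phi> t) x) \<le> K1" if t: "0 < t" "t \<le> T" for t x
  proof (rule norm_grad_le_Lipschitz)
    show "\<phi> t differentiable (at x)" by (rule Ck_on_1_differentiable[OF \<phi>_Ck[OF t(1)]])
    have "\<phi> t = newton_potential (combo z t)" using newton[OF t(1)] by (simp only: charge_eq)
    then show "\<bar>\<phi> t x - \<phi> t y\<bar> \<le> K1 * norm (x - y)" for y
      using K0[OF combo_Ck[OF t(1)] Bz[OF t]] by (simp add: K1_def)
  qed
  have u2: "integrable lborel (\<lambda>x. (norm (u t x))\<^sup>2) \<and> (\<integral>x. (norm (u t x))\<^sup>2 \<partial>lborel) \<le> K1\<^sup>2 * Bz" if t: "0 < t" "t \<le> T" for t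
  proof -
    define F where "F x = combo z t x *\<^sub>R grad (\<phi> t) x" for x
    have l: "leray_projection F (\<lambda>x. - u t x)" using leray[OF t(1)] by (simp only: charge_eq F_def[abs_def])
    then have F: "in_L2 F" and s: "solenoidal_L2 (\<lambda>x. - u t x)" by (auto simp: leray_projection_def)
    then have um: "u t \<in> borel_measurable borel" and ui: "integrable lborel (\<lambda>x. (norm (u t x))\<^sup>2)"
      by (auto simp: solenoidal_L2_def in_L2_def)
    have Fi: "integrable lborel (\<lambda>x. (norm (F x))\<^sup>2)" using F by (simp add: in_L2_def)
    have [measurable]: "u t \<in> borel_measurable borel" "F \<in> borel_measurable borel" using um F by (auto simp: in_L2_def)
    have Fu: "integrable lborel (\<lambda>x. F x \<bullet> u t x)"
    proof (rule Bochner_Integration.integrable_bound)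
      show "integrable lborel (\<lambda>x. norm (F x) * norm (u t x))"
        using Fi ui by (intro integrable_mult_of_squares) auto
      show "AE x in lborel. norm (F x \<bullet> u t x) \<le> norm (norm (F x) * norm (u t x))"
        using Cauchy_Schwarz_ineq2 by auto
    qed simp
    \<comment> \<open>The projection is itself divergence-free and may serve as the test field. This
      yields that the integral of |u|^2 is minus that of F . u, hence that projecting does not
      increase the L^2 norm.\<close>
    have "(\<integral>x. (F x - (- u t x)) \<bullet> (- u t x) \<partial>lborel) = 0" using l s unfolding leray_projection_def by blast
    moreover have "(F x - (- u t x)) \<bullet> (- u t x) = - (F x \<bullet> u t x) - (norm (u t x))\<^sup>2" for x
      by (simp add: inner_add_left power2_norm_eq_inner)
    ultimately have "(\<integral>x. - (F x \<bullet> u t x) - (norm (u t x))\<^sup>2 \<partial>lborel) = 0" by (simp only:)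
    then have e: "(\<integral>x. (norm (u t x))\<^sup>2 \<partial>lborel) = - (\<integral>x. F x \<bullet> u t x \<partial>lborel)"
      using Fu ui by simp
    have "- (\<integral>x. F x \<bullet> u t x \<partial>lborel) = (\<integral>x. - (F x \<bullet> u t x) \<partial>lborel)" by simp
    also have "\<dots> \<le> (\<integral>x. ((norm (F x))\<^sup>2 + (norm (u t x))\<^sup>2) / 2 \<partial>lborel)"
    proof (rule integral_mono)
      fix x
      have "- (F x \<bullet> u t x) \<le> norm (F x) * norm (u t x)" using Cauchy_Schwarz_ineq2[of "F x" "u t x"] by linarith
      then show "- (F x \<bullet> u t x) \<le> ((norm (F x))\<^sup>2 + (norm (u t x))\<^sup>2) / 2"
        using sum_squares_bound[of "norm (F x)" "norm (u t x)"] by simp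
    qed (use Fu Fi ui in auto)
    also have "\<dots> = ((\<integral>x. (norm (F x))\<^sup>2 \<partial>lborel) + (\<integral>x. (norm (u t x))\<^sup>2 \<partial>lborel)) / 2" using Fi ui by simp
    finally have "(\<integral>x. (norm (u t x))\<^sup>2 \<partial>lborel) \<le> (\<integral>x. (norm (F x))\<^sup>2 \<partial>lborel)" using e by simp
    also have "\<dots> \<le> (\<integral>x. K1\<^sup>2 * (combo z t x)\<^sup>2 \<partial>lborel)"
    proof (rule integral_mono)
      show "integrable lborel (\<lambda>x. K1\<^sup>2 * (combo z t x)\<^sup>2)" using Bz[OF t] by (simp add: H1_L1_bound_def)
      fix x
      have "(norm (grad (\<phi> t) x))\<^sup>2 \<le> K1\<^sup>2" by (intro power_mono gphi t) auto
      then show "(norm (F x))\<^sup>2 \<le> K1\<^sup>2 * (combo z t x)\<^sup>2"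
        using mult_left_mono[of "(norm (grad (\<phi> t) x))\<^sup>2" "K1\<^sup>2" "(combo z t x)\<^sup>2"]
        by (simp add: F_def power_mult_distrib mult.commute)
    qed (rule Fi)
    also have "\<dots> \<le> K1\<^sup>2 * Bz" using Bz[OF t] by (auto simp: H1_L1_bound_def intro: mult_left_mono)
    finally show ?thesis using ui by simp
  qed
  have cu: "integrable lborel (\<lambda>x. \<bar>combo a t x\<bar> * norm (u t x)) \<and> (\<integral>x. \<bar>combo a t x\<bar> * norm (u t x) \<partial>lborel) \<le> Q1"
    if t: "0 < t" "t \<le> T" for t
  proof -
    have [measurable]: "combo a t \<in> borel_measurable borel" "u t \<in> borel_measurable borel"
      using Ck_on_imp_continuous_on[OF combo_Ck[OF t(1)]] Ck_on_imp_continuous_on[OF u_Ck[OF t(1)]]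
      by (auto intro: borel_measurable_continuous_onI)
    have ci: "integrable lborel (\<lambda>x. (combo a t x)\<^sup>2)" "(\<integral>x. (combo a t x)\<^sup>2 \<partial>lborel) \<le> Ba"
      using Ba[OF t] by (auto simp: H1_L1_bound_def)
    have i: "integrable lborel (\<lambda>x. \<bar>combo a t x\<bar> * norm (u t x))"
      using ci u2[OF t] by (intro integrable_mult_of_squares) auto
    have "(\<integral>x. \<bar>combo a t x\<bar> * norm (u t x) \<partial>lborel) \<le> (\<integral>x. ((combo a t x)\<^sup>2 + (norm (u t x))\<^sup>2) / 2 \<partial>lborel)"
    proof (rule integral_mono[OF i])
      show "\<bar>combo a t x\<bar> * norm (u t x) \<le> ((combo a t x)\<^sup>2 + (norm (u t x))\<^sup>2) / 2" for x
        using sum_squares_bound[of "\<bar>combo a t x\<bar>" "norm (u t x)"] by simp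
    qed (use ci u2[OF t] in auto)
    also have "\<dots> = ((\<integral>x. (combo a t x)\<^sup>2 \<partial>lborel) + (\<integral>x. (norm (u t x))\<^sup>2 \<partial>lborel)) / 2" using ci u2[OF t] by simp
    also have "\<dots> \<le> Q1" unfolding Q1_def using ci u2[OF t] by (intro divide_right_mono add_mono) auto
    finally show ?thesis using i by blast
  qed
  have eq: "deriv (\<lambda>s. combo a s x) t = D * laplacian (combo a t) x - u t x \<bullet> grad (combo a t) x
      + \<zeta> * D * (grad (combo a t) x \<bullet> grad (\<phi> t) x - combo a t x * \<rho> t x)" if t: "0 < t" for t x
  proof -
    note d = Ck_on_1_differentiable
    have lap: "laplacian (\<phi> t) x = - \<rho> t x" using Poisson[OF t, of x] by simp
    note e = Nernst_Planck[OF t, of _ x]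
    have dv: "divergence (\<lambda>y. c i t y *\<^sub>R grad (\<phi> t) y) x = grad (c i t) x \<bullet> grad (\<phi> t) x - c i t x * \<rho> t x" for i
      using divergence_scaleR[OF d[OF c_Ck[OF t]] d[OF continuous_grad_laplacian(3)[OF \<phi>_Ck[OF t]]], of i x]
      by (simp add: lap laplacian_def[symmetric])
    have ds: "((\<lambda>s. c i s x) has_real_derivative deriv (\<lambda>s. c i s x) t) (at t)" for i
      by (rule slice_time_derivative(1)[OF smooth_c t])
    have "((\<lambda>s. combo a s x) has_real_derivative (\<Sum>i\<in>UNIV. a i * deriv (\<lambda>s. c i s x) t)) (at t)"
      unfolding combo_def by (intro DERIV_sum DERIV_cmult ds)
    then have 1: "deriv (\<lambda>s. combo a s x) t = (\<Sum>i\<in>UNIV. a i * deriv (\<lambda>s. c i s x) t)" by (rule DERIV_imp_deriv)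
    have 2: "grad (combo a t) x = (\<Sum>i\<in>UNIV. a i *\<^sub>R grad (c i t) x)"
      unfolding combo_def[abs_def] by (rule grad_sum_scaled(2)) (rule d[OF c_Ck[OF t]])
    have 3: "laplacian (combo a t) x = (\<Sum>i\<in>UNIV. a i * laplacian (c i t) x)"
      unfolding combo_def[abs_def] by (rule laplacian_sum_scaled) (rule c_Ck[OF t])
    have "a i * deriv (\<lambda>s. c i s x) t = D * (a i * laplacian (c i t) x) - a i * (u t x \<bullet> grad (c i t) x)
        + \<zeta> * D * (a i * (grad (c i t) x \<bullet> grad (\<phi> t) x) - a i * c i t x * \<rho> t x)" for i
    proof -
      have "deriv (\<lambda>s. c i s x) t = D * laplacian (c i t) x - u t x \<bullet> grad (c i t) x
          + z i * D * (grad (c i t) x \<bullet> grad (\<phi> t) x - c i t x * \<rho> t x)"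
        using e[of i] unfolding dv by linarith
      then have "a i * deriv (\<lambda>s. c i s x) t = D * (a i * laplacian (c i t) x) - a i * (u t x \<bullet> grad (c i t) x)
          + (a i * z i) * D * (grad (c i t) x \<bullet> grad (\<phi> t) x - c i t x * \<rho> t x)"
        by algebra
      then show ?thesis unfolding a by (simp add: algebra_simps)
    qed
    then show ?thesis
      unfolding 1 2 3 unfolding combo_def
      by (simp add: sum.distrib sum_subtractf sum_distrib_left sum_distrib_right inner_sum_left inner_sum_right right_diff_distrib)
  qed
  define k where "k = max (max Ba Bz) (max Q1 K1)"
  have k: "Ba \<le> k" "Bz \<le> k" "Q1 \<le> k" "K1 \<le> k" by (auto simp: k_def)
  show ?thesis
  proof (rule that[of k])
    fix M Q K :: real assume MQK: "k \<le> M" "k \<le> Q" "k \<le> K"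
    show "drift_diffusion D \<zeta> T M Q K (combo a) \<phi> \<rho> u"
    proof
      show "D > 0" by (rule D)
      show "smooth_on ({0<..} \<times> UNIV) (\<lambda>(t, x). combo a t x)" by (rule combo_smooth)
      show "Ck_on 2 UNIV (\<phi> t)" "Ck_on 1 UNIV (u t)" if "0 < t" for t
        by (rule \<phi>_Ck[OF that], rule u_Ck[OF that])
      show "divergence (u t) x = 0" if "0 < t" for t x by (rule div_u[OF that])
      show "laplacian (\<phi> t) x = - \<rho> t x" if "0 < t" for t x
        using Poisson[OF that, of x] by simp
    next
      fix t assume t: "0 < t" "t \<le> T"
      note A = Ba[OF t, unfolded H1_L1_bound_def] and Z = Bz[OF t, unfolded H1_L1_bound_def]
      show "integrable lborel (combo a t)" "(\<integral>x. \<bar>combo a t x\<bar> \<partial>lborel) \<le> M" using A k MQK by auto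
      show "integrable lborel (\<rho> t)" "(\<integral>x. \<bar>\<rho> t x\<bar> \<partial>lborel) \<le> M" using Z k MQK unfolding charge_eq by auto
      show "integrable lborel (\<lambda>x. \<bar>combo a t x\<bar> * norm (u t x))" "(\<integral>x. \<bar>combo a t x\<bar> * norm (u t x) \<partial>lborel) \<le> Q"
        using cu[OF t] k MQK by auto
      show "norm (grad (\<phi> t) x) \<le> K" for x using gphi[OF t, of x] k MQK by auto
    qed (rule eq)
  qed
qed

end

section \<open>Continuity of integrals at the initial time\<close>

lemma tendsto_integral_mult_of_L1:
  fixes f :: "real \<Rightarrow> real^3 \<Rightarrow> real"
  assumes lim: "((\<lambda>s. \<integral>x. \<bar>f s x - h x\<bar> \<partial>lborel) \<longlongrightarrow> 0) (at_right 0)"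
    and int: "\<And>s. s > 0 \<Longrightarrow> integrable lborel (f s)" "integrable lborel h"
    and w: "w \<in> borel_measurable borel" "\<And>x. \<bar>w x\<bar> \<le> b"
  shows "((\<lambda>s. \<integral>x. w x * f s x \<partial>lborel) \<longlongrightarrow> (\<integral>x. w x * h x \<partial>lborel)) (at_right 0)"
proof -
  have wi: "integrable lborel (\<lambda>x. w x * q x)" if "integrable lborel q" for q
  proof (rule Bochner_Integration.integrable_bound[OF integrable_mult_right[OF that, of b]])
    have [measurable]: "q \<in> borel_measurable borel" "w \<in> borel_measurable borel" using that w by auto
    show "(\<lambda>x. w x * q x) \<in> borel_measurable lborel" by measurable
    have "\<bar>w x\<bar> \<le> \<bar>b\<bar>" for x using w(2)[of x] by linarith
    then show "AE x in lborel. norm (w x * q x) \<le> norm (b * q x)"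
      by (auto simp: abs_mult intro!: AE_I2 mult_right_mono)
  qed
  have "((\<lambda>s. (\<integral>x. w x * f s x \<partial>lborel) - (\<integral>x. w x * h x \<partial>lborel)) \<longlongrightarrow> 0) (at_right 0)"
  proof (rule Lim_null_comparison)
    show "((\<lambda>s. b * (\<integral>x. \<bar>f s x - h x\<bar> \<partial>lborel)) \<longlongrightarrow> 0) (at_right 0)"
      by (intro tendsto_mult_right_zero lim)
    have "norm ((\<integral>x. w x * f s x \<partial>lborel) - (\<integral>x. w x * h x \<partial>lborel)) \<le> b * (\<integral>x. \<bar>f s x - h x\<bar> \<partial>lborel)" if s: "s > 0" for s
    proof -
      have d: "integrable lborel (\<lambda>x. f s x - h x)" using int s by simp
      have "(\<integral>x. w x * f s x \<partial>lborel) - (\<integral>x. w x * h x \<partial>lborel) = (\<integral>x. w x * (f s x - h x) \<partial>lborel)"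
        using wi[OF int(1)[OF s]] wi[OF int(2)] by (simp add: right_diff_distrib)
      also have "norm \<dots> \<le> (\<integral>x. norm (w x * (f s x - h x)) \<partial>lborel)" by (rule integral_norm_bound)
      also have "\<dots> \<le> (\<integral>x. b * \<bar>f s x - h x\<bar> \<partial>lborel)"
      proof (rule integral_mono)
        show "integrable lborel (\<lambda>x. norm (w x * (f s x - h x)))" using wi[OF d] by (rule integrable_norm)
        show "integrable lborel (\<lambda>x. b * \<bar>f s x - h x\<bar>)" using d by simp
        show "norm (w x * (f s x - h x)) \<le> b * \<bar>f s x - h x\<bar>" for x
          using w(2)[of x] by (simp add: abs_mult mult_right_mono)
      qed
      finally show ?thesis by simp
    qed
    then show "\<forall>\<^sub>F s in at_right 0. norm ((\<integral>x. w x * f s x \<partial>lborel) - (\<integral>x. w x * h x \<partial>lborel)) \<le> b * (\<integral>x. \<bar>f s x - h x\<bar> \<partial>lborel)"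
      by (auto simp: eventually_at_filter)
  qed
  then show ?thesis by (rule LIM_zero_cancel)
qed

lemma tendsto_integral_abs_of_L1:
  fixes f :: "real \<Rightarrow> real^3 \<Rightarrow> real"
  assumes lim: "((\<lambda>s. \<integral>x. \<bar>f s x - h x\<bar> \<partial>lborel) \<longlongrightarrow> 0) (at_right 0)"
    and int: "\<And>s. s > 0 \<Longrightarrow> integrable lborel (f s)" "integrable lborel h"
  shows "((\<lambda>s. \<integral>x. \<bar>f s x\<bar> \<partial>lborel) \<longlongrightarrow> (\<integral>x. \<bar>h x\<bar> \<partial>lborel)) (at_right 0)"
proof -
  have "((\<lambda>s. (\<integral>x. \<bar>f s x\<bar> \<partial>lborel) - (\<integral>x. \<bar>h x\<bar> \<partial>lborel)) \<longlongrightarrow> 0) (at_right 0)"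
  proof (rule Lim_null_comparison[OF _ lim])
    have "norm ((\<integral>x. \<bar>f s x\<bar> \<partial>lborel) - (\<integral>x. \<bar>h x\<bar> \<partial>lborel)) \<le> (\<integral>x. \<bar>f s x - h x\<bar> \<partial>lborel)" if s: "s > 0" for s
    proof -
      have "(\<integral>x. \<bar>f s x\<bar> \<partial>lborel) - (\<integral>x. \<bar>h x\<bar> \<partial>lborel) = (\<integral>x. \<bar>f s x\<bar> - \<bar>h x\<bar> \<partial>lborel)"
        using int s by simp
      also have "norm \<dots> \<le> (\<integral>x. norm (\<bar>f s x\<bar> - \<bar>h x\<bar>) \<partial>lborel)" by (rule integral_norm_bound)
      also have "\<dots> \<le> (\<integral>x. \<bar>f s x - h x\<bar> \<partial>lborel)"
        using int s by (intro integral_mono) auto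
      finally show ?thesis .
    qed
    then show "\<forall>\<^sub>F s in at_right 0. norm ((\<integral>x. \<bar>f s x\<bar> \<partial>lborel) - (\<integral>x. \<bar>h x\<bar> \<partial>lborel)) \<le> (\<integral>x. \<bar>f s x - h x\<bar> \<partial>lborel)"
      by (auto simp: eventually_at_filter)
  qed
  then show ?thesis by (rule LIM_zero_cancel)
qed

lemma tendsto_integral_square_of_L2:
  fixes f :: "real \<Rightarrow> real^3 \<Rightarrow> real"
  assumes lim: "((\<lambda>s. \<integral>x. (f s x - h x)\<^sup>2 \<partial>lborel) \<longlongrightarrow> 0) (at_right 0)"
    and L2: "\<And>s. s > 0 \<Longrightarrow> in_L2 (f s)" "in_L2 h"
  shows "((\<lambda>s. \<integral>x. (f s x)\<^sup>2 \<partial>lborel) \<longlongrightarrow> (\<integral>x. (h x)\<^sup>2 \<partial>lborel)) (at_right 0)"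
proof -
  define d where "d s = (\<integral>x. (f s x - h x)\<^sup>2 \<partial>lborel)" for s
  \<comment> \<open>The weight in Young's inequality 2 |a h| <= q h^2 + a^2 / q. It is about the
    square root of \<open>d\<close>, so that both terms tend to 0; the summand s keeps it positive
    even where \<open>d\<close> vanishes.\<close>
  define q where "q s = sqrt (d s) + s" for s
  define H where "H = (\<integral>x. (h x)\<^sup>2 \<partial>lborel)"
  have d0: "d s \<ge> 0" for s unfolding d_def by simp
  have dl: "(d \<longlongrightarrow> 0) (at_right 0)" using lim by (simp add: d_def[abs_def])
  have "(q \<longlongrightarrow> sqrt 0 + 0) (at_right 0)" unfolding q_def
    by (intro tendsto_intros dl)
  then have ql: "(q \<longlongrightarrow> 0) (at_right 0)" by simp
  have h2: "integrable lborel (\<lambda>x. (h x)\<^sup>2)" using L2(2) by (simp add: in_L2_def)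
  have "((\<lambda>s. (\<integral>x. (f s x)\<^sup>2 \<partial>lborel) - H) \<longlongrightarrow> 0) (at_right 0)"
  proof (rule Lim_null_comparison)
    show "((\<lambda>s. d s + q s * H + q s) \<longlongrightarrow> 0) (at_right 0)"
      by (intro tendsto_add_zero tendsto_mult_left_zero dl ql)
    have "norm ((\<integral>x. (f s x)\<^sup>2 \<partial>lborel) - H) \<le> d s + q s * H + q s" if s: "s > 0" for s
    proof -
      have q: "q s > 0" using s d0[of s] by (simp add: q_def add_nonneg_pos)
      have f2: "integrable lborel (\<lambda>x. (f s x)\<^sup>2)" using L2(1)[OF s] by (simp add: in_L2_def)
      have "in_L2 (\<lambda>x. f s x - h x)" using in_L2_add_scaled(1)[OF L2(1)[OF s] L2(2), of "-1"] by simp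
      then have d2: "integrable lborel (\<lambda>x. (f s x - h x)\<^sup>2)" by (simp add: in_L2_def)
      have pt: "\<bar>(f s x)\<^sup>2 - (h x)\<^sup>2\<bar> \<le> (f s x - h x)\<^sup>2 + (q s * (h x)\<^sup>2 + (f s x - h x)\<^sup>2 / q s)" for x
      proof -
        define a where "a = f s x - h x"
        have "(f s x)\<^sup>2 - (h x)\<^sup>2 = a\<^sup>2 + 2 * a * h x" by (simp add: a_def power2_eq_square algebra_simps)
        moreover have "2 * (\<bar>a\<bar> * \<bar>h x\<bar>) \<le> q s * (h x)\<^sup>2 + a\<^sup>2 / q s"
        proof -
          have "0 \<le> (q s * \<bar>h x\<bar> - \<bar>a\<bar>)\<^sup>2 / q s" using q by simp
          also have "\<dots> = q s * (h x)\<^sup>2 + a\<^sup>2 / q s - 2 * (\<bar>a\<bar> * \<bar>h x\<bar>)"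
            using q by (simp add: power2_diff power_mult_distrib field_simps power2_eq_square)
          finally show ?thesis by simp
        qed
        moreover have "\<bar>2 * a * h x\<bar> = 2 * (\<bar>a\<bar> * \<bar>h x\<bar>)" by (simp add: abs_mult)
        moreover have "0 \<le> a\<^sup>2" by simp
        ultimately show ?thesis unfolding a_def[symmetric] by linarith
      qed
      have "(\<integral>x. (f s x)\<^sup>2 \<partial>lborel) - H = (\<integral>x. (f s x)\<^sup>2 - (h x)\<^sup>2 \<partial>lborel)" using f2 h2 by (simp add: H_def)
      also have "norm \<dots> \<le> (\<integral>x. norm ((f s x)\<^sup>2 - (h x)\<^sup>2) \<partial>lborel)" by (rule integral_norm_bound)
      also have "\<dots> \<le> (\<integral>x. (f s x - h x)\<^sup>2 + (q s * (h x)\<^sup>2 + (f s x - h x)\<^sup>2 / q s) \<partial>lborel)"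
        using f2 h2 d2 pt by (intro integral_mono) auto
      also have "\<dots> = d s + (q s * H + d s / q s)" using h2 d2 by (simp add: d_def H_def)
      also have "d s / q s \<le> q s"
      proof -
        have "sqrt (d s) * sqrt (d s) \<le> q s * q s" using s d0[of s] by (intro mult_mono) (auto simp: q_def)
        then show ?thesis using q d0[of s] by (simp add: pos_divide_le_eq)
      qed
      finally show ?thesis by simp
    qed
    then show "\<forall>\<^sub>F s in at_right 0. norm ((\<integral>x. (f s x)\<^sup>2 \<partial>lborel) - H) \<le> d s + q s * H + q s"
      by (auto simp: eventually_at_filter)
  qed
  then show ?thesis unfolding H_def by (rule LIM_zero_cancel)
qed

context npd
begin

lemma c_L1: "t \<ge> 0 \<Longrightarrow> integrable lborel (c i t)"
  and c_H1: "t \<ge> 0 \<Longrightarrow> in_H1 (c i t)"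
  using c_cont[of i] by (auto simp: continuous_into_H1_L1_def in_L1_def)

lemma c_L2: "t \<ge> 0 \<Longrightarrow> in_L2 (c i t)"
  using c_H1[of t i] by (auto simp: in_H1_def weak_grad_def)

lemma combo_L1: "t \<ge> 0 \<Longrightarrow> integrable lborel (combo a t)"
  unfolding combo_def[abs_def] using c_L1 by (intro Bochner_Integration.integrable_sum integrable_mult_right) auto

lemma combo_single: "combo (\<lambda>j. if j = i then 1 else 0) t = c i t"
proof (rule ext)
  fix x
  have "(if j = i then 1 else 0) * c j t x = (if j = i then c j t x else 0)" for j by simp
  then show "combo (\<lambda>j. if j = i then 1 else 0) t x = c i t x" by (simp add: combo_def)
qed

lemma sq_sum_le:
  fixes a b :: "'n \<Rightarrow> real"
  assumes a: "\<And>i. \<bar>a i\<bar> \<le> 1"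
  shows "(\<Sum>i\<in>UNIV. a i * b i)\<^sup>2 \<le> real CARD('n) * (\<Sum>i\<in>UNIV. (b i)\<^sup>2)"
proof -
  have "(\<Sum>i\<in>UNIV. a i * b i)\<^sup>2 \<le> (\<Sum>i\<in>UNIV. (a i * b i)\<^sup>2) * real CARD('n)"
    by (rule sum_squared_le_sum_of_squares)
  also have "\<dots> \<le> (\<Sum>i\<in>UNIV. (b i)\<^sup>2) * real CARD('n)"
  proof (intro mult_right_mono sum_mono)
    fix i
    have "\<bar>a i\<bar>\<^sup>2 \<le> 1\<^sup>2" using a by (intro power_mono) auto
    then have "(a i)\<^sup>2 * (b i)\<^sup>2 \<le> 1 * (b i)\<^sup>2" by (intro mult_right_mono) auto
    then show "(a i * b i)\<^sup>2 \<le> (b i)\<^sup>2" by (simp add: power_mult_distrib)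
  qed auto
  finally show ?thesis by (simp add: mult.commute)
qed

lemma combo_L2: "t \<ge> 0 \<Longrightarrow> in_L2 (combo a t)"
proof -
  assume t: "t \<ge> 0"
  have "in_L2 (\<lambda>x. \<Sum>i\<in>A. a i * c i t x)" for A :: "'n set"
  proof (induction A rule: infinite_finite_induct)
    case (insert i A)
    have "in_L2 (\<lambda>x. (\<Sum>i\<in>A. a i * c i t x) + a i *\<^sub>R c i t x)"
      by (rule in_L2_add_scaled(1)[OF insert(3) c_L2[OF t]])
    then show ?case using insert(1,2) by (simp add: add.commute)
  qed (simp_all add: in_L2_def)
  then show ?thesis by (simp add: combo_def[abs_def])
qed

lemma combo_square_tendsto:
  assumes a: "\<And>i. \<bar>a i\<bar> \<le> 1"
  shows "((\<lambda>s. \<integral>x. (combo a s x)\<^sup>2 \<partial>lborel) \<longlongrightarrow> (\<integral>x. (combo a 0 x)\<^sup>2 \<partial>lborel)) (at_right 0)"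
proof (rule tendsto_integral_square_of_L2)
  show "in_L2 (combo a s)" if "s > 0" for s using that by (intro combo_L2) simp
  show "in_L2 (combo a 0)" by (intro combo_L2) simp
  have di: "integrable lborel (\<lambda>x. (c i s x - c i 0 x)\<^sup>2)" if "s > 0" for i s
    using in_L2_add_scaled(1)[OF c_L2[of s i] c_L2[of 0 i], of "-1"] that by (simp add: in_L2_def)
  show "((\<lambda>s. \<integral>x. (combo a s x - combo a 0 x)\<^sup>2 \<partial>lborel) \<longlongrightarrow> 0) (at_right 0)"
  proof (rule Lim_null_comparison)
    have "((\<lambda>s. real CARD('n) * (\<Sum>i\<in>UNIV. \<integral>x. (c i s x - c i 0 x)\<^sup>2 \<partial>lborel)) \<longlongrightarrow> real CARD('n) * (\<Sum>i\<in>(UNIV :: 'n set). 0)) (at_right 0)"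
      by (intro tendsto_intros continuous_into_H1_L1_at_0(2) c_cont)
    then show "((\<lambda>s. real CARD('n) * (\<Sum>i\<in>UNIV. \<integral>x. (c i s x - c i 0 x)\<^sup>2 \<partial>lborel)) \<longlongrightarrow> 0) (at_right 0)" by simp
    have "norm (\<integral>x. (combo a s x - combo a 0 x)\<^sup>2 \<partial>lborel) \<le> real CARD('n) * (\<Sum>i\<in>UNIV. \<integral>x. (c i s x - c i 0 x)\<^sup>2 \<partial>lborel)" if s: "s > 0" for s
    proof -
      have "(\<integral>x. (combo a s x - combo a 0 x)\<^sup>2 \<partial>lborel) \<le> (\<integral>x. real CARD('n) * (\<Sum>i\<in>UNIV. (c i s x - c i 0 x)\<^sup>2) \<partial>lborel)"
      proof (rule integral_mono')
        show "integrable lborel (\<lambda>x. real CARD('n) * (\<Sum>i\<in>UNIV. (c i s x - c i 0 x)\<^sup>2))" using di[OF s] by simp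
        show "(combo a s x - combo a 0 x)\<^sup>2 \<le> real CARD('n) * (\<Sum>i\<in>UNIV. (c i s x - c i 0 x)\<^sup>2)" for x
          using sq_sum_le[of a "\<lambda>i. c i s x - c i 0 x"] a
          by (simp add: combo_def right_diff_distrib sum_subtractf)
      qed (auto intro!: mult_nonneg_nonneg sum_nonneg)
      then show ?thesis using di[OF s] by simp
    qed
    then show "\<forall>\<^sub>F s in at_right 0. norm (\<integral>x. (combo a s x - combo a 0 x)\<^sup>2 \<partial>lborel) \<le> real CARD('n) * (\<Sum>i\<in>UNIV. \<integral>x. (c i s x - c i 0 x)\<^sup>2 \<partial>lborel)"
      by (auto simp: eventually_at_filter)
  qed
qed

lemma drift_diffusion_single:
  obtains M Q K where "drift_diffusion D (z i) T M Q K (c i) \<phi> \<rho> u"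
proof -
  obtain k where k: "\<And>M Q K. k \<le> M \<Longrightarrow> k \<le> Q \<Longrightarrow> k \<le> K \<Longrightarrow>
      drift_diffusion D (z i) T M Q K (combo (\<lambda>j. if j = i then 1 else 0)) \<phi> \<rho> u"
    by (rule drift_diffusion_combo[of "\<lambda>j. if j = i then 1 else 0" "z i" T]) auto
  have "combo (\<lambda>j. if j = i then 1 else 0) = c i" by (rule ext) (rule combo_single)
  then show ?thesis using k[of k k k] that by simp
qed

lemma mass: "t \<ge> 0 \<Longrightarrow> (\<integral>x. c i t x \<partial>lborel) = (\<integral>x. c i 0 x \<partial>lborel)"
proof (cases "t = 0")
  case False
  assume "t \<ge> 0"
  then have t: "t > 0" using False by simp
  obtain M Q K where dd: "drift_diffusion D (z i) t M Q K (c i) \<phi> \<rho> u" by (rule drift_diffusion_single)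
  have "((\<lambda>s. \<integral>x. 1 * c i s x \<partial>lborel) \<longlongrightarrow> (\<integral>x. 1 * c i 0 x \<partial>lborel)) (at_right 0)"
    by (rule tendsto_integral_mult_of_L1[OF continuous_into_H1_L1_at_0(1)[OF c_cont], of _ _ 1]) (use c_L1 in auto)
  moreover have "\<forall>\<^sub>F s in at_right 0. (\<integral>x. 1 * c i s x \<partial>lborel) = (\<integral>x. c i t x \<partial>lborel)"
  proof (rule eventually_at_rightI[of 0 t])
    fix s assume "s \<in> {0<..<t}"
    then show "(\<integral>x. 1 * c i s x \<partial>lborel) = (\<integral>x. c i t x \<partial>lborel)"
      using drift_diffusion.mass_conservation[OF dd, of s t] by simp
  qed (rule t)
  ultimately have "((\<lambda>s. \<integral>x. c i t x \<partial>lborel) \<longlongrightarrow> (\<integral>x. 1 * c i 0 x \<partial>lborel)) (at_right (0::real))"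
    by (rule Lim_transform_eventually)
  then show ?thesis by (simp add: tendsto_const_iff)
qed simp

lemma c_nonneg:
  assumes init: "AE x in lborel. 0 \<le> c i 0 x" and t: "t > 0"
  shows "0 \<le> c i t x"
proof -
  obtain M Q K where dd: "drift_diffusion D (z i) t M Q K (c i) \<phi> \<rho> u" by (rule drift_diffusion_single)
  have "((\<lambda>s. \<integral>x. \<bar>c i s x\<bar> \<partial>lborel) \<longlongrightarrow> (\<integral>x. \<bar>c i 0 x\<bar> \<partial>lborel)) (at_right 0)"
    by (rule tendsto_integral_abs_of_L1[OF continuous_into_H1_L1_at_0(1)[OF c_cont]]) (use c_L1 in auto)
  moreover have "\<forall>\<^sub>F s in at_right 0. (\<integral>x. \<bar>c i t x\<bar> \<partial>lborel) \<le> (\<integral>x. \<bar>c i s x\<bar> \<partial>lborel)"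
  proof (rule eventually_at_rightI[of 0 t])
    fix s assume "s \<in> {0<..<t}"
    then show "(\<integral>x. \<bar>c i t x\<bar> \<partial>lborel) \<le> (\<integral>x. \<bar>c i s x\<bar> \<partial>lborel)"
      using drift_diffusion.L1_contraction[OF dd, of s t] by simp
  qed (rule t)
  ultimately have "(\<integral>x. \<bar>c i t x\<bar> \<partial>lborel) \<le> (\<integral>x. \<bar>c i 0 x\<bar> \<partial>lborel)"
    by (intro tendsto_lowerbound) auto
  also have "\<dots> = (\<integral>x. c i 0 x \<partial>lborel)" using init c_L1[of 0 i] by (intro integral_cong_AE) auto
  also have "\<dots> = (\<integral>x. c i t x \<partial>lborel)" using mass[of t i] t by simp
  finally have "(\<integral>x. \<bar>c i t x\<bar> - c i t x \<partial>lborel) \<le> 0" using c_L1[of t i] t by simp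
  moreover have "(\<integral>x. \<bar>c i t x\<bar> - c i t x \<partial>lborel) \<ge> 0" by (intro Bochner_Integration.integral_nonneg) auto
  ultimately have "(\<integral>x. \<bar>c i t x\<bar> - c i t x \<partial>lborel) = 0" by simp
  then have "AE x in lborel. \<bar>c i t x\<bar> - c i t x = 0"
    using c_L1[of t i] t by (subst (asm) integral_nonneg_eq_0_iff_AE) auto
  then have "AE x in lborel. 0 \<le> c i t x" by eventually_elim simp
  then show ?thesis by (rule AE_nonneg_continuous[OF Ck_on_imp_continuous_on[OF c_Ck[OF t]]])
qed

end

section \<open>From square integrals to entropies\<close>

lemma entropy_upper_bound:
  fixes f :: "real^3 \<Rightarrow> real"
  assumes f: "AE x in lborel. 0 \<le> f x" "integrable lborel f" "integrable lborel (\<lambda>x. (f x)\<^sup>2)"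
    and ent: "entropy_finite f" and m: "(\<integral>x. f x \<partial>lborel) = m" "m > 0"
    and X: "(\<integral>x. (f x)\<^sup>2 \<partial>lborel) \<le> X" "X > 0"
  shows "m * ln m - m * ln X \<le> - entropy f"
proof -
  \<comment> \<open>The choice k = X/m minimises X/k + m ln k; it makes X/k cancel the -m and leaves
    m ln (X/m).\<close>
  define k where "k = X / m"
  have k: "k > 0" using X m by (simp add: k_def)
  have "entropy f \<le> (\<integral>x. (f x)\<^sup>2 / k + f x * (ln k - 1) \<partial>lborel)"
    unfolding entropy_def
  proof (rule integral_mono_AE)
    show "integrable lborel (\<lambda>x. f x * ln (f x))" using ent by (simp add: entropy_finite_def)
    show "integrable lborel (\<lambda>x. (f x)\<^sup>2 / k + f x * (ln k - 1))" using f by simp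
    show "AE x in lborel. f x * ln (f x) \<le> (f x)\<^sup>2 / k + f x * (ln k - 1)"
      using f(1)
    proof eventually_elim
      fix x assume "0 \<le> f x"
      show "f x * ln (f x) \<le> (f x)\<^sup>2 / k + f x * (ln k - 1)"
      proof (cases "f x = 0")
        case False
        then have p: "f x > 0" using \<open>0 \<le> f x\<close> by simp
        have "ln (f x / k) \<le> f x / k - 1" using p k by (intro ln_le_minus_one) simp
        then have "ln (f x) \<le> f x / k + (ln k - 1)" using p k by (simp add: ln_div)
        then have "f x * ln (f x) \<le> f x * (f x / k + (ln k - 1))" using p by (intro mult_left_mono) auto
        then show ?thesis by (simp add: power2_eq_square distrib_left)
      qed simp
    qed
  qed
  also have "\<dots> = (\<integral>x. (f x)\<^sup>2 \<partial>lborel) / k + m * (ln k - 1)" using f m by simp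
  also have "\<dots> \<le> X / k + m * (ln k - 1)" using X k by (intro add_right_mono divide_right_mono) auto
  also have "X / k = m" using X m by (simp add: k_def)
  also have "ln k = ln X - ln m" using X m by (simp add: k_def ln_div)
  finally show ?thesis by (simp add: algebra_simps)
qed

section \<open>Energy decay and finiteness of the entropies\<close>

locale npd_data = npd D z c u p \<phi>
  for D :: real and z :: "'n::finite \<Rightarrow> real" and c u p \<phi> +
  assumes valences: "\<And>i j. \<bar>z i\<bar> = \<bar>z j\<bar>"
    and init_nonneg: "\<And>i. AE x in lborel. 0 \<le> c i 0 x"
    and init_entropy: "\<And>i. entropy_finite (c i 0)"
begin

text \<open>\<open>undefined\<close> stands for an arbitrary species; all species have the same
  absolute valence.\<close>

definition zeta :: real where "zeta = \<bar>z undefined\<bar>"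

text \<open>A vanishing valence counts as positive. As all |z i| agree, this happens only if all
  valences vanish; then \<open>zeta\<close> is 0 and the negative class is empty.\<close>

definition pos_part :: "'n \<Rightarrow> real" where "pos_part i = (if z i \<ge> 0 then 1 else 0)"

definition neg_part :: "'n \<Rightarrow> real" where "neg_part i = (if z i \<ge> 0 then 0 else 1)"

definition energy :: "real \<Rightarrow> real" where
  "energy t = (\<integral>x. (combo pos_part t x)\<^sup>2 \<partial>lborel) + (\<integral>x. (combo neg_part t x)\<^sup>2 \<partial>lborel)"

lemma z_eq: "z i = zeta * (pos_part i - neg_part i)"
  using valences[of i undefined] by (auto simp: zeta_def pos_part_def neg_part_def)

lemma part_range: "0 \<le> pos_part i" "pos_part i \<le> 1" "0 \<le> neg_part i" "neg_part i \<le> 1" "pos_part i + neg_part i = 1"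
  by (auto simp: pos_part_def neg_part_def)

lemma part_charge: "pos_part i * z i = zeta * pos_part i" "neg_part i * z i = - zeta * neg_part i"
proof -
  have "pos_part i * (zeta * (pos_part i - neg_part i)) = zeta * pos_part i"
    "neg_part i * (zeta * (pos_part i - neg_part i)) = - zeta * neg_part i"
    by (simp_all add: pos_part_def neg_part_def)
  then show "pos_part i * z i = zeta * pos_part i" "neg_part i * z i = - zeta * neg_part i"
    by (simp_all only: z_eq[of i, symmetric])
qed

lemma combo_nonneg: "t > 0 \<Longrightarrow> (\<And>i. 0 \<le> a i) \<Longrightarrow> 0 \<le> combo a t x"
  unfolding combo_def by (intro sum_nonneg mult_nonneg_nonneg c_nonneg init_nonneg)

lemma combo_mass:
  assumes t: "t \<ge> 0" and a: "\<And>i. 0 \<le> a i" "\<And>i. a i \<le> 1"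
  shows "(\<integral>x. combo a t x \<partial>lborel) \<le> (\<Sum>i\<in>UNIV. \<integral>x. c i 0 x \<partial>lborel)"
proof -
  have "(\<integral>x. combo a t x \<partial>lborel) = (\<Sum>i\<in>UNIV. a i * (\<integral>x. c i 0 x \<partial>lborel))"
    unfolding combo_def using c_L1[OF t] mass[OF t] by simp
  also have "\<dots> \<le> (\<Sum>i\<in>UNIV. 1 * (\<integral>x. c i 0 x \<partial>lborel))"
  proof (intro sum_mono mult_right_mono a)
    show "0 \<le> (\<integral>x. c i 0 x \<partial>lborel)" for i using init_nonneg by (rule integral_nonneg_AE)
  qed
  finally show ?thesis by simp
qed

text \<open>\<open>energy_inequality\<close> is applied twice. With the lower bound 0 for the
  dissipation it shows that the energy decreases; then Nash's inequality with the final energy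
  bounds the dissipation below by one constant on all of [s, t].\<close>

lemma energy_decay_positive:
  assumes st: "0 < s" "s \<le> t" and m: "m > 0" "(\<Sum>i\<in>UNIV. \<integral>x. c i 0 x \<partial>lborel) \<le> m"
  shows "energy t + 2 * D * nash_const m * energy t powr (5 / 3) * (t - s) \<le> energy s"
proof -
  obtain k1 where k1: "\<And>M Q K. k1 \<le> M \<Longrightarrow> k1 \<le> Q \<Longrightarrow> k1 \<le> K \<Longrightarrow> drift_diffusion D zeta t M Q K (combo pos_part) \<phi> \<rho> u"
    by (rule drift_diffusion_combo[OF part_charge(1)]) blast
  obtain k2 where k2: "\<And>M Q K. k2 \<le> M \<Longrightarrow> k2 \<le> Q \<Longrightarrow> k2 \<le> K \<Longrightarrow> drift_diffusion D (- zeta) t M Q K (combo neg_part) \<phi> \<rho> u"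
    by (rule drift_diffusion_combo[OF part_charge(2)]) blast
  define k where "k = max k1 k2"
  have P: "drift_diffusion D zeta t k k k (combo pos_part) \<phi> \<rho> u" by (rule k1) (auto simp: k_def)
  have N: "drift_diffusion D (- zeta) t k k k (combo neg_part) \<phi> \<rho> u" by (rule k2) (auto simp: k_def)
  obtain B1 where B1: "\<And>\<tau>. 0 < \<tau> \<Longrightarrow> \<tau> \<le> t \<Longrightarrow> H1_L1_bound B1 (combo pos_part \<tau>)" by (rule combo_bounded) blast
  obtain B2 where B2: "\<And>\<tau>. 0 < \<tau> \<Longrightarrow> \<tau> \<le> t \<Longrightarrow> H1_L1_bound B2 (combo neg_part \<tau>)" by (rule combo_bounded) blast
  have z0: "zeta \<ge> 0" by (simp add: zeta_def)
  have rho: "\<rho> \<tau> x = zeta * (combo pos_part \<tau> x - combo neg_part \<tau> x)" for \<tau> x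
    unfolding charge_eq combo_def sum_subtractf[symmetric] sum_distrib_left
    by (intro sum.cong refl) (subst z_eq, simp add: algebra_simps)
  have nn: "0 < \<tau> \<Longrightarrow> 0 \<le> combo pos_part \<tau> x" "0 < \<tau> \<Longrightarrow> 0 \<le> combo neg_part \<tau> x" for \<tau> x
    by (intro combo_nonneg part_range; assumption)+
  have i: "0 < \<tau> \<Longrightarrow> \<tau> \<le> t \<Longrightarrow> integrable lborel (\<lambda>x. (combo pos_part \<tau> x)\<^sup>2)"
    "0 < \<tau> \<Longrightarrow> \<tau> \<le> t \<Longrightarrow> integrable lborel (\<lambda>x. (combo neg_part \<tau> x)\<^sup>2)"
    "0 < \<tau> \<Longrightarrow> \<tau> \<le> t \<Longrightarrow> integrable lborel (\<lambda>x. (norm (grad (combo pos_part \<tau>) x))\<^sup>2)"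
    "0 < \<tau> \<Longrightarrow> \<tau> \<le> t \<Longrightarrow> integrable lborel (\<lambda>x. (norm (grad (combo neg_part \<tau>) x))\<^sup>2)" for \<tau>
    using B1[of \<tau>] B2[of \<tau>] unfolding H1_L1_bound_def by blast+
  have ineq: "energy t' + 2 * D * k * (t' - s') \<le> energy s'"
    if "0 < s'" "s' \<le> t'" "t' \<le> t"
      "\<And>\<tau>. \<tau> \<in> {s'..t'} \<Longrightarrow> k \<le> (\<integral>x. (norm (grad (combo pos_part \<tau>) x))\<^sup>2 \<partial>lborel) + (\<integral>x. (norm (grad (combo neg_part \<tau>) x))\<^sup>2 \<partial>lborel)"
    for k s' t'
    unfolding energy_def using nn i that
    by (intro energy_inequality[OF P N z0 rho]) auto
  have mono: "energy t \<le> energy \<tau>" if "\<tau> \<in> {s..t}" for \<tau>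
    using ineq[of \<tau> t 0] that st by (auto intro!: add_nonneg_nonneg Bochner_Integration.integral_nonneg)
  have e0: "energy t \<ge> 0" unfolding energy_def by (intro add_nonneg_nonneg Bochner_Integration.integral_nonneg) auto
  have "nash_const m * energy t powr (5 / 3)
      \<le> (\<integral>x. (norm (grad (combo pos_part \<tau>) x))\<^sup>2 \<partial>lborel) + (\<integral>x. (norm (grad (combo neg_part \<tau>) x))\<^sup>2 \<partial>lborel)"
    if \<tau>: "\<tau> \<in> {s..t}" for \<tau>
  proof -
    have t: "0 < \<tau>" "\<tau> \<le> t" using \<tau> st by auto
    have mp: "(\<integral>x. combo pos_part \<tau> x \<partial>lborel) \<le> m" "(\<integral>x. combo neg_part \<tau> x \<partial>lborel) \<le> m"
      using t by (auto intro!: order_trans[OF combo_mass m(2)] part_range)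
    show ?thesis
      using t mono[OF \<tau>] unfolding energy_def[of \<tau>]
      by (intro Nash_lower_bound combo_Ck nn i mp m e0 combo_L1) auto
  qed
  from ineq[OF st order_refl this] show ?thesis by (simp add: mult.assoc)
qed

lemma energy_decay:
  assumes st: "0 \<le> s" "s \<le> t" and m: "m > 0" "(\<Sum>i\<in>UNIV. \<integral>x. c i 0 x \<partial>lborel) \<le> m"
  shows "energy t + 2 * D * nash_const m * energy t powr (5 / 3) * (t - s) \<le> energy s"
proof (cases "s > 0 \<or> t = 0")
  case True
  then show ?thesis using energy_decay_positive[OF _ st(2) m] st by auto
next
  case False
  then have s0: "s = 0" and t: "t > 0" using st by auto
  have lim: "(energy \<longlongrightarrow> energy 0) (at_right 0)"
    unfolding energy_def[abs_def] using part_range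
    by (intro tendsto_add combo_square_tendsto) (auto simp: abs_of_nonneg)
  have lim2: "((\<lambda>s. energy t + 2 * D * nash_const m * energy t powr (5 / 3) * (t - s)) \<longlongrightarrow>
      energy t + 2 * D * nash_const m * energy t powr (5 / 3) * (t - 0)) (at_right 0)"
    by (intro tendsto_intros)
  have "\<forall>\<^sub>F s in at_right 0. energy t + 2 * D * nash_const m * energy t powr (5 / 3) * (t - s) \<le> energy s"
    by (rule eventually_at_rightI[OF _ t]) (auto intro!: energy_decay_positive m)
  from tendsto_le[OF _ lim lim2 this] show ?thesis by (simp add: s0)
qed

text \<open>By nonnegativity a species is dominated by the sum over its class.\<close>

lemma square_le_energy:
  assumes t: "t \<ge> 0"
  shows "(\<integral>x. (c i t x)\<^sup>2 \<partial>lborel) \<le> energy t"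
proof -
  have nn: "AE x in lborel. \<forall>j. 0 \<le> c j t x"
  proof (cases "t = 0")
    case True
    then show ?thesis using init_nonneg by (simp add: AE_all_countable)
  next
    case False
    then show ?thesis using t c_nonneg[OF init_nonneg] by auto
  qed
  define a where "a = (if z i \<ge> 0 then pos_part else neg_part)"
  have a: "a i = 1" "\<And>j. 0 \<le> a j" by (auto simp: a_def pos_part_def neg_part_def)
  have "(\<integral>x. (c i t x)\<^sup>2 \<partial>lborel) \<le> (\<integral>x. (combo a t x)\<^sup>2 \<partial>lborel)"
  proof (rule integral_mono_AE)
    show "integrable lborel (\<lambda>x. (c i t x)\<^sup>2)" "integrable lborel (\<lambda>x. (combo a t x)\<^sup>2)"
      using c_L2[OF t] combo_L2[OF t] by (auto simp: in_L2_def)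
    show "AE x in lborel. (c i t x)\<^sup>2 \<le> (combo a t x)\<^sup>2" using nn
    proof eventually_elim
      fix x assume nn: "\<forall>j. 0 \<le> c j t x"
      have "a i * c i t x \<le> combo a t x" unfolding combo_def
        using nn a by (intro member_le_sum) auto
      then show "(c i t x)\<^sup>2 \<le> (combo a t x)\<^sup>2" using nn a by (intro power_mono) auto
    qed
  qed
  also have "\<dots> \<le> energy t" unfolding energy_def a_def by (auto intro!: Bochner_Integration.integral_nonneg)
  finally show ?thesis .
qed

text \<open>Expresses the initial energy by quantities on which the second constant may depend; the
  factor 2 counts the two classes.\<close>

lemma energy_0_le: "energy 0 \<le> 2 * real CARD('n) * (\<Sum>i\<in>UNIV. (L2_norm (c i 0))\<^sup>2)"
proof -
  have L2: "integrable lborel (\<lambda>x. (c i 0 x)\<^sup>2)" for i using c_L2[of 0 i] by (simp add: in_L2_def)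
  have q: "(L2_norm (c i 0))\<^sup>2 = (\<integral>x. (c i 0 x)\<^sup>2 \<partial>lborel)" for i by (simp add: L2_norm_def)
  have "(\<integral>x. (combo a 0 x)\<^sup>2 \<partial>lborel) \<le> real CARD('n) * (\<Sum>i\<in>UNIV. (L2_norm (c i 0))\<^sup>2)"
    if a: "\<And>i. \<bar>a i\<bar> \<le> 1" for a
  proof -
    have "(\<integral>x. (combo a 0 x)\<^sup>2 \<partial>lborel) \<le> (\<integral>x. real CARD('n) * (\<Sum>i\<in>UNIV. (c i 0 x)\<^sup>2) \<partial>lborel)"
    proof (rule integral_mono)
      show "integrable lborel (\<lambda>x. (combo a 0 x)\<^sup>2)" using combo_L2[of 0 a] by (simp add: in_L2_def)
      show "integrable lborel (\<lambda>x. real CARD('n) * (\<Sum>i\<in>UNIV. (c i 0 x)\<^sup>2))" using L2 by simp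
      show "(combo a 0 x)\<^sup>2 \<le> real CARD('n) * (\<Sum>i\<in>UNIV. (c i 0 x)\<^sup>2)" for x
        unfolding combo_def using a by (rule sq_sum_le)
    qed
    then show ?thesis using L2 by (simp add: q)
  qed
  from this[of pos_part] this[of neg_part] part_range show ?thesis
    by (auto simp: energy_def abs_of_nonneg)
qed

lemma entropy_finite_at:
  assumes t: "t > 0"
  shows "entropy_finite (c i t)"
proof -
  \<comment> \<open>The data are nonnegative only almost everywhere, whereas
    \<open>conv_weight\<close> asks for it at every point; the absolute value is a suitable version
    of the data.\<close>
  define f where "f x = \<bar>c i 0 x\<bar>" for x
  have cL1: "integrable lborel (c i 0)" "integrable lborel (c i t)" using c_L1 t by auto
  have f: "integrable lborel f" "\<And>x. 0 \<le> f x" using cL1 by (auto simp: f_def[abs_def])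
  have [measurable]: "c i 0 \<in> borel_measurable borel" "c i t \<in> borel_measurable borel" using cL1 by auto
  interpret W: conv_weight f using f by unfold_locales
  have fc: "AE x in lborel. f x = c i 0 x" using init_nonneg[of i] by eventually_elim (simp add: f_def)
  define m where "m = (\<integral>x. f x \<partial>lborel)"
  have mc: "m = (\<integral>x. c i 0 x \<partial>lborel)" unfolding m_def using fc f cL1 by (intro integral_cong_AE) auto
  have m0: "m \<ge> 0" unfolding m_def by (rule W.mass_nonneg)
  note nn = c_nonneg[OF init_nonneg t]
  show ?thesis
  proof (cases "m = 0")
    case True
    then have "(\<integral>x. c i t x \<partial>lborel) = 0" using mass[of t i] t mc by simp
    then have "AE x in lborel. c i t x = 0" using nn cL1 by (subst (asm) integral_nonneg_eq_0_iff_AE) auto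
    then have "AE x in lborel. c i t x * ln (c i t x) = 0" by eventually_elim simp
    then have "integrable lborel (\<lambda>x. c i t x * ln (c i t x)) \<longleftrightarrow> integrable lborel (\<lambda>x::real^3. 0::real)"
      by (intro integrable_cong_AE) auto
    then show ?thesis by (simp add: entropy_finite_def)
  next
    case False
    then have m: "m > 0" using m0 by simp
    have ent: "integrable lborel (\<lambda>x. f x * ln (f x))"
    proof -
      have "integrable lborel (\<lambda>x. f x * ln (f x)) \<longleftrightarrow> integrable lborel (\<lambda>x. c i 0 x * ln (c i 0 x))"
      proof (rule integrable_cong_AE)
        show "AE x in lborel. f x * ln (f x) = c i 0 x * ln (c i 0 x)" using fc by eventually_elim simp
      qed (auto simp: f_def)
      then show ?thesis using init_entropy[of i] by (simp add: entropy_finite_def)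
    qed
    obtain B where B: "\<And>s. 0 < s \<Longrightarrow> s \<le> t \<Longrightarrow> H1_L1_bound B (c i s)"
      using continuous_into_H1_L1_locally_bounded[OF c_cont c_Ck] by blast
    have B0: "B \<ge> 0"
    proof -
      have "0 \<le> (\<integral>x. \<bar>c i t x\<bar> \<partial>lborel)" by simp
      also have "\<dots> \<le> B" using B[OF t order_refl] by (simp add: H1_L1_bound_def)
      finally show ?thesis .
    qed
    \<comment> \<open>At time 0 only a weak gradient exists. The translation estimate holds at
      positive times with the uniform bound \<open>B\<close> and passes to the limit, translations
      being isometries of L^2.\<close>
    have tr: "(\<integral>\<^sup>+x. ennreal ((f (x + h) - f x)\<^sup>2) \<partial>lborel) \<le> ennreal ((norm h)\<^sup>2 * B)" for h
    proof -
      have L2: "in_L2 (c i s)" if "s \<ge> 0" for s by (rule c_L2[OF that])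
      have sh: "in_L2 (\<lambda>x. c i s (x + h))" if "s \<ge> 0" for s
      proof -
        have [measurable]: "c i s \<in> borel_measurable borel" using L2[OF that] by (simp add: in_L2_def)
        show ?thesis using L2[OF that] integrable_translation_iff[of "\<lambda>x. (c i s x)\<^sup>2" h] by (simp add: in_L2_def)
      qed
      have diff: "in_L2 (\<lambda>x. c i s (x + h) - c i s x)" if "s \<ge> 0" for s
        using in_L2_add_scaled(1)[OF sh[OF that] L2[OF that], of "-1"] by simp
      have lim: "((\<lambda>s. \<integral>x. (c i s (x + h) - c i s x)\<^sup>2 \<partial>lborel) \<longlongrightarrow> (\<integral>x. (c i 0 (x + h) - c i 0 x)\<^sup>2 \<partial>lborel)) (at_right 0)"
      proof (rule tendsto_integral_square_of_L2)
        define d where "d s = (\<integral>x. (c i s x - c i 0 x)\<^sup>2 \<partial>lborel)" for s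
        show "((\<lambda>s. \<integral>x. (c i s (x + h) - c i s x - (c i 0 (x + h) - c i 0 x))\<^sup>2 \<partial>lborel) \<longlongrightarrow> 0) (at_right 0)"
        proof (rule Lim_null_comparison)
          show "((\<lambda>s. 4 * d s) \<longlongrightarrow> 0) (at_right 0)"
            unfolding d_def by (intro tendsto_mult_right_zero continuous_into_H1_L1_at_0(2) c_cont)
          have "norm (\<integral>x. (c i s (x + h) - c i s x - (c i 0 (x + h) - c i 0 x))\<^sup>2 \<partial>lborel) \<le> 4 * d s" if s: "s > 0" for s
          proof -
            have d1: "in_L2 (\<lambda>x. c i s x - c i 0 x)" using in_L2_add_scaled(1)[OF L2[of s] L2[of 0], of "-1"] s by simp
            have [measurable]: "c i s \<in> borel_measurable borel" using L2[of s] s by (simp add: in_L2_def)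
            have T: "(\<integral>x. (c i s (x + h) - c i 0 (x + h))\<^sup>2 \<partial>lborel) = d s"
              "integrable lborel (\<lambda>x. (c i s (x + h) - c i 0 (x + h))\<^sup>2)"
              using lborel_translation[of "\<lambda>x. (c i s x - c i 0 x)\<^sup>2" h] d1 by (simp_all add: d_def in_L2_def)
            have d2: "in_L2 (\<lambda>x. c i s (x + h) - c i 0 (x + h))" using T(2) by (simp add: in_L2_def)
            have "(\<integral>x. (c i s (x + h) - c i s x - (c i 0 (x + h) - c i 0 x))\<^sup>2 \<partial>lborel)
                = (\<integral>x. (norm ((c i s (x + h) - c i 0 (x + h)) + (- 1) *\<^sub>R (c i s x - c i 0 x)))\<^sup>2 \<partial>lborel)"
              by (intro Bochner_Integration.integral_cong refl) (simp add: algebra_simps)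
            also have "\<dots> \<le> 2 * d s + 2 * d s" using in_L2_add_scaled(2)[OF d2 d1, of "-1"] T(1) by (simp add: d_def)
            finally show ?thesis by simp
          qed
          then show "\<forall>\<^sub>F s in at_right 0. norm (\<integral>x. (c i s (x + h) - c i s x - (c i 0 (x + h) - c i 0 x))\<^sup>2 \<partial>lborel) \<le> 4 * d s"
            by (auto simp: eventually_at_filter)
        qed
      qed (use diff in auto)
      have "(\<integral>x. (c i 0 (x + h) - c i 0 x)\<^sup>2 \<partial>lborel) \<le> (norm h)\<^sup>2 * B"
      proof (rule tendsto_upperbound[OF lim])
        show "\<forall>\<^sub>F s in at_right 0. (\<integral>x. (c i s (x + h) - c i s x)\<^sup>2 \<partial>lborel) \<le> (norm h)\<^sup>2 * B"
        proof (rule eventually_at_rightI[OF _ t])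
          fix s assume s: "s \<in> {0<..<t}"
          then have Bs: "integrable lborel (\<lambda>x. (norm (grad (c i s) x))\<^sup>2)" "(\<integral>x. (norm (grad (c i s) x))\<^sup>2 \<partial>lborel) \<le> B"
            using B[of s] by (auto simp: H1_L1_bound_def)
          have "ennreal (\<integral>x. (c i s (x + h) - c i s x)\<^sup>2 \<partial>lborel) = (\<integral>\<^sup>+x. ennreal ((c i s (x + h) - c i s x)\<^sup>2) \<partial>lborel)"
            using diff[of s] s by (subst nn_integral_eq_integral) (auto simp: in_L2_def)
          also have "\<dots> \<le> ennreal ((norm h)\<^sup>2 * (\<integral>x. (norm (grad (c i s) x))\<^sup>2 \<partial>lborel))"
            using s by (intro translation_estimate c_Ck Bs) auto
          finally have "(\<integral>x. (c i s (x + h) - c i s x)\<^sup>2 \<partial>lborel) \<le> (norm h)\<^sup>2 * (\<integral>x. (norm (grad (c i s) x))\<^sup>2 \<partial>lborel)"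
            by (subst (asm) ennreal_le_iff) auto
          also have "\<dots> \<le> (norm h)\<^sup>2 * B" using Bs by (intro mult_left_mono) auto
          finally show "(\<integral>x. (c i s (x + h) - c i s x)\<^sup>2 \<partial>lborel) \<le> (norm h)\<^sup>2 * B" .
        qed
      qed simp
      then have le: "ennreal (\<integral>x. (c i 0 (x + h) - c i 0 x)\<^sup>2 \<partial>lborel) \<le> ennreal ((norm h)\<^sup>2 * B)" by (rule ennreal_leI)
      have "(\<integral>\<^sup>+x. ennreal ((f (x + h) - f x)\<^sup>2) \<partial>lborel) \<le> (\<integral>\<^sup>+x. ennreal ((c i 0 (x + h) - c i 0 x)\<^sup>2) \<partial>lborel)"
      proof (intro nn_integral_mono ennreal_leI)
        fix x
        have "\<bar>f (x + h) - f x\<bar>\<^sup>2 \<le> \<bar>c i 0 (x + h) - c i 0 x\<bar>\<^sup>2" unfolding f_def by (intro power_mono) auto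
        then show "(f (x + h) - f x)\<^sup>2 \<le> (c i 0 (x + h) - c i 0 x)\<^sup>2" by simp
      qed
      also have "\<dots> = ennreal (\<integral>x. (c i 0 (x + h) - c i 0 x)\<^sup>2 \<partial>lborel)"
        using diff[of 0] by (intro nn_integral_eq_integral) (auto simp: in_L2_def)
      finally show ?thesis using le by (rule order_trans)
    qed
    have flng: "integrable lborel (\<lambda>x. f x * ln (W.g x))"
      by (rule W.integrable_mult_ln_g[OF ent _ B0 tr]) (use m in \<open>simp add: m_def\<close>)
    obtain M Q K where dd: "drift_diffusion D (z i) t M Q K (c i) \<phi> \<rho> u" by (rule drift_diffusion_single)
    \<comment> \<open>The absolute value makes the growth bound monotone in the length of the
      interval, so that t may replace t - s.\<close>
    define \<Lambda> where "\<Lambda> = t * \<bar>(D * 198 + \<bar>z i\<bar> * D * K * 6) * M + 6 * Q\<bar>"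
    define w0 where "w0 x = ln (m + 1) - ln (W.g x)" for x
    have gpos: "W.g x > 0" for x by (rule W.g_pos) (use m in \<open>simp add: m_def\<close>)
    have gle: "W.g x \<le> m" for x unfolding m_def by (rule W.g_le)
    have wle: "W.weight e x \<le> w0 x" if "e > 0" for e x
      using that gpos[of x] by (simp add: W.weight_def w0_def m_def)
    have wm: "W.weight e \<in> borel_measurable borel" if "e > 0" for e
      by (rule borel_measurable_continuous_onI[OF Ck_on_imp_continuous_on[OF W.weight_Ck[OF that]]])
    have gm [measurable]: "W.g \<in> borel_measurable borel"
      by (rule borel_measurable_continuous_onI[OF Ck_on_imp_continuous_on[OF W.g_Ck]])
    have fw0: "integrable lborel (\<lambda>x. f x * w0 x)" unfolding w0_def right_diff_distrib using flng f by simp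
    define A where "A = (\<integral>x. f x * w0 x \<partial>lborel)"
    have wi: "integrable lborel (\<lambda>x. W.weight e x * q x)" if e: "0 < e" "e \<le> 1" and q: "integrable lborel q" for e q
    proof (rule Bochner_Integration.integrable_bound[OF integrable_mult_right[OF q, of "ln (m + 1) - ln e"]])
      have [measurable]: "q \<in> borel_measurable borel" "W.weight e \<in> borel_measurable borel" using q wm[OF e(1)] by auto
      show "(\<lambda>x. W.weight e x * q x) \<in> borel_measurable lborel" by measurable
      have "\<bar>W.weight e x\<bar> \<le> \<bar>ln (m + 1) - ln e\<bar>" for x using W.weight_range[OF e, of x] unfolding m_def by linarith
      then show "AE x in lborel. norm (W.weight e x * q x) \<le> norm ((ln (m + 1) - ln e) * q x)"
        by (auto simp: abs_mult intro!: AE_I2 mult_right_mono)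
    qed
    \<comment> \<open>Independence of e is the point: it lets the regularisation be removed by
      Fatou's lemma.\<close>
    have bound: "(\<integral>x. W.weight e x * c i t x \<partial>lborel) \<le> A + \<Lambda>" if e: "0 < e" "e \<le> 1" for e
    proof -
      have "((\<lambda>s. \<integral>x. W.weight e x * c i s x \<partial>lborel) \<longlongrightarrow> (\<integral>x. W.weight e x * c i 0 x \<partial>lborel)) (at_right 0)"
      proof (rule tendsto_integral_mult_of_L1[OF continuous_into_H1_L1_at_0(1)[OF c_cont] _ _ wm[OF e(1)]])
        show "\<bar>W.weight e x\<bar> \<le> \<bar>ln (m + 1) - ln e\<bar>" for x using W.weight_range[OF e, of x] unfolding m_def by linarith
      qed (use c_L1 in auto)
      then have lim: "((\<lambda>s. (\<integral>x. W.weight e x * c i s x \<partial>lborel) + \<Lambda>) \<longlongrightarrow> (\<integral>x. W.weight e x * c i 0 x \<partial>lborel) + \<Lambda>) (at_right 0)"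
        by (intro tendsto_intros)
      have "(\<integral>x. W.weight e x * c i t x \<partial>lborel) \<le> (\<integral>x. W.weight e x * c i 0 x \<partial>lborel) + \<Lambda>"
      proof (rule tendsto_lowerbound[OF lim])
        show "\<forall>\<^sub>F s in at_right 0. (\<integral>x. W.weight e x * c i t x \<partial>lborel) \<le> (\<integral>x. W.weight e x * c i s x \<partial>lborel) + \<Lambda>"
        proof (rule eventually_at_rightI[OF _ t])
          fix s assume s: "s \<in> {0<..<t}"
          have "(\<integral>x. W.weight e x * c i t x \<partial>lborel) - (\<integral>x. W.weight e x * c i s x \<partial>lborel)
              \<le> (t - s) * ((D * 198 + \<bar>z i\<bar> * D * K * 6) * M + 6 * Q)"
            using s by (intro drift_diffusion.weight_Lipschitz[OF dd W.conv_weight_axioms e]) auto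
          also have "\<dots> \<le> (t - s) * \<bar>(D * 198 + \<bar>z i\<bar> * D * K * 6) * M + 6 * Q\<bar>" using s by (intro mult_left_mono) auto
          also have "\<dots> \<le> \<Lambda>" unfolding \<Lambda>_def using s by (intro mult_right_mono) auto
          finally show "(\<integral>x. W.weight e x * c i t x \<partial>lborel) \<le> (\<integral>x. W.weight e x * c i s x \<partial>lborel) + \<Lambda>" by simp
        qed
      qed simp
      also have "(\<integral>x. W.weight e x * c i 0 x \<partial>lborel) \<le> A"
        unfolding A_def
      proof (rule integral_mono_AE)
        show "integrable lborel (\<lambda>x. W.weight e x * c i 0 x)" by (rule wi[OF e cL1(1)])
        show "AE x in lborel. W.weight e x * c i 0 x \<le> f x * w0 x" using fc
        proof eventually_elim
          fix x assume "f x = c i 0 x"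
          then show "W.weight e x * c i 0 x \<le> f x * w0 x"
            using mult_left_mono[OF wle[OF e(1), of x] f(2)[of x]] by (simp add: mult.commute)
        qed
      qed (rule fw0)
      finally show ?thesis by simp
    qed
    define e where "e n = inverse (real (Suc n))" for n
    have e: "0 < e n" "e n \<le> 1" for n by (auto simp: e_def inverse_le_1_iff)
    have "integrable lborel (\<lambda>x. w0 x * c i t x)"
    proof (rule Fatou_integrable(1)[where s = "\<lambda>n x. W.weight (e n) x * c i t x"])
      show "(\<lambda>x. w0 x * c i t x) \<in> borel_measurable lborel" unfolding w0_def by measurable
      show "integrable lborel (\<lambda>x. W.weight (e n) x * c i t x)" for n by (rule wi[OF e cL1(2)])
      show "0 \<le> W.weight (e n) x * c i t x" for n x by (intro mult_nonneg_nonneg nn W.weight_range(1) e)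
      show "AE x in lborel. (\<lambda>n. W.weight (e n) x * c i t x) \<longlonglongrightarrow> w0 x * c i t x"
      proof (rule AE_I2)
        fix x
        have "(\<lambda>n. ln (m + 1) - ln (W.g x + e n)) \<longlonglongrightarrow> ln (m + 1) - ln (W.g x + 0)"
          unfolding e_def using gpos[of x] by (intro tendsto_intros LIMSEQ_inverse_real_of_nat) auto
        then have "(\<lambda>n. W.weight (e n) x) \<longlonglongrightarrow> w0 x" by (simp add: W.weight_def w0_def m_def)
        then show "(\<lambda>n. W.weight (e n) x * c i t x) \<longlonglongrightarrow> w0 x * c i t x" by (intro tendsto_intros)
      qed
      show "(\<integral>x. W.weight (e n) x * c i t x \<partial>lborel) \<le> A + \<Lambda>" for n by (rule bound[OF e])
    qed (rule tendsto_const)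
    \<comment> \<open>A majorant of |a ln a| for a = c and b = g. From above a ln a <= a^2; from
      below ln (b/a) <= b/a - 1, hence -a ln a <= b - a ln b. The term with |ln (m + 1)| makes up
      for the shift in \<open>w0\<close>.\<close>
    then have cw: "integrable lborel (\<lambda>x. w0 x * c i t x + \<bar>ln (m + 1)\<bar> * c i t x + W.g x + (c i t x)\<^sup>2)"
      using cL1 W.g_integrable c_L2[of t i] t by (simp add: in_L2_def)
    show ?thesis unfolding entropy_finite_def
    proof (rule Bochner_Integration.integrable_bound[OF cw])
      show "AE x in lborel. norm (c i t x * ln (c i t x)) \<le> norm (w0 x * c i t x + \<bar>ln (m + 1)\<bar> * c i t x + W.g x + (c i t x)\<^sup>2)"
      proof (rule AE_I2)
        fix x
        define a where "a = c i t x"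
        define b where "b = W.g x"
        have b: "b > 0" "b \<le> m" using gpos gle by (auto simp: b_def)
        have a0: "a \<ge> 0" using nn by (simp add: a_def)
        have "0 \<le> w0 x" using b unfolding w0_def b_def[symmetric] by simp
        then have w: "0 \<le> w0 x * a" using a0 by simp
        have "\<bar>a * ln a\<bar> \<le> w0 x * a + \<bar>ln (m + 1)\<bar> * a + b + a\<^sup>2"
        proof (cases "a = 0")
          case False
          then have a: "a > 0" using a0 by simp
          have "ln a \<le> a" using ln_le_minus_one[OF a] by simp
          then have 1: "a * ln a \<le> a\<^sup>2" using a by (simp add: power2_eq_square mult_left_mono)
          have "ln (b / a) \<le> b / a - 1" using a b by (intro ln_le_minus_one) simp
          then have "- ln a \<le> b / a - ln b" using a b by (simp add: ln_div)
          then have "a * - ln a \<le> a * (b / a - ln b)" using a by (intro mult_left_mono) auto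
          also have "\<dots> = b + (w0 x * a - ln (m + 1) * a)" using a by (simp add: w0_def b_def algebra_simps)
          finally have 2: "- (a * ln a) \<le> b + (w0 x * a - ln (m + 1) * a)" by simp
          have 3: "- (ln (m + 1) * a) \<le> \<bar>ln (m + 1)\<bar> * a" using a m by simp
          have 4: "0 \<le> \<bar>ln (m + 1)\<bar> * a" "0 \<le> a\<^sup>2" using a by auto
          show ?thesis using 1 2 3 4 w b by (intro abs_leI) linarith+
        qed (use b in simp)
        then show "norm (c i t x * ln (c i t x)) \<le> norm (w0 x * c i t x + \<bar>ln (m + 1)\<bar> * c i t x + W.g x + (c i t x)\<^sup>2)"
          unfolding a_def b_def by simp
      qed
    qed measurable
  qed
qed

end

section \<open>The constants and the entropy estimate\<close>

definition mass_scale :: "('n::finite \<Rightarrow> real) \<Rightarrow> real" where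
  "mass_scale m = exp (- (\<Sum>i\<in>UNIV. \<bar>ln (m i)\<bar> + 1 / \<bar>m i\<bar>))"

text \<open>For D > 0 this is a/16 with a = 2 D \<open>nash_const\<close>, the rate in
  \<open>decay_of_differential_inequality\<close>. The case distinction and the summand 1 keep it
  positive for all arguments, as the theorem asks.\<close>

definition decay_rate :: "real \<Rightarrow> ('n::finite \<Rightarrow> real) \<Rightarrow> real" where
  "decay_rate D m = (if D > 0 then D else 1) * nash_const (1 + (\<Sum>i\<in>UNIV. \<bar>m i\<bar>)) / 8"

text \<open>A^(-2/3) / 2, where A is 1 plus the bound of \<open>energy_0_le\<close>; the 1 keeps A
  positive when all data vanish.\<close>

definition initial_scale :: "('n::finite \<Rightarrow> real) \<Rightarrow> real" where
  "initial_scale q = (1 + 2 * real CARD('n) * (\<Sum>i\<in>UNIV. (q i)\<^sup>2)) powr (- (2 / 3)) / 2"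

lemma constants_pos: "mass_scale m > 0" "decay_rate D m > 0" "initial_scale q > 0"
proof -
  show "mass_scale m > 0" by (simp add: mass_scale_def)
  have "0 < 1 + (\<Sum>i\<in>UNIV. \<bar>m i\<bar>)" by (intro add_pos_nonneg sum_nonneg) auto
  then show "decay_rate D m > 0"
    unfolding decay_rate_def by (intro divide_pos_pos mult_pos_pos nash_const_pos) auto
  have "0 < 1 + 2 * real CARD('b) * (\<Sum>i\<in>UNIV. (q i)\<^sup>2)"
    by (intro add_pos_nonneg mult_nonneg_nonneg sum_nonneg) auto
  then show "initial_scale q > 0" by (simp add: initial_scale_def)
qed

text \<open>This explains the form of \<open>mass_scale\<close>: the part |ln m| outweighs m ln m,
  and the part 1/m contributes 3/2, more than the 1 wanted as first constant. Summing over all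
  species serves every i at once and keeps the dependence on the masses alone.\<close>

lemma mass_scale_bound:
  assumes "m i > 0"
  shows "1 + 3 / 2 * m i * ln (mass_scale m) \<le> m i * ln (m i)"
proof -
  have "\<bar>ln (m i)\<bar> + 1 / \<bar>m i\<bar> \<le> (\<Sum>i\<in>UNIV. \<bar>ln (m i)\<bar> + 1 / \<bar>m i\<bar>)"
    by (rule member_le_sum[of i UNIV "\<lambda>i. \<bar>ln (m i)\<bar> + 1 / \<bar>m i\<bar>"]) auto
  then have "ln (mass_scale m) \<le> - \<bar>ln (m i)\<bar> - 1 / m i" using assms by (simp add: mass_scale_def)
  then have "3 / 2 * m i * ln (mass_scale m) \<le> 3 / 2 * m i * (- \<bar>ln (m i)\<bar> - 1 / m i)"
    using assms by (intro mult_left_mono) auto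
  also have "\<dots> = - (3 / 2) * (m i * \<bar>ln (m i)\<bar>) - 3 / 2" using assms by (simp add: field_simps)
  finally have 1: "3 / 2 * m i * ln (mass_scale m) \<le> - (3 / 2) * (m i * \<bar>ln (m i)\<bar>) - 3 / 2" .
  have "m i * - ln (m i) \<le> m i * \<bar>ln (m i)\<bar>" using assms by (intro mult_left_mono) auto
  moreover have "0 \<le> m i * \<bar>ln (m i)\<bar>" using assms by simp
  ultimately show ?thesis using 1 by linarith
qed

context npd_data
begin

text \<open>The energy is at most Y^(-3/2) with Y affine in t, so the entropy comparison yields
  (3/2) m ln Y + m ln m. Multiplying Y by \<open>mass_scale\<close> inside the logarithm absorbs m
  ln m and leaves room for the additive 1.\<close>

lemma entropy_bound:
  fixes m q
  defines "m \<equiv> \<lambda>i. L1_norm (c i 0)" and "q \<equiv> \<lambda>i. L2_norm (c i 0)"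
  assumes t: "t \<ge> 0" and m: "m i > 0"
  shows "1 + 3 / 2 * m i * ln (mass_scale m * initial_scale q + mass_scale m * decay_rate D m * t) \<le> - entropy (c i t)"
proof -
  have m_eq: "m j = (\<integral>x. c j 0 x \<partial>lborel)" for j
    unfolding m_def L1_norm_def using init_nonneg[of j] c_L1[of 0 j] by (intro integral_cong_AE) auto
  define M where "M = 1 + (\<Sum>i\<in>UNIV. \<bar>m i\<bar>)"
  have M: "M > 0" unfolding M_def by (intro add_pos_nonneg sum_nonneg) auto
  have "(\<Sum>i\<in>UNIV. m i) \<le> (\<Sum>i\<in>UNIV. \<bar>m i\<bar>)" by (intro sum_mono) auto
  then have le: "(\<Sum>i\<in>UNIV. \<integral>x. c i 0 x \<partial>lborel) \<le> M" by (simp add: M_def m_eq)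
  define A where "A = 1 + 2 * real CARD('n) * (\<Sum>i\<in>UNIV. (q i)\<^sup>2)"
  have A: "A > 0" "energy 0 \<le> A"
    using energy_0_le unfolding A_def q_def by (auto intro!: add_pos_nonneg mult_nonneg_nonneg sum_nonneg)
  define Y where "Y = initial_scale q + decay_rate D m * t"
  have Y: "Y > 0" unfolding Y_def using constants_pos(2)[of D m] constants_pos(3)[of q] t
    by (intro add_pos_nonneg) auto
  have "energy t \<le> (A powr (- (2 / 3)) / 2 + 2 * D * nash_const M / 16 * t) powr (- (3 / 2))"
  proof (rule decay_of_differential_inequality[where E = energy, OF _ _ _ A t])
    show "0 < 2 * D * nash_const M" using D nash_const_pos[OF M] by simp
    show "0 \<le> energy s" for s unfolding energy_def by (intro add_nonneg_nonneg Bochner_Integration.integral_nonneg) auto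
    show "energy t + 2 * D * nash_const M * energy t powr (5 / 3) * (t - s) \<le> energy s" if "0 \<le> s" "s \<le> t" for s t
      by (rule energy_decay[OF that M le])
  qed
  also have "A powr (- (2 / 3)) / 2 + 2 * D * nash_const M / 16 * t = Y"
    using D by (simp add: Y_def A_def initial_scale_def decay_rate_def M_def)
  finally have E: "energy t \<le> Y powr (- (3 / 2))" .
  have nn: "AE x in lborel. 0 \<le> c i t x"
  proof (cases "t = 0")
    case False
    then show ?thesis using t c_nonneg[OF init_nonneg] by auto
  qed (simp add: init_nonneg)
  have ef: "entropy_finite (c i t)" using entropy_finite_at[of t i] init_entropy t by (cases "t = 0") auto
  have "m i * ln (m i) - m i * ln (Y powr (- (3 / 2))) \<le> - entropy (c i t)"
  proof (rule entropy_upper_bound[OF nn c_L1[OF t] _ ef])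
    show "integrable lborel (\<lambda>x. (c i t x)\<^sup>2)" using c_L2[OF t, of i] by (simp add: in_L2_def)
    show "(\<integral>x. c i t x \<partial>lborel) = m i" using mass[OF t, of i] by (simp add: m_eq)
    show "(\<integral>x. (c i t x)\<^sup>2 \<partial>lborel) \<le> Y powr (- (3 / 2))" by (rule order_trans[OF square_le_energy[OF t] E])
  qed (use m Y in auto)
  moreover have "m i * ln (Y powr (- (3 / 2))) = - (3 / 2 * m i * ln Y)" using Y by (simp add: ln_powr)
  moreover have L: "ln (mass_scale m * initial_scale q + mass_scale m * decay_rate D m * t) = ln (mass_scale m) + ln Y"
  proof -
    have "mass_scale m * initial_scale q + mass_scale m * decay_rate D m * t = mass_scale m * Y"
      by (simp add: Y_def algebra_simps)
    then show ?thesis using Y constants_pos(1)[of m] by (simp add: ln_mult)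
  qed
  moreover have "3 / 2 * m i * (ln (mass_scale m) + ln Y) = 3 / 2 * m i * ln (mass_scale m) + 3 / 2 * m i * ln Y"
    by (rule distrib_left)
  ultimately show ?thesis using mass_scale_bound[of m i, OF m] unfolding L by linarith
qed

lemma entropy_eq_0:
  assumes t: "t \<ge> 0" and m: "\<not> L1_norm (c i 0) > 0"
  shows "entropy (c i t) = 0"
proof -
  have m_eq: "L1_norm (c i 0) = (\<integral>x. c i 0 x \<partial>lborel)"
    unfolding L1_norm_def using init_nonneg[of i] c_L1[of 0 i] by (intro integral_cong_AE) auto
  have "L1_norm (c i 0) \<ge> 0" by (simp add: L1_norm_def)
  then have 0: "(\<integral>x. c i t x \<partial>lborel) = 0" using m m_eq mass[OF t, of i] by simp
  have nn: "AE x in lborel. 0 \<le> c i t x"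
  proof (cases "t = 0")
    case False
    then show ?thesis using t c_nonneg[OF init_nonneg] by auto
  qed (simp add: init_nonneg)
  have [measurable]: "c i t \<in> borel_measurable borel" using c_L1[OF t, of i] by auto
  have "AE x in lborel. c i t x = 0"
    using 0 nn c_L1[OF t, of i] by (subst (asm) integral_nonneg_eq_0_iff_AE) auto
  then have "AE x in lborel. c i t x * ln (c i t x) = 0" by eventually_elim simp
  then have "entropy (c i t) = (\<integral>x. 0 \<partial>(lborel :: (real^3) measure))"
    unfolding entropy_def by (intro integral_cong_AE) auto
  then show ?thesis by simp
qed

text \<open>The lower bound for one species with mass tends to infinity, those for the other species
  with mass are eventually nonnegative, and massless species contribute 0.\<close>

lemma entropy_tendsto:
  assumes "L1_norm (c i 0) > 0"
  shows "filterlim (\<lambda>t. \<Sum>i\<in>UNIV. entropy (c i t)) at_bot at_top"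
proof -
  define m where "m = (\<lambda>i. L1_norm (c i 0))"
  define q where "q = (\<lambda>i. L2_norm (c i 0))"
  define b where "b j t = 1 + 3 / 2 * m j * ln (mass_scale m * initial_scale q + mass_scale m * decay_rate D m * t)" for j t
  define S where "S = {j. m j > 0}"
  have i: "i \<in> S" using assms by (simp add: S_def m_def)
  have pos: "0 < mass_scale m * initial_scale q" "0 < mass_scale m * decay_rate D m"
    using constants_pos(1)[of m] constants_pos(2)[of D m] constants_pos(3)[of q] by auto
  have lim: "filterlim (\<lambda>t. b j t) at_top at_top" if "j \<in> S" for j
  proof -
    have mj: "3 / 2 * m j > 0" using that by (simp add: S_def)
    have "filterlim (\<lambda>t. mass_scale m * initial_scale q + mass_scale m * decay_rate D m * t) at_top at_top"
      by (intro filterlim_tendsto_add_at_top[OF tendsto_const] filterlim_tendsto_pos_mult_at_top[OF tendsto_const pos(2)] filterlim_ident)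
    then have "filterlim (\<lambda>t. ln (mass_scale m * initial_scale q + mass_scale m * decay_rate D m * t)) at_top at_top"
      by (rule filterlim_compose[OF ln_at_top])
    then show ?thesis unfolding b_def
      by (intro filterlim_tendsto_add_at_top[OF tendsto_const] filterlim_tendsto_pos_mult_at_top[OF tendsto_const mj])
  qed
  have "filterlim (\<lambda>t. - (\<Sum>i\<in>UNIV. entropy (c i t))) at_top at_top"
  proof (rule filterlim_at_top_mono[OF lim[OF i]])
    have "\<forall>\<^sub>F t in at_top. \<forall>j\<in>S. 0 \<le> b j t"
      using lim by (intro eventually_ball_finite) (auto simp: filterlim_at_top)
    then show "\<forall>\<^sub>F t in at_top. b i t \<le> - (\<Sum>i\<in>UNIV. entropy (c i t))"
      using eventually_ge_at_top[of 0]
    proof eventually_elim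
      fix t :: real assume b: "\<forall>j\<in>S. 0 \<le> b j t" and t: "0 \<le> t"
      have "b i t \<le> (\<Sum>j\<in>S. b j t)" using b i by (intro member_le_sum) auto
      also have "\<dots> \<le> (\<Sum>j\<in>S. - entropy (c j t))"
        using entropy_bound[OF t] by (intro sum_mono) (auto simp: b_def S_def m_def q_def)
      also have "\<dots> = (\<Sum>j\<in>UNIV. - entropy (c j t))"
        using entropy_eq_0[OF t] by (intro sum.mono_neutral_left) (auto simp: S_def m_def)
      finally show "b i t \<le> - (\<Sum>i\<in>UNIV. entropy (c i t))" by (simp add: sum_negf)
    qed
  qed
  then show ?thesis by (simp add: filterlim_uminus_at_bot)
qed

end

text \<open>The constants are quantified before the solution, as functions of the quantities on
  which they may depend. A species without mass has entropy 0 at all times, while the right-hand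
  side would be the positive \<open>\<Gamma>1\<close>; hence the restriction to positive mass.
  Finiteness of the entropies is asserted because the integral of a non-integrable function is 0 by
  convention.\<close>

theorem proposition6:
  shows "\<exists>(\<Gamma>1 :: real \<Rightarrow> ('n::finite \<Rightarrow> real) \<Rightarrow> ('n \<Rightarrow> real) \<Rightarrow> ('n \<Rightarrow> real) \<Rightarrow> ('n \<Rightarrow> real) \<Rightarrow> real)
          (\<Gamma>2 :: real \<Rightarrow> ('n \<Rightarrow> real) \<Rightarrow> ('n \<Rightarrow> real) \<Rightarrow> ('n \<Rightarrow> real) \<Rightarrow> ('n \<Rightarrow> real) \<Rightarrow> real)
          (\<Gamma>3 :: real \<Rightarrow> ('n \<Rightarrow> real) \<Rightarrow> real).
    (\<forall>D z E m q. \<Gamma>1 D z E m q > 0 \<and> \<Gamma>2 D z E m q > 0) \<and> (\<forall>D m. \<Gamma>3 D m > 0) \<and>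
    (\<forall>(D :: real) (z :: 'n \<Rightarrow> real) c u p \<phi>.
       D > 0 \<longrightarrow> (\<forall>i j. \<bar>z i\<bar> = \<bar>z j\<bar>) \<longrightarrow>
       (\<forall>i. (AE x in lborel. 0 \<le> c i 0 x) \<and> in_H1 (c i 0) \<and> in_L1 (c i 0) \<and> entropy_finite (c i 0)) \<longrightarrow>
       (\<integral>x. charge z c 0 x \<partial>lborel) = 0 \<longrightarrow>
       npd_solution D z c u p \<phi> \<longrightarrow>
       (let E = (\<lambda>i. entropy (c i 0)); m = (\<lambda>i. L1_norm (c i 0)); q = (\<lambda>i. L2_norm (c i 0)) in
         (\<forall>i. \<forall>t\<ge>0. entropy_finite (c i t)) \<and>
         (\<forall>i. m i > 0 \<longrightarrow>
            (\<forall>t\<ge>0. - entropy (c i t) \<ge> \<Gamma>1 D z E m q + 3 / 2 * m i * ln (\<Gamma>2 D z E m q + \<Gamma>3 D m * t))) \<and>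
         ((\<exists>i. m i > 0) \<longrightarrow> filterlim (\<lambda>t. \<Sum>i\<in>UNIV. entropy (c i t)) at_bot at_top)))"
proof (rule exI[of _ "\<lambda>D z E m q. 1"], rule exI[of _ "\<lambda>D z E m q. mass_scale m * initial_scale q"],
    rule exI[of _ "\<lambda>D m. mass_scale m * decay_rate D m"], intro conjI allI impI)
  fix D :: real and z :: "'n \<Rightarrow> real" and c u p \<phi>
  assume D: "D > 0" and z: "\<forall>i j. \<bar>z i\<bar> = \<bar>z j\<bar>"
    and init: "\<forall>i. (AE x in lborel. 0 \<le> c i 0 x) \<and> in_H1 (c i 0) \<and> in_L1 (c i 0) \<and> entropy_finite (c i 0)"
    and sol: "npd_solution D z c u p \<phi>"
  interpret npd_data D z c u p \<phi>
    using D z init sol by unfold_locales auto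
  have "entropy_finite (c i t)" if "t \<ge> 0" for i t
    using entropy_finite_at[of t i] init that by (cases "t = 0") auto
  then show "let E = (\<lambda>i. entropy (c i 0)); m = (\<lambda>i. L1_norm (c i 0)); q = (\<lambda>i. L2_norm (c i 0)) in
         (\<forall>i. \<forall>t\<ge>0. entropy_finite (c i t)) \<and>
         (\<forall>i. m i > 0 \<longrightarrow>
            (\<forall>t\<ge>0. - entropy (c i t) \<ge> 1 + 3 / 2 * m i * ln (mass_scale m * initial_scale q + mass_scale m * decay_rate D m * t))) \<and>
         ((\<exists>i. m i > 0) \<longrightarrow> filterlim (\<lambda>t. \<Sum>i\<in>UNIV. entropy (c i t)) at_bot at_top)"
    unfolding Let_def using entropy_bound entropy_tendsto by blast
qed (use constants_pos in \<open>auto intro!: mult_pos_pos\<close>)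

end
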